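(* Let $p\in(1,2]$, $q\in[2,\infty)$, $s>0$, $r=\max\{2,p,q\}$. Let $\mathcal X=B^0_{p,q}(\mathbb T^d)$, $\mathcal Y=L^2(\mathbb T^d)$, $\mathcal R=\frac1r\|\cdot\|_{B^0_{p,q},\mathcal W}^r$, let $T_{\mathrm{BH}}$ be the forward operator of the backwards heat equation (see context), and let $g^{\mathrm{obs}}=T_{\mathrm{BH}}f^\dagger+\varepsilon Z$ with $\varepsilon>0$ and a noise process $Z$ satisfying the deviation inequality in the context (with constants $C_Z,M_Z,\mu$ for the index $\tilde p=p'$). Suppose that $f^\dagger\in\mathcal D\cap B^s_{p,\infty}$ with $\|f^\dagger\|_{B^s_{p,\infty}}\le\varrho$. Then a minimizer $\widehat f_\alpha$ over $\mathcal D$ of $f\mapsto\frac12\|T_{\mathrm{BH}}f\|_{L^2}^2-\langle g^{\mathrm{obs}},T_{\mathrm{BH}}f\rangle+\alpha\mathcal R(f)$ is well defined almost surely, and for $\alpha=\varepsilon/4$ it satisfies $$\forall t>0:\quad\mathbb P\Big[\|\widehat f_\alpha-f^\dagger\|_{B^0_{p,q}}\ge c\Big(\varrho\Big(\ln\frac\varrho\varepsilon\Big)^{-s/2}+t\Big)\Big]\le\exp\Big(-C_Z\,\varepsilon^{-\frac\mu4}\,t^{\frac{3q-2}4\mu}\Big)$$ with a constant $c>0$ independent of $f^\dagger$, $\varrho$ and $\varepsilon$.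
   Context: $\mathbb T^d=\mathbb R^d/\mathbb Z^d$; $B^s_{p,q}=B^s_{p,q}(\mathbb T^d)$ are the Besov spaces; $p'$ is the Hölder conjugate of $p$; $\mathcal D\subset\mathcal X$ is nonempty, closed and convex. For fixed $\bar t>0$, $T_{\mathrm{BH}}f=u(\cdot,\bar t)$, where $u$ solves $\partial_tu=\Delta u$ in $\mathbb T^d\times(0,\bar t)$, $u(\cdot,0)=f$ on $\mathbb T^d$. $\langle g^{\mathrm{obs}},T_{\mathrm{BH}}f\rangle$ is the duality pairing of $B^{-d/2}_{p',\infty}$ and $B^{d/2}_{p,1}$. Deviation inequality for $Z$: $Z$ is a random variable with values in the distributions on $\mathbb T^d$; for every $\tilde p\in(1,\infty)$ we have $Z\in B^{-d/2}_{\tilde p,\infty}$ almost surely, and there are constants $C_Z,M_Z,\mu>0$ (possibly depending on $\tilde p$) with $$\mathbb P\big(\|Z\|_{B^{-d/2}_{\tilde p,\infty}}>M_Z+t\big)\le\exp(-C_Zt^\mu)\qquad\text{for all }t>0.$$ $\|\cdot\|_{B^s_{p,q},\mathcal W}$ is the wavelet norm: a fixed orthonormal system $(\phi_{j,l})_{j\in\mathbb N_0,\,l\in I_j}$ of $L^2(\mathbb T^d)$, $\phi_{j,l}\in C^\sigma(\mathbb T^d,\mathbb R)$ (e.g. periodized Daubechies or Meyer wavelets), is assumed to generate the Besov spaces, i.e. for $p,q\in[1,\infty]$ and $|s|<\sigma$ a distribution $f$ lies in $B^s_{p,q}$ iff $$\|f\|_{B^s_{p,q},\mathcal W}=\Big[\sum_{j\in\mathbb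 N_0}2^{jsq}2^{jd(\frac12-\frac1p)q}\Big(\sum_{l\in I_j}|\langle f,\phi_{j,l}\rangle|^p\Big)^{q/p}\Big]^{1/q}<\infty$$ (usual modifications for $\infty$), this is an equivalent norm, and $f=\sum_{j,l}\langle f,\phi_{j,l}\rangle\phi_{j,l}$ uniquely. $\sigma$ is assumed to be larger than all absolute values of smoothness indices that occur. All other Besov norms may be any fixed equivalent norms.
   Formalization: The bound is proved for 0<ε<ϱ: c is independent of f†, ϱ, ε once ε is below a threshold depending on ϱ; for other ε<ϱ the constant may depend on ϱ (one c for all ϱ, ε fails, e.g. Z=0, ε=ϱ/K, ϱ→∞). The smoothness indices σ must exceed include s(q-1). *)

theory Defs
  imports "HOL-Probability.Probability"
begin

section \<open>Functions on the torus\<close>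

text \<open>The torus \<open>\<real>\<^sup>d/\<int>\<^sup>d\<close> has dimension \<open>d = CARD('d)\<close>; functions on it are
  \<open>\<int>\<^sup>d\<close>-periodic functions on \<^typ>\<open>real^'d\<close>, integrated over the unit cube.\<close>

definition int_vec :: "int ^ 'd \<Rightarrow> real ^ 'd" where
  "int_vec k = (\<chi> i. of_int (k $ i))"

definition periodic :: "(real ^ 'd \<Rightarrow> 'b) \<Rightarrow> bool" where
  "periodic f \<longleftrightarrow> (\<forall>x k. f (x + int_vec k) = f x)"

definition torus :: "(real ^ 'd::finite) measure" where
  "torus = restrict_space lborel (cbox 0 One)"

fun Dpart :: "'d::finite list \<Rightarrow> (real ^ 'd \<Rightarrow> real) \<Rightarrow> real ^ 'd \<Rightarrow> real" where
  "Dpart [] f = f"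
| "Dpart (i # is) f = (\<lambda>x. deriv (\<lambda>h. Dpart is f (x + h *\<^sub>R axis i 1)) 0)"

definition C_k :: "nat \<Rightarrow> (real ^ 'd::finite \<Rightarrow> real) \<Rightarrow> bool" where
  "C_k n f \<longleftrightarrow>
     (\<forall>is. length is \<le> n \<longrightarrow> continuous_on UNIV (Dpart is f)) \<and>
     (\<forall>is i x. length is < n \<longrightarrow>
        (\<lambda>h. Dpart is f (x + h *\<^sub>R axis i 1)) field_differentiable (at 0))"

definition smooth :: "(real ^ 'd::finite \<Rightarrow> real) \<Rightarrow> bool" where
  "smooth f \<longleftrightarrow> (\<forall>n. C_k n f)"

text \<open>\<open>C\<^sup>\<sigma>\<close> on the torus for real \<open>\<sigma>\<close> (Hoelder space for non-integer \<open>\<sigma>\<close>). For integer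
  \<open>\<sigma>\<close> the last condition only says that derivatives of a periodic \<open>C\<^sup>\<sigma>\<close> function have bounded
  oscillation, which is automatic.\<close>

definition C_sigma :: "real \<Rightarrow> (real ^ 'd::finite \<Rightarrow> real) \<Rightarrow> bool" where
  "C_sigma \<sigma> f \<longleftrightarrow> periodic f \<and> C_k (nat \<lfloor>\<sigma>\<rfloor>) f \<and>
     (\<forall>is. length is = nat \<lfloor>\<sigma>\<rfloor> \<longrightarrow>
        (\<exists>K. \<forall>x y. \<bar>Dpart is f x - Dpart is f y\<bar> \<le> K * dist x y powr frac \<sigma>))"

definition laplacian :: "(real ^ 'd::finite \<Rightarrow> real) \<Rightarrow> real ^ 'd \<Rightarrow> real" where
  "laplacian f x = (\<Sum>i\<in>UNIV. Dpart [i, i] f x)"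


section \<open>Distributions\<close>

definition test_function :: "(real ^ 'd::finite \<Rightarrow> real) \<Rightarrow> bool" where
  "test_function \<eta> \<longleftrightarrow> periodic \<eta> \<and> smooth \<eta>"

text \<open>Real linear functionals on the test functions that are continuous in the usual Frechet
  topology, i.e. bounded by finitely many of the norms \<open>sup \<bar>D\<^sup>\<beta>\<eta>\<bar>\<close>. They are set to zero outside
  the test functions so that equality of distributions is equality of functions.\<close>

definition is_distribution :: "((real ^ 'd::finite \<Rightarrow> real) \<Rightarrow> real) \<Rightarrow> bool" where
  "is_distribution F \<longleftrightarrow>
     (\<forall>\<eta>. \<not> test_function \<eta> \<longrightarrow> F \<eta> = 0) \<and>
     (\<forall>\<eta> \<zeta>. test_function \<eta> \<longrightarrow> test_function \<zeta> \<longrightarrow> F (\<lambda>x. \<eta> x + \<zeta> x) = F \<eta> + F \<zeta>) \<and>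
     (\<forall>a \<eta>. test_function \<eta> \<longrightarrow> F (\<lambda>x. a * \<eta> x) = a * F \<eta>) \<and>
     (\<exists>C N. \<forall>\<eta> K. test_function \<eta> \<longrightarrow> (\<forall>is x. length is \<le> N \<longrightarrow> \<bar>Dpart is \<eta> x\<bar> \<le> K) \<longrightarrow>
        \<bar>F \<eta>\<bar> \<le> C * K)"

lemma is_distribution_zero: "is_distribution (\<lambda>_. 0)"
  unfolding is_distribution_def by (auto intro!: exI[of _ 0])

lemma is_distribution_add:
  assumes "is_distribution F" "is_distribution G"
  shows "is_distribution (\<lambda>\<eta>. F \<eta> + G \<eta>)"
proof -
  obtain C N where 1: "\<And>\<eta> K. test_function \<eta> \<Longrightarrow> (\<forall>is x. length is \<le> N \<longrightarrow> \<bar>Dpart is \<eta> x\<bar> \<le> K) \<Longrightarrow>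
        \<bar>F \<eta>\<bar> \<le> C * K" using assms(1) unfolding is_distribution_def by blast
  obtain C' N' where 2: "\<And>\<eta> K. test_function \<eta> \<Longrightarrow> (\<forall>is x. length is \<le> N' \<longrightarrow> \<bar>Dpart is \<eta> x\<bar> \<le> K) \<Longrightarrow>
        \<bar>G \<eta>\<bar> \<le> C' * K" using assms(2) unfolding is_distribution_def by blast
  have "\<bar>F \<eta> + G \<eta>\<bar> \<le> (C + C') * K"
    if t: "test_function \<eta>" and b: "\<forall>is x. length is \<le> max N N' \<longrightarrow> \<bar>Dpart is \<eta> x\<bar> \<le> K" for \<eta> K
    using 1[OF t, of K] 2[OF t, of K] b by (auto simp: distrib_right)
  then have "\<exists>C N. \<forall>\<eta> K. test_function \<eta> \<longrightarrow> (\<forall>is x. length is \<le> N \<longrightarrow> \<bar>Dpart is \<eta> x\<bar> \<le> K) \<longrightarrow>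
        \<bar>F \<eta> + G \<eta>\<bar> \<le> C * K" by blast
  with assms show ?thesis
    unfolding is_distribution_def by (simp add: algebra_simps)
qed

lemma is_distribution_scale:
  assumes "is_distribution F"
  shows "is_distribution (\<lambda>\<eta>. c * F \<eta>)"
proof -
  obtain C N where 1: "\<And>\<eta> K. test_function \<eta> \<Longrightarrow> (\<forall>is x. length is \<le> N \<longrightarrow> \<bar>Dpart is \<eta> x\<bar> \<le> K) \<Longrightarrow>
        \<bar>F \<eta>\<bar> \<le> C * K" using assms(1) unfolding is_distribution_def by blast
  have "\<bar>c * F \<eta>\<bar> \<le> (\<bar>c\<bar> * C) * K"
    if t: "test_function \<eta>" and b: "\<forall>is x. length is \<le> N \<longrightarrow> \<bar>Dpart is \<eta> x\<bar> \<le> K" for \<eta> K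
    using mult_left_mono[OF 1[OF t b], of "\<bar>c\<bar>"] by (simp add: abs_mult mult.assoc)
  then have "\<exists>C N. \<forall>\<eta> K. test_function \<eta> \<longrightarrow> (\<forall>is x. length is \<le> N \<longrightarrow> \<bar>Dpart is \<eta> x\<bar> \<le> K) \<longrightarrow>
        \<bar>c * F \<eta>\<bar> \<le> C * K" by blast
  with assms show ?thesis
    unfolding is_distribution_def by (simp add: algebra_simps)
qed

typedef (overloaded) 'd distribution = "{F :: (real ^ 'd::finite \<Rightarrow> real) \<Rightarrow> real. is_distribution F}"
  morphisms dapp Abs_distribution
  using is_distribution_zero by blast

setup_lifting type_definition_distribution

instantiation distribution :: (finite) real_vector
begin

lift_definition zero_distribution :: "'a distribution" is "\<lambda>_. 0"
  by (rule is_distribution_zero)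

lift_definition plus_distribution :: "'a distribution \<Rightarrow> 'a distribution \<Rightarrow> 'a distribution"
  is "\<lambda>F G \<eta>. F \<eta> + G \<eta>"
  by (rule is_distribution_add)

lift_definition scaleR_distribution :: "real \<Rightarrow> 'a distribution \<Rightarrow> 'a distribution"
  is "\<lambda>c F \<eta>. c * F \<eta>"
  by (rule is_distribution_scale)

lift_definition uminus_distribution :: "'a distribution \<Rightarrow> 'a distribution"
  is "\<lambda>F \<eta>. - F \<eta>"
  using is_distribution_scale[where c = "-1"] by simp

lift_definition minus_distribution :: "'a distribution \<Rightarrow> 'a distribution \<Rightarrow> 'a distribution"
  is "\<lambda>F G \<eta>. F \<eta> - G \<eta>"
  using is_distribution_add[OF _ is_distribution_scale[where c = "-1"]] by simp

instance
  by standard (transfer; auto simp: algebra_simps)+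

end

definition regular_functional :: "(real ^ 'd::finite \<Rightarrow> real) \<Rightarrow> (real ^ 'd \<Rightarrow> real) \<Rightarrow> real" where
  "regular_functional g \<eta> = (if test_function \<eta> then (\<integral>x. g x * \<eta> x \<partial>torus) else 0)"

definition regular_distribution :: "(real ^ 'd::finite \<Rightarrow> real) \<Rightarrow> 'd distribution" where
  "regular_distribution g = Abs_distribution (regular_functional g)"

lemma smooth_Dpart_differentiable:
  "smooth f \<Longrightarrow> (\<lambda>h. Dpart is f (x + h *\<^sub>R axis i 1)) field_differentiable (at 0)"
  unfolding smooth_def C_k_def by (meson lessI)

lemma Dpart_add:
  assumes "smooth f" "smooth g"
  shows "Dpart is (\<lambda>x. f x + g x) = (\<lambda>x. Dpart is f x + Dpart is g x)"
  by (induction "is") (simp_all add: deriv_add smooth_Dpart_differentiable assms)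

lemma Dpart_cmult:
  assumes "smooth f"
  shows "Dpart is (\<lambda>x. a * f x) = (\<lambda>x. a * Dpart is f x)"
  by (induction "is") (simp_all add: deriv_cmult smooth_Dpart_differentiable assms)

lemma test_function_add:
  assumes "test_function f" "test_function g"
  shows "test_function (\<lambda>x. f x + g x)"
proof -
  have sm: "smooth f" "smooth g" using assms by (auto simp: test_function_def)
  then have "smooth (\<lambda>x. f x + g x)"
    unfolding smooth_def C_k_def Dpart_add[OF sm]
    by (auto intro!: continuous_intros field_differentiable_add)
  then show ?thesis using assms by (auto simp: test_function_def periodic_def)
qed

lemma test_function_cmult:
  assumes "test_function f"
  shows "test_function (\<lambda>x. a * f x)"
proof -
  have sm: "smooth f" using assms by (auto simp: test_function_def)
  then have "smooth (\<lambda>x. a * f x)"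
    unfolding smooth_def C_k_def Dpart_cmult[OF sm]
    by (auto intro!: continuous_intros field_differentiable_mult)
  then show ?thesis using assms by (auto simp: test_function_def periodic_def)
qed

lemma is_distribution_regular_functional:
  fixes g :: "real ^ 'd::finite \<Rightarrow> real"
  assumes g: "integrable torus g"
  shows "is_distribution (regular_functional g)"
proof -
  have dom: "integrable torus (\<lambda>x. g x * \<eta> x)" "\<bar>\<integral>x. g x * \<eta> x \<partial>torus\<bar> \<le> (\<integral>x. \<bar>g x\<bar> \<partial>torus) * K"
    if c: "continuous_on UNIV \<eta>" and b: "\<And>x. \<bar>\<eta> x\<bar> \<le> K" for \<eta> :: "real ^ 'd \<Rightarrow> real" and K
  proof -
    have m: "\<eta> \<in> borel_measurable torus"
      unfolding torus_def
      by (rule measurable_restrict_space1) (simp add: borel_measurable_continuous_onI c)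
    have le: "\<bar>g x * \<eta> x\<bar> \<le> \<bar>g x\<bar> * K" for x
      using b[of x] by (simp add: abs_mult mult_left_mono)
    have i: "integrable torus (\<lambda>x. \<bar>g x\<bar> * K)" using g by simp
    show int: "integrable torus (\<lambda>x. g x * \<eta> x)"
      by (rule Bochner_Integration.integrable_bound[OF i])
         (use g m in \<open>auto intro: order_trans[OF le abs_ge_self]\<close>)
    have "\<bar>\<integral>x. g x * \<eta> x \<partial>torus\<bar> \<le> (\<integral>x. \<bar>g x * \<eta> x\<bar> \<partial>torus)"
      by (rule integral_abs_bound)
    also have "\<dots> \<le> (\<integral>x. \<bar>g x\<bar> * K \<partial>torus)"
      by (rule integral_mono) (use int i le in auto)
    finally show "\<bar>\<integral>x. g x * \<eta> x \<partial>torus\<bar> \<le> (\<integral>x. \<bar>g x\<bar> \<partial>torus) * K" by simp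
  qed
  have cont: "continuous_on UNIV (Dpart is \<eta>)" if "test_function \<eta>" for \<eta> :: "real ^ 'd \<Rightarrow> real" and "is"
    using that unfolding test_function_def smooth_def C_k_def by blast
  have cont0: "continuous_on UNIV \<eta>" if "test_function \<eta>" for \<eta> :: "real ^ 'd \<Rightarrow> real"
    using cont[OF that, of "[]"] by simp
  have bdd: "\<exists>K. \<forall>x. \<bar>\<eta> x\<bar> \<le> K" if t: "test_function \<eta>" for \<eta> :: "real ^ 'd \<Rightarrow> real"
  proof -
    have "compact (\<eta> ` cbox 0 One)"
      by (rule compact_continuous_image) (use cont0[OF t] continuous_on_subset in auto)
    then have "\<exists>K. \<forall>x\<in>cbox 0 One. \<bar>\<eta> x\<bar> \<le> K"
      by (auto dest!: compact_imp_bounded simp: bounded_iff)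
    then obtain K where K: "\<And>x. x \<in> cbox 0 One \<Longrightarrow> \<bar>\<eta> x\<bar> \<le> K"
      by blast
    have "\<bar>\<eta> x\<bar> \<le> K" for x
    proof -
      define k :: "int ^ 'd" where "k = (\<chi> i. - \<lfloor>x $ i\<rfloor>)"
      have "x + int_vec k \<in> cbox 0 One"
      proof -
        have frac: "0 \<le> x $ i + real_of_int (- \<lfloor>x $ i\<rfloor>)" "x $ i + real_of_int (- \<lfloor>x $ i\<rfloor>) \<le> 1" for i
          using floor_correct[of "x $ i"] by (simp, linarith)
        have "0 \<bullet> b \<le> (x + int_vec k) \<bullet> b \<and> (x + int_vec k) \<bullet> b \<le> One \<bullet> b"
          if "b \<in> Basis" for b :: "real ^ 'd"
        proof -
          have "One \<bullet> b = 1"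
            using inner_sum_left_Basis[OF that, of "\<lambda>_. 1"] by simp
          moreover have "0 \<le> (x + int_vec k) \<bullet> b" "(x + int_vec k) \<bullet> b \<le> 1"
            using that frac by (auto simp: k_def int_vec_def Basis_vec_def inner_axis)
          ultimately show ?thesis by simp
        qed
        then show ?thesis by (simp add: mem_box)
      qed
      then have "\<bar>\<eta> (x + int_vec k)\<bar> \<le> K" by (rule K)
      then show ?thesis using t by (simp add: test_function_def periodic_def)
    qed
    then show ?thesis by blast
  qed
  have int: "integrable torus (\<lambda>x. g x * \<eta> x)" if t: "test_function \<eta>" for \<eta> :: "real ^ 'd \<Rightarrow> real"
    using bdd[OF t] dom(1)[OF cont0[OF t]] by blast
  have "regular_functional g (\<lambda>x. \<eta> x + \<zeta> x) = regular_functional g \<eta> + regular_functional g \<zeta>"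
    if "test_function \<eta>" "test_function \<zeta>" for \<eta> \<zeta>
    using that int by (simp add: regular_functional_def test_function_add distrib_left)
  moreover have "regular_functional g (\<lambda>x. a * \<eta> x) = a * regular_functional g \<eta>"
    if "test_function \<eta>" for a \<eta>
    using that by (simp add: regular_functional_def test_function_cmult mult.left_commute)
  moreover have "\<bar>regular_functional g \<eta>\<bar> \<le> (\<integral>x. \<bar>g x\<bar> \<partial>torus) * K"
    if t: "test_function \<eta>" and b: "\<forall>is x. length is \<le> 0 \<longrightarrow> \<bar>Dpart is \<eta> x\<bar> \<le> K" for \<eta> K
    using dom(2)[OF cont0[OF t], of K] b t by (simp add: regular_functional_def)
  moreover have "regular_functional g \<eta> = 0" if "\<not> test_function \<eta>" for \<eta>
    using that by (simp add: regular_functional_def)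
  ultimately show ?thesis
    unfolding is_distribution_def by blast
qed

lemma dapp_regular_distribution:
  assumes "integrable torus g"
  shows "dapp (regular_distribution g) = regular_functional g"
  unfolding regular_distribution_def
  using is_distribution_regular_functional[OF assms] by (simp add: Abs_distribution_inverse)

definition random_distribution :: "'w measure \<Rightarrow> ('w \<Rightarrow> 'd::finite distribution) \<Rightarrow> bool" where
  "random_distribution M Z \<longleftrightarrow> (\<forall>\<eta>. (\<lambda>\<omega>. dapp (Z \<omega>) \<eta>) \<in> borel_measurable M)"


section \<open>Besov spaces\<close>

text \<open>Integrability indices range over \<open>[1,\<infinity>]\<close> and are extended non-negative reals;
  \<^term>\<open>recip p\<close> is \<open>1/p\<close>, with \<open>1/\<infinity> = 0\<close>. With counting measures, \<open>Lp_norm\<close> is the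
  \<open>\<ell>\<^sup>p\<close> norm.\<close>

definition recip :: "ennreal \<Rightarrow> real" where
  "recip p = enn2real (inverse p)"

definition epowr :: "ennreal \<Rightarrow> real \<Rightarrow> ennreal" where
  "epowr x a = (if x = \<top> then \<top> else ennreal (enn2real x powr a))"

definition Lp_norm :: "'a measure \<Rightarrow> ennreal \<Rightarrow> ('a \<Rightarrow> ennreal) \<Rightarrow> ennreal" where
  "Lp_norm M p g = (if p = \<top> then esssup M g
     else epowr (\<integral>\<^sup>+x. epowr (g x) (enn2real p) \<partial>M) (recip p))"

definition fourier :: "'d::finite distribution \<Rightarrow> int ^ 'd \<Rightarrow> complex" where
  "fourier f k = Complex (dapp f (\<lambda>x. cos (2 * pi * (int_vec k \<bullet> x))))
                         (- dapp f (\<lambda>x. sin (2 * pi * (int_vec k \<bullet> x))))"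

text \<open>Littlewood-Paley decomposition: \<open>\<psi>\<close> generates a smooth dyadic resolution of unity
  \<open>1 = \<Sum>\<^sub>j \<psi>\<^sub>j\<close> on the frequency side.\<close>

definition lp_cutoff :: "(real ^ 'd::finite \<Rightarrow> real) \<Rightarrow> bool" where
  "lp_cutoff \<psi> \<longleftrightarrow> smooth \<psi> \<and> (\<forall>\<xi>. norm \<xi> \<le> 1 \<longrightarrow> \<psi> \<xi> = 1) \<and> (\<forall>\<xi>. norm \<xi> \<ge> 2 \<longrightarrow> \<psi> \<xi> = 0)"

definition lp_symbol :: "(real ^ 'd::finite \<Rightarrow> real) \<Rightarrow> nat \<Rightarrow> real ^ 'd \<Rightarrow> real" where
  "lp_symbol \<psi> j \<xi> = (if j = 0 then \<psi> \<xi> else \<psi> (\<xi> /\<^sub>R 2 ^ j) - \<psi> (\<xi> /\<^sub>R 2 ^ (j - 1)))"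

definition lp_block :: "(real ^ 'd::finite \<Rightarrow> real) \<Rightarrow> nat \<Rightarrow> 'd distribution \<Rightarrow> real ^ 'd \<Rightarrow> complex" where
  "lp_block \<psi> j f x =
     (\<Sum>k | lp_symbol \<psi> j (int_vec k) \<noteq> 0.
        of_real (lp_symbol \<psi> j (int_vec k)) * fourier f k * cis (2 * pi * (int_vec k \<bullet> x)))"

definition besov_norm ::
  "(real ^ 'd::finite \<Rightarrow> real) \<Rightarrow> real \<Rightarrow> ennreal \<Rightarrow> ennreal \<Rightarrow> 'd distribution \<Rightarrow> ennreal" where
  "besov_norm \<psi> s p q f = Lp_norm (count_space UNIV) q
     (\<lambda>j. ennreal (2 powr (real j * s)) * Lp_norm torus p (\<lambda>x. ennreal (norm (lp_block \<psi> j f x))))"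

definition besov ::
  "(real ^ 'd::finite \<Rightarrow> real) \<Rightarrow> real \<Rightarrow> ennreal \<Rightarrow> ennreal \<Rightarrow> 'd distribution set" where
  "besov \<psi> s p q = {f. besov_norm \<psi> s p q f < \<top>}"

definition besov_equiv_norm ::
  "(real ^ 'd::finite \<Rightarrow> real) \<Rightarrow> real \<Rightarrow> ennreal \<Rightarrow> ennreal \<Rightarrow> ('d distribution \<Rightarrow> real) \<Rightarrow> bool" where
  "besov_equiv_norm \<psi> s p q N \<longleftrightarrow>
     (\<forall>f\<in>besov \<psi> s p q. \<forall>g\<in>besov \<psi> s p q. N (f + g) \<le> N f + N g) \<and>
     (\<forall>f\<in>besov \<psi> s p q. \<forall>a. N (a *\<^sub>R f) = \<bar>a\<bar> * N f) \<and>
     (\<exists>c>0. \<exists>C>0. \<forall>f\<in>besov \<psi> s p q.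
        c * enn2real (besov_norm \<psi> s p q f) \<le> N f \<and> N f \<le> C * enn2real (besov_norm \<psi> s p q f))"

definition besov_closed ::
  "(real ^ 'd::finite \<Rightarrow> real) \<Rightarrow> real \<Rightarrow> ennreal \<Rightarrow> ennreal \<Rightarrow> 'd distribution set \<Rightarrow> bool" where
  "besov_closed \<psi> s p q D \<longleftrightarrow>
     (\<forall>F f. (\<forall>n. F n \<in> D) \<longrightarrow> f \<in> besov \<psi> s p q \<longrightarrow>
        (\<lambda>n. besov_norm \<psi> s p q (F n - f)) \<longlonglongrightarrow> 0 \<longrightarrow> f \<in> D)"


section \<open>Wavelets\<close>

text \<open>Wavelets need not be smooth, so \<open>\<langle>f,h\<rangle>\<close> is not simply the value of a distribution at a test
  function. It is defined by smooth truncation in frequency. For \<open>f\<close> in a Besov space of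
  smoothness \<open>s\<close> and \<open>h \<in> C\<^sup>\<sigma>\<close> with \<open>\<bar>s\<bar> < \<sigma>\<close> the limit exists and is the duality
  pairing; for a test function \<open>h\<close> it is \<^term>\<open>dapp f h\<close>.\<close>

definition pairing ::
  "(real ^ 'd::finite \<Rightarrow> real) \<Rightarrow> 'd distribution \<Rightarrow> (real ^ 'd \<Rightarrow> real) \<Rightarrow> real" where
  "pairing \<psi> f h = Re (lim (\<lambda>J.
     \<Sum>k | \<psi> (int_vec k /\<^sub>R 2 ^ J) \<noteq> 0.
        of_real (\<psi> (int_vec k /\<^sub>R 2 ^ J)) * fourier f k * cnj (fourier (regular_distribution h) k)))"

definition besov_seq_norm ::
  "'d::finite itself \<Rightarrow> (nat \<Rightarrow> 'l set) \<Rightarrow> real \<Rightarrow> ennreal \<Rightarrow> ennreal \<Rightarrow> (nat \<Rightarrow> 'l \<Rightarrow> real) \<Rightarrow> ennreal" where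
  "besov_seq_norm _ I s p q c = Lp_norm (count_space UNIV) q
     (\<lambda>j. ennreal (2 powr (real j * s) * 2 powr (real j * real CARD('d) * (1/2 - recip p))) *
          Lp_norm (count_space (I j)) p (\<lambda>l. ennreal \<bar>c j l\<bar>))"

definition wavelet_norm ::
  "(real ^ 'd::finite \<Rightarrow> real) \<Rightarrow> (nat \<Rightarrow> 'l set) \<Rightarrow> (nat \<Rightarrow> 'l \<Rightarrow> real ^ 'd \<Rightarrow> real) \<Rightarrow>
     real \<Rightarrow> ennreal \<Rightarrow> ennreal \<Rightarrow> 'd distribution \<Rightarrow> ennreal" where
  "wavelet_norm \<psi> I \<phi> s p q f =
     besov_seq_norm TYPE('d) I s p q (\<lambda>j l. pairing \<psi> f (\<phi> j l))"

definition wavelet_expansion ::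
  "(nat \<Rightarrow> 'l set) \<Rightarrow> (nat \<Rightarrow> 'l \<Rightarrow> real ^ 'd::finite \<Rightarrow> real) \<Rightarrow> (nat \<Rightarrow> 'l \<Rightarrow> real) \<Rightarrow>
     'd distribution \<Rightarrow> bool" where
  "wavelet_expansion I \<phi> c f \<longleftrightarrow> (\<forall>\<eta>. test_function \<eta> \<longrightarrow>
     ((\<lambda>(j, l). c j l * dapp (regular_distribution (\<phi> j l)) \<eta>) has_sum dapp f \<eta>)
       (SIGMA j:UNIV. I j))"

text \<open>The system \<open>(\<phi>\<^sub>j\<^sub>,\<^sub>l)\<close> is orthonormal, consists of \<open>C\<^sup>\<sigma>\<close> functions and generates the Besov
  spaces of smoothness \<open>\<bar>s\<bar> < \<sigma>\<close>. The characterization of membership is required among the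
  distributions that can be paired with \<open>C\<^sup>\<sigma>\<close> functions at all: on the torus every
  \<open>B\<^sup>u\<^sub>a\<^sub>,\<^sub>b\<close> with \<open>\<bar>u\<bar> < \<sigma>\<close> is contained in \<open>B\<^sup>u\<^sub>1\<^sub>,\<^sub>\<infinity>\<close>. Uniqueness of expansions refers
  to coefficients in the sequence space of \<open>B\<^sup>s\<^sub>p\<^sub>,\<^sub>q\<close>.\<close>

definition generates_besov ::
  "(real ^ 'd::finite \<Rightarrow> real) \<Rightarrow> real \<Rightarrow> (nat \<Rightarrow> 'l set) \<Rightarrow> (nat \<Rightarrow> 'l \<Rightarrow> real ^ 'd \<Rightarrow> real) \<Rightarrow> bool" where
  "generates_besov \<psi> \<sigma> I \<phi> \<longleftrightarrow>
     (\<forall>j. \<forall>l\<in>I j. C_sigma \<sigma> (\<phi> j l)) \<and>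
     (\<forall>j j'. \<forall>l\<in>I j. \<forall>l'\<in>I j'.
        (\<integral>x. \<phi> j l x * \<phi> j' l' x \<partial>torus) = (if j = j' \<and> l = l' then 1 else 0)) \<and>
     (\<forall>s p q. \<bar>s\<bar> < \<sigma> \<longrightarrow> 1 \<le> p \<longrightarrow> 1 \<le> q \<longrightarrow>
        (\<forall>u f. \<bar>u\<bar> < \<sigma> \<longrightarrow> f \<in> besov \<psi> u 1 \<top> \<longrightarrow>
           (f \<in> besov \<psi> s p q \<longleftrightarrow> wavelet_norm \<psi> I \<phi> s p q f < \<top>)) \<and>
        besov_equiv_norm \<psi> s p q (\<lambda>f. enn2real (wavelet_norm \<psi> I \<phi> s p q f)) \<and>
        (\<forall>f\<in>besov \<psi> s p q.
           wavelet_expansion I \<phi> (\<lambda>j l. pairing \<psi> f (\<phi> j l)) f \<and>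
           (\<forall>c. besov_seq_norm TYPE('d) I s p q c < \<top> \<longrightarrow> wavelet_expansion I \<phi> c f \<longrightarrow>
              (\<forall>j. \<forall>l\<in>I j. c j l = pairing \<psi> f (\<phi> j l)))))"


section \<open>Backwards heat equation and Tikhonov functional\<close>

text \<open>The initial value is attained in the sense of distributions. Solutions are unique on
  \<open>(0, tbar]\<close>, so the definite description below is meaningful whenever a solution exists.\<close>

definition heat_solution :: "real \<Rightarrow> 'd::finite distribution \<Rightarrow> (real \<Rightarrow> real ^ 'd \<Rightarrow> real) \<Rightarrow> bool" where
  "heat_solution tbar f u \<longleftrightarrow>
     (\<forall>t\<in>{0<..tbar}. test_function (u t)) \<and>
     continuous_on ({0<..tbar} \<times> UNIV) (\<lambda>(t, x). u t x) \<and>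
     (\<forall>t\<in>{0<..<tbar}. \<forall>x. ((\<lambda>\<tau>. u \<tau> x) has_real_derivative laplacian (u t) x) (at t)) \<and>
     (\<forall>\<eta>. test_function \<eta> \<longrightarrow>
        ((\<lambda>t. \<integral>x. u t x * \<eta> x \<partial>torus) \<longlongrightarrow> dapp f \<eta>) (at_right 0))"

definition T_BH :: "real \<Rightarrow> 'd::finite distribution \<Rightarrow> real ^ 'd \<Rightarrow> real" where
  "T_BH tbar f = (THE g. \<exists>u. heat_solution tbar f u \<and> g = u tbar)"

definition penalty ::
  "(real ^ 'd::finite \<Rightarrow> real) \<Rightarrow> (nat \<Rightarrow> 'l set) \<Rightarrow> (nat \<Rightarrow> 'l \<Rightarrow> real ^ 'd \<Rightarrow> real) \<Rightarrow>
     real \<Rightarrow> real \<Rightarrow> real \<Rightarrow> 'd distribution \<Rightarrow> real" where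
  "penalty \<psi> I \<phi> p q r f = 1 / r * enn2real (wavelet_norm \<psi> I \<phi> 0 (ennreal p) (ennreal q) f) powr r"

text \<open>As \<^term>\<open>T_BH tbar f\<close> is a test function, its pairing with \<open>gobs\<close> is evaluation of the
  distribution \<open>gobs\<close>.\<close>

definition tikhonov ::
  "real \<Rightarrow> real \<Rightarrow> ('d::finite distribution \<Rightarrow> real) \<Rightarrow> 'd distribution \<Rightarrow> 'd distribution \<Rightarrow> real" where
  "tikhonov tbar \<alpha> R gobs f =
     1/2 * (\<integral>x. (T_BH tbar f x)\<^sup>2 \<partial>torus) - dapp gobs (T_BH tbar f) + \<alpha> * R f"

definition observation ::
  "real \<Rightarrow> real \<Rightarrow> 'd::finite distribution \<Rightarrow> 'd distribution \<Rightarrow> 'd distribution" where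
  "observation tbar \<epsilon> z f = regular_distribution (T_BH tbar f) + \<epsilon> *\<^sub>R z"


section \<open>Deviation inequality\<close>

text \<open>Probabilities are outer probabilities, which agree with the probability on events: this
  avoids measurability questions for arbitrary equivalent norms and arbitrary selections of
  minimizers.\<close>

definition deviation_inequality ::
  "'w measure \<Rightarrow> ('w \<Rightarrow> 'd::finite distribution) \<Rightarrow> ('d distribution \<Rightarrow> real) \<Rightarrow>
     real \<Rightarrow> real \<Rightarrow> real \<Rightarrow> bool" where
  "deviation_inequality M Z N C m \<mu> \<longleftrightarrow> C > 0 \<and> m > 0 \<and> \<mu> > 0 \<and>
     (\<forall>t>0. outer_measure_of M {\<omega> \<in> space M. N (Z \<omega>) > m + t} \<le> ennreal (exp (- C * t powr \<mu>)))"

end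

theory Submission
  imports Defs
begin

text \<open>In Fourier coefficients \<open>T_BH\<close> is multiplication by \<open>exp (- 4\<pi>\<^sup>2 \<bar>k\<bar>\<^sup>2 tbar)\<close>. As \<open>r = q\<close>, the penalty is a
  \<open>q\<close>-th power of a norm and inherits \<open>q\<close>-uniform convexity from \<open>\<ell>\<^sup>p\<close> (\<open>1 < p \<le> 2\<close>). Minimizing sequences
  are therefore Cauchy, and comparing a minimizer with its midpoint with \<open>f\<^sub>0\<close> gives, for the error \<open>h\<close>,
  \<open>3/8 \<parallel>T h\<parallel>\<^sup>2 + \<epsilon> k\<^sub>1 \<parallel>h\<parallel>\<^sup>q\<close> \<open>\<le>\<close> \<open>\<epsilon>/2 \<langle>Z, T h\<rangle> + \<epsilon>/8 (R f\<^sub>0 - R fhat)\<close>, where \<open>R f = \<parallel>f\<parallel>\<^sup>q / q\<close>.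

  The noise term is at most \<open>C \<parallel>Z\<parallel> sqrt (\<parallel>T h\<parallel> \<parallel>h\<parallel>)\<close>. The penalty difference is at most a multiple of
  \<open>\<rho> powr (q - 1)\<close> times the norm of \<open>h\<close> of smoothness \<open>- s (q - 1)\<close>; splitting the latter at frequency \<open>2\<^sup>K\<close>, where
  the low frequencies are controlled by \<open>exp (C 4\<^sup>K) \<parallel>T h\<parallel>\<close>, and choosing \<open>4\<^sup>K\<close> proportional to \<open>ln (\<rho> / \<epsilon>)\<close> yields the
  logarithmic rate. Finally the noise is controlled outside the event
  \<open>\<parallel>Z\<parallel> > M\<^sub>Z + \<epsilon> powr (- 1/4) * t powr ((3 q - 2) / 4)\<close>.\<close>

section \<open>The torus\<close>

text \<open>Two objects are given only implicitly. \<open>T_BH\<close> is a definite description, so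
  its Fourier multiplier is available only after existence and uniqueness of
  \<open>heat_solution\<close>; uniqueness rests on a maximum principle and on completeness of the
  trigonometric system. \<open>pairing\<close> is a limit, so the properties of wavelet coefficients
  are drawn from \<open>generates_besov\<close>.

  The exponents come from scaling. Write a for \<open>T_norm\<close> of the error, b for its norm, n
  for the noise norm. Young's inequality with exponents 4 and 4/3 splits eps n sqrt(a b) into a^2/8,
  absorbed by the data term, and a multiple of (eps n)^(4/3) b^(2/3). Division by eps b^(2/3) leaves
  b^(q - 2/3) of order (eps^(1/4) n)^(4/3), so b is of order (eps^(1/4) n)^(4/(3q-2)), which for n =
  eps^(-1/4) t^((3q-2)/4) is exactly t.

  The other terms are not homogeneous in the radius \<open>\<rho>\<close>: powers of eps fall below
  \<open>\<rho>\<close> times the logarithmic factor only for eps small depending on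
  \<open>\<rho>\<close>. Hence one constant common to all radii below a threshold
  \<open>\<epsilon>0\<close>, and another one above it.\<close>

lemma int_vec_nth [simp]: "int_vec k $ i = of_int (k $ i)"
  by (simp add: int_vec_def)

lemma int_vec_add: "int_vec (k + l) = int_vec k + int_vec l"
  by (simp add: vec_eq_iff)

lemma int_vec_minus: "int_vec (k - l) = int_vec k - int_vec l"
  by (simp add: vec_eq_iff)

lemma int_vec_uminus: "int_vec (- k) = - int_vec k"
  by (simp add: vec_eq_iff)

lemma int_vec_zero [simp]: "int_vec 0 = 0"
  by (simp add: vec_eq_iff)

lemma int_vec_axis: "int_vec (axis i a) = axis i (of_int a)"
  by (simp add: vec_eq_iff axis_def)

lemma inner_int_vec: "int_vec k \<bullet> x = (\<Sum>i\<in>UNIV. of_int (k $ i) * x $ i)"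
  by (simp add: inner_vec_def)

lemma One_vec_nth [simp]: "(One :: real ^ 'd::finite) $ i = 1"
  using inner_sum_left_Basis[of "axis i 1 :: real ^ 'd" "\<lambda>_. 1"]
  by (simp add: inner_axis)

lemma sum_Basis_vec_nth [simp]: "(\<Sum>b\<in>Basis. (b :: real ^ 'd::finite) $ i) = 1"
  using One_vec_nth[of i] unfolding sum_component .

lemma axis_nth': "axis i a $ j = (if j = i then a else 0)"
  by (simp add: axis_def)

lemma mem_unit_cube: "x \<in> cbox 0 (One :: real ^ 'd::finite) \<longleftrightarrow> (\<forall>i. 0 \<le> x $ i \<and> x $ i \<le> 1)"
  by (simp add: mem_box_cart)

lemma prob_space_torus: "prob_space (torus :: (real ^ 'd::finite) measure)"
proof
  have "emeasure torus (space (torus :: (real ^ 'd) measure)) = emeasure lborel (cbox 0 (One :: real ^ 'd))"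
    unfolding torus_def by (simp add: emeasure_restrict_space space_restrict_space)
  also have "\<dots> = 1"
    by (subst emeasure_lborel_cbox) auto
  finally show "emeasure torus (space (torus :: (real ^ 'd) measure)) = 1" .
qed

interpretation torus: prob_space "torus :: (real ^ 'd::finite) measure"
  by (rule prob_space_torus)

lemma borel_measurable_torus:
  fixes f :: "real ^ 'd::finite \<Rightarrow> 'b::topological_space"
  assumes "continuous_on UNIV f"
  shows "f \<in> borel_measurable torus"
  unfolding torus_def
  by (rule measurable_restrict_space1) (simp add: borel_measurable_continuous_onI assms)

lemma
  fixes f :: "real ^ 'd::finite \<Rightarrow> real"
  assumes "continuous_on UNIV f"
  shows integrable_torus: "integrable torus f"
    and integral_torus: "(\<integral>x. f x \<partial>torus) = integral (cbox 0 One) f"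
proof -
  have "continuous_on (cbox 0 One) f"
    using assms continuous_on_subset by blast
  then have *: "set_integrable lborel (cbox 0 One) f"
    unfolding set_integrable_def by (intro borel_integrable_compact) auto
  then show "integrable torus f"
    unfolding torus_def by (simp add: integrable_restrict_space set_integrable_def)
  show "(\<integral>x. f x \<partial>torus) = integral (cbox 0 One) f"
    using set_borel_integral_eq_integral(2)[OF *]
    unfolding torus_def by (simp add: integral_restrict_space set_lebesgue_integral_def)
qed

lemma periodic_unit_cube_representative:
  assumes "periodic (f :: real ^ 'd::finite \<Rightarrow> 'b)"
  obtains y where "y \<in> cbox 0 One" "f y = f x" "\<And>z. f (z + (y - x)) = f z"
proof -
  define k :: "int ^ 'd" where "k = (\<chi> i. - \<lfloor>x $ i\<rfloor>)"
  have "0 \<le> x $ i + real_of_int (- \<lfloor>x $ i\<rfloor>)" "x $ i + real_of_int (- \<lfloor>x $ i\<rfloor>) \<le> 1" for i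
    using floor_correct[of "x $ i"] by (simp, linarith)
  then have "x + int_vec k \<in> cbox 0 One"
    unfolding mem_unit_cube by (simp add: k_def)
  with assms show ?thesis
    by (intro that[of "x + int_vec k"]) (auto simp: periodic_def)
qed

lemma periodic_translate:
  "periodic f \<Longrightarrow> periodic (\<lambda>x. f (x + a))"
  by (simp add: periodic_def add.assoc add.commute[of a]) (metis add.assoc add.commute)

text \<open>The shift pushes a slab of thickness \<open>h\<close> out of the unit cube; periodicity
  brings it back at the opposite face. Both integrals are therefore cut by a hyperplane, at height
  \<open>1 - h\<close> and at height \<open>h\<close>, and the pieces are matched.\<close>

lemma integral_torus_translate_axis_aux:
  fixes f :: "real ^ 'd::finite \<Rightarrow> real"
  assumes f: "continuous_on UNIV f" "periodic f" and h: "0 \<le> h" "h \<le> 1"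
  shows "(\<integral>x. f (x + axis i h) \<partial>torus) = (\<integral>x. f x \<partial>torus)"
proof -
  let ?Q = "cbox 0 (One :: real ^ 'd)" and ?e = "axis i 1 :: real ^ 'd"
  have cf: "continuous_on UNIV (\<lambda>x. f (x + axis i h))"
    by (intro continuous_on_compose2[OF f(1)] continuous_intros) auto
  have io: "g integrable_on ?Q" if "continuous_on UNIV g" for g :: "real ^ 'd \<Rightarrow> real"
    using that by (intro integrable_continuous) (auto intro: continuous_on_subset)
  have low: "?Q \<inter> {x. x \<bullet> ?e \<le> a} = cbox 0 (One - axis i (1 - a))" if "0 \<le> a" "a \<le> 1" for a
    using that by (auto simp: mem_box_cart inner_axis axis_nth' split: if_splits)
       (smt (verit, best))+
  have high: "?Q \<inter> {x. a \<le> x \<bullet> ?e} = cbox (axis i a) One" if "0 \<le> a" "a \<le> 1" for a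
    using that by (auto simp: mem_box_cart inner_axis axis_nth' split: if_splits)
       (smt (verit, best))+
  have e: "?e \<in> Basis" by (auto simp: Basis_vec_def)
  have "integral ?Q (\<lambda>x. f (x + axis i h))
      = integral (cbox 0 (One - axis i h)) (\<lambda>x. f (x + axis i h))
      + integral (cbox (axis i (1 - h)) One) (\<lambda>x. f (x + axis i h))"
    using integral_split[OF io[OF cf] e, of "1 - h"] h by (simp add: low high)
  also have "integral (cbox 0 (One - axis i h)) (\<lambda>x. f (x + axis i h)) = integral (cbox (axis i h) One) f"
    using integral_shift_cbox[of "axis i h" "axis i h" One f] by simp
  \<comment> \<open>On the slab that leaves the cube, \<open>h\<close> is replaced by
    \<open>h - 1\<close>, one lattice step back.\<close>
  also have "integral (cbox (axis i (1 - h)) One) (\<lambda>x. f (x + axis i h)) = integral (cbox (axis i (1 - h)) One) (\<lambda>x. f (x + axis i (h - 1)))"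
  proof (rule integral_cong)
    fix x
    have "f (x + axis i (h - 1) + int_vec (axis i 1)) = f (x + axis i (h - 1))"
      using f(2) unfolding periodic_def by blast
    moreover have "x + axis i (h - 1) + int_vec (axis i 1) = x + axis i h"
      by (simp add: vec_eq_iff axis_def)
    ultimately show "f (x + axis i h) = f (x + axis i (h - 1))" by simp
  qed
  also have "\<dots> = integral (cbox 0 (One - axis i (1 - h))) f"
  proof -
    have eqs: "(0 :: real ^ 'd) - axis i (h - 1) = axis i (1 - h)"
      "One - axis i (1 - h) - axis i (h - 1) = (One :: real ^ 'd)"
      by (simp_all add: vec_eq_iff axis_def)
    show ?thesis
      using integral_shift_cbox[of 0 "axis i (h - 1)" "One - axis i (1 - h)" f] unfolding eqs .
  qed
  also have "integral (cbox (axis i h) One) f + \<dots> = integral ?Q f"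
    using integral_split[OF io[OF f(1)] e, of h] h by (simp add: low high)
  finally show ?thesis
    by (simp add: integral_torus f(1) cf)
qed

lemma integral_torus_translate_axis:
  fixes f :: "real ^ 'd::finite \<Rightarrow> real"
  assumes f: "continuous_on UNIV f" "periodic f"
  shows "(\<integral>x. f (x + axis i h) \<partial>torus) = (\<integral>x. f x \<partial>torus)"
proof -
  have "f (x + axis i h) = f (x + axis i (frac h))" for x
  proof -
    have "x + axis i h = x + axis i (frac h) + int_vec (axis i \<lfloor>h\<rfloor>)"
      by (simp add: vec_eq_iff axis_def frac_def)
    with f(2) show ?thesis unfolding periodic_def by metis
  qed
  then show ?thesis
    using integral_torus_translate_axis_aux[OF f, of "frac h" i] by (simp add: frac_ge_0 frac_lt_1 less_imp_le)
qed

lemma integral_torus_translate: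
  fixes f :: "real ^ 'd::finite \<Rightarrow> real"
  assumes f: "continuous_on UNIV f" "periodic f"
  shows "(\<integral>x. f (x + a) \<partial>torus) = (\<integral>x. f x \<partial>torus)"
proof -
  have "(\<integral>x. f (x + (\<Sum>i\<in>S. axis i (a $ i))) \<partial>torus) = (\<integral>x. f x \<partial>torus)" if "finite S" for S
    using that
  proof induction
    case (insert i S)
    let ?g = "\<lambda>x. f (x + (\<Sum>i\<in>S. axis i (a $ i)))"
    have "continuous_on UNIV ?g"
      by (intro continuous_on_compose2[OF f(1)] continuous_intros) auto
    then have "(\<integral>x. ?g (x + axis i (a $ i)) \<partial>torus) = (\<integral>x. ?g x \<partial>torus)"
      by (rule integral_torus_translate_axis) (rule periodic_translate[OF f(2)])
    with insert show ?case by (simp add: add.assoc)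
  qed simp
  moreover have "(\<Sum>i\<in>UNIV. axis i (a $ i)) = a"
    by (simp add: vec_eq_iff axis_nth')
  ultimately show ?thesis by (metis finite)
qed

section \<open>Trigonometric series and test functions\<close>

text \<open>An enumeration of the frequency lattice, which turns lattice sums into series over
  \<open>nat\<close>, so that theorems on term-by-term limits apply. The series formed with it
  converge absolutely, so the order is immaterial.\<close>

definition freq :: "nat \<Rightarrow> int ^ 'd::finite" where
  "freq = from_nat_into UNIV"

lemma bij_freq: "bij (freq :: nat \<Rightarrow> int ^ 'd::finite)"
proof -
  have "inj (axis undefined :: int \<Rightarrow> int ^ 'd)"
    by (auto intro!: injI simp: axis_eq_axis)
  then have "infinite (range (axis undefined :: int \<Rightarrow> int ^ 'd))"
    by (simp only: finite_image_iff infinite_UNIV_int not_False_eq_True)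
  then have "infinite (UNIV :: (int ^ 'd) set)"
    by (rule infinite_super[OF subset_UNIV])
  then show ?thesis
    unfolding freq_def using bij_betw_from_nat_into[of "UNIV :: (int ^ 'd) set"] by simp
qed

lemma freq_eq_iff [simp]: "(freq m :: int ^ 'd::finite) = freq n \<longleftrightarrow> m = n"
  using bij_freq[where 'd = 'd] by (metis bij_is_inj injD)

lemma freq_surj: obtains n where "k = freq n"
  using bij_freq by (metis bij_pointE)

section \<open>Polynomial weights on the lattice; sequences of rapid decay and of moderate
  growth\<close>

definition wt :: "int ^ 'd::finite \<Rightarrow> real" where
  "wt k = 1 + norm (int_vec k)"

lemma wt_ge_1: "1 \<le> wt k" and wt_pos: "0 < wt k" and wt_nonneg: "0 \<le> wt k"
  by (simp_all add: wt_def add_pos_nonneg)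

lemma abs_nth_le_wt: "\<bar>real_of_int (k $ i)\<bar> \<le> wt k"
  using component_le_norm_cart[of "int_vec k" i] by (simp add: wt_def)

text \<open>Since \<open>wt k\<close> dominates each \<open>1 + \<bar>k $ i\<bar>\<close>, the term
  is at most a product of one-dimensional terms \<open>g (k $ i)\<close>, each summable over the
  integers. Finite sums are enlarged to a box, where the sum of products factorizes.\<close>

lemma summable_inverse_wt: "summable (\<lambda>n. 1 / wt (freq n :: int ^ 'd::finite) ^ (2 * CARD('d)))"
proof -
  define g :: "int \<Rightarrow> real" where "g a = 1 / (1 + \<bar>of_int a\<bar>)\<^sup>2" for a
  define S where "S = 2 * (\<Sum>m. 1 / (1 + real m)\<^sup>2)"
  have sm: "summable (\<lambda>m. 1 / (1 + real m)\<^sup>2)"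
    using inverse_power_summable[of 2, where 'a = real] summable_Suc_iff[of "\<lambda>m. inverse ((real m)\<^sup>2)"]
    by (simp add: inverse_eq_divide)
  have gS: "(\<Sum>a\<in>{-int B..int B}. g a) \<le> S" for B
  proof -
    have "{-int B..int B} \<subseteq> int ` {..B} \<union> (\<lambda>m. - int m) ` {..B}"
    proof
      fix a assume "a \<in> {-int B..int B}"
      then have "a = int (nat a) \<and> nat a \<le> B \<or> a = - int (nat (- a)) \<and> nat (- a) \<le> B" by auto
      then show "a \<in> int ` {..B} \<union> (\<lambda>m. - int m) ` {..B}" by blast
    qed
    then have "(\<Sum>a\<in>{-int B..int B}. g a) \<le> (\<Sum>a\<in>int ` {..B} \<union> (\<lambda>m. - int m) ` {..B}. g a)"
      by (intro sum_mono2) (auto simp: g_def)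
    also have "\<dots> \<le> (\<Sum>a\<in>int ` {..B}. g a) + (\<Sum>a\<in>(\<lambda>m. - int m) ` {..B}. g a)"
      by (subst sum.union_inter[symmetric]) (auto simp: g_def intro!: sum_nonneg)
    also have "\<dots> = 2 * (\<Sum>m\<le>B. 1 / (1 + real m)\<^sup>2)"
      by (subst (1 2) sum.reindex) (auto simp: inj_on_def g_def)
    also have "\<dots> \<le> S"
      unfolding S_def by (intro mult_left_mono sum_le_suminf sm) auto
    finally show ?thesis .
  qed
  have prod_bound: "1 / wt k ^ (2 * CARD('d)) \<le> (\<Prod>i\<in>UNIV. g (k $ i))" for k :: "int ^ 'd"
  proof -
    have "(\<Prod>i\<in>(UNIV :: 'd set). 1 / (wt k)\<^sup>2) \<le> (\<Prod>i\<in>UNIV. g (k $ i))"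
    proof (intro prod_mono conjI)
      fix i
      have "1 + \<bar>real_of_int (k $ i)\<bar> \<le> wt k"
        using component_le_norm_cart[of "int_vec k" i] by (simp add: wt_def)
      then show "1 / (wt k)\<^sup>2 \<le> g (k $ i)"
        unfolding g_def by (intro divide_left_mono power_mono mult_pos_pos zero_less_power) (auto simp: wt_pos)
    qed simp
    then show ?thesis by (simp add: power_mult power_one_over)
  qed
  have partial: "(\<Sum>n<m. 1 / wt (freq n :: int ^ 'd) ^ (2 * CARD('d))) \<le> S ^ CARD('d)" for m
  proof -
    let ?K = "(freq :: nat \<Rightarrow> int ^ 'd) ` {..<m}"
    have "\<exists>B. \<forall>k\<in>?K. \<forall>i. \<bar>k $ i\<bar> \<le> int B"
    proof -
      have "finite ((\<lambda>(k, i). nat \<bar>k $ i\<bar>) ` (?K \<times> UNIV))" by simp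
      then obtain B where "\<forall>b\<in>(\<lambda>(k, i). nat \<bar>k $ i\<bar>) ` (?K \<times> UNIV). b \<le> B"
        using finite_nat_set_iff_bounded_le by blast
      then have "\<forall>k\<in>?K. \<forall>i. \<bar>k $ i\<bar> \<le> int B" by (auto simp: nat_le_iff)
      then show ?thesis by blast
    qed
    then obtain B where B: "\<And>k i. k \<in> ?K \<Longrightarrow> \<bar>k $ i\<bar> \<le> int B" by blast
    let ?P = "PiE UNIV (\<lambda>_::'d. {-int B..int B})"
    have sub: "?K \<subseteq> vec_lambda ` ?P"
    proof
      fix k assume "k \<in> ?K"
      then have "(\<lambda>i. k $ i) \<in> ?P" using B by (force simp: abs_le_iff)
      then show "k \<in> vec_lambda ` ?P" by (metis image_eqI vec_nth_inverse)
    qed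
    have fin: "finite ?P" by (intro finite_PiE) auto
    have "(\<Sum>n<m. 1 / wt (freq n :: int ^ 'd) ^ (2 * CARD('d))) = (\<Sum>k\<in>?K. 1 / wt k ^ (2 * CARD('d)))"
      by (subst sum.reindex) (auto simp: inj_on_def)
    also have "\<dots> \<le> (\<Sum>k\<in>?K. \<Prod>i\<in>UNIV. g (k $ i))"
      by (intro sum_mono prod_bound)
    also have "\<dots> \<le> (\<Sum>k\<in>vec_lambda ` ?P. \<Prod>i\<in>UNIV. g (k $ i))"
      by (intro sum_mono2 sub) (auto simp: fin g_def intro!: prod_nonneg)
    also have "\<dots> = (\<Sum>f\<in>?P. \<Prod>i\<in>UNIV. g (f i))"
      by (subst sum.reindex) (auto simp: inj_on_def vec_lambda_inject)
    also have "\<dots> = (\<Prod>i\<in>(UNIV :: 'd set). \<Sum>a\<in>{-int B..int B}. g a)"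
      by (subst prod_sum_PiE) auto
    also have "\<dots> = (\<Sum>a\<in>{-int B..int B}. g a) ^ CARD('d)" by simp
    also have "\<dots> \<le> S ^ CARD('d)"
      by (intro power_mono gS sum_nonneg) (simp add: g_def)
    finally show ?thesis .
  qed
  show ?thesis
    by (intro summableI_nonneg_bounded[OF _ partial]) (simp add: wt_nonneg)
qed

text \<open>Rapid sequences are the Fourier coefficients of test functions, \<open>moderate\<close>
  ones those of distributions. A product of the two is rapid, hence pairings converge
  absolutely.\<close>

definition rapid :: "(int ^ 'd::finite \<Rightarrow> complex) \<Rightarrow> bool" where
  "rapid c \<longleftrightarrow> (\<forall>N. \<exists>C. \<forall>k. norm (c k) * wt k ^ N \<le> C)"

definition moderate :: "(int ^ 'd::finite \<Rightarrow> complex) \<Rightarrow> bool" where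
  "moderate m \<longleftrightarrow> (\<exists>N C. 0 \<le> C \<and> (\<forall>k. norm (m k) \<le> C * wt k ^ N))"

lemma rapid_bound:
  assumes "rapid c"
  obtains C where "0 \<le> C" "\<And>k. norm (c k) * wt k ^ N \<le> C"
proof -
  from assms obtain C where C: "\<And>k. norm (c k) * wt k ^ N \<le> C" unfolding rapid_def by blast
  moreover have "0 \<le> C"
    using C[of 0] by (rule order_trans[rotated]) (simp add: wt_nonneg)
  ultimately show ?thesis using that by blast
qed

text \<open>The decay is used with \<open>2 * CARD('d)\<close> additional powers of the weight,
  which pay for the summation over the lattice.\<close>

lemma rapid_summable:
  assumes "rapid (c :: int ^ 'd::finite \<Rightarrow> complex)"
  shows "summable (\<lambda>n. norm (c (freq n)) * wt (freq n :: int ^ 'd) ^ N)"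
proof -
  let ?d = "2 * CARD('d)"
  obtain C where C: "0 \<le> C" "\<And>k. norm (c k) * wt k ^ (N + ?d) \<le> C"
    using rapid_bound[OF assms] by blast
  have "norm (c k) * wt k ^ N \<le> C * (1 / wt k ^ ?d)" for k
    using C(2)[of k] wt_pos[of k] by (simp add: field_simps power_add)
  then have "norm (norm (c (freq n)) * wt (freq n :: int ^ 'd) ^ N) \<le> C * (1 / wt (freq n :: int ^ 'd) ^ ?d)" for n
    by (simp only: real_norm_def abs_mult abs_norm_cancel abs_of_nonneg[OF zero_le_power[OF wt_nonneg]])
  then show ?thesis
    by (rule summable_comparison_test'[OF summable_mult[OF summable_inverse_wt], of 0])
qed

lemma rapid_mult_moderate:
  assumes "rapid c" "moderate m"
  shows "rapid (\<lambda>k. c k * m k)"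
  unfolding rapid_def
proof
  fix N
  from assms(2) obtain M C where C: "0 \<le> C" "\<And>k. norm (m k) \<le> C * wt k ^ M"
    unfolding moderate_def by blast
  obtain B where B: "0 \<le> B" "\<And>k. norm (c k) * wt k ^ (M + N) \<le> B"
    using rapid_bound[OF assms(1)] by blast
  have "norm (c k * m k) * wt k ^ N \<le> C * B" for k
  proof -
    have "norm (c k * m k) * wt k ^ N \<le> norm (c k) * (C * wt k ^ M) * wt k ^ N"
      unfolding norm_mult by (intro mult_right_mono mult_left_mono C(2)) (auto simp: wt_nonneg)
    also have "\<dots> = C * (norm (c k) * wt k ^ (M + N))" by (simp add: power_add)
    also have "\<dots> \<le> C * B" by (intro mult_left_mono B C)
    finally show ?thesis .
  qed
  then show "\<exists>C. \<forall>k. norm (c k * m k) * wt k ^ N \<le> C" by blast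
qed

lemma rapid_mono:
  assumes "rapid c" "\<And>k. norm (c' k) \<le> norm (c k)"
  shows "rapid c'"
  using assms unfolding rapid_def
  by (meson mult_right_mono order_trans wt_nonneg zero_le_power)

text \<open>One complex number carries the cosine and the sine coefficient, so that differentiation
  and translation act on it as complex multiplication.\<close>

definition trig :: "int ^ 'd::finite \<Rightarrow> complex \<Rightarrow> real ^ 'd \<Rightarrow> real" where
  "trig k z x = Re (z * cis (2 * pi * (int_vec k \<bullet> x)))"

lemma trig_eq: "trig k z x = Re z * cos (2 * pi * (int_vec k \<bullet> x)) - Im z * sin (2 * pi * (int_vec k \<bullet> x))"
  by (simp add: trig_def)

lemma abs_trig_le: "\<bar>trig k z x\<bar> \<le> norm z"
  unfolding trig_def using abs_Re_le_cmod[of "z * cis (2 * pi * (int_vec k \<bullet> x))"] by (simp add: norm_mult)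

lemma cis_2pi_int_vec: "cis (2 * pi * (int_vec k \<bullet> int_vec l)) = 1"
proof -
  have "int_vec k \<bullet> int_vec l = of_int (\<Sum>i\<in>UNIV. k $ i * l $ i)"
    by (simp add: inner_int_vec)
  then show ?thesis by (metis Ints_of_int cis_multiple_2pi)
qed

lemma trig_periodic: "trig k z (x + int_vec l) = trig k z x"
  by (simp add: trig_def inner_add_right distrib_left cis_mult[symmetric] cis_2pi_int_vec)

lemma continuous_trig: "continuous_on UNIV (trig k z)"
  unfolding trig_eq[abs_def] by (intro continuous_intros)

text \<open>Taking real parts term by term makes this a real function for every \<open>c\<close>; it
  is the Fourier series with coefficients \<open>c\<close> when \<open>c\<close> is
  Hermitian.\<close>

definition trig_series :: "(int ^ 'd::finite \<Rightarrow> complex) \<Rightarrow> real ^ 'd \<Rightarrow> real" where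
  "trig_series c x = (\<Sum>n. trig (freq n) (c (freq n)) x)"

lemma rapid_summable_norm: "rapid c \<Longrightarrow> summable (\<lambda>n. norm (c (freq n)))"
  using rapid_summable[of c 0] by simp

lemma trig_series_sums:
  assumes "rapid c"
  shows "(\<lambda>n. trig (freq n) (c (freq n)) x) sums trig_series c x"
  unfolding trig_series_def
  by (intro summable_sums summable_comparison_test'[OF rapid_summable_norm[OF assms], of 0]) (simp add: abs_trig_le)

lemma abs_trig_series_le:
  assumes "rapid c"
  shows "\<bar>trig_series c x\<bar> \<le> (\<Sum>n. norm (c (freq n)))"
proof -
  have "summable (\<lambda>n. norm (trig (freq n) (c (freq n)) x))"
    by (intro summable_comparison_test'[OF rapid_summable_norm[OF assms], of 0]) (simp add: abs_trig_le)
  then have "\<bar>trig_series c x\<bar> \<le> (\<Sum>n. norm (trig (freq n) (c (freq n)) x))"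
    unfolding trig_series_def using summable_norm by fastforce
  also have "\<dots> \<le> (\<Sum>n. norm (c (freq n)))"
    by (intro suminf_le) (auto simp: abs_trig_le rapid_summable_norm assms intro!: summable_comparison_test'[OF rapid_summable_norm[OF assms], of 0])
  finally show ?thesis .
qed

text \<open>The Fourier symbol of the differential operator \<open>Dpart is\<close>.\<close>

definition dsym :: "'d::finite list \<Rightarrow> int ^ 'd \<Rightarrow> complex" where
  "dsym is k = (\<Prod>i\<leftarrow>is. 2 * of_real pi * \<i> * of_int (k $ i))"

lemma dsym_Nil [simp]: "dsym [] k = 1" and dsym_Cons: "dsym (i # is) k = 2 * of_real pi * \<i> * of_int (k $ i) * dsym is k"
  by (simp_all add: dsym_def)

lemma norm_dsym_le: "norm (dsym is k) \<le> (2 * pi * wt k) ^ length is"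
proof (induction "is")
  case (Cons i "is")
  have "norm (2 * of_real pi * \<i> * of_int (k $ i) :: complex) \<le> 2 * pi * wt k"
    by (simp add: norm_mult abs_nth_le_wt)
  then have "norm (dsym (i # is) k) \<le> (2 * pi * wt k) * (2 * pi * wt k) ^ length is"
    unfolding dsym_Cons norm_mult[of _ "dsym is k"] by (intro mult_mono Cons) (auto simp: wt_nonneg)
  then show ?case by simp
qed simp

lemma moderate_dsym: "moderate (dsym is)"
  unfolding moderate_def
  by (intro exI[of _ "length is"] exI[of _ "(2 * pi) ^ length is"])
     (use norm_dsym_le[of "is"] in \<open>simp add: power_mult_distrib\<close>)

lemma rapid_dsym: "rapid c \<Longrightarrow> rapid (\<lambda>k. c k * dsym is k)"
  by (intro rapid_mult_moderate moderate_dsym)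

lemma DERIV_trig:
  "((\<lambda>h. trig k z (x + h *\<^sub>R axis i 1)) has_field_derivative
     trig k (z * (2 * of_real pi * \<i> * of_int (k $ i))) (x + h *\<^sub>R axis i 1)) (at h)"
  unfolding trig_eq
  by (auto intro!: derivative_eq_intros simp: inner_add_right inner_axis algebra_simps)

lemma DERIV_trig_series:
  assumes "rapid c"
  shows "((\<lambda>h. trig_series c (x + h *\<^sub>R axis i 1)) has_field_derivative
           trig_series (\<lambda>k. c k * (2 * of_real pi * \<i> * of_int (k $ i))) x) (at 0)"
proof -
  let ?c = "\<lambda>k. c k * (2 * of_real pi * \<i> * of_int (k $ i))"
  have r: "rapid ?c"
    using rapid_dsym[OF assms, of "[i]"] by (simp add: dsym_Cons)
  have "((\<lambda>h. \<Sum>n. trig (freq n) (c (freq n)) (x + h *\<^sub>R axis i 1)) has_field_derivative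
     (\<Sum>n. trig (freq n) (?c (freq n)) (x + 0 *\<^sub>R axis i 1))) (at 0)"
  proof (rule has_field_derivative_series'(2)[where S = UNIV and ?x0.0 = 0])
    show "uniformly_convergent_on UNIV (\<lambda>n h. \<Sum>j<n. trig (freq j) (?c (freq j)) (x + h *\<^sub>R axis i 1))"
      by (rule Weierstrass_m_test'[OF _ rapid_summable_norm[OF r]]) (simp add: abs_trig_le)
    show "summable (\<lambda>n. trig (freq n) (c (freq n)) (x + 0 *\<^sub>R axis i 1))"
      using trig_series_sums[OF assms] by (simp add: sums_iff)
  qed (auto intro: DERIV_trig)
  then show ?thesis by (simp add: trig_series_def)
qed

lemma continuous_trig_series:
  assumes "rapid c"
  shows "continuous_on UNIV (trig_series c)"
proof -
  have "uniform_limit UNIV (\<lambda>n x. \<Sum>j<n. trig (freq j) (c (freq j)) x) (\<lambda>x. \<Sum>j. trig (freq j) (c (freq j)) x) sequentially"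
    by (rule Weierstrass_m_test[OF _ rapid_summable_norm[OF assms]]) (simp add: abs_trig_le)
  then have "continuous_on UNIV (\<lambda>x. \<Sum>j. trig (freq j) (c (freq j)) x)"
    by (rule uniform_limit_theorem[rotated]) (auto intro!: always_eventually continuous_on_sum continuous_trig)
  then show ?thesis by (simp add: trig_series_def[abs_def])
qed

lemma Dpart_trig_series:
  assumes "rapid c"
  shows "Dpart is (trig_series c) = trig_series (\<lambda>k. c k * dsym is k)"
proof (induction "is")
  case Nil
  show ?case by simp
next
  case (Cons i "is")
  show ?case
  proof
    fix x
    have eq: "(\<lambda>k. (c k * dsym is k) * (2 * of_real pi * \<i> * of_int (k $ i))) = (\<lambda>k. c k * dsym (i # is) k)"
      by (simp only: dsym_Cons mult_ac)
    have D: "((\<lambda>h. trig_series (\<lambda>k. c k * dsym is k) (x + h *\<^sub>R axis i 1)) has_field_derivative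
        trig_series (\<lambda>k. c k * dsym (i # is) k) x) (at 0)"
      using DERIV_trig_series[OF rapid_dsym[OF assms, of "is"], of x i] unfolding eq .
    show "Dpart (i # is) (trig_series c) x = trig_series (\<lambda>k. c k * dsym (i # is) k) x"
      unfolding Dpart.simps Cons.IH by (rule DERIV_imp_deriv[OF D])
  qed
qed

lemma test_function_trig_series:
  assumes "rapid c"
  shows "test_function (trig_series c)"
  unfolding test_function_def smooth_def C_k_def
proof (intro conjI allI impI)
  show "periodic (trig_series c)"
    by (simp add: periodic_def trig_series_def trig_periodic)
next
  fix "is" :: "'a list" 
  show "continuous_on UNIV (Dpart is (trig_series c))"
    by (simp add: Dpart_trig_series assms continuous_trig_series rapid_dsym)
next
  fix n :: nat and "is" :: "'a list" and i x
  show "(\<lambda>h. Dpart is (trig_series c) (x + h *\<^sub>R axis i 1)) field_differentiable at 0"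
    unfolding Dpart_trig_series[OF assms] field_differentiable_def
    by (rule exI, rule DERIV_trig_series[OF rapid_dsym[OF assms]])
qed

lemma rapid_finite_support:
  assumes "finite S" "\<And>k. k \<notin> S \<Longrightarrow> c k = 0"
  shows "rapid c"
  unfolding rapid_def
proof
  fix N
  have "norm (c k) * wt k ^ N \<le> (\<Sum>k\<in>S. norm (c k) * wt k ^ N)" for k
  proof (cases "k \<in> S")
    case True
    then show ?thesis by (intro member_le_sum assms(1)) (auto simp: wt_nonneg)
  qed (auto simp: assms wt_nonneg intro!: sum_nonneg)
  then show "\<exists>C. \<forall>k. norm (c k) * wt k ^ N \<le> C" by blast
qed

lemma trig_series_single: "trig_series (\<lambda>l. if l = k then z else 0) = trig k z"
proof
  fix x
  obtain n where n: "k = freq n" by (rule freq_surj)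
  have "(\<lambda>m. trig (freq m) (if freq m = k then z else 0) x) = (\<lambda>m. if m = n then trig k z x else 0)"
    by (auto simp: n trig_def)
  then show "trig_series (\<lambda>l. if l = k then z else 0) x = trig k z x"
    unfolding trig_series_def using sums_single[of n "\<lambda>_. trig k z x"] by (simp add: sums_iff)
qed

lemma rapid_single: "rapid (\<lambda>l. if l = k then z else 0)"
  by (rule rapid_finite_support[of "{k}"]) auto

lemma test_function_trig: "test_function (trig k z)"
  using test_function_trig_series[OF rapid_single] by (simp add: trig_series_single)

lemma abs_Dpart_trig_le: "\<bar>Dpart is (trig k z) x\<bar> \<le> norm z * (2 * pi * wt k) ^ length is"
proof -
  have eq: "(\<lambda>l. (if l = k then z else 0) * dsym is l) = (\<lambda>l. if l = k then z * dsym is k else 0)"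
    by auto
  have "Dpart is (trig k z) = trig k (z * dsym is k)"
    using Dpart_trig_series[OF rapid_single[of k z], of "is"] unfolding eq trig_series_single .
  then have "\<bar>Dpart is (trig k z) x\<bar> \<le> norm (z * dsym is k)" by (simp add: abs_trig_le)
  also have "\<dots> \<le> norm z * (2 * pi * wt k) ^ length is"
    unfolding norm_mult by (intro mult_left_mono norm_dsym_le) auto
  finally show ?thesis .
qed

section \<open>Fourier coefficients of distributions and their pairing with trigonometric
  series\<close>

lemma is_distribution_dapp: "is_distribution (dapp F)"
  using dapp by blast

lemma dapp_add: "test_function \<eta> \<Longrightarrow> test_function \<zeta> \<Longrightarrow> dapp F (\<lambda>x. \<eta> x + \<zeta> x) = dapp F \<eta> + dapp F \<zeta>"
  and dapp_cmult: "test_function \<eta> \<Longrightarrow> dapp F (\<lambda>x. a * \<eta> x) = a * dapp F \<eta>"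
  using is_distribution_dapp[of F] unfolding is_distribution_def by blast+

lemma dapp_bound:
  obtains C N where "0 \<le> C"
    "\<And>\<eta> K. test_function \<eta> \<Longrightarrow> (\<And>is x. length is \<le> N \<Longrightarrow> \<bar>Dpart is \<eta> x\<bar> \<le> K) \<Longrightarrow> \<bar>dapp F \<eta>\<bar> \<le> C * K"
proof -
  from is_distribution_dapp[of F] obtain C N where
    C: "\<And>\<eta> K. test_function \<eta> \<Longrightarrow> (\<And>is x. length is \<le> N \<Longrightarrow> \<bar>Dpart is \<eta> x\<bar> \<le> K) \<Longrightarrow> \<bar>dapp F \<eta>\<bar> \<le> C * K"
    unfolding is_distribution_def by meson
  have "\<bar>dapp F \<eta>\<bar> \<le> \<bar>C\<bar> * K"
    if "test_function \<eta>" and b: "\<And>is x. length is \<le> N \<Longrightarrow> \<bar>Dpart is \<eta> x\<bar> \<le> K" for \<eta> K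
  proof -
    have "0 \<le> K" using b[of "[]" 0] by simp
    then have "C * K \<le> \<bar>C\<bar> * K" by (intro mult_right_mono) auto
    with C[OF that] show ?thesis by linarith
  qed
  then show ?thesis using that[of "\<bar>C\<bar>" N] by auto
qed

lemma trig_cos: "trig k 1 = (\<lambda>x. cos (2 * pi * (int_vec k \<bullet> x)))"
  and trig_sin: "trig k (- \<i>) = (\<lambda>x. sin (2 * pi * (int_vec k \<bullet> x)))"
  by (auto simp: trig_eq)

lemma fourier_trig: "fourier F k = Complex (dapp F (trig k 1)) (- dapp F (trig k (- \<i>)))"
  by (simp add: fourier_def trig_cos trig_sin)

text \<open>The conjugate appears because \<open>fourier\<close> pairs with the exponential of
  frequency \<open>- k\<close>, whereas \<open>trig k z\<close> is built from that of frequency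
  \<open>k\<close>.\<close>

lemma dapp_trig: "dapp F (trig k z) = Re (z * cnj (fourier F k))"
proof -
  have "trig k z = (\<lambda>x. Re z * trig k 1 x + (- Im z) * trig k (- \<i>) x)"
    by (auto simp: trig_eq)
  then have "dapp F (trig k z) = Re z * dapp F (trig k 1) + (- Im z) * dapp F (trig k (- \<i>))"
    by (simp only: dapp_add dapp_cmult test_function_trig test_function_cmult)
  then show ?thesis by (simp add: fourier_trig)
qed

text \<open>A distribution has finite order \<open>N\<close>, and derivatives of order up to
  \<open>N\<close> of a unit exponential grow at most like
  \<open>(2 * pi * wt k) ^ N\<close>.\<close>

lemma moderate_fourier: "moderate (fourier F)"
proof -
  obtain C N where C: "0 \<le> C"
    "\<And>\<eta> K. test_function \<eta> \<Longrightarrow> (\<And>is x. length is \<le> N \<Longrightarrow> \<bar>Dpart is \<eta> x\<bar> \<le> K) \<Longrightarrow> \<bar>dapp F \<eta>\<bar> \<le> C * K"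
    using dapp_bound by blast
  have *: "\<bar>dapp F (trig k z)\<bar> \<le> C * (2 * pi * wt k) ^ N" if "norm z = 1" for k z
  proof (rule C(2)[OF test_function_trig])
    fix "is" :: "'a list" and x assume "length is \<le> N"
    moreover have "1 \<le> 2 * pi * wt k"
      using mult_mono[of 1 "2 * pi" 1 "wt k"] pi_ge_two wt_ge_1[of k] by simp
    ultimately show "\<bar>Dpart is (trig k z) x\<bar> \<le> (2 * pi * wt k) ^ N"
      using abs_Dpart_trig_le[of "is" k z x] power_increasing[of "length is" N "2 * pi * wt k"] that by simp
  qed
  have "norm (fourier F k) \<le> (2 * C * (2 * pi) ^ N) * wt k ^ N" for k
    using cmod_le[of "fourier F k"] *[of 1 k] *[of "- \<i>" k] by (simp add: fourier_trig power_mult_distrib)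
  then show ?thesis
    unfolding moderate_def using C(1) by (intro exI[of _ N] exI[of _ "2 * C * (2 * pi) ^ N"]) auto
qed

lemma trig_series_add:
  assumes "rapid c" "rapid c'"
  shows "trig_series (\<lambda>k. c k + c' k) x = trig_series c x + trig_series c' x"
proof -
  have "(\<lambda>n. trig (freq n) (c (freq n) + c' (freq n)) x) sums (trig_series c x + trig_series c' x)"
    using sums_add[OF trig_series_sums[OF assms(1), of x] trig_series_sums[OF assms(2), of x]]
    by (simp add: trig_eq algebra_simps)
  then show ?thesis by (simp add: trig_series_def sums_iff)
qed

text \<open>Finite sums are handled by linearity. The tail is a test function whose derivatives up
  to the order \<open>N\<close> of \<open>F\<close> are bounded by the tail of a convergent series,
  so \<open>F\<close> of it tends to zero.\<close>

lemma dapp_trig_series: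
  fixes F :: "'d::finite distribution"
  assumes c: "rapid c"
  shows "(\<lambda>n. Re (c (freq n) * cnj (fourier F (freq n)))) sums dapp F (trig_series c)"
proof -
  obtain C N where C: "0 \<le> C"
    "\<And>\<eta> K. test_function \<eta> \<Longrightarrow> (\<And>is x. length is \<le> N \<Longrightarrow> \<bar>Dpart is \<eta> x\<bar> \<le> K) \<Longrightarrow> \<bar>dapp F \<eta>\<bar> \<le> C * K"
    using dapp_bound by blast
  define lo where "lo m k = (if k \<in> freq ` {..<m} then c k else 0)" for m k
  define hi where "hi m k = (if k \<in> freq ` {..<m} then 0 else c k)" for m k
  have rl: "rapid (lo m)" and rh: "rapid (hi m)" for m
    by (auto intro!: rapid_mono[OF c] simp: lo_def hi_def)
  have eq: "(\<lambda>k. lo m k + hi m k) = c" for m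
    by (auto simp: lo_def hi_def)
  have split: "trig_series c = (\<lambda>x. trig_series (lo m) x + trig_series (hi m) x)" for m
    using trig_series_add[OF rl[of m] rh[of m]] unfolding eq by (rule ext)
  have low: "dapp F (trig_series (lo m)) = (\<Sum>n<m. Re (c (freq n) * cnj (fourier F (freq n))))" for m
  proof (induction m)
    case 0
    have "trig_series (lo 0) = trig 0 0" by (rule ext) (simp add: lo_def trig_series_def trig_def)
    then show ?case by (simp add: dapp_trig)
  next
    case (Suc m)
    have "lo (Suc m) = (\<lambda>k. lo m k + (if k = freq m then c (freq m) else 0))"
      by (intro ext) (auto simp: lo_def lessThan_Suc)
    then have "trig_series (lo (Suc m)) x = trig_series (lo m) x + trig (freq m) (c (freq m)) x" for x
      using trig_series_add[OF rl[of m] rapid_single[of "freq m" "c (freq m)"], of x] by (simp only: trig_series_single)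
    then have "trig_series (lo (Suc m)) = (\<lambda>x. trig_series (lo m) x + trig (freq m) (c (freq m)) x)"
      by (rule ext)
    then show ?case
      by (simp add: dapp_add test_function_trig test_function_trig_series rl dapp_trig Suc)
  qed
  \<comment> \<open>A common majorant for all derivatives of order at most \<open>N\<close>: as
    \<open>2 * pi * wt\<close> is at least 1, the highest power dominates.\<close>
  define t where "t n = norm (c (freq n)) * (2 * pi * wt (freq n :: int ^ 'd)) ^ N" for n
  have t: "summable t"
    using summable_mult[OF rapid_summable[OF c, of N], of "(2 * pi) ^ N"]
    by (simp add: t_def[abs_def] power_mult_distrib mult_ac)
  have high: "\<bar>dapp F (trig_series (hi m))\<bar> \<le> C * (\<Sum>n. t (n + m))" for m
  proof (rule C(2)[OF test_function_trig_series[OF rh]])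
    fix "is" :: "'d list" and x assume l: "length is \<le> N"
    have le: "norm (hi m (freq n) * dsym is (freq n :: int ^ 'd)) \<le> (if n < m then 0 else t n)" for n
    proof (cases "n < m")
      case False
      have "1 \<le> 2 * pi * wt (freq n :: int ^ 'd)"
        using mult_mono[of 1 "2 * pi" 1 "wt (freq n :: int ^ 'd)"] pi_ge_two wt_ge_1[of "freq n :: int ^ 'd"] by simp
      then have "norm (dsym is (freq n :: int ^ 'd)) \<le> (2 * pi * wt (freq n :: int ^ 'd)) ^ N"
        using norm_dsym_le[of "is" "freq n"] power_increasing[OF l, of "2 * pi * wt (freq n :: int ^ 'd)"] by simp
      with False show ?thesis
        by (auto simp: hi_def t_def norm_mult intro!: mult_left_mono)
    qed (auto simp: hi_def)
    have st: "summable (\<lambda>n. if n < m then 0 else t n)"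
      by (rule summable_comparison_test'[OF t, of 0]) (simp add: t_def wt_nonneg)
    have "\<bar>Dpart is (trig_series (hi m)) x\<bar> \<le> (\<Sum>n. norm (hi m (freq n) * dsym is (freq n :: int ^ 'd)))"
      unfolding Dpart_trig_series[OF rh] by (rule abs_trig_series_le[OF rapid_dsym[OF rh]])
    also have "\<dots> \<le> (\<Sum>n. if n < m then 0 else t n)"
      by (intro suminf_le le st rapid_summable_norm[OF rapid_dsym[OF rh]])
    also have "\<dots> = (\<Sum>n. t (n + m))"
      using suminf_split_initial_segment[OF st, of m] by simp
    finally show "\<bar>Dpart is (trig_series (hi m)) x\<bar> \<le> (\<Sum>n. t (n + m))" .
  qed
  have "(\<lambda>m. C * (\<Sum>n. t (n + m))) \<longlonglongrightarrow> C * 0"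
    by (intro tendsto_intros suminf_exist_split2 t)
  then have "(\<lambda>m. C * (\<Sum>n. t (n + m))) \<longlonglongrightarrow> 0" by simp
  then have "(\<lambda>m. dapp F (trig_series (hi m))) \<longlonglongrightarrow> 0"
    by (rule Lim_null_comparison[rotated]) (intro always_eventually allI, simp only: real_norm_def high)
  moreover have "dapp F (trig_series c) - (\<Sum>n<m. Re (c (freq n) * cnj (fourier F (freq n)))) = dapp F (trig_series (hi m))" for m
    using low[of m] arg_cong[OF split[of m], of "dapp F"]
    by (simp only: dapp_add test_function_trig_series rl rh)
  ultimately have "(\<lambda>m. dapp F (trig_series c) - (dapp F (trig_series c) - (\<Sum>n<m. Re (c (freq n) * cnj (fourier F (freq n)))))) \<longlonglongrightarrow> dapp F (trig_series c) - 0"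
    by (intro tendsto_intros) simp
  then show ?thesis by (simp add: sums_def)
qed

lemma complex_eqI_Re_mult:
  assumes "\<And>z. Re (z * a) = Re (z * b)"
  shows "a = b"
  using assms[of 1] assms[of \<i>] by (simp add: complex_eq_iff)

section \<open>Fourier coefficients of continuous functions and orthogonality\<close>

definition fcoeff :: "(real ^ 'd::finite \<Rightarrow> real) \<Rightarrow> int ^ 'd \<Rightarrow> complex" where
  "fcoeff g = fourier (regular_distribution g)"

lemma dapp_regular:
  "continuous_on UNIV g \<Longrightarrow> test_function \<eta> \<Longrightarrow> dapp (regular_distribution g) \<eta> = (\<integral>x. g x * \<eta> x \<partial>torus)"
  by (simp add: dapp_regular_distribution integrable_torus regular_functional_def)

lemma integral_trig_fcoeff:
  "continuous_on UNIV g \<Longrightarrow> (\<integral>x. g x * trig k z x \<partial>torus) = Re (z * cnj (fcoeff g k))"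
  by (simp add: dapp_regular[symmetric] test_function_trig dapp_trig fcoeff_def)

lemma fcoeff_unique:
  assumes "continuous_on UNIV g" "\<And>z. (\<integral>x. g x * trig k z x \<partial>torus) = Re (z * cnj a)"
  shows "fcoeff g k = a"
proof -
  have "cnj (fcoeff g k) = cnj a"
  proof (rule complex_eqI_Re_mult)
    show "Re (z * cnj (fcoeff g k)) = Re (z * cnj a)" for z
      using integral_trig_fcoeff[OF assms(1), of k z] assms(2)[of z] by simp
  qed
  then show ?thesis by simp
qed

text \<open>The symmetry of the coefficients of real functions. Without it, taking real parts would
  symmetrize \<open>c\<close>, and \<open>c\<close> could not be recovered from
  \<open>trig_series c\<close>.\<close>

definition hermitian :: "(int ^ 'd::finite \<Rightarrow> complex) \<Rightarrow> bool" where
  "hermitian c \<longleftrightarrow> (\<forall>k. c (- k) = cnj (c k))"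

lemma trig_uminus: "trig (- k) z = trig k (cnj z)"
  by (rule ext) (simp add: trig_eq int_vec_uminus)

lemma hermitian_fourier: "hermitian (fourier F)"
  unfolding hermitian_def
proof
  fix k
  have "cnj (fourier F (- k)) = fourier F k"
  proof (rule complex_eqI_Re_mult)
    fix z
    show "Re (z * cnj (fourier F (- k))) = Re (z * fourier F k)"
      using dapp_trig[of F "- k" z] dapp_trig[of F k "cnj z"] by (simp add: trig_uminus)
  qed
  then show "fourier F (- k) = cnj (fourier F k)" by (metis complex_cnj_cnj)
qed

lemma trig_translate: "trig k z (x + a) = trig k (z * cis (2 * pi * (int_vec k \<bullet> a))) x"
  by (simp add: trig_def inner_add_right distrib_left cis_mult[symmetric] mult_ac)

text \<open>For \<open>k \<noteq> 0\<close> some component is nonzero, and the translation by half a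
  period in that coordinate changes the sign of the function but not its integral.\<close>

lemma integral_trig: "(\<integral>x. trig k z x \<partial>torus) = (if k = 0 then Re z else 0)"
proof (cases "k = 0")
  case True
  then show ?thesis by (simp add: trig_def torus.prob_space)
next
  case False
  then obtain i where i: "k $ i \<noteq> 0" by (auto simp: vec_eq_iff)
  let ?a = "axis i (1 / (2 * of_int (k $ i))) :: real ^ 'a"
  have half: "2 * pi * (int_vec k \<bullet> ?a) = pi" using i by (simp add: inner_axis)
  have "trig k z (x + ?a) = - trig k z x" for x
    unfolding trig_translate half by (simp add: trig_def)
  moreover have "(\<integral>x. trig k z (x + ?a) \<partial>torus) = (\<integral>x. trig k z x \<partial>torus)"
    by (rule integral_torus_translate[OF continuous_trig]) (simp add: periodic_def trig_periodic)
  ultimately show ?thesis using False by simp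
qed

lemma trig_mult: "trig k z x * trig l w x = (trig (k + l) (z * w) x + trig (k - l) (z * cnj w) x) / 2"
proof -
  let ?a = "2 * pi * (int_vec k \<bullet> x)" and ?b = "2 * pi * (int_vec l \<bullet> x)"
  have "cis (2 * pi * (int_vec (k + l) \<bullet> x)) = cis ?a * cis ?b"
    "cis (2 * pi * (int_vec (k - l) \<bullet> x)) = cis ?a * cnj (cis ?b)"
    by (simp_all add: int_vec_add int_vec_minus inner_add_left inner_diff_left cis_cnj cis_mult algebra_simps)
  then have "z * w * cis (2 * pi * (int_vec (k + l) \<bullet> x)) = (z * cis ?a) * (w * cis ?b)"
    "z * cnj w * cis (2 * pi * (int_vec (k - l) \<bullet> x)) = (z * cis ?a) * cnj (w * cis ?b)"
    by (simp_all only: complex_cnj_mult mult_ac)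
  moreover have "Re a * Re b = (Re (a * b) + Re (a * cnj b)) / 2" for a b by simp
  ultimately show ?thesis unfolding trig_def by metis
qed

lemma integrable_trig: "integrable torus (trig k z)"
  by (rule integrable_torus[OF continuous_trig])

text \<open>A real part contains the frequencies \<open>l\<close> and \<open>- l\<close> with half
  the weight each. For \<open>l = 0\<close> both cases apply and give \<open>Re w\<close>.\<close>

lemma fcoeff_trig: "fcoeff (trig l w) k = ((if k = - l then cnj w else 0) + (if k = l then w else 0)) / 2"
proof (rule fcoeff_unique[OF continuous_trig])
  fix z
  have "(\<integral>x. trig l w x * trig k z x \<partial>torus) = ((\<integral>x. trig (l + k) (w * z) x \<partial>torus) + (\<integral>x. trig (l - k) (w * cnj z) x \<partial>torus)) / 2"
    by (simp add: trig_mult integrable_trig)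
  moreover have "l + k = 0 \<longleftrightarrow> k = - l" "l - k = 0 \<longleftrightarrow> k = l"
    by (auto simp: add_eq_0_iff)
  ultimately show "(\<integral>x. trig l w x * trig k z x \<partial>torus)
      = Re (z * cnj (((if k = - l then cnj w else 0) + (if k = l then w else 0)) / 2))"
    by (simp add: integral_trig algebra_simps)
qed

lemma sums_freq_single: "(\<lambda>n. if freq n = k then f (freq n) else 0) sums (f k :: real)"
proof -
  obtain m where m: "k = freq m" by (rule freq_surj)
  have "(\<lambda>n. if freq n = k then f (freq n) else 0) = (\<lambda>n. if n = m then f k else 0)"
    by (auto simp: m)
  then show ?thesis using sums_single[of m "\<lambda>_. f k"] by simp
qed

text \<open>By duality: the integral against \<open>trig l w\<close> is the value of the regular
  distribution of \<open>trig l w\<close> at the series, which \<open>dapp_trig_series\<close>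
  expands. Only the terms with index \<open>l\<close> and \<open>- l\<close> survive, and Hermitian
  symmetry merges the two halves.\<close>

lemma fcoeff_trig_series:
  fixes c :: "int ^ 'd::finite \<Rightarrow> complex"
  assumes c: "rapid c" "hermitian c"
  shows "fcoeff (trig_series c) = c"
proof
  fix l :: "int ^ 'd"
  show "fcoeff (trig_series c) l = c l"
  proof (rule fcoeff_unique[OF continuous_trig_series[OF c(1)]])
    fix w
    let ?t = "\<lambda>k. Re (c k * cnj ((if k = - l then cnj w else 0) + (if k = l then w else 0))) / 2"
    have 1: "(\<integral>x. trig_series c x * trig l w x \<partial>torus) = dapp (regular_distribution (trig l w)) (trig_series c)"
      by (simp add: dapp_regular continuous_trig test_function_trig_series c mult.commute)
    have "(\<lambda>n. Re (c (freq n) * cnj (fcoeff (trig l w) (freq n)))) sums dapp (regular_distribution (trig l w)) (trig_series c)"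
      unfolding fcoeff_def by (rule dapp_trig_series[OF c(1)])
    then have 2: "(\<lambda>n. ?t (freq n)) sums dapp (regular_distribution (trig l w)) (trig_series c)"
      by (simp add: fcoeff_trig)
    have 3: "(\<lambda>n. ?t (freq n)) sums (Re (c (- l) * w) / 2 + Re (c l * cnj w) / 2)"
    proof -
      have g: "Re (a * cnj ((if P then cnj w else 0) + (if Q then w else 0))) / 2
          = (if P then Re (a * w) / 2 else 0) + (if Q then Re (a * cnj w) / 2 else 0)" for a P Q
        by (simp add: distrib_left add_divide_distrib)
      show ?thesis
        unfolding g
        by (rule sums_add[OF sums_freq_single[of "- l" "\<lambda>k. Re (c k * w) / 2"] sums_freq_single[of l "\<lambda>k. Re (c k * cnj w) / 2"]])
    qed
    have "(\<integral>x. trig_series c x * trig l w x \<partial>torus) = Re (c (- l) * w) / 2 + Re (c l * cnj w) / 2"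
      unfolding 1 by (rule sums_unique2[OF 2 3])
    also have "\<dots> = Re (w * cnj (c l))"
      using c(2) by (simp add: hermitian_def mult.commute)
    finally show "(\<integral>x. trig_series c x * trig l w x \<partial>torus) = Re (w * cnj (c l))" .
  qed
qed

section \<open>Integration by parts and decay of the Fourier coefficients of test functions\<close>

lemma periodic_continuous_bounded:
  fixes f :: "real ^ 'd::finite \<Rightarrow> real"
  assumes "periodic f" "continuous_on UNIV f"
  obtains K where "0 \<le> K" "\<And>x. \<bar>f x\<bar> \<le> K"
proof -
  have "compact (f ` cbox 0 One)"
    by (rule compact_continuous_image) (use assms continuous_on_subset in auto)
  then have "\<exists>K. \<forall>x\<in>cbox 0 One. \<bar>f x\<bar> \<le> K"
    by (auto dest!: compact_imp_bounded simp: bounded_iff)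
  then obtain K where K: "\<And>x. x \<in> cbox 0 One \<Longrightarrow> \<bar>f x\<bar> \<le> K"
    by blast
  have *: "\<bar>f x\<bar> \<le> K" for x
    using periodic_unit_cube_representative[OF assms(1), of x] K by metis
  then show ?thesis using that[of K] by (meson abs_ge_zero order_trans)
qed

text \<open>Difference quotients of \<open>g\<close> have integral zero by translation invariance.
  The mean value theorem bounds them by a bound of \<open>g'\<close>, so dominated convergence
  passes to the derivative.\<close>

lemma integral_torus_derivative:
  fixes g g' :: "real ^ 'd::finite \<Rightarrow> real"
  assumes g: "continuous_on UNIV g" "periodic g" and g': "continuous_on UNIV g'" "periodic g'"
    and D: "\<And>x. ((\<lambda>h. g (x + h *\<^sub>R axis i 1)) has_field_derivative g' x) (at 0)"
  shows "(\<integral>x. g' x \<partial>torus) = 0"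
proof -
  obtain K where K: "0 \<le> K" "\<And>x. \<bar>g' x\<bar> \<le> K"
    using periodic_continuous_bounded[OF g'(2,1)] by blast
  let ?e = "axis i 1 :: real ^ 'd"
  have D': "((\<lambda>h. g (x + h *\<^sub>R ?e)) has_field_derivative g' (x + t *\<^sub>R ?e)) (at t)" for x t
    using DERIV_shift[of "\<lambda>h. g (x + h *\<^sub>R ?e)" "g' (x + t *\<^sub>R ?e)" 0 t] D[of "x + t *\<^sub>R ?e"]
    by (simp add: algebra_simps)
  define q where "q n x = (g (x + (1 / Suc n) *\<^sub>R ?e) - g x) / (1 / Suc n)" for n :: nat and x
  have qb: "\<bar>q n x\<bar> \<le> K" for n x
  proof -
    obtain z where "g (x + (1 / Suc n) *\<^sub>R ?e) - g (x + 0 *\<^sub>R ?e) = (1 / Suc n - 0) * g' (x + z *\<^sub>R ?e)"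
      using MVT2[of 0 "1 / Suc n" "\<lambda>h. g (x + h *\<^sub>R ?e)" "\<lambda>t. g' (x + t *\<^sub>R ?e)"] D' by auto
    then have "q n x = g' (x + z *\<^sub>R ?e)" unfolding q_def by simp
    then show ?thesis using K by simp
  qed
  have c: "continuous_on UNIV (\<lambda>x. g (x + (1 / Suc n) *\<^sub>R ?e))" for n
    by (intro continuous_on_compose2[OF g(1)] continuous_intros) auto
  have cq: "continuous_on UNIV (q n)" for n
    unfolding q_def[abs_def] by (intro continuous_intros c g) auto
  have lim: "(\<lambda>n. q n x) \<longlonglongrightarrow> g' x" for x
  proof -
    have "((\<lambda>h. (g (x + h *\<^sub>R ?e) - g x) / h) \<longlongrightarrow> g' x) (at 0)"
      using D[of x] by (simp add: DERIV_def)
    moreover have "filterlim (\<lambda>n. 1 / real (Suc n)) (at 0) sequentially"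
      by (intro filterlim_atI LIMSEQ_Suc lim_1_over_n always_eventually) auto
    ultimately show ?thesis unfolding q_def by (rule filterlim_compose)
  qed
  have "(\<lambda>n. \<integral>x. q n x \<partial>torus) \<longlonglongrightarrow> (\<integral>x. g' x \<partial>torus)"
    by (rule integral_dominated_convergence[where w = "\<lambda>_. K"])
       (auto simp: qb lim borel_measurable_torus cq g')
  moreover have "(\<integral>x. q n x \<partial>torus) = 0" for n
  proof -
    have "(\<integral>x. g (x + (1 / Suc n) *\<^sub>R ?e) \<partial>torus) = (\<integral>x. g x \<partial>torus)"
      by (rule integral_torus_translate[OF g])
    then show ?thesis
      unfolding q_def by (simp add: integrable_torus g c[simplified])
  qed
  ultimately show ?thesis by (simp add: LIMSEQ_const_iff)
qed

lemma test_function_Dpart_continuous: "test_function \<eta> \<Longrightarrow> continuous_on UNIV (Dpart is \<eta>)"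
  unfolding test_function_def smooth_def C_k_def by blast

lemma test_function_continuous: "test_function \<eta> \<Longrightarrow> continuous_on UNIV \<eta>"
  using test_function_Dpart_continuous[of \<eta> "[]"] by simp

lemma test_function_periodic: "test_function \<eta> \<Longrightarrow> periodic \<eta>"
  by (simp add: test_function_def)

lemma test_function_DERIV:
  assumes "test_function \<eta>"
  shows "((\<lambda>h. Dpart is \<eta> (x + h *\<^sub>R axis i 1)) has_field_derivative Dpart (i # is) \<eta> x) (at 0)"
  using smooth_Dpart_differentiable[of \<eta> "is" x i] assms
  by (simp add: test_function_def field_differentiable_derivI)

lemma Dpart_append: "Dpart is (Dpart js \<eta>) = Dpart (is @ js) \<eta>"
  by (induction "is") simp_all

lemma test_function_Dpart:
  assumes "test_function \<eta>"
  shows "test_function (Dpart js \<eta>)"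
proof -
  have "periodic (Dpart js \<eta>)"
  proof (induction js)
    case (Cons j js)
    have "Dpart js \<eta> (x + int_vec k + h *\<^sub>R axis j 1) = Dpart js \<eta> (x + h *\<^sub>R axis j 1)" for x k h
      using Cons unfolding periodic_def by (metis add.assoc add.commute)
    then show ?case by (simp add: periodic_def)
  qed (simp add: assms test_function_periodic)
  then show ?thesis
    using smooth_Dpart_differentiable[of \<eta>] test_function_Dpart_continuous[OF assms] assms
    by (simp add: test_function_def smooth_def C_k_def Dpart_append)
qed

text \<open>Integration by parts, without boundary terms on the torus: the derivative of the product
  of \<open>\<eta>\<close> and \<open>trig k z\<close> has integral zero.\<close>

lemma fcoeff_Dpart1:
  assumes t: "test_function \<eta>"
  shows "fcoeff (Dpart [i] \<eta>) k = 2 * of_real pi * \<i> * of_int (k $ i) * fcoeff \<eta> k"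
proof (rule fcoeff_unique)
  show c: "continuous_on UNIV (Dpart [i] \<eta>)" by (rule test_function_Dpart_continuous[OF t])
  have c0: "continuous_on UNIV \<eta>" and p0: "periodic \<eta>"
    by (rule test_function_continuous[OF t], rule test_function_periodic[OF t])
  have p: "periodic (Dpart [i] \<eta>)" by (rule test_function_periodic[OF test_function_Dpart[OF t]])
  fix z
  let ?w = "z * (2 * of_real pi * \<i> * of_int (k $ i))"
  have "(\<integral>x. Dpart [i] \<eta> x * trig k z x + \<eta> x * trig k ?w x \<partial>torus) = 0"
  proof (rule integral_torus_derivative[where g = "\<lambda>x. \<eta> x * trig k z x" and i = i])
    fix x
    show "((\<lambda>h. \<eta> (x + h *\<^sub>R axis i 1) * trig k z (x + h *\<^sub>R axis i 1)) has_field_derivative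
        Dpart [i] \<eta> x * trig k z x + \<eta> x * trig k ?w x) (at 0)"
      using DERIV_mult[OF test_function_DERIV[OF t, of "[]" x i] DERIV_trig[of k z x i 0]] by (simp add: mult.commute)
  next
    show "continuous_on UNIV (\<lambda>x. \<eta> x * trig k z x)"
      "continuous_on UNIV (\<lambda>x. Dpart [i] \<eta> x * trig k z x + \<eta> x * trig k ?w x)"
      by (intro continuous_intros continuous_trig c c0)+
    show "periodic (\<lambda>x. \<eta> x * trig k z x)"
      "periodic (\<lambda>x. Dpart [i] \<eta> x * trig k z x + \<eta> x * trig k ?w x)"
      using p p0 unfolding periodic_def trig_periodic by simp_all
  qed
  moreover have "integrable torus (\<lambda>x. Dpart [i] \<eta> x * trig k z x)" "integrable torus (\<lambda>x. \<eta> x * trig k ?w x)"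
    by (intro integrable_torus continuous_intros continuous_trig c c0)+
  ultimately have "(\<integral>x. Dpart [i] \<eta> x * trig k z x \<partial>torus) = - (\<integral>x. \<eta> x * trig k ?w x \<partial>torus)"
    by simp
  also have "\<dots> = - Re (?w * cnj (fcoeff \<eta> k))"
    by (simp only: integral_trig_fcoeff[OF c0])
  also have "\<dots> = Re (z * cnj (2 * of_real pi * \<i> * of_int (k $ i) * fcoeff \<eta> k))"
    by (simp add: algebra_simps)
  finally show "(\<integral>x. Dpart [i] \<eta> x * trig k z x \<partial>torus) = Re (z * cnj (2 * of_real pi * \<i> * of_int (k $ i) * fcoeff \<eta> k))" .
qed

lemma fcoeff_Dpart: "test_function \<eta> \<Longrightarrow> fcoeff (Dpart is \<eta>) k = dsym is k * fcoeff \<eta> k"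
proof (induction "is")
  case (Cons i "is")
  have "Dpart (i # is) \<eta> = Dpart [i] (Dpart is \<eta>)" by (simp add: Dpart_append)
  then show ?case
    using Cons fcoeff_Dpart1[OF test_function_Dpart[of \<eta> "is"], of i k] by (simp only: dsym_Cons mult_ac)
qed simp

text \<open>The factor 2 stems from estimating real and imaginary part separately, with
  \<open>z = 1\<close> and \<open>z = \<i>\<close>.\<close>

lemma norm_fcoeff_le:
  assumes g: "continuous_on UNIV g"
  shows "norm (fcoeff g k) \<le> 2 * (\<integral>x. \<bar>g x\<bar> \<partial>torus)"
proof -
  have "\<bar>Re (z * cnj (fcoeff g k))\<bar> \<le> (\<integral>x. \<bar>g x\<bar> \<partial>torus)" if "norm z = 1" for z
  proof -
    have "\<bar>\<integral>x. g x * trig k z x \<partial>torus\<bar> \<le> (\<integral>x. \<bar>g x * trig k z x\<bar> \<partial>torus)"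
      by (rule integral_abs_bound)
    also have "\<dots> \<le> (\<integral>x. \<bar>g x\<bar> \<partial>torus)"
    proof (rule integral_mono)
      show "\<bar>g x * trig k z x\<bar> \<le> \<bar>g x\<bar>" for x
        using mult_left_mono[OF abs_trig_le[of k z x], of "\<bar>g x\<bar>"] that by (simp add: abs_mult)
    qed (intro integrable_torus continuous_intros g continuous_trig)+
    finally show ?thesis by (simp only: integral_trig_fcoeff[OF g])
  qed
  from this[of 1] this[of \<i>] show ?thesis
    using cmod_le[of "fcoeff g k"] by simp
qed

text \<open>The weight is comparable to 1 plus the largest component of \<open>k\<close>, so
  \<open>wt k ^ N\<close> is controlled by 1 and the symbols of the \<open>N\<close>-fold
  derivatives in the coordinate directions. One factor \<open>CARD('d) + 1\<close> counts these
  operators, the others come from comparing \<open>wt k\<close> with the maximal component.\<close>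

lemma norm_fcoeff_wt_le:
  fixes \<eta> :: "real ^ 'd::finite \<Rightarrow> real"
  assumes t: "test_function \<eta>" and K: "\<And>is x. length is \<le> N \<Longrightarrow> \<bar>Dpart is \<eta> x\<bar> \<le> K"
  shows "norm (fcoeff \<eta> k) * wt k ^ N \<le> 2 * (real CARD('d) + 1) ^ (N + 1) * K"
proof -
  define B where "B is = 2 * (\<integral>x. \<bar>Dpart is \<eta> x\<bar> \<partial>torus)" for "is" :: "'d list"
  have B: "norm (dsym is k) * norm (fcoeff \<eta> k) \<le> B is" for "is" k
    using norm_fcoeff_le[OF test_function_Dpart_continuous[OF t], of "is" k]
    by (simp add: B_def fcoeff_Dpart[OF t] norm_mult)
  define D where "D = real CARD('d) + 1"
  have wt: "wt k ^ N \<le> D ^ N * (1 + (\<Sum>i\<in>UNIV. norm (dsym (replicate N i) k)))" for k :: "int ^ 'd"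
  proof -
    define m where "m = Max ((\<lambda>i. \<bar>real_of_int (k $ i)\<bar>) ` UNIV)"
    have m: "\<bar>real_of_int (k $ i)\<bar> \<le> m" for i unfolding m_def by (intro Max_ge) auto
    have "m \<in> (\<lambda>i. \<bar>real_of_int (k $ i)\<bar>) ` UNIV" unfolding m_def by (intro Max_in) auto
    then obtain i where i: "m = \<bar>real_of_int (k $ i)\<bar>" by blast
    have "wt k \<le> 1 + (\<Sum>i\<in>UNIV. \<bar>real_of_int (k $ i)\<bar>)"
      unfolding wt_def using norm_le_l1_cart[of "int_vec k"] by simp
    also have "\<dots> \<le> 1 + (\<Sum>i\<in>(UNIV :: 'd set). m)" by (intro add_left_mono sum_mono m)
    also have "\<dots> \<le> D * max 1 m"
      by (auto simp: D_def max_def algebra_simps mult_left_mono)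
    finally have "wt k ^ N \<le> (D * max 1 m) ^ N" by (intro power_mono wt_nonneg)
    also have "\<dots> = D ^ N * max 1 m ^ N" by (rule power_mult_distrib)
    also have "max 1 m ^ N \<le> 1 + norm (dsym (replicate N i) k)"
    proof -
      have "norm (dsym (replicate N i) k) = (2 * pi * m) ^ N"
        unfolding dsym_def by (simp add: i map_replicate prod_list_replicate norm_power norm_mult)
      moreover have "m ^ N \<le> (2 * pi * m) ^ N"
        using i mult_right_mono[of 1 "2 * pi" m] pi_ge_two by (intro power_mono) auto
      moreover have "0 \<le> m ^ N" using i by simp
      ultimately show ?thesis by (auto simp: max_def)
    qed
    also have "norm (dsym (replicate N i) k) \<le> (\<Sum>i\<in>UNIV. norm (dsym (replicate N i) k))"
      by (intro member_le_sum) auto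
    finally show ?thesis by (simp add: D_def mult_left_mono)
  qed
  have BK: "B is \<le> 2 * K" if "length is \<le> N" for "is"
  proof -
    have "(\<integral>x. \<bar>Dpart is \<eta> x\<bar> \<partial>torus) \<le> (\<integral>x. K \<partial>(torus :: (real ^ 'd) measure))"
      by (intro integral_mono integrable_torus continuous_intros test_function_Dpart_continuous[OF t] K[OF that])
    then show ?thesis by (simp add: B_def torus.prob_space)
  qed
  have "norm (fcoeff \<eta> k) * wt k ^ N \<le> norm (fcoeff \<eta> k) * (D ^ N * (1 + (\<Sum>i\<in>UNIV. norm (dsym (replicate N i) k))))"
    by (intro mult_left_mono wt) auto
  also have "\<dots> = D ^ N * (norm (dsym [] k) * norm (fcoeff \<eta> k) + (\<Sum>i\<in>UNIV. norm (dsym (replicate N i) k) * norm (fcoeff \<eta> k)))"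
    by (simp add: sum_distrib_left sum_distrib_right algebra_simps)
  also have "\<dots> \<le> D ^ N * (B [] + (\<Sum>i\<in>UNIV. B (replicate N i)))"
    by (intro mult_left_mono add_mono sum_mono B) (auto simp: D_def)
  also have "\<dots> \<le> D ^ N * (2 * K + (\<Sum>i\<in>(UNIV :: 'd set). 2 * K))"
    by (intro mult_left_mono add_mono sum_mono BK) (auto simp: D_def)
  also have "\<dots> = 2 * D ^ (N + 1) * K" by (simp add: D_def algebra_simps)
  finally show ?thesis by (simp add: D_def)
qed

lemma test_function_Dpart_bounded:
  assumes t: "test_function (\<eta> :: real ^ 'd::finite \<Rightarrow> real)"
  obtains K where "0 \<le> K" "\<And>is x. length is \<le> N \<Longrightarrow> \<bar>Dpart is \<eta> x\<bar> \<le> K"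
proof -
  have "\<forall>is. \<exists>K\<ge>0. \<forall>x. \<bar>Dpart is \<eta> x\<bar> \<le> K"
    using periodic_continuous_bounded[OF test_function_periodic[OF test_function_Dpart[OF t]] test_function_Dpart_continuous[OF t]]
    by metis
  then obtain K where K: "\<And>is. 0 \<le> K is" "\<And>is x. \<bar>Dpart is \<eta> x\<bar> \<le> K is" by metis
  define S where "S = {is :: 'd list. set is \<subseteq> UNIV \<and> length is \<le> N}"
  have fin: "finite S" unfolding S_def by (rule finite_lists_length_le) simp
  have "\<bar>Dpart is \<eta> x\<bar> \<le> sum K S" if "length is \<le> N" for "is" x
  proof -
    have "K is \<le> sum K S" using that fin K(1) by (intro member_le_sum) (auto simp: S_def)
    then show ?thesis using K(2)[of "is" x] by simp
  qed
  moreover have "0 \<le> sum K S" using K(1) by (intro sum_nonneg) auto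
  ultimately show ?thesis using that by blast
qed

lemma rapid_fcoeff:
  assumes t: "test_function \<eta>"
  shows "rapid (fcoeff \<eta>)"
  unfolding rapid_def
proof
  fix N
  obtain K where "\<And>is x. length is \<le> N \<Longrightarrow> \<bar>Dpart is \<eta> x\<bar> \<le> K"
    using test_function_Dpart_bounded[OF t, of N] by metis
  then show "\<exists>C. \<forall>k. norm (fcoeff \<eta> k) * wt k ^ N \<le> C"
    using norm_fcoeff_wt_le[OF t, of N K] by blast
qed

section \<open>Completeness of the trigonometric system\<close>

text \<open>Provides the neighbourhood of the centre on which the powers of a peaking function stay
  comparatively large.\<close>

lemma integral_torus_ge_indicator:
  assumes "0 < r" "r \<le> 1/2"
  defines "V \<equiv> ball (\<chi> i. 1/2) r :: (real ^ 'd::finite) set"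
  shows "V \<subseteq> cbox 0 One" "integrable torus (indicator V :: _ \<Rightarrow> real)" "0 < (\<integral>x. indicator V x \<partial>torus :: real)"
proof -
  show sub: "V \<subseteq> cbox 0 One"
  proof
    fix x assume x: "x \<in> V"
    have "\<bar>x $ i - 1/2\<bar> \<le> 1/2" for i
    proof -
      have "\<bar>x $ i - 1/2\<bar> = \<bar>(x - (\<chi> i. 1/2)) $ i\<bar>" by simp
      also have "\<dots> \<le> norm (x - (\<chi> i. 1/2))" by (rule component_le_norm_cart)
      also have "\<dots> \<le> 1/2" using x assms(2) by (simp add: V_def dist_norm norm_minus_commute)
      finally show ?thesis .
    qed
    then show "x \<in> cbox 0 One" unfolding mem_unit_cube by (smt (verit, best) field_sum_of_halves)
  qed
  have "V \<in> sets lborel" by (simp add: V_def)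
  then have s: "V \<in> sets torus"
    unfolding torus_def using sub by (simp add: sets_restrict_space_iff)
  then show "integrable torus (indicator V :: _ \<Rightarrow> real)" by (simp add: torus.emeasure_eq_measure)
  have "(\<integral>x. indicator V x \<partial>torus :: real) = measure torus V"
    using s sets.sets_into_space[OF s] by (simp add: Int_absorb2)
  also have "\<dots> = measure lborel V"
    unfolding torus_def by (rule measure_restrict_space) (use sub in auto)
  also have "\<dots> > 0" unfolding V_def by (rule content_ball_pos[OF assms(1)])
  finally show "0 < (\<integral>x. indicator V x \<partial>torus :: real)" .
qed

text \<open>If \<open>g\<close> were positive at the centre of the unit cube, integrating it against large powers of a
  trigonometric polynomial \<open>R\<close> with \<open>0 \<le> R \<le> 1\<close> and \<open>R = 1\<close> only there would give a positive value.\<close>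

lemma trig_complete_center:
  fixes g :: "real ^ 'd::finite \<Rightarrow> real"
  assumes g: "continuous_on UNIV g" "periodic g" and z: "\<And>k z. (\<integral>x. g x * trig k z x \<partial>torus) = 0"
  shows "g (\<chi> i. 1/2) \<le> 0"
proof (rule ccontr)
  let ?c = "(\<chi> i. 1/2) :: real ^ 'd"
  assume "\<not> g ?c \<le> 0"
  then have pos: "0 < g ?c" by simp
  \<comment> \<open>\<open>R x\<close> is the mean of \<open>sin (pi * x $ i) ^ 2\<close> over the
    coordinates, hence at most 1, with equality in the cube only at the centre.\<close>
  define R where "R x = 1/2 + (\<Sum>i\<in>(UNIV :: 'd set). trig (axis i 1) (- 1 / (2 * CARD('d))) x)" for x
  have R_eq: "R x = 1/2 - (\<Sum>i\<in>(UNIV :: 'd set). cos (2 * pi * x $ i)) / (2 * CARD('d))" for x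
    unfolding R_def trig_eq by (simp add: int_vec_axis inner_axis' sum_negf sum_divide_distrib)
  have cR: "continuous_on UNIV R"
    unfolding R_def[abs_def] by (intro continuous_intros continuous_trig)
  have sum_cos: "\<bar>\<Sum>i\<in>(UNIV :: 'd set). cos (2 * pi * x $ i)\<bar> \<le> CARD('d)" for x
    by (rule order_trans[OF sum_abs]) (use sum_bounded_above[of "UNIV :: 'd set" "\<lambda>i. \<bar>cos (2 * pi * x $ i)\<bar>" 1] in simp)
  have R01: "0 \<le> R x" "R x \<le> 1" for x
  proof -
    have "\<bar>(\<Sum>i\<in>(UNIV :: 'd set). cos (2 * pi * x $ i)) / (2 * CARD('d))\<bar> \<le> 1/2"
      using sum_cos[of x] by (simp add: abs_divide divide_simps)
    then show "0 \<le> R x" "R x \<le> 1" unfolding R_eq by linarith+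
  qed
  have Rc: "R ?c = 1" unfolding R_eq by simp
  have R1: "x = ?c" if "x \<in> cbox 0 One" "R x = 1" for x
  proof -
    have "(\<Sum>i\<in>(UNIV :: 'd set). cos (2 * pi * x $ i)) = - CARD('d)"
      using that(2) unfolding R_eq by (simp add: divide_simps)
    then have "(\<Sum>i\<in>(UNIV :: 'd set). 1 + cos (2 * pi * x $ i)) = 0" by (simp add: sum.distrib)
    moreover have nn: "0 \<le> 1 + cos t" for t :: real using cos_ge_minus_one[of t] by linarith
    ultimately have "1 + cos (2 * pi * x $ i) = 0" for i
      by (subst (asm) sum_nonneg_eq_0_iff) auto
    then have "cos (2 * pi * x $ i - pi) = 1" for i
      by (simp add: cos_diff) (smt (verit))
    then have "\<exists>n::int. 2 * pi * x $ i - pi = n * 2 * pi" for i by (simp only: cos_one_2pi_int)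
    moreover have "x $ i = 1/2" if "2 * pi * x $ i - pi = of_int n * 2 * pi" for i and n :: int
    proof -
      have "pi * (2 * x $ i) = pi * (2 * of_int n + 1)" using that by (simp add: algebra_simps)
      then have e: "2 * x $ i = 2 * of_int n + 1" by (simp only: mult_cancel_left pi_neq_zero simp_thms)
      moreover have "0 \<le> x $ i" "x $ i \<le> 1" using \<open>x \<in> cbox 0 One\<close> by (auto simp: mem_unit_cube)
      ultimately have "- 1 < real_of_int n" "real_of_int n < 1" by linarith+
      then have "n = 0" by linarith
      then show ?thesis using e by simp
    qed
    ultimately have "x $ i = 1/2" for i by blast
    then show ?thesis by (simp add: vec_eq_iff)
  qed
  \<comment> \<open>A product of trigonometric functions is a sum of such functions, so
    orthogonality of \<open>g\<close> to all of them passes to \<open>g\<close> times each power of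
    \<open>R\<close>.\<close>
  have zero: "\<forall>k z. (\<integral>x. g x * R x ^ n * trig k z x \<partial>torus) = 0" for n
  proof (induction n)
    case (Suc n)
    have "(\<integral>x. g x * R x ^ Suc n * trig k z x \<partial>torus) = 0" for k z
    proof -
      let ?a = "- 1 / (2 * CARD('d)) :: real"
      have i: "integrable torus (\<lambda>x. g x * R x ^ n * trig k z x)" for k z
        by (intro integrable_torus continuous_intros g cR continuous_trig)
      have "g x * R x ^ Suc n * trig k z x = (g x * R x ^ n * trig k z x) / 2 +
         (\<Sum>i\<in>(UNIV :: 'd set). (g x * R x ^ n * trig (axis i 1 + k) (?a * z) x
            + g x * R x ^ n * trig (axis i 1 - k) (?a * cnj z) x) / 2)" for x
      proof -
        have "R x * trig k z x = trig k z x / 2 + (\<Sum>i\<in>(UNIV :: 'd set). (trig (axis i 1 + k) (?a * z) x + trig (axis i 1 - k) (?a * cnj z) x) / 2)"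
          unfolding R_def distrib_right sum_distrib_right trig_mult by simp
        then have "g x * R x ^ n * (R x * trig k z x) = g x * R x ^ n * (trig k z x / 2 + (\<Sum>i\<in>(UNIV :: 'd set). (trig (axis i 1 + k) (?a * z) x + trig (axis i 1 - k) (?a * cnj z) x) / 2))"
          by simp
        then show ?thesis by (simp add: distrib_left sum_distrib_left mult_ac)
      qed
      then have "(\<integral>x. g x * R x ^ Suc n * trig k z x \<partial>torus)
        = (\<integral>x. (g x * R x ^ n * trig k z x) / 2 + (\<Sum>i\<in>(UNIV :: 'd set).
            (g x * R x ^ n * trig (axis i 1 + k) (?a * z) x + g x * R x ^ n * trig (axis i 1 - k) (?a * cnj z) x) / 2) \<partial>torus)"
        by (simp only:)
      also have "\<dots> = 0" using Suc by (simp add: i)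
      finally show ?thesis .
    qed
    then show ?case by blast
  qed (simp add: z)
  then have zero: "(\<integral>x. g x * R x ^ n \<partial>torus) = 0" for n
    using spec[OF spec[OF zero[of n], of 0], of 1] by (simp add: trig_def)
  obtain G where G: "0 \<le> G" "\<And>x. \<bar>g x\<bar> \<le> G" using periodic_continuous_bounded[OF g(2,1)] by blast
  have "\<exists>d>0. \<forall>x. dist x ?c < d \<longrightarrow> dist (g x) (g ?c) < g ?c / 2"
    using g(1)[unfolded continuous_on_iff, rule_format, of ?c "g ?c / 2"] pos by auto
  then obtain d where d: "0 < d" "\<And>x. dist x ?c < d \<Longrightarrow> \<bar>g x - g ?c\<bar> < g ?c / 2"
    unfolding dist_real_def by blast
  have gd: "g ?c / 2 \<le> g x" if "dist x ?c < d" for x using d(2)[OF that] by (simp add: abs_if split: if_splits)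
  have "\<exists>\<rho>. 0 \<le> \<rho> \<and> \<rho> < 1 \<and> (\<forall>x\<in>cbox 0 One - ball ?c d. R x \<le> \<rho>)"
  proof (cases "cbox 0 One - ball ?c d = {}")
    case True
    then show ?thesis by (intro exI[of _ 0]) auto
  next
    case False
    have "compact (cbox 0 One - ball ?c d)" by (intro compact_diff) auto
    then obtain y where y: "y \<in> cbox 0 One - ball ?c d" "\<And>x. x \<in> cbox 0 One - ball ?c d \<Longrightarrow> R x \<le> R y"
      using continuous_attains_sup[OF _ False, of R] cR continuous_on_subset by (metis subset_UNIV)
    have "y \<noteq> ?c" using y(1) d(1) by auto
    then have "R y \<noteq> 1" using R1 y(1) by blast
    then show ?thesis using R01[of y] y(2) by (intro exI[of _ "R y"]) auto
  qed
  then obtain \<rho> where \<rho>: "0 \<le> \<rho>" "\<rho> < 1" "\<And>x. x \<in> cbox 0 One - ball ?c d \<Longrightarrow> R x \<le> \<rho>" by blast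
  \<comment> \<open>An intermediate level: outside the ball of radius \<open>d\<close> the powers
    are at most \<open>\<rho> ^ n\<close>, while close to the centre they are at least
    \<open>\<rho>' ^ n\<close>, which eventually dominates.\<close>
  define \<rho>' where "\<rho>' = (1 + \<rho>) / 2"
  have \<rho>': "\<rho> < \<rho>'" "0 < \<rho>'" "\<rho>' < 1" using \<rho> by (auto simp: \<rho>'_def)
  have "\<exists>d>0. \<forall>x. dist x ?c < d \<longrightarrow> dist (R x) (R ?c) < 1 - \<rho>'"
    using cR[unfolded continuous_on_iff, rule_format, of ?c "1 - \<rho>'"] \<rho>' by auto
  then obtain d' where d': "0 < d'" "\<And>x. dist x ?c < d' \<Longrightarrow> \<bar>R x - R ?c\<bar> < 1 - \<rho>'"
    unfolding dist_real_def by blast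
  define r where "r = min (1/2) (min d d')"
  have r: "0 < r" "r \<le> 1/2" "r \<le> d" "r \<le> d'" using d d' by (auto simp: r_def)
  define V where "V = ball ?c r"
  note V = integral_torus_ge_indicator[OF r(1,2), where 'd = 'd, folded V_def]
  define v where "v = (\<integral>x. indicator V x \<partial>torus :: real)"
  have v: "0 < v" using V(3) by (simp add: v_def)
  have bound: "g ?c / 2 * v * \<rho>' ^ n \<le> G * \<rho> ^ n" for n
  proof -
    have "(\<integral>x. g ?c / 2 * \<rho>' ^ n * indicator V x - G * \<rho> ^ n \<partial>torus) \<le> (\<integral>x. g x * R x ^ n \<partial>torus)"
    proof (rule integral_mono_AE)
      show "integrable torus (\<lambda>x. g ?c / 2 * \<rho>' ^ n * indicator V x - G * \<rho> ^ n)"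
        using V(2) by simp
      show "integrable torus (\<lambda>x. g x * R x ^ n)"
        by (intro integrable_torus continuous_intros g cR)
      have "g ?c / 2 * \<rho>' ^ n * indicator V x - G * \<rho> ^ n \<le> g x * R x ^ n" if x: "x \<in> cbox 0 One" for x
      proof -
        have Gn: "0 \<le> G * \<rho> ^ n" using G \<rho> by simp
        consider "x \<in> V" | "x \<notin> V" "x \<in> ball ?c d" | "x \<notin> V" "x \<notin> ball ?c d" by blast
        then show ?thesis
        proof cases
          case 1
          then have *: "dist x ?c < r" by (simp add: V_def dist_commute)
          then have "\<bar>R x - R ?c\<bar> < 1 - \<rho>'" using d'(2) r by simp
          then have "\<rho>' \<le> R x" by (simp add: Rc abs_if split: if_splits)
          then have "g ?c / 2 * \<rho>' ^ n \<le> g x * R x ^ n"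
            using gd[of x] * r pos \<rho>' by (intro mult_mono power_mono) auto
          then show ?thesis using 1 Gn by simp
        next
          case 2
          then have "0 \<le> g x" using gd[of x] pos by (simp add: dist_commute)
          then have "0 \<le> g x * R x ^ n" using R01[of x] by simp
          with Gn show ?thesis using 2 by simp
        next
          case 3
          then have "R x ^ n \<le> \<rho> ^ n" using \<rho>(3)[of x] R01[of x] x by (intro power_mono) auto
          then have "\<bar>g x\<bar> * R x ^ n \<le> G * \<rho> ^ n" using G R01[of x] by (intro mult_mono) auto
          moreover have "- (\<bar>g x\<bar> * R x ^ n) \<le> g x * R x ^ n"
            using mult_right_mono[of "- \<bar>g x\<bar>" "g x" "R x ^ n"] R01[of x] by simp
          ultimately show ?thesis using 3 by simp
        qed
      qed
      then show "AE x in torus. g ?c / 2 * \<rho>' ^ n * indicator V x - G * \<rho> ^ n \<le> g x * R x ^ n"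
        by (intro AE_I2) (simp add: torus_def space_restrict_space)
    qed
    moreover have "(\<integral>x. g ?c / 2 * \<rho>' ^ n * indicator V x - G * \<rho> ^ n \<partial>torus) = g ?c / 2 * \<rho>' ^ n * v - G * \<rho> ^ n"
      using V(2) by (simp add: v_def torus.prob_space)
    ultimately show ?thesis using zero[of n] by (simp add: mult_ac)
  qed
  have "(\<lambda>n. G * (\<rho> / \<rho>') ^ n) \<longlonglongrightarrow> G * 0"
    using \<rho> \<rho>' by (intro tendsto_intros LIMSEQ_realpow_zero) auto
  moreover have "g ?c / 2 * v \<le> G * (\<rho> / \<rho>') ^ n" for n
    using bound[of n] \<rho>' by (simp add: power_divide field_simps)
  ultimately have "g ?c / 2 * v \<le> G * 0"
    by (intro LIMSEQ_le_const) auto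
  moreover have "0 < g ?c / 2 * v" using pos v by simp
  ultimately show False by simp
qed

text \<open>Translation to the centre of the cube multiplies the coefficients by phases only, so
  they still vanish. The one-sided result is applied to \<open>g\<close> and to its
  negative.\<close>

lemma trig_complete:
  fixes g :: "real ^ 'd::finite \<Rightarrow> real"
  assumes g: "continuous_on UNIV g" "periodic g" and z: "\<And>k. fcoeff g k = 0"
  shows "g y = 0"
proof -
  have le: "h y \<le> 0" if h: "continuous_on UNIV h" "periodic h" and z: "\<And>k. fcoeff h k = 0"
    for h :: "real ^ 'd \<Rightarrow> real"
  proof -
    let ?a = "y - (\<chi> i. 1/2)"
    have ct: "continuous_on UNIV (\<lambda>x. h (x + ?a))"
      by (intro continuous_on_compose2[OF h(1)] continuous_intros) auto
    have "(\<integral>x. h (x + ?a) * trig k z x \<partial>torus) = 0" for k z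
    proof -
      let ?w = "z * cis (2 * pi * (int_vec k \<bullet> - ?a))"
      have "(\<integral>x. h (x + ?a) * trig k z x \<partial>torus) = (\<integral>x. h (x + ?a) * trig k ?w (x + ?a) \<partial>torus)"
        by (simp add: trig_translate[symmetric])
      also have "\<dots> = (\<integral>x. h x * trig k ?w x \<partial>torus)"
        using integral_torus_translate[of "\<lambda>x. h x * trig k ?w x" ?a] h
        by (simp add: periodic_def trig_periodic continuous_on_mult continuous_trig)
      also have "\<dots> = 0" by (simp add: integral_trig_fcoeff h z)
      finally show ?thesis .
    qed
    from trig_complete_center[OF ct periodic_translate[OF h(2)] this]
    show ?thesis by simp
  qed
  have "fcoeff (\<lambda>x. - g x) k = 0" for k
  proof (rule fcoeff_unique)
    show "continuous_on UNIV (\<lambda>x. - g x)" by (intro continuous_intros g)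
    show "(\<integral>x. - g x * trig k z x \<partial>torus) = Re (z * cnj 0)" for z
      using integral_trig_fcoeff[OF g(1), of k z] assms(3) by simp
  qed
  then have "- g y \<le> 0"
    using g by (intro le) (auto intro!: continuous_intros simp: periodic_def)
  with le[OF assms] show ?thesis by simp
qed

lemma hermitian_fcoeff: "hermitian (fcoeff g)"
  unfolding fcoeff_def by (rule hermitian_fourier)

text \<open>Function and series are continuous and periodic with the same coefficients, so their
  difference is zero by completeness.\<close>

theorem fourier_expansion:
  assumes t: "test_function \<eta>"
  shows "trig_series (fcoeff \<eta>) = \<eta>"
proof
  fix y
  let ?s = "trig_series (fcoeff \<eta>)"
  have s: "test_function ?s" by (rule test_function_trig_series[OF rapid_fcoeff[OF t]])
  note c = test_function_continuous[OF t] test_function_continuous[OF s]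
  have "?s y - \<eta> y = 0"
  proof (rule trig_complete[where g = "\<lambda>x. ?s x - \<eta> x"])
    show "continuous_on UNIV (\<lambda>x. ?s x - \<eta> x)" by (intro continuous_intros c)
    show "periodic (\<lambda>x. ?s x - \<eta> x)"
      using test_function_periodic[OF t] test_function_periodic[OF s] by (simp add: periodic_def)
    show "fcoeff (\<lambda>x. ?s x - \<eta> x) k = 0" for k
    proof (rule fcoeff_unique)
      show "continuous_on UNIV (\<lambda>x. ?s x - \<eta> x)" by (intro continuous_intros c)
      have i: "integrable torus (\<lambda>x. ?s x * trig k z x)" "integrable torus (\<lambda>x. \<eta> x * trig k z x)" for z
        by (intro integrable_torus continuous_intros c continuous_trig)+
      show "(\<integral>x. (?s x - \<eta> x) * trig k z x \<partial>torus) = Re (z * cnj 0)" for z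
        using integral_trig_fcoeff[OF c(1), of k z] integral_trig_fcoeff[OF c(2), of k z] i[of z]
        by (simp add: left_diff_distrib fcoeff_trig_series rapid_fcoeff[OF t] hermitian_fcoeff)
    qed
  qed
  then show "?s y = \<eta> y" by simp
qed

section \<open>The heat equation\<close>

text \<open>The eigenvalue of the negative Laplacian at frequency \<open>k\<close>.\<close>

definition heat_rate :: "int ^ 'd::finite \<Rightarrow> real" where
  "heat_rate k = 4 * pi\<^sup>2 * (norm (int_vec k))\<^sup>2"

definition heat_coeff :: "(int ^ 'd::finite \<Rightarrow> complex) \<Rightarrow> real \<Rightarrow> int ^ 'd \<Rightarrow> complex" where
  "heat_coeff c t k = exp (- heat_rate k * t) *\<^sub>R c k"

lemma heat_rate_nonneg: "0 \<le> heat_rate k"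
  by (simp add: heat_rate_def)

lemma heat_rate_uminus: "heat_rate (- k) = heat_rate k"
  by (simp add: heat_rate_def int_vec_uminus)

lemma heat_rate_le: "heat_rate k \<le> 4 * pi\<^sup>2 * (wt k)\<^sup>2"
  unfolding heat_rate_def wt_def by (intro mult_left_mono power_mono) auto

lemma norm_heat_coeff: "norm (heat_coeff c t k) = exp (- heat_rate k * t) * norm (c k)"
  by (simp add: heat_coeff_def)

lemma heat_coeff_zero [simp]: "heat_coeff c 0 = c"
  by (simp add: heat_coeff_def fun_eq_iff)

lemma hermitian_heat_coeff: "hermitian c \<Longrightarrow> hermitian (heat_coeff c t)"
  by (simp add: hermitian_def heat_coeff_def heat_rate_uminus)

text \<open>With \<open>r = norm (int_vec k)\<close> the weight is at most \<open>exp r\<close>;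
  completing the square in \<open>N * r - 4 * pi\<^sup>2 * t * r\<^sup>2\<close> gives the
  bound.\<close>

lemma exp_heat_rate_wt_bound:
  assumes "t > 0"
  shows "exp (- heat_rate k * t) * wt k ^ N \<le> exp ((real N)\<^sup>2 / (16 * pi\<^sup>2 * t))"
proof -
  let ?r = "norm (int_vec k)" and ?a = "4 * pi\<^sup>2 * t"
  have a: "0 < ?a" using assms by simp
  have "wt k ^ N \<le> exp ?r ^ N"
    unfolding wt_def by (intro power_mono exp_ge_add_one_self) auto
  then have "exp (- heat_rate k * t) * wt k ^ N \<le> exp (- heat_rate k * t) * exp ?r ^ N" by simp
  also have "\<dots> = exp (N * ?r - ?a * ?r\<^sup>2)"
    by (simp add: heat_rate_def exp_of_nat_mult[symmetric] mult_exp_exp algebra_simps)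
  also have "N * ?r - ?a * ?r\<^sup>2 \<le> (real N)\<^sup>2 / (4 * ?a)"
  proof -
    have "n * r - A * r\<^sup>2 \<le> n\<^sup>2 / (4 * A)" if "0 < A" for n r A :: real
    proof -
      have "0 \<le> (2 * A * r - n)\<^sup>2" by simp
      then have "(n * r - A * r\<^sup>2) * (4 * A) \<le> n\<^sup>2" by (simp add: power2_eq_square algebra_simps)
      then show ?thesis using that by (simp add: pos_le_divide_eq)
    qed
    then show ?thesis using a .
  qed
  finally show ?thesis by (simp add: mult_ac)
qed

lemma moderate_heat_rate: "moderate (\<lambda>k. of_real (- heat_rate k))"
  unfolding moderate_def
  by (intro exI[of _ "2 :: nat"] exI[of _ "4 * pi\<^sup>2"]) (simp add: heat_rate_nonneg heat_rate_le)

lemma rapid_exp_heat_rate: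
  assumes "t > 0"
  shows "rapid (\<lambda>k :: int ^ 'd::finite. of_real (exp (- heat_rate k * t)))"
  unfolding rapid_def
proof
  fix N
  show "\<exists>C. \<forall>k :: int ^ 'd. norm (of_real (exp (- heat_rate k * t)) :: complex) * wt k ^ N \<le> C"
    using exp_heat_rate_wt_bound[OF assms, where 'a = 'd] by (intro exI[of _ "exp ((real N)\<^sup>2 / (16 * pi\<^sup>2 * t))"]) simp
qed

lemma rapid_heat_coeff:
  assumes "moderate c" "t > 0"
  shows "rapid (heat_coeff c t)"
  using rapid_mult_moderate[OF rapid_exp_heat_rate[OF assms(2)] assms(1)]
  by (simp add: heat_coeff_def[abs_def] scaleR_conv_of_real)

lemma rapid_imp_moderate: "rapid c \<Longrightarrow> moderate c"
  using rapid_bound[of c 0] unfolding moderate_def by (metis mult.right_neutral power_0)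

lemma rapid_heat_coeff0: "rapid c \<Longrightarrow> t \<ge> 0 \<Longrightarrow> rapid (heat_coeff c t)"
  by (cases "t = 0") (auto intro: rapid_heat_coeff rapid_imp_moderate)

lemma norm_heat_coeff_mono: "s \<le> t \<Longrightarrow> norm (heat_coeff c t k) \<le> norm (heat_coeff c s k)"
  unfolding norm_heat_coeff
  by (intro mult_right_mono) (auto simp: heat_rate_nonneg mult_left_mono)

lemma dsym_twice: "(\<Sum>i\<in>UNIV. dsym [i, i] k) = of_real (- heat_rate k)"
proof -
  have "(norm (int_vec k))\<^sup>2 = (\<Sum>i\<in>UNIV. (of_int (k $ i))\<^sup>2)"
    unfolding power2_norm_eq_inner inner_int_vec by (simp add: power2_eq_square)
  then show ?thesis
    by (simp add: dsym_Cons heat_rate_def power2_eq_square sum_distrib_left sum_negf algebra_simps)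
qed

lemma trig_sum: "(\<Sum>i\<in>S. trig k (z i) x) = trig k (\<Sum>i\<in>S. z i) x"
  by (simp add: trig_def sum_distrib_right)

lemma laplacian_trig_series:
  fixes c :: "int ^ 'd::finite \<Rightarrow> complex"
  assumes "rapid c"
  shows "laplacian (trig_series c) x = trig_series (\<lambda>k. of_real (- heat_rate k) * c k) x"
proof -
  have "(\<lambda>n. \<Sum>i\<in>(UNIV :: 'd set). trig (freq n) (c (freq n) * dsym [i, i] (freq n)) x) sums
      (\<Sum>i\<in>(UNIV :: 'd set). trig_series (\<lambda>k. c k * dsym [i, i] k) x)"
    by (intro sums_sum trig_series_sums rapid_dsym assms)
  then have "(\<lambda>n. trig (freq n) (of_real (- heat_rate (freq n :: int ^ 'd)) * c (freq n)) x) sums laplacian (trig_series c) x"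
    unfolding laplacian_def Dpart_trig_series[OF assms] trig_sum sum_distrib_left[symmetric] dsym_twice
    by (simp only: mult.commute)
  then show ?thesis by (simp add: trig_series_def sums_iff)
qed

text \<open>On the time interval from \<open>t/2\<close> to \<open>2 * t\<close> all terms of the
  differentiated series are dominated by their size at \<open>t/2\<close>, which decays rapidly
  although \<open>c\<close> itself may grow.\<close>

lemma DERIV_heat_series:
  fixes c :: "int ^ 'd::finite \<Rightarrow> complex"
  assumes c: "moderate c" and t: "t > 0"
  shows "((\<lambda>\<tau>. trig_series (heat_coeff c \<tau>) x) has_real_derivative laplacian (trig_series (heat_coeff c t)) x) (at t)"
proof -
  let ?c' = "\<lambda>t k. of_real (- heat_rate k) * heat_coeff c t k"
  have D: "((\<lambda>\<tau>. trig k (heat_coeff c \<tau> k) x) has_field_derivative trig k (?c' \<tau> k) x) (at \<tau> within S)" for k \<tau> S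
    unfolding trig_def heat_coeff_def
    by (auto intro!: derivative_eq_intros simp: algebra_simps)
  have r: "rapid (?c' (t/2))"
    using rapid_mult_moderate[OF rapid_heat_coeff[OF c] moderate_heat_rate, of "t/2"] t by (simp add: mult.commute)
  have "((\<lambda>\<tau>. \<Sum>n. trig (freq n) (heat_coeff c \<tau> (freq n)) x) has_field_derivative
     (\<Sum>n. trig (freq n) (?c' t (freq n)) x)) (at t)"
  proof (rule has_field_derivative_series'(2)[where S = "{t/2..2*t}" and ?x0.0 = t])
    show "uniformly_convergent_on {t/2..2*t} (\<lambda>n \<tau>. \<Sum>j<n. trig (freq j) (?c' \<tau> (freq j)) x)"
    proof (rule Weierstrass_m_test'[OF _ rapid_summable_norm[OF r]])
      fix n \<tau> assume "\<tau> \<in> {t/2..2*t}"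
      then have "norm (heat_coeff c \<tau> (freq n)) \<le> norm (heat_coeff c (t/2) (freq n))"
        by (intro norm_heat_coeff_mono) auto
      then have "norm (?c' \<tau> (freq n)) \<le> norm (?c' (t/2) (freq n))"
        unfolding norm_mult by (intro mult_left_mono) auto
      then show "norm (trig (freq n) (?c' \<tau> (freq n)) x) \<le> norm (?c' (t/2) (freq n))"
        using abs_trig_le[of "freq n" "?c' \<tau> (freq n)" x] by (simp only: real_norm_def)
    qed
    show "summable (\<lambda>n. trig (freq n) (heat_coeff c t (freq n)) x)"
      using trig_series_sums[OF rapid_heat_coeff[OF c t]] by (simp add: sums_iff)
    show "t \<in> interior {t/2..2*t}" using t by simp
  qed (use t D in auto)
  then show ?thesis
    by (simp only: trig_series_def laplacian_trig_series[OF rapid_heat_coeff[OF c t]])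
qed

lemma continuous_heat_series_from:
  fixes c :: "int ^ 'd::finite \<Rightarrow> complex"
  assumes r: "rapid (heat_coeff c s)"
  shows "continuous_on ({s..} \<times> UNIV) (\<lambda>(t, x). trig_series (heat_coeff c t) x)"
proof -
  have bound: "norm (case p of (t, x) \<Rightarrow> trig (freq n) (heat_coeff c t (freq n)) x) \<le> norm (heat_coeff c s (freq n))"
    if "p \<in> {s..} \<times> UNIV" for n p
  proof -
    obtain t x where p: "p = (t, x)" by (cases p)
    then have "norm (heat_coeff c t (freq n)) \<le> norm (heat_coeff c s (freq n))"
      using that by (intro norm_heat_coeff_mono) auto
    then show ?thesis
      using abs_trig_le[of "freq n" "heat_coeff c t (freq n)" x] by (simp add: p)
  qed
  have "uniform_limit ({s..} \<times> UNIV) (\<lambda>n p. \<Sum>j<n. case p of (t, x) \<Rightarrow> trig (freq j) (heat_coeff c t (freq j)) x)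
     (\<lambda>p. \<Sum>j. case p of (t, x) \<Rightarrow> trig (freq j) (heat_coeff c t (freq j)) x) sequentially"
    by (rule Weierstrass_m_test[OF bound rapid_summable_norm[OF r]])
  moreover have "continuous_on ({s..} \<times> UNIV) (\<lambda>p. \<Sum>j<n. case p of (t, x) \<Rightarrow> trig (freq j) (heat_coeff c t (freq j)) x)" for n
    unfolding trig_def heat_coeff_def case_prod_unfold by (intro continuous_intros)
  ultimately have "continuous_on ({s..} \<times> UNIV) (\<lambda>p. \<Sum>j. case p of (t, x) \<Rightarrow> trig (freq j) (heat_coeff c t (freq j)) x)"
    by (intro uniform_limit_theorem[OF always_eventually]) auto
  then show ?thesis by (simp add: trig_series_def case_prod_unfold)
qed

lemma continuous_heat_series:
  fixes c :: "int ^ 'd::finite \<Rightarrow> complex"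
  assumes c: "moderate c"
  shows "continuous_on ({0<..} \<times> UNIV) (\<lambda>(t, x). trig_series (heat_coeff c t) x)"
proof -
  have "continuous_on (\<Union>s\<in>{0<..}. {s<..} \<times> UNIV) (\<lambda>(t, x). trig_series (heat_coeff c t) x)"
  proof (rule continuous_on_open_UN)
    fix s :: real assume "s \<in> {0<..}"
    then show "continuous_on ({s<..} \<times> UNIV) (\<lambda>(t, x). trig_series (heat_coeff c t) x)"
      by (intro continuous_on_subset[OF continuous_heat_series_from[OF rapid_heat_coeff[OF c]]]) auto
  qed (auto intro!: open_Times)
  moreover have "({0<..} \<times> (UNIV :: (real ^ 'd) set)) \<subseteq> (\<Union>s\<in>{(0::real)<..}. {s<..} \<times> UNIV)"
  proof
    fix p :: "real \<times> (real ^ 'd)" assume "p \<in> {0<..} \<times> UNIV"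
    then have "fst p / 2 \<in> {0<..}" "p \<in> {fst p / 2<..} \<times> UNIV" by (auto simp: mem_Times_iff)
    then show "p \<in> (\<Union>s\<in>{(0::real)<..}. {s<..} \<times> UNIV)" by blast
  qed
  ultimately show ?thesis by (rule continuous_on_subset)
qed

text \<open>The multiplier series is smooth for positive times. The point is the weak initial value:
  paired with a test function, the terms are dominated uniformly in \<open>t \<ge> 0\<close> by a
  rapid sequence, so the sum is continuous up to \<open>t = 0\<close>.\<close>

lemma heat_solution_exists:
  fixes f :: "'d::finite distribution"
  assumes "tbar > 0"
  shows "heat_solution tbar f (\<lambda>t. trig_series (heat_coeff (fourier f) t))"
  unfolding heat_solution_def
proof (intro conjI ballI allI impI)
  note m = moderate_fourier[of f]
  show "test_function (trig_series (heat_coeff (fourier f) t))" if "t \<in> {0<..tbar}" for t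
    using that by (intro test_function_trig_series rapid_heat_coeff m) auto
  show "continuous_on ({0<..tbar} \<times> UNIV) (\<lambda>(t, x). trig_series (heat_coeff (fourier f) t) x)"
    by (rule continuous_on_subset[OF continuous_heat_series[OF m]]) auto
  show "((\<lambda>\<tau>. trig_series (heat_coeff (fourier f) \<tau>) x) has_real_derivative
      laplacian (trig_series (heat_coeff (fourier f) t)) x) (at t)" if "t \<in> {0<..<tbar}" for t x
    using that by (intro DERIV_heat_series m) auto
  fix \<eta> :: "real ^ 'd \<Rightarrow> real" assume t: "test_function \<eta>"
  let ?h = "\<lambda>t n. Re (fcoeff \<eta> (freq n) * cnj (heat_coeff (fourier f) t (freq n)))"
  have rapid: "rapid (\<lambda>k. fcoeff \<eta> k * fourier f k)"
    by (rule rapid_mult_moderate[OF rapid_fcoeff[OF t] m])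
  have cont: "continuous_on {0..} (\<lambda>t. \<Sum>n. ?h t n)"
  proof (rule uniform_limit_theorem[OF always_eventually])
    show "uniform_limit {0..} (\<lambda>n t. \<Sum>j<n. ?h t j) (\<lambda>t. \<Sum>n. ?h t n) sequentially"
    proof (rule Weierstrass_m_test[OF _ rapid_summable_norm[OF rapid]])
      fix n and t :: real assume "t \<in> {0..}"
      then have "norm (heat_coeff (fourier f) t (freq n)) \<le> norm (heat_coeff (fourier f) 0 (freq n))"
        by (intro norm_heat_coeff_mono) auto
      then have "norm (fcoeff \<eta> (freq n) * cnj (heat_coeff (fourier f) t (freq n))) \<le> norm (fcoeff \<eta> (freq n) * fourier f (freq n))"
        unfolding norm_mult complex_mod_cnj by (intro mult_left_mono) auto
      then show "norm (?h t n) \<le> norm (fcoeff \<eta> (freq n) * fourier f (freq n))"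
        unfolding real_norm_def by (rule order_trans[OF abs_Re_le_cmod])
    qed
    show "\<forall>n. continuous_on {0..} (\<lambda>t. \<Sum>j<n. ?h t j)"
      unfolding heat_coeff_def by (intro allI continuous_intros)
  qed auto
  have "((\<lambda>t. \<Sum>n. ?h t n) \<longlongrightarrow> (\<Sum>n. ?h 0 n)) (at 0 within {0..})"
    by (rule cont[unfolded continuous_on_def, rule_format]) simp
  then have lim: "((\<lambda>t. \<Sum>n. ?h t n) \<longlongrightarrow> (\<Sum>n. ?h 0 n)) (at_right 0)"
    by (rule tendsto_within_subset) auto
  have "(\<Sum>n. ?h 0 n) = dapp f \<eta>"
    using dapp_trig_series[OF rapid_fcoeff[OF t], of f] by (simp add: fourier_expansion[OF t] sums_iff)
  moreover have "(\<integral>x. trig_series (heat_coeff (fourier f) t) x * \<eta> x \<partial>torus) = (\<Sum>n. ?h t n)" if "t > 0" for t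
  proof -
    let ?u = "trig_series (heat_coeff (fourier f) t)"
    have r: "rapid (heat_coeff (fourier f) t)" by (rule rapid_heat_coeff[OF m that])
    have "fourier (regular_distribution ?u) = heat_coeff (fourier f) t"
      using fcoeff_trig_series[OF r hermitian_heat_coeff[OF hermitian_fourier]] by (simp add: fcoeff_def)
    then have "(\<lambda>n. ?h t n) sums dapp (regular_distribution ?u) (trig_series (fcoeff \<eta>))"
      using dapp_trig_series[OF rapid_fcoeff[OF t], of "regular_distribution ?u"] by simp
    then show ?thesis
      using \<open>test_function \<eta>\<close>
      by (simp add: fourier_expansion dapp_regular continuous_trig_series r sums_iff)
  qed
  ultimately show "((\<lambda>t. \<integral>x. trig_series (heat_coeff (fourier f) t) x * \<eta> x \<partial>torus) \<longlongrightarrow> dapp f \<eta>) (at_right 0)"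
    using lim by (auto elim!: Lim_transform_eventually intro!: eventually_at_right_less[THEN eventually_mono])
qed

section \<open>Maximum principle and uniqueness of solutions\<close>

lemma second_derivative_at_max:
  assumes t: "test_function \<eta>" and max: "\<And>y. \<eta> y \<le> \<eta> x"
  shows "Dpart [i, i] \<eta> x \<le> 0"
proof (rule ccontr)
  assume "\<not> Dpart [i, i] \<eta> x \<le> 0"
  then have pos: "0 < Dpart [i, i] \<eta> x" by simp
  let ?\<phi> = "\<lambda>h. \<eta> (x + h *\<^sub>R axis i 1)" and ?\<phi>' = "\<lambda>h. Dpart [i] \<eta> (x + h *\<^sub>R axis i 1)"
  have D: "(?\<phi> has_real_derivative ?\<phi>' h) (at h)" for h
    using DERIV_shift[of ?\<phi> "?\<phi>' h" 0 h] test_function_DERIV[OF t, of "[]" "x + h *\<^sub>R axis i 1" i]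
    by (simp add: algebra_simps)
  have 0: "?\<phi>' 0 = 0"
    by (rule DERIV_local_max[OF D, of 1]) (auto simp: max)
  obtain d where d: "0 < d" "\<And>h. 0 < h \<Longrightarrow> h < d \<Longrightarrow> ?\<phi>' 0 < ?\<phi>' (0 + h)"
    using DERIV_pos_inc_right[OF test_function_DERIV[OF t, of "[i]" x i] pos] by blast
  obtain z where z: "0 < z" "z < d / 2" "?\<phi> (d / 2) - ?\<phi> 0 = (d / 2 - 0) * ?\<phi>' z"
    using MVT2[of 0 "d / 2" ?\<phi> ?\<phi>'] d(1) D by auto
  have "?\<phi>' 0 < ?\<phi>' (0 + z)" using z(1,2) d(1) by (intro d(2)) auto
  then have "0 < ?\<phi>' z" unfolding 0 by (simp only: add_0)
  then have "0 < ?\<phi> (d / 2) - ?\<phi> 0" unfolding z(3) using d(1) by (intro mult_pos_pos) auto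
  then show False using max[of "x + (d / 2) *\<^sub>R axis i 1"] by simp
qed

text \<open>The perturbation by \<open>\<delta> * (t - a)\<close> makes the inequality strict: at a
  positive maximum of \<open>v\<close> the Laplacian is nonpositive, while the time derivative,
  equal to the Laplacian minus \<open>\<delta>\<close>, would have to be nonnegative.\<close>

lemma heat_maximum_principle:
  fixes w :: "real \<Rightarrow> real ^ 'd::finite \<Rightarrow> real"
  assumes cont: "continuous_on ({a..b} \<times> UNIV) (\<lambda>(t, x). w t x)"
    and per: "\<And>t. t \<in> {a..b} \<Longrightarrow> periodic (w t)"
    and test: "\<And>t. t \<in> {a<..b} \<Longrightarrow> test_function (w t)"
    and D: "\<And>t x. t \<in> {a<..b} \<Longrightarrow> ((\<lambda>\<tau>. w \<tau> x) has_real_derivative laplacian (w t) x) (at t)"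
    and init: "\<And>x. w a x \<le> 0"
    and t1: "t1 \<in> {a..b}"
  shows "w t1 x1 \<le> 0"
proof (rule ccontr)
  assume "\<not> w t1 x1 \<le> 0"
  then have pos: "0 < w t1 x1" by simp
  with init[of x1] t1 have t1': "a < t1" by (cases "t1 = a") auto
  \<comment> \<open>Half of the positive value \<open>w t1 x1\<close> survives the
    perturbation.\<close>
  define \<delta> where "\<delta> = w t1 x1 / (2 * (t1 - a))"
  have \<delta>: "0 < \<delta>" using pos t1' by (simp add: \<delta>_def)
  define v where "v t x = w t x - \<delta> * (t - a)" for t x
  let ?K = "{a..b} \<times> cbox 0 (One :: real ^ 'd)"
  have "compact ?K" by (intro compact_Times) auto
  moreover have "?K \<noteq> {}" using t1 by auto
  moreover have "continuous_on ?K (\<lambda>(t, x). v t x)"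
    using continuous_on_subset[OF cont, of ?K] unfolding v_def case_prod_unfold
    by (intro continuous_intros) auto
  ultimately obtain p where p: "p \<in> ?K" "\<And>q. q \<in> ?K \<Longrightarrow> (\<lambda>(t, x). v t x) q \<le> (\<lambda>(t, x). v t x) p"
    using continuous_attains_sup[of ?K "\<lambda>(t, x). v t x"] by blast
  obtain s y where sy: "p = (s, y)" by (cases p)
  have s: "s \<in> {a..b}" using p(1) sy by auto
  have max: "v t x \<le> v s y" if t: "t \<in> {a..b}" for t x
  proof -
    obtain x' where "x' \<in> cbox 0 One" "w t x' = w t x"
      using periodic_unit_cube_representative[OF per[OF t], of x] by blast
    then show ?thesis using p(2)[of "(t, x')"] t sy by (simp add: v_def)
  qed
  have "\<delta> * (t1 - a) = w t1 x1 / 2" using t1' by (simp add: \<delta>_def field_simps)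
  then have "0 < v t1 x1" using pos by (simp add: v_def)
  then have "0 < v s y" using max[OF t1, of x1] by simp
  then have as: "a < s" using init[of y] s by (cases "s = a") (auto simp: v_def)
  then have s': "s \<in> {a<..b}" using s by auto
  have Dv: "((\<lambda>\<tau>. v \<tau> y) has_real_derivative (laplacian (w s) y - \<delta>)) (at s)"
    unfolding v_def by (auto intro!: derivative_eq_intros D[OF s'])
  \<comment> \<open>Only earlier times are compared, since the maximum may be attained at
    \<open>s = b\<close>.\<close>
  have "0 \<le> laplacian (w s) y - \<delta>"
  proof (rule ccontr)
    assume "\<not> 0 \<le> laplacian (w s) y - \<delta>"
    then obtain d where d: "0 < d" "\<And>h. 0 < h \<Longrightarrow> h < d \<Longrightarrow> v s y < v (s - h) y"
      using DERIV_neg_dec_left[OF Dv] by auto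
    let ?h = "min (d / 2) (s - a)"
    have "v s y < v (s - ?h) y" using d as by (intro d(2)) auto
    moreover have "v (s - ?h) y \<le> v s y" using s' d by (intro max) auto
    ultimately show False by simp
  qed
  moreover have "laplacian (w s) y \<le> 0"
    unfolding laplacian_def
  proof (intro sum_nonpos second_derivative_at_max test s')
    show "w s x \<le> w s y" for x using max[OF s, of x] by (simp add: v_def)
  qed
  ultimately show False using \<delta> by simp
qed

lemma test_function_uminus: "test_function f \<Longrightarrow> test_function (\<lambda>x. - f x)"
  using test_function_cmult[of f "-1"] by simp

lemma test_function_diff: "test_function f \<Longrightarrow> test_function g \<Longrightarrow> test_function (\<lambda>x. f x - g x)"
  using test_function_add[of f "\<lambda>x. - g x"] test_function_uminus[of g] by simp

lemma laplacian_diff: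
  assumes "test_function f" "test_function g"
  shows "laplacian (\<lambda>x. f x - g x) x = laplacian f x - laplacian g x"
proof -
  have sm: "smooth f" "smooth g" "smooth (\<lambda>x. (- 1) * g x)"
    using assms test_function_cmult[of g "-1"] by (auto simp: test_function_def)
  have "Dpart is (\<lambda>x. f x + (- 1) * g x) = (\<lambda>x. Dpart is f x + (- 1) * Dpart is g x)" for "is"
    by (simp only: Dpart_add[OF sm(1,3)] Dpart_cmult[OF sm(2)])
  then have "Dpart is (\<lambda>x. f x - g x) = (\<lambda>x. Dpart is f x - Dpart is g x)" for "is" by simp
  then show ?thesis unfolding laplacian_def by (simp only: sum_subtractf)
qed

text \<open>A solution attains its initial value only weakly, so the maximum principle is applied from a
  positive time \<open>t0\<close>; afterwards \<open>t0 \<rightarrow> 0\<close> in each Fourier coefficient.\<close>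

lemma heat_solution_evolution:
  fixes f :: "'d::finite distribution"
  assumes u: "heat_solution tbar f u" and t0: "0 < t0" "t0 < b" "b < tbar"
  shows "u b x = trig_series (heat_coeff (fcoeff (u t0)) (b - t0)) x"
proof -
  have test: "test_function (u t)" if "t \<in> {0<..tbar}" for t
    using u that by (simp add: heat_solution_def)
  have cu: "continuous_on ({0<..tbar} \<times> UNIV) (\<lambda>(t, x). u t x)"
    using u by (simp add: heat_solution_def)
  have Du: "((\<lambda>\<tau>. u \<tau> x) has_real_derivative laplacian (u t) x) (at t)" if "t \<in> {0<..<tbar}" for t x
    using u that by (simp add: heat_solution_def)
  let ?c = "fcoeff (u t0)"
  let ?s = "\<lambda>t. trig_series (heat_coeff ?c (t - t0))"
  have r: "rapid ?c" by (rule rapid_fcoeff[OF test]) (use t0 in auto)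
  have tests: "test_function (?s t)" if "t0 \<le> t" for t
    using that by (intro test_function_trig_series rapid_heat_coeff0 r) auto
  have Ds: "((\<lambda>\<tau>. ?s \<tau> x) has_real_derivative laplacian (?s t) x) (at t)" if "t0 < t" for t x
    using DERIV_shift[of "\<lambda>\<tau>. trig_series (heat_coeff ?c \<tau>) x" "laplacian (?s t) x" t "- t0"]
      DERIV_heat_series[OF rapid_imp_moderate[OF r], of "t - t0" x] that by simp
  have cs: "continuous_on ({t0..b} \<times> UNIV) (\<lambda>(t, x). ?s t x)"
  proof -
    have "continuous_on ({0..} \<times> UNIV) (\<lambda>(t, x). trig_series (heat_coeff ?c t) x)"
      by (rule continuous_heat_series_from) (simp add: r)
    then have "continuous_on ({t0..b} \<times> UNIV) (\<lambda>p. (\<lambda>(t, x). trig_series (heat_coeff ?c t) x) (fst p - t0, snd p))"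
      by (rule continuous_on_compose2) (auto intro!: continuous_intros)
    then show ?thesis by (simp add: case_prod_unfold)
  qed
  have cu': "continuous_on ({t0..b} \<times> UNIV) (\<lambda>(t, x). u t x)"
    by (rule continuous_on_subset[OF cu]) (use t0 in auto)
  have init: "?s t0 x = u t0 x" for x
    using fourier_expansion[OF test, of t0] t0 by simp
  have "u b x - ?s b x \<le> 0"
  proof (rule heat_maximum_principle[where a = t0 and b = b and w = "\<lambda>t x. u t x - ?s t x"])
    show "continuous_on ({t0..b} \<times> UNIV) (\<lambda>(t, x). u t x - ?s t x)"
      using cu' cs unfolding case_prod_unfold by (rule continuous_on_diff)
    show tt: "test_function (\<lambda>x. u t x - ?s t x)" if "t \<in> {t0<..b}" for t
      using that t0 by (intro test_function_diff test tests) auto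
    show "periodic (\<lambda>x. u t x - ?s t x)" if "t \<in> {t0..b}" for t
      using that t0 by (intro test_function_periodic test_function_diff test tests) auto
    show "((\<lambda>\<tau>. u \<tau> x - ?s \<tau> x) has_real_derivative laplacian (\<lambda>x. u t x - ?s t x) x) (at t)" if "t \<in> {t0<..b}" for t x
    proof -
      have "laplacian (\<lambda>x. u t x - ?s t x) x = laplacian (u t) x - laplacian (?s t) x"
        using that t0 by (intro laplacian_diff test tests) auto
      moreover have "((\<lambda>\<tau>. u \<tau> x - ?s \<tau> x) has_real_derivative laplacian (u t) x - laplacian (?s t) x) (at t)"
        using that t0 by (intro DERIV_diff Du Ds) auto
      ultimately show ?thesis by simp
    qed
  qed (use t0 init in auto)
  moreover have "?s b x - u b x \<le> 0"
  proof (rule heat_maximum_principle[where a = t0 and b = b and w = "\<lambda>t x. ?s t x - u t x"])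
    show "continuous_on ({t0..b} \<times> UNIV) (\<lambda>(t, x). ?s t x - u t x)"
      using cs cu' unfolding case_prod_unfold by (rule continuous_on_diff)
    show tt: "test_function (\<lambda>x. ?s t x - u t x)" if "t \<in> {t0<..b}" for t
      using that t0 by (intro test_function_diff test tests) auto
    show "periodic (\<lambda>x. ?s t x - u t x)" if "t \<in> {t0..b}" for t
      using that t0 by (intro test_function_periodic test_function_diff test tests) auto
    show "((\<lambda>\<tau>. ?s \<tau> x - u \<tau> x) has_real_derivative laplacian (\<lambda>x. ?s t x - u t x) x) (at t)" if "t \<in> {t0<..b}" for t x
    proof -
      have "laplacian (\<lambda>x. ?s t x - u t x) x = laplacian (?s t) x - laplacian (u t) x"
        using that t0 by (intro laplacian_diff test tests) auto
      moreover have "((\<lambda>\<tau>. ?s \<tau> x - u \<tau> x) has_real_derivative laplacian (?s t) x - laplacian (u t) x) (at t)"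
        using that t0 by (intro DERIV_diff Du Ds) auto
      ultimately show ?thesis by simp
    qed
  qed (use t0 init in auto)
  ultimately show ?thesis by simp
qed

lemma heat_solution_fcoeff:
  fixes f :: "'d::finite distribution"
  assumes u: "heat_solution tbar f u" and b: "0 < b" "b < tbar"
  shows "fcoeff (u b) = heat_coeff (fourier f) b"
proof
  fix k :: "int ^ 'd"
  have test: "test_function (u t)" if "t \<in> {0<..tbar}" for t
    using u that by (simp add: heat_solution_def)
  have *: "fcoeff (u b) k = heat_coeff (fcoeff (u t0)) (b - t0) k" if "0 < t0" "t0 < b" for t0
  proof -
    have r: "rapid (heat_coeff (fcoeff (u t0)) (b - t0))"
      using that b by (intro rapid_heat_coeff0 rapid_fcoeff test) auto
    have "u b = trig_series (heat_coeff (fcoeff (u t0)) (b - t0))"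
      by (rule ext, rule heat_solution_evolution[OF u that b(2)])
    then show ?thesis
      using fcoeff_trig_series[OF r hermitian_heat_coeff[OF hermitian_fcoeff]] by simp
  qed
  show "fcoeff (u b) k = heat_coeff (fourier f) b k"
  proof (rule fcoeff_unique[OF test_function_continuous[OF test]])
    show "b \<in> {0<..tbar}" using b by auto
    fix z
    \<comment> \<open>The factor propagates the coefficient from time \<open>t\<close> to time
      \<open>b\<close>, so the expression does not depend on \<open>t\<close>; its limit at 0 is
      given by the weak initial condition.\<close>
    have lim: "((\<lambda>t. exp (- heat_rate k * (b - t)) * (\<integral>x. u t x * trig k z x \<partial>torus)) \<longlongrightarrow>
        exp (- heat_rate k * (b - 0)) * dapp f (trig k z)) (at_right 0)"
      using u test_function_trig[of k z] unfolding heat_solution_def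
      by (intro tendsto_intros) auto
    have eq: "exp (- heat_rate k * (b - t)) * (\<integral>x. u t x * trig k z x \<partial>torus) = (\<integral>x. u b x * trig k z x \<partial>torus)"
      if "0 < t" "t < b" for t
      using *[OF that] that b
      by (simp add: integral_trig_fcoeff test_function_continuous[OF test] heat_coeff_def scaleR_conv_of_real algebra_simps)
    have "eventually (\<lambda>t. t < b) (at_right 0)" "eventually (\<lambda>t. 0 < t) (at_right (0::real))"
      using b by (auto intro: eventually_at_right_less order_tendstoD(2)[OF tendsto_ident_at])
    then have "eventually (\<lambda>t. exp (- heat_rate k * (b - t)) * (\<integral>x. u t x * trig k z x \<partial>torus) = (\<integral>x. u b x * trig k z x \<partial>torus)) (at_right 0)"
      by eventually_elim (rule eq)
    from iffD1[OF tendsto_cong[OF this] lim] have "((\<lambda>t. \<integral>x. u b x * trig k z x \<partial>torus) \<longlongrightarrow> exp (- heat_rate k * (b - 0)) * dapp f (trig k z)) (at_right (0::real))"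
      .
    then have "(\<integral>x. u b x * trig k z x \<partial>torus) = exp (- heat_rate k * (b - 0)) * dapp f (trig k z)"
      by (simp add: tendsto_const_iff)
    then show "(\<integral>x. u b x * trig k z x \<partial>torus) = Re (z * cnj (heat_coeff (fourier f) b k))"
      by (simp add: dapp_trig heat_coeff_def scaleR_conv_of_real algebra_simps)
  qed
qed

text \<open>The differential equation is imposed only before \<open>tbar\<close>; at
  \<open>tbar\<close> itself the value is the limit of earlier ones by joint continuity.\<close>

lemma heat_solution_unique:
  fixes f :: "'d::finite distribution"
  assumes u: "heat_solution tbar f u" and tbar: "tbar > 0"
  shows "u tbar = trig_series (heat_coeff (fourier f) tbar)"
proof
  fix x
  have test: "test_function (u t)" if "t \<in> {0<..tbar}" for t
    using u that by (simp add: heat_solution_def)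
  have eq: "u t x = trig_series (heat_coeff (fourier f) t) x" if "t \<in> {0<..<tbar}" for t
    using fourier_expansion[OF test, of t] heat_solution_fcoeff[OF u, of t] that by simp
  have "continuous_on ({0<..tbar} \<times> UNIV) (\<lambda>(t, x). u t x)"
    "continuous_on ({0<..tbar} \<times> UNIV) (\<lambda>(t, x). trig_series (heat_coeff (fourier f) t) x)"
    using u heat_solution_exists[OF tbar, of f] by (simp_all add: heat_solution_def)
  note c = this
  have "continuous_on {0<..tbar} (\<lambda>t. (\<lambda>(t, x). u t x) (t, x))"
    "continuous_on {0<..tbar} (\<lambda>t. (\<lambda>(t, x). trig_series (heat_coeff (fourier f) t) x) (t, x))"
    by (rule continuous_on_compose2[OF c(1)] continuous_on_compose2[OF c(2)]; auto intro!: continuous_intros)+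
  note c = this[unfolded prod.case, unfolded continuous_on_def, rule_format, of tbar]
  have sub: "{0<..<tbar} \<subseteq> {0<..tbar}" by auto
  have l: "((\<lambda>t. u t x) \<longlongrightarrow> u tbar x) (at tbar within {0<..<tbar})"
    "((\<lambda>t. trig_series (heat_coeff (fourier f) t) x) \<longlongrightarrow> trig_series (heat_coeff (fourier f) tbar) x) (at tbar within {0<..<tbar})"
    by (rule tendsto_within_subset[OF _ sub], rule c, use tbar in simp)+
  have "eventually (\<lambda>t. u t x = trig_series (heat_coeff (fourier f) t) x) (at tbar within {0<..<tbar})"
    unfolding eventually_at_filter by (intro always_eventually) (use eq in auto)
  then have "((\<lambda>t. trig_series (heat_coeff (fourier f) t) x) \<longlongrightarrow> u tbar x) (at tbar within {0<..<tbar})"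
    by (rule Lim_transform_eventually[OF l(1)])
  moreover have "at tbar within {0<..<tbar} \<noteq> bot"
    using tbar by (subst at_within_eq_bot_iff) (simp add: closure_greaterThanLessThan islimpt_greaterThanLessThan2 trivial_limit_within)
  ultimately show "u tbar x = trig_series (heat_coeff (fourier f) tbar) x"
    using tendsto_unique[OF _ _ l(2)] by blast
qed

theorem T_BH_eq:
  assumes "tbar > 0"
  shows "T_BH tbar f = trig_series (heat_coeff (fourier f) tbar)"
  unfolding T_BH_def
proof (rule the_equality)
  show "\<exists>u. heat_solution tbar f u \<and> trig_series (heat_coeff (fourier f) tbar) = u tbar"
    using heat_solution_exists[OF assms, of f] by blast
  show "g = trig_series (heat_coeff (fourier f) tbar)" if "\<exists>u. heat_solution tbar f u \<and> g = u tbar" for g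
    using that heat_solution_unique[OF _ assms] by blast
qed

section \<open>Uniform convexity of Lebesgue norms\<close>

text \<open>Real-valued norms for finite exponents over an arbitrary measure: used for blocks on the
  torus, for coefficients within a level and for sequences over levels, the latter two with counting
  measures.\<close>

definition Lp_fun :: "'a measure \<Rightarrow> real \<Rightarrow> ('a \<Rightarrow> real) \<Rightarrow> bool" where
  "Lp_fun M p u \<longleftrightarrow> u \<in> borel_measurable M \<and> integrable M (\<lambda>x. \<bar>u x\<bar> powr p)"

definition lpn :: "'a measure \<Rightarrow> real \<Rightarrow> ('a \<Rightarrow> real) \<Rightarrow> real" where
  "lpn M p u = (\<integral>x. \<bar>u x\<bar> powr p \<partial>M) powr (1 / p)"

text \<open>Convexity of the power is used for positive arguments; if one argument is zero, the
  claim reduces to \<open>c powr p \<le> c\<close> for \<open>c\<close> between 0 and 1.\<close>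

lemma powr_convex_comb:
  fixes a b l m p :: real
  assumes p: "1 \<le> p" and ab: "0 \<le> a" "0 \<le> b" and lm: "0 \<le> l" "0 \<le> m" "l + m = 1"
  shows "(l * a + m * b) powr p \<le> l * a powr p + m * b powr p"
proof -
  have *: "(c * x) powr p \<le> c * x powr p" if "0 \<le> c" "c \<le> 1" "0 \<le> x" for c x :: real
  proof -
    have "c powr p \<le> c" using powr_mono'[of 1 p c] p that by simp
    then show ?thesis using that by (simp add: powr_mult mult_right_mono)
  qed
  consider "a = 0" | "b = 0" | "0 < a" "0 < b" using ab by linarith
  then show ?thesis
  proof cases
    case 3
    then show ?thesis
      using convex_onD[OF powr_convex[OF p], of m a b] lm by (simp add: eq_diff_eq[symmetric])
  qed (use * ab lm in auto)
qed

lemma powr_mean_le: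
  fixes a b p :: real
  assumes "1 \<le> p" "0 \<le> a" "0 \<le> b"
  shows "((a + b) / 2) powr p \<le> (a powr p + b powr p) / 2"
  using powr_convex_comb[OF assms, of "1/2" "1/2"] by (simp add: add_divide_distrib)

lemma powr_add_crude:
  fixes a b p :: real
  assumes "0 \<le> p" "0 \<le> a" "0 \<le> b"
  shows "(a + b) powr p \<le> 2 powr p * (a powr p + b powr p)"
proof -
  have "(a + b) powr p \<le> (2 * max a b) powr p" using assms by (intro powr_mono2) auto
  also have "\<dots> = 2 powr p * max a b powr p" using assms by (simp add: powr_mult)
  also have "\<dots> \<le> 2 powr p * (a powr p + b powr p)" by (intro mult_left_mono) (auto simp: max_def)
  finally show ?thesis .
qed

lemma lpn_nonneg [simp]: "0 \<le> lpn M p u"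
  by (simp add: lpn_def)

lemma lpn_powr: "0 < p \<Longrightarrow> lpn M p u powr p = (\<integral>x. \<bar>u x\<bar> powr p \<partial>M)"
  by (simp add: lpn_def powr_powr)

lemma lpn_le:
  assumes "0 < p" "0 \<le> B" "(\<integral>x. \<bar>u x\<bar> powr p \<partial>M) \<le> B powr p"
  shows "lpn M p u \<le> B"
proof -
  have "lpn M p u \<le> (B powr p) powr (1 / p)"
    unfolding lpn_def using assms by (intro powr_mono2) auto
  then show ?thesis using assms by (simp add: powr_powr)
qed

lemma lpn_cmult: "0 < p \<Longrightarrow> lpn M p (\<lambda>x. a * u x) = \<bar>a\<bar> * lpn M p u"
  by (simp add: lpn_def abs_mult powr_mult powr_powr)

lemma lpn_minus: "lpn M p (\<lambda>x. u x - v x) = lpn M p (\<lambda>x. v x - u x)"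
  by (simp add: lpn_def abs_minus_commute)

lemma Lp_fun_cmult: "Lp_fun M p u \<Longrightarrow> Lp_fun M p (\<lambda>x. a * u x)"
  by (auto simp: Lp_fun_def abs_mult powr_mult)

lemma Lp_fun_mono:
  assumes "Lp_fun M p v" "0 \<le> p" "u \<in> borel_measurable M" "\<And>x. x \<in> space M \<Longrightarrow> \<bar>u x\<bar> \<le> \<bar>v x\<bar>"
  shows "Lp_fun M p u"
  unfolding Lp_fun_def
proof
  show "integrable M (\<lambda>x. \<bar>u x\<bar> powr p)"
  proof (rule Bochner_Integration.integrable_bound)
    show "integrable M (\<lambda>x. \<bar>v x\<bar> powr p)" using assms by (simp add: Lp_fun_def)
    show "AE x in M. norm (\<bar>u x\<bar> powr p) \<le> norm (\<bar>v x\<bar> powr p)"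
      using assms by (intro AE_I2) (simp add: powr_mono2)
  qed (use assms in measurable)
qed (fact assms)

lemma lpn_mono:
  assumes "0 < p" "Lp_fun M p v" "Lp_fun M p u" "\<And>x. x \<in> space M \<Longrightarrow> \<bar>u x\<bar> \<le> \<bar>v x\<bar>"
  shows "lpn M p u \<le> lpn M p v"
  unfolding lpn_def
  using assms by (intro powr_mono2 integral_mono) (auto simp: Lp_fun_def powr_mono2)

lemma Lp_fun_add:
  assumes p: "0 \<le> p" and u: "Lp_fun M p u" and v: "Lp_fun M p v"
  shows "Lp_fun M p (\<lambda>x. u x + v x)"
  unfolding Lp_fun_def
proof
  have m: "u \<in> borel_measurable M" "v \<in> borel_measurable M" using u v by (auto simp: Lp_fun_def)
  then show m': "(\<lambda>x. u x + v x) \<in> borel_measurable M" by measurable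
  show "integrable M (\<lambda>x. \<bar>u x + v x\<bar> powr p)"
  proof (rule Bochner_Integration.integrable_bound)
    show "integrable M (\<lambda>x. 2 powr p * (\<bar>u x\<bar> powr p + \<bar>v x\<bar> powr p))"
      using u v by (auto simp: Lp_fun_def)
    have "\<bar>u x + v x\<bar> powr p \<le> 2 powr p * (\<bar>u x\<bar> powr p + \<bar>v x\<bar> powr p)" for x
    proof -
      have "\<bar>u x + v x\<bar> powr p \<le> (\<bar>u x\<bar> + \<bar>v x\<bar>) powr p" using p by (intro powr_mono2) auto
      also have "\<dots> \<le> 2 powr p * (\<bar>u x\<bar> powr p + \<bar>v x\<bar> powr p)" by (intro powr_add_crude p) auto
      finally show ?thesis .
    qed
    then show "AE x in M. norm (\<bar>u x + v x\<bar> powr p) \<le> norm (2 powr p * (\<bar>u x\<bar> powr p + \<bar>v x\<bar> powr p))"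
      by (intro AE_I2) simp
  qed (use m in measurable)
qed

lemma Lp_fun_diff:
  assumes "0 \<le> p" "Lp_fun M p u" "Lp_fun M p v"
  shows "Lp_fun M p (\<lambda>x. u x - v x)"
  using Lp_fun_add[OF assms(1,2) Lp_fun_cmult[OF assms(3), of "-1"]] by simp

text \<open>After division by \<open>X + Y\<close> the sum is dominated by a convex combination of
  \<open>\<bar>u\<bar> / X\<close> and \<open>\<bar>v\<bar> / Y\<close>, and convexity of the power
  is integrated. The term \<open>e / 2\<close> keeps \<open>X\<close> and \<open>Y\<close> positive
  when a norm vanishes.\<close>

lemma lpn_add:
  assumes p: "1 \<le> p" and u: "Lp_fun M p u" and v: "Lp_fun M p v"
  shows "lpn M p (\<lambda>x. u x + v x) \<le> lpn M p u + lpn M p v"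
proof (rule field_le_epsilon)
  fix e :: real assume e: "0 < e"
  define X where "X = lpn M p u + e / 2"
  define Y where "Y = lpn M p v + e / 2"
  have pos: "0 < X" "0 < Y" using e by (auto simp: X_def Y_def add_nonneg_pos)
  define l where "l = X / (X + Y)"
  define m where "m = Y / (X + Y)"
  have lm: "0 \<le> l" "0 \<le> m" "l + m = 1" using pos by (auto simp: l_def m_def add_divide_distrib[symmetric])
  have i: "integrable M (\<lambda>x. \<bar>u x\<bar> powr p)" "integrable M (\<lambda>x. \<bar>v x\<bar> powr p)"
    using u v by (auto simp: Lp_fun_def)
  have pt: "\<bar>u x + v x\<bar> powr p \<le> (X + Y) powr p * (l / X powr p * \<bar>u x\<bar> powr p + m / Y powr p * \<bar>v x\<bar> powr p)" for x
  proof -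
    have "\<bar>u x + v x\<bar> \<le> (X + Y) * (l * (\<bar>u x\<bar> / X) + m * (\<bar>v x\<bar> / Y))"
      using pos by (simp add: l_def m_def distrib_left)
    then have "\<bar>u x + v x\<bar> powr p \<le> ((X + Y) * (l * (\<bar>u x\<bar> / X) + m * (\<bar>v x\<bar> / Y))) powr p"
      using p by (intro powr_mono2) auto
    also have "\<dots> = (X + Y) powr p * (l * (\<bar>u x\<bar> / X) + m * (\<bar>v x\<bar> / Y)) powr p"
      by (rule powr_mult)
    also have "\<dots> \<le> (X + Y) powr p * (l * (\<bar>u x\<bar> / X) powr p + m * (\<bar>v x\<bar> / Y) powr p)"
      using pos lm p by (intro mult_left_mono powr_convex_comb) auto
    finally show ?thesis using pos by (simp add: powr_divide)
  qed
  have "(\<integral>x. \<bar>u x + v x\<bar> powr p \<partial>M) \<le> (\<integral>x. (X + Y) powr p * (l / X powr p * \<bar>u x\<bar> powr p + m / Y powr p * \<bar>v x\<bar> powr p) \<partial>M)"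
    using Lp_fun_add[of p M u v] u v p i by (intro integral_mono pt) (auto simp: Lp_fun_def)
  also have "\<dots> = (X + Y) powr p * (l / X powr p * lpn M p u powr p + m / Y powr p * lpn M p v powr p)"
    using i p by (simp add: lpn_powr)
  also have "\<dots> \<le> (X + Y) powr p * (l / X powr p * X powr p + m / Y powr p * Y powr p)"
    using e lm p pos by (intro mult_left_mono add_mono powr_mono2) (auto simp: X_def Y_def)
  also have "\<dots> = (X + Y) powr p" using pos lm by simp
  finally have "lpn M p (\<lambda>x. u x + v x) \<le> X + Y"
    using p pos by (intro lpn_le) auto
  then show "lpn M p (\<lambda>x. u x + v x) \<le> lpn M p u + lpn M p v + e" by (simp add: X_def Y_def)
qed

lemma lpn_diff_le:
  assumes p: "1 \<le> p" and u: "Lp_fun M p u" and v: "Lp_fun M p v"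
  shows "lpn M p (\<lambda>x. u x - v x) \<le> lpn M p u + lpn M p v"
  using lpn_add[OF p u Lp_fun_cmult[OF v, of "-1"]] lpn_cmult[of p M "-1" v] p by simp

lemma lpn_abs_diff:
  assumes p: "1 \<le> p" and u: "Lp_fun M p u" and v: "Lp_fun M p v"
  shows "\<bar>lpn M p u - lpn M p v\<bar> \<le> lpn M p (\<lambda>x. u x - v x)"
proof -
  have "lpn M p u \<le> lpn M p (\<lambda>x. u x - v x) + lpn M p v"
    using lpn_add[OF p Lp_fun_diff[OF _ u v] v] p by simp
  moreover have "lpn M p v \<le> lpn M p (\<lambda>x. v x - u x) + lpn M p u"
    using lpn_add[OF p Lp_fun_diff[OF _ v u] u] p by simp
  ultimately show ?thesis by (simp add: lpn_minus[of M p v u])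
qed

text \<open>Weighted Young inequality for the functions divided by their integrals, with
  \<open>e > 0\<close> added to avoid division by zero, and then \<open>e\<close> tends to
  0.\<close>

lemma Holder_powr:
  fixes f g :: "'a \<Rightarrow> real"
  assumes a: "0 < a" "a \<le> 1" and f: "integrable M f" "\<And>x. 0 \<le> f x" and g: "integrable M g" "\<And>x. 0 \<le> g x"
  shows "(\<integral>x. f x powr a * g x powr (1 - a) \<partial>M) \<le> (\<integral>x. f x \<partial>M) powr a * (\<integral>x. g x \<partial>M) powr (1 - a)"
proof (cases "a = 1")
  case True
  have "(\<integral>x. f x powr a * g x powr (1 - a) \<partial>M) \<le> (\<integral>x. f x \<partial>M)"
  proof (rule integral_mono')
    show "f x powr a * g x powr (1 - a) \<le> f x" for x using True f(2)[of x] by simp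
  qed (use f in auto)
  \<comment> \<open>As \<open>0 powr 0 = 0\<close>, the right-hand side vanishes if \<open>g\<close>
    has integral zero; then \<open>g = 0\<close> almost everywhere and the left-hand side vanishes
    for the same reason.\<close>
  moreover have "(\<integral>x. f x powr a * g x powr (1 - a) \<partial>M) = 0" if "(\<integral>x. g x \<partial>M) = 0"
  proof -
    have "AE x in M. g x = 0" using that g by (simp add: integral_nonneg_eq_0_iff_AE)
    then have "AE x in M. f x powr a * g x powr (1 - a) = 0" by eventually_elim simp
    then show ?thesis by (rule integral_eq_zero_AE)
  qed
  moreover have "0 \<le> (\<integral>x. f x \<partial>M)" "0 \<le> (\<integral>x. g x \<partial>M)" using f g by auto
  ultimately show ?thesis using True by (cases "(\<integral>x. g x \<partial>M) = 0") auto
next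
  case False
  have le: "(\<integral>x. f x powr a * g x powr (1 - a) \<partial>M) \<le> (E + e) powr a * (T + e) powr (1 - a)"
    if "e > 0" "E = (\<integral>x. f x \<partial>M)" "T = (\<integral>x. g x \<partial>M)" for e E T
  proof -
    have pos: "0 < E + e" "0 < T + e" using that f g by (auto intro!: add_nonneg_pos)
    let ?C = "(E + e) powr a * (T + e) powr (1 - a)"
    have pt: "f x powr a * g x powr (1 - a) \<le> ?C * (a * (f x / (E + e)) + (1 - a) * (g x / (T + e)))" for x
    proof (cases "f x = 0 \<or> g x = 0")
      case True
      then have "f x powr a * g x powr (1 - a) = 0" by auto
      then show ?thesis using a f(2)[of x] g(2)[of x] pos by (auto intro!: mult_nonneg_nonneg add_nonneg_nonneg)
    next
      case F: False
      have "(f x / (E + e)) powr a * (g x / (T + e)) powr (1 - a) \<le> a * (f x / (E + e)) + (1 - a) * (g x / (T + e))"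
        using F pos a f(2)[of x] g(2)[of x] by (intro Youngs_inequality_0) auto
      then have "?C * ((f x / (E + e)) powr a * (g x / (T + e)) powr (1 - a)) \<le> ?C * (a * (f x / (E + e)) + (1 - a) * (g x / (T + e)))"
        by (intro mult_left_mono) auto
      moreover have "?C * ((f x / (E + e)) powr a * (g x / (T + e)) powr (1 - a)) = f x powr a * g x powr (1 - a)"
        using pos f(2)[of x] g(2)[of x] by (simp add: powr_divide)
      ultimately show ?thesis by simp
    qed
    have "(\<integral>x. f x powr a * g x powr (1 - a) \<partial>M) \<le> (\<integral>x. ?C * (a * (f x / (E + e)) + (1 - a) * (g x / (T + e))) \<partial>M)"
      using f g a pos by (intro integral_mono' pt) (auto intro!: mult_nonneg_nonneg add_nonneg_nonneg)
    also have "\<dots> = ?C * (a * (E / (E + e)) + (1 - a) * (T / (T + e)))"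
      using f g that by simp
    also have "\<dots> \<le> ?C * (a * 1 + (1 - a) * 1)"
      using pos a that by (intro mult_left_mono add_mono) (auto simp: divide_simps)
    finally show ?thesis by simp
  qed
  let ?E = "\<integral>x. f x \<partial>M" and ?T = "\<integral>x. g x \<partial>M"
  have "0 \<le> ?E" "0 \<le> ?T" using f g by auto
  then have "((\<lambda>e. (?E + e) powr a * (?T + e) powr (1 - a)) \<longlongrightarrow> (?E + 0) powr a * (?T + 0) powr (1 - a)) (at_right 0)"
    using a False
    by (intro tendsto_mult tendsto_powr' tendsto_intros)
       (auto intro!: eventually_at_right_less[THEN eventually_mono])
  moreover have "eventually (\<lambda>e. (\<integral>x. f x powr a * g x powr (1 - a) \<partial>M) \<le> (?E + e) powr a * (?T + e) powr (1 - a)) (at_right 0)"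
    using eventually_at_right_less by (rule eventually_mono) (rule le; simp)
  ultimately show ?thesis
    by (intro tendsto_lowerbound[where F = "at_right (0::real)"]) auto
qed

text \<open>The constant comes from convexity of \<open>\<bar>x\<bar> powr p - p * (p - 1) / 2 * S powr (p - 2) * x\<^sup>2\<close> on \<open>[- S, S]\<close>.\<close>

lemma uniform_convexity_powr_real:
  fixes a b p :: real
  assumes p: "1 < p" "p \<le> 2"
  defines "S \<equiv> \<bar>a\<bar> + \<bar>b\<bar>"
  shows "p * (p - 1) / 8 * ((a - b)\<^sup>2 * S powr (p - 2)) + \<bar>(a + b) / 2\<bar> powr p \<le> (\<bar>a\<bar> powr p + \<bar>b\<bar> powr p) / 2"
proof (cases "S = 0")
  case True
  then have "a = 0" "b = 0" unfolding S_def by linarith+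
  then show ?thesis by simp
next
  case False
  then have S: "0 < S" by (auto simp: S_def)
  \<comment> \<open>Twice \<open>c\<close> is the least value of the second derivative
    \<open>p * (p - 1) * x powr (p - 2)\<close> of the power for \<open>0 < x \<le> S\<close>,
    attained at \<open>S\<close> because \<open>p \<le> 2\<close>; so \<open>h\<close> is convex
    there.\<close>
  define c where "c = p * (p - 1) / 2 * S powr (p - 2)"
  define h where "h x = \<bar>x\<bar> powr p - c * x\<^sup>2" for x :: real
  define h' where "h' x = p * x powr (p - 1) - 2 * c * x" for x :: real
  have c0: "0 \<le> c" using p by (simp add: c_def)
  have D: "(h has_real_derivative h' x) (at x)" if "0 \<le> x" for x
  proof (cases "x = 0")
    case True
    have "((\<lambda>t. \<bar>t\<bar> powr (p - 1)) \<longlongrightarrow> 0) (at (0::real))"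
      using p by (intro tendsto_zero_powrI[where b = "p - 1"] tendsto_intros) (auto intro!: tendsto_eq_intros)
    then have "((\<lambda>t. \<bar>t\<bar> powr p / t) \<longlongrightarrow> 0) (at (0::real))"
    proof (rule Lim_null_comparison[rotated])
      show "eventually (\<lambda>t. norm (\<bar>t\<bar> powr p / t) \<le> \<bar>t\<bar> powr (p - 1)) (at (0::real))"
        by (intro always_eventually allI) (auto simp: powr_diff abs_divide)
    qed
    then have "((\<lambda>x. \<bar>x\<bar> powr p) has_real_derivative 0) (at 0)"
      by (simp add: DERIV_def)
    then have "(h has_real_derivative 0 - c * 0) (at 0)"
      unfolding h_def by (intro derivative_intros) (auto intro!: derivative_eq_intros)
    then show ?thesis using True by (simp add: h'_def)
  next
    case False
    then have x: "0 < x" using that by simp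
    have "((\<lambda>x. x powr p - c * x\<^sup>2) has_real_derivative h' x) (at x)"
      unfolding h'_def using x by (auto intro!: derivative_eq_intros)
    moreover have "eventually (\<lambda>y. y \<in> {0<..}) (nhds x)"
      using x by (intro eventually_nhds_in_open) auto
    then have "eventually (\<lambda>y. y powr p - c * y\<^sup>2 = h y) (nhds x)"
      by eventually_elim (simp add: h_def)
    ultimately show ?thesis by (subst (asm) DERIV_cong_ev[OF refl _ refl])
  qed
  have low: "S powr (p - 2) \<le> x powr (p - 2)" if "0 < x" "x \<le> S" for x
    using that p by (intro powr_mono2') auto
  have h'_nonneg: "0 \<le> h' x" if "0 \<le> x" "x \<le> S" for x
  proof (cases "x = 0")
    case False
    then have x: "0 < x" using that by simp
    have "x powr (p - 1) = x * x powr (p - 2)" using x by (simp add: powr_diff power2_eq_square)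
    then have "h' x = p * x * (x powr (p - 2) - (p - 1) * S powr (p - 2))"
      by (simp add: h'_def c_def field_simps)
    moreover have "(p - 1) * S powr (p - 2) \<le> 1 * S powr (p - 2)" using p by (intro mult_right_mono) auto
    ultimately show ?thesis using low[OF x that(2)] p x by simp
  qed (simp add: h'_def)
  have h'_mono: "h' x \<le> h' y" if "0 \<le> x" "x \<le> y" "y \<le> S" for x y
  proof (cases "x = 0")
    case True
    then show ?thesis using h'_nonneg[of y] that by (simp add: h'_def)
  next
    case False
    show ?thesis
    proof (rule DERIV_nonneg_imp_nondecreasing[OF that(2)])
      fix z assume z: "x \<le> z" "z \<le> y"
      then have "0 < z" "z \<le> S" using False that by auto
      then have "(h' has_real_derivative p * ((p - 1) * z powr (p - 2)) - 2 * c) (at z)"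
        unfolding h'_def by (auto intro!: derivative_eq_intros)
      moreover have "0 \<le> p * ((p - 1) * z powr (p - 2)) - 2 * c"
        using mult_left_mono[OF low[OF \<open>0 < z\<close> \<open>z \<le> S\<close>], of "p * (p - 1)"] p by (simp add: c_def)
      ultimately show "\<exists>d. (h' has_real_derivative d) (at z) \<and> 0 \<le> d" by blast
    qed
  qed
  have "convex_on {0..S} h"
    by (rule convex_on_realI[where f' = h']) (auto intro: D h'_mono)
  from convex_onD[OF this, of "1/2" "\<bar>a\<bar>" "\<bar>b\<bar>"]
  have conv: "h ((\<bar>a\<bar> + \<bar>b\<bar>) / 2) \<le> (h \<bar>a\<bar> + h \<bar>b\<bar>) / 2"
    by (simp add: S_def add_divide_distrib)
  \<comment> \<open>\<open>h\<close> is nondecreasing on nonnegative arguments up to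
    \<open>S\<close>, which allows the signs of \<open>a\<close> and \<open>b\<close> to
    differ.\<close>
  have "h \<bar>(a + b) / 2\<bar> \<le> h ((\<bar>a\<bar> + \<bar>b\<bar>) / 2)"
  proof (rule DERIV_nonneg_imp_nondecreasing[where f = h])
    show "\<bar>(a + b) / 2\<bar> \<le> (\<bar>a\<bar> + \<bar>b\<bar>) / 2" by simp
    fix x assume x: "\<bar>(a + b) / 2\<bar> \<le> x" "x \<le> (\<bar>a\<bar> + \<bar>b\<bar>) / 2"
    have "0 \<le> x" using x(1) abs_ge_zero order_trans by blast
    have "x \<le> S" using x(2) S unfolding S_def by argo
    show "\<exists>d. (h has_real_derivative d) (at x) \<and> 0 \<le> d" using D[OF \<open>0 \<le> x\<close>] h'_nonneg[OF \<open>0 \<le> x\<close> \<open>x \<le> S\<close>] by blast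
  qed
  moreover have "h \<bar>t\<bar> = \<bar>t\<bar> powr p - c * t\<^sup>2" for t by (simp add: h_def)
  ultimately have "\<bar>(a + b) / 2\<bar> powr p - c * ((a + b) / 2)\<^sup>2 \<le> (\<bar>a\<bar> powr p - c * a\<^sup>2 + (\<bar>b\<bar> powr p - c * b\<^sup>2)) / 2"
    using conv by (metis order_trans)
  \<comment> \<open>The parallelogram identity returns the quadratic gain, with a quarter of
    \<open>c\<close>.\<close>
  moreover have "c * ((a + b) / 2)\<^sup>2 = (c * a\<^sup>2 + c * b\<^sup>2) / 2 - c / 4 * (a - b)\<^sup>2"
    by (simp add: power2_eq_square field_simps)
  moreover have "p * (p - 1) / 8 * ((a - b)\<^sup>2 * S powr (p - 2)) = c / 4 * (a - b)\<^sup>2"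
    by (simp add: c_def)
  ultimately show ?thesis by (simp add: field_simps)
qed

text \<open>A gain \<open>w\<close> in the power \<open>p\<close> becomes a gain
  \<open>w * P powr (s - 1)\<close> after raising to \<open>s\<close>; applied with
  \<open>s = q / p\<close>.\<close>

lemma powr_sub_le:
  fixes P w s :: real
  assumes "1 \<le> s" "0 \<le> w" "w \<le> P"
  shows "(P - w) powr s + w * P powr (s - 1) \<le> P powr s"
proof (cases "P = w")
  case True
  then show ?thesis using assms by (cases "w = 0") (auto simp: powr_diff)
next
  case False
  then have P: "0 < P - w" "0 < P" using assms by auto
  have "(P - w) powr s = (P - w) * (P - w) powr (s - 1)" using P by (simp add: powr_diff)
  also have "\<dots> \<le> (P - w) * P powr (s - 1)" using P assms by (intro mult_left_mono powr_mono2) auto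
  also have "\<dots> = P powr s - w * P powr (s - 1)" using P by (simp add: powr_diff left_diff_distrib diff_divide_distrib)
  finally show ?thesis by simp
qed

text \<open>The scalar inequality is integrated, Hoelder's inequality bounds the resulting gain
  \<open>E\<close> from below by \<open>D\<^sup>2 * W powr (p - 2)\<close>, and raising to
  \<open>q / p\<close> passes to \<open>q\<close>-th powers. In \<open>\<kappa>\<close> the factor
  \<open>p * (p - 1) / 8\<close> is the scalar constant, and \<open>2 powr (p - q)\<close> stems
  from \<open>(W / 2) powr p \<le> P\<close>.\<close>

theorem lpn_uniformly_convex:
  fixes u v :: "'a \<Rightarrow> real"
  assumes p: "1 < p" "p \<le> 2" and q: "2 \<le> q" and u: "Lp_fun M p u" and v: "Lp_fun M p v"
  defines "\<kappa> \<equiv> p * (p - 1) / 8 * 2 powr (p - q)"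
  shows "lpn M p (\<lambda>x. (u x + v x) / 2) powr q + \<kappa> * lpn M p (\<lambda>x. u x - v x) powr q
    \<le> (lpn M p u powr q + lpn M p v powr q) / 2"
proof -
  define X where "X = lpn M p u"
  define Y where "Y = lpn M p v"
  define D where "D = lpn M p (\<lambda>x. u x - v x)"
  define m where "m = lpn M p (\<lambda>x. (u x + v x) / 2)"
  define W where "W = X + Y"
  define \<kappa>0 where "\<kappa>0 = p * (p - 1) / 8"
  have \<kappa>0: "0 < \<kappa>0" using p by (simp add: \<kappa>0_def)
  have nn: "0 \<le> X" "0 \<le> Y" "0 \<le> D" "0 \<le> m" by (auto simp: X_def Y_def D_def m_def)
  have p1: "1 \<le> p" "0 < p" "0 \<le> p" using p by auto
  have meas: "u \<in> borel_measurable M" "v \<in> borel_measurable M" using u v by (auto simp: Lp_fun_def)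
  have iu: "integrable M (\<lambda>x. \<bar>u x\<bar> powr p)" and iv: "integrable M (\<lambda>x. \<bar>v x\<bar> powr p)"
    using u v by (auto simp: Lp_fun_def)
  have DW: "D \<le> W" unfolding D_def W_def X_def Y_def by (rule lpn_diff_le[OF p1(1) u v])
  let ?S = "\<lambda>x. \<bar>u x\<bar> + \<bar>v x\<bar>"
  let ?E = "\<lambda>x. (u x - v x)\<^sup>2 * ?S x powr (p - 2)"
  have pt: "\<kappa>0 * ?E x + \<bar>(u x + v x) / 2\<bar> powr p \<le> (\<bar>u x\<bar> powr p + \<bar>v x\<bar> powr p) / 2" for x
    unfolding \<kappa>0_def by (rule uniform_convexity_powr_real[OF p])
  have iE: "integrable M ?E"
  proof (rule Bochner_Integration.integrable_bound)
    show "integrable M (\<lambda>x. 1 / \<kappa>0 * ((\<bar>u x\<bar> powr p + \<bar>v x\<bar> powr p) / 2))" using iu iv by auto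
    have "?E x \<le> 1 / \<kappa>0 * ((\<bar>u x\<bar> powr p + \<bar>v x\<bar> powr p) / 2)" for x
    proof -
      have "\<kappa>0 * ?E x \<le> (\<bar>u x\<bar> powr p + \<bar>v x\<bar> powr p) / 2"
        using pt[of x] powr_ge_zero[of "\<bar>(u x + v x) / 2\<bar>" p] by linarith
      then show ?thesis using \<kappa>0 by (simp add: field_simps)
    qed
    then show "AE x in M. norm (?E x) \<le> norm (1 / \<kappa>0 * ((\<bar>u x\<bar> powr p + \<bar>v x\<bar> powr p) / 2))"
      using \<kappa>0 by (intro AE_I2) simp
  qed (use meas in measurable)
  define E where "E = (\<integral>x. ?E x \<partial>M)"
  have E0: "0 \<le> E" unfolding E_def by (intro integral_nonneg_AE) auto
  have mfun: "Lp_fun M p (\<lambda>x. (u x + v x) / 2)"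
    using Lp_fun_cmult[OF Lp_fun_add[OF p1(3) u v], of "1/2"] by simp
  have dfun: "Lp_fun M p (\<lambda>x. u x - v x)" by (rule Lp_fun_diff[OF p1(3) u v])
  have "Lp_fun M p (\<lambda>x. \<bar>u x\<bar>)" "Lp_fun M p (\<lambda>x. \<bar>v x\<bar>)"
    using u v by (simp_all add: Lp_fun_def borel_measurable_abs)
  then have Sfun: "Lp_fun M p ?S" by (rule Lp_fun_add[OF p1(3)])
  have "(\<integral>x. \<kappa>0 * ?E x + \<bar>(u x + v x) / 2\<bar> powr p \<partial>M) \<le> (\<integral>x. (\<bar>u x\<bar> powr p + \<bar>v x\<bar> powr p) / 2 \<partial>M)"
    using iE mfun iu iv by (intro integral_mono pt) (auto simp: Lp_fun_def)
  also have "(\<integral>x. \<kappa>0 * ?E x + \<bar>(u x + v x) / 2\<bar> powr p \<partial>M) = \<kappa>0 * E + m powr p"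
  proof -
    have "integrable M (\<lambda>x. \<bar>(u x + v x) / 2\<bar> powr p)" using mfun unfolding Lp_fun_def by blast
    then show ?thesis using iE by (subst Bochner_Integration.integral_add) (auto simp: E_def m_def lpn_powr p1)
  qed
  also have "(\<integral>x. (\<bar>u x\<bar> powr p + \<bar>v x\<bar> powr p) / 2 \<partial>M) = (X powr p + Y powr p) / 2"
    using iu iv by (simp add: X_def Y_def lpn_powr p1)
  finally have main: "\<kappa>0 * E + m powr p \<le> (X powr p + Y powr p) / 2" .
  define P where "P = (X powr p + Y powr p) / 2"
  \<comment> \<open>The integrand \<open>\<bar>u x - v x\<bar> powr p\<close> is the product of the
    integrand of \<open>E\<close> to the power \<open>p / 2\<close> and of
    \<open>?S x powr p\<close> to the power \<open>1 - p / 2\<close>.\<close>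
  have holder: "D powr p \<le> E powr (p / 2) * (W powr p) powr (1 - p / 2)"
  proof -
    have T: "(\<integral>x. ?S x powr p \<partial>M) \<le> W powr p"
    proof -
      have "lpn M p ?S \<le> lpn M p (\<lambda>x. \<bar>u x\<bar>) + lpn M p (\<lambda>x. \<bar>v x\<bar>)"
        using u v by (intro lpn_add p1) (auto simp: Lp_fun_def)
      also have "\<dots> = W" by (simp add: W_def X_def Y_def lpn_def)
      finally have "lpn M p ?S powr p \<le> W powr p" using p1 by (intro powr_mono2) auto
      moreover have "lpn M p ?S powr p = (\<integral>x. ?S x powr p \<partial>M)" using p1 by (simp add: lpn_powr)
      ultimately show ?thesis by simp
    qed
    have "D powr p = (\<integral>x. \<bar>u x - v x\<bar> powr p \<partial>M)" by (simp add: D_def lpn_powr p1)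
    also have "\<dots> = (\<integral>x. ?E x powr (p / 2) * (?S x powr p) powr (1 - p / 2) \<partial>M)"
    proof (rule Bochner_Integration.integral_cong[OF refl])
      fix x
      show "\<bar>u x - v x\<bar> powr p = ?E x powr (p / 2) * (?S x powr p) powr (1 - p / 2)"
      proof (cases "?S x = 0")
        case False
        then have S: "0 < ?S x" by linarith
        have "((u x - v x)\<^sup>2) powr (p / 2) = \<bar>u x - v x\<bar> powr p"
        proof -
          have "(u x - v x)\<^sup>2 = \<bar>u x - v x\<bar> powr 2" by simp
          then show ?thesis by (simp only: powr_powr) simp
        qed
        then have 1: "?E x powr (p / 2) = \<bar>u x - v x\<bar> powr p * ?S x powr ((p - 2) * (p / 2))"
          by (simp add: powr_mult powr_powr)
        have "(p - 2) * (p / 2) + p * (1 - p / 2) = 0" by (simp add: field_simps)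
        then have 2: "?S x powr ((p - 2) * (p / 2)) * (?S x powr p) powr (1 - p / 2) = 1"
          using S by (simp only: powr_powr powr_add[symmetric]) simp
        show ?thesis unfolding 1 mult.assoc 2 by simp
      next
        case True
        then have "u x = 0" "v x = 0" by linarith+
        then show ?thesis by simp
      qed
    qed
    also have "\<dots> \<le> E powr (p / 2) * (\<integral>x. ?S x powr p \<partial>M) powr (1 - p / 2)"
      unfolding E_def using p iE Sfun by (intro Holder_powr) (auto simp: Lp_fun_def)
    also have "\<dots> \<le> E powr (p / 2) * (W powr p) powr (1 - p / 2)"
      using T p by (intro mult_left_mono powr_mono2) auto
    finally show ?thesis .
  qed
  show ?thesis
  proof (cases "W = 0")
    case True
    then have z: "X = 0" "Y = 0" "D = 0" using nn DW by (auto simp: W_def)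
    have "0 \<le> \<kappa>0 * E" using \<kappa>0 E0 by simp
    moreover have "\<kappa>0 * E + m powr p \<le> 0" using main unfolding z by simp
    ultimately have "m powr p \<le> 0" by linarith
    then have "m = 0" by simp
    then show ?thesis using z by (simp add: X_def Y_def D_def m_def)
  next
    case False
    then have W: "0 < W" using nn by (simp add: W_def)
    have E: "D\<^sup>2 * W powr (p - 2) \<le> E"
    proof -
      have "(D powr p) powr (2 / p) \<le> (E powr (p / 2) * (W powr p) powr (1 - p / 2)) powr (2 / p)"
        using holder p1 by (intro powr_mono2) auto
      moreover have "(D powr p) powr (2 / p) = D\<^sup>2" using p1 nn by (simp add: powr_powr)
      moreover have "(E powr (p / 2) * (W powr p) powr (1 - p / 2)) powr (2 / p) = E * W powr (2 - p)"
      proof -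
        have e: "p / 2 * (2 / p) = 1" "p * (1 - p / 2) * (2 / p) = 2 - p" using p1 by (simp_all add: field_simps)
        show ?thesis unfolding powr_mult powr_powr e using E0 by simp
      qed
      ultimately have "D\<^sup>2 \<le> E * W powr (2 - p)" by simp
      then have "D\<^sup>2 * W powr (p - 2) \<le> E * W powr (2 - p) * W powr (p - 2)" by (intro mult_right_mono) auto
      also have "\<dots> = E" using W by (simp add: mult.assoc powr_add[symmetric])
      finally show ?thesis .
    qed
    define w where "w = \<kappa>0 * (D\<^sup>2 * W powr (p - 2))"
    have w0: "0 \<le> w" using \<kappa>0 by (simp add: w_def)
    have "w \<le> \<kappa>0 * E" unfolding w_def using E \<kappa>0 by (intro mult_left_mono) auto
    then have mw: "m powr p \<le> P - w" using main unfolding P_def by linarith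
    then have wP: "w \<le> P" using powr_ge_zero[of m p] by linarith
    define s where "s = q / p"
    have s: "1 \<le> s" using p q by (simp add: s_def)
    have "m powr q = (m powr p) powr s" using p1 by (simp add: s_def powr_powr)
    also have "\<dots> \<le> (P - w) powr s" using mw s by (intro powr_mono2) auto
    also have "\<dots> \<le> P powr s - w * P powr (s - 1)"
      using powr_sub_le[OF s w0 wP] by simp
    also have "P powr s \<le> ((X powr p) powr s + (Y powr p) powr s) / 2"
      unfolding P_def using s by (intro powr_mean_le) auto
    also have "\<dots> = (X powr q + Y powr q) / 2" using p1 by (simp add: s_def powr_powr)
    finally have 1: "m powr q + w * P powr (s - 1) \<le> (X powr q + Y powr q) / 2" by linarith
    have "\<kappa> * D powr q \<le> w * P powr (s - 1)"
    proof -
      have "(W / 2) powr p \<le> P" unfolding P_def W_def using nn p1 by (intro powr_mean_le) auto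
      then have "((W / 2) powr p) powr (s - 1) \<le> P powr (s - 1)" using s by (intro powr_mono2) auto
      moreover have "((W / 2) powr p) powr (s - 1) = W powr (q - p) * 2 powr (p - q)"
        using W p1 by (simp add: powr_powr s_def right_diff_distrib powr_divide powr_minus_divide[symmetric])
          (simp add: powr_diff)
      ultimately have "w * (W powr (q - p) * 2 powr (p - q)) \<le> w * P powr (s - 1)"
        using w0 by (intro mult_left_mono) auto
      moreover have "w * (W powr (q - p) * 2 powr (p - q)) = \<kappa> * (D\<^sup>2 * W powr (q - 2))"
      proof -
        have "W powr (p - 2) * W powr (q - p) = W powr (q - 2)" using W by (simp add: powr_add[symmetric])
        then show ?thesis by (simp add: w_def \<kappa>_def \<kappa>0_def mult_ac)
      qed
      \<comment> \<open>Here \<open>D \<le> W\<close> and \<open>q \<ge> 2\<close> trade powers of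
        \<open>W\<close> for powers of \<open>D\<close>.\<close>
      moreover have "\<kappa> * D powr q \<le> \<kappa> * (D\<^sup>2 * W powr (q - 2))"
      proof (cases "D = 0")
        case False
        then have "D powr q = D\<^sup>2 * D powr (q - 2)" using nn by (simp add: powr_diff)
        also have "\<dots> \<le> D\<^sup>2 * W powr (q - 2)" using DW nn q by (intro mult_left_mono powr_mono2) auto
        finally show ?thesis using p by (intro mult_left_mono) (auto simp: \<kappa>_def)
      qed (use p in \<open>auto simp: \<kappa>_def\<close>)
      ultimately show ?thesis by simp
    qed
    with 1 show ?thesis by (simp add: X_def Y_def D_def m_def)
  qed
qed

section \<open>Besov norms by Littlewood--Paley blocks\<close>

lemma epowr_ennreal: "0 \<le> y \<Longrightarrow> epowr (ennreal y) a = ennreal (y powr a)"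
  by (simp add: epowr_def)

lemma epowr_less_top: "epowr x a < \<top> \<longleftrightarrow> x < \<top>"
  by (simp add: epowr_def less_top)

lemma recip_ennreal: "0 < p \<Longrightarrow> recip (ennreal p) = 1 / p"
  by (simp add: recip_def inverse_ennreal inverse_eq_divide)

lemma Lp_norm_eq_lpn:
  assumes p: "0 < p" and u: "Lp_fun M p u"
  shows "Lp_norm M (ennreal p) (\<lambda>x. ennreal \<bar>u x\<bar>) = ennreal (lpn M p u)"
proof -
  have "(\<integral>\<^sup>+x. epowr (ennreal \<bar>u x\<bar>) p \<partial>M) = (\<integral>\<^sup>+x. ennreal (\<bar>u x\<bar> powr p) \<partial>M)"
    by (simp add: epowr_ennreal)
  also have "\<dots> = ennreal (\<integral>x. \<bar>u x\<bar> powr p \<partial>M)"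
    using u by (intro nn_integral_eq_integral) (auto simp: Lp_fun_def)
  finally show ?thesis
    using p by (simp add: Lp_norm_def recip_ennreal epowr_ennreal lpn_def)
qed

lemma Lp_norm_less_top:
  assumes p: "0 < p" and u: "u \<in> borel_measurable M" and fin: "Lp_norm M (ennreal p) (\<lambda>x. ennreal \<bar>u x\<bar>) < \<top>"
  shows "Lp_fun M p u"
proof -
  have "(\<integral>\<^sup>+x. epowr (ennreal \<bar>u x\<bar>) p \<partial>M) < \<top>"
    using fin p by (simp add: Lp_norm_def epowr_less_top)
  then have "(\<integral>\<^sup>+x. ennreal (norm (\<bar>u x\<bar> powr p)) \<partial>M) < \<infinity>"
    by (simp add: epowr_ennreal)
  then show ?thesis using u by (auto simp: Lp_fun_def integrable_iff_bounded)
qed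

lemma Lp_norm_less_top_iff:
  assumes "0 < p" "u \<in> borel_measurable M"
  shows "Lp_norm M (ennreal p) (\<lambda>x. ennreal \<bar>u x\<bar>) < \<top> \<longleftrightarrow> Lp_fun M p u"
  using Lp_norm_less_top[OF assms] Lp_norm_eq_lpn[of p M u] assms by auto

lemma Lp_norm_sequence_component:
  assumes q: "q = \<top> \<or> (\<exists>r>0. q = ennreal r)" and fin: "Lp_norm (count_space A) q g < \<top>" and j: "j \<in> A"
  shows "g j < \<top>"
  using q
proof
  assume "q = \<top>"
  then have "esssup (count_space A) g < \<top>" using fin by (simp add: Lp_norm_def)
  moreover have "AE j in count_space A. g j \<le> esssup (count_space A) g" by (rule esssup_AE)
  ultimately show ?thesis using j by (auto simp: AE_count_space intro: le_less_trans)
next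
  assume "\<exists>r>0. q = ennreal r"
  then obtain r where r: "q = ennreal r" "0 < r" by blast
  then have "(\<integral>\<^sup>+j. epowr (g j) r \<partial>count_space A) < \<top>"
    using fin by (simp add: Lp_norm_def epowr_less_top)
  moreover have "epowr (g j) r \<le> (\<integral>\<^sup>+j. epowr (g j) r \<partial>count_space A)"
    using j by (rule nn_integral_ge_point)
  ultimately show ?thesis by (simp add: le_less_trans epowr_less_top[symmetric, of "g j" r])
qed

lemma Lp_norm_top_le:
  assumes "\<And>j. j \<in> A \<Longrightarrow> g j \<le> B"
  shows "Lp_norm (count_space A) \<top> g \<le> B"
  unfolding Lp_norm_def using assms by (auto intro!: esssup_I simp: AE_count_space)

lemma Lp_norm_top_ge:
  assumes "j \<in> A"
  shows "g j \<le> Lp_norm (count_space A) \<top> g"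
proof -
  have "AE j in count_space A. g j \<le> esssup (count_space A) g" by (rule esssup_AE)
  then show ?thesis using assms by (simp add: Lp_norm_def AE_count_space)
qed

section \<open>Sequence norms over the levels, and the Littlewood-Paley symbols\<close>

abbreviation lq_fun :: "real \<Rightarrow> (nat \<Rightarrow> real) \<Rightarrow> bool" where
  "lq_fun \<equiv> Lp_fun (count_space UNIV)"

abbreviation lqn :: "real \<Rightarrow> (nat \<Rightarrow> real) \<Rightarrow> real" where
  "lqn \<equiv> lpn (count_space UNIV)"

lemma lq_fun_iff: "lq_fun q a \<longleftrightarrow> summable (\<lambda>j. \<bar>a j\<bar> powr q)"
  by (simp add: Lp_fun_def integrable_count_space_nat_iff)

lemma lqn_powr: "0 < q \<Longrightarrow> lq_fun q a \<Longrightarrow> lqn q a powr q = (\<Sum>j. \<bar>a j\<bar> powr q)"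
  by (simp add: lpn_powr integral_count_space_nat Lp_fun_def)

lemma component_le_lqn:
  assumes "0 < q" "lq_fun q a"
  shows "\<bar>a j\<bar> \<le> lqn q a"
proof -
  have "\<bar>a j\<bar> powr q \<le> (\<Sum>j. \<bar>a j\<bar> powr q)"
    using sum_le_suminf[of "\<lambda>j. \<bar>a j\<bar> powr q" "{j}"] assms(2) by (simp add: lq_fun_iff)
  also have "\<dots> = lqn q a powr q" using lqn_powr[OF assms] by simp
  finally have "\<bar>a j\<bar> powr q \<le> lqn q a powr q" .
  then have le: "(\<bar>a j\<bar> powr q) powr (1 / q) \<le> (lqn q a powr q) powr (1 / q)"
    using assms(1) by (intro powr_mono2[of "1 / q"]) simp_all
  have "(x powr q) powr (1 / q) = x" if "0 \<le> x" for x
    using that assms(1) by (simp add: powr_powr)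
  then show ?thesis using le by (metis abs_ge_zero lpn_nonneg)
qed

lemma finite_int_vec_box: "finite {k :: int ^ 'd::finite. \<forall>i. \<bar>k $ i\<bar> \<le> B}"
proof -
  have "{k :: int ^ 'd. \<forall>i. \<bar>k $ i\<bar> \<le> B} \<subseteq> vec_lambda ` PiE UNIV (\<lambda>_. {-B..B})"
  proof
    fix k :: "int ^ 'd" assume "k \<in> {k. \<forall>i. \<bar>k $ i\<bar> \<le> B}"
    then have "(\<lambda>i. k $ i) \<in> PiE UNIV (\<lambda>_. {-B..B})" by (auto simp: abs_le_iff) (metis minus_le_iff)
    then show "k \<in> vec_lambda ` PiE UNIV (\<lambda>_. {-B..B})" by (metis image_eqI vec_nth_inverse)
  qed
  then show ?thesis by (rule finite_subset) (intro finite_imageI finite_PiE; simp)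
qed

lemma finite_int_vec_norm_le: "finite {k :: int ^ 'd::finite. norm (int_vec k) \<le> R}"
proof (rule finite_subset[OF _ finite_int_vec_box])
  show "{k :: int ^ 'd. norm (int_vec k) \<le> R} \<subseteq> {k. \<forall>i. \<bar>k $ i\<bar> \<le> \<lceil>R\<rceil>}"
  proof
    fix k :: "int ^ 'd" assume k: "k \<in> {k. norm (int_vec k) \<le> R}"
    have "\<bar>k $ i\<bar> \<le> \<lceil>R\<rceil>" for i
    proof -
      have "real_of_int \<bar>k $ i\<bar> \<le> R" using component_le_norm_cart[of "int_vec k" i] k by simp
      then show ?thesis by (metis ceiling_mono ceiling_of_int)
    qed
    then show "k \<in> {k. \<forall>i. \<bar>k $ i\<bar> \<le> \<lceil>R\<rceil>}" by simp
  qed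
qed

lemma lp_symbol_support:
  assumes "lp_cutoff \<psi>" "lp_symbol \<psi> j \<xi> \<noteq> 0"
  shows "norm \<xi> \<le> 2 * 2 ^ j"
proof (rule ccontr)
  assume "\<not> norm \<xi> \<le> 2 * 2 ^ j"
  then have n: "norm \<xi> > 2 * 2 ^ j" by simp
  have *: "\<psi> (\<xi> /\<^sub>R 2 ^ i) = 0" if "i \<le> j" for i
  proof -
    have "(2::real) * 2 ^ i \<le> 2 * 2 ^ j" using that by (simp add: power_increasing)
    then have "2 * 2 ^ i \<le> norm \<xi>" using n by linarith
    then have "2 \<le> norm (\<xi> /\<^sub>R 2 ^ i)" by (simp add: field_simps)
    then show ?thesis using assms(1) by (simp add: lp_cutoff_def)
  qed
  show False using assms(2) *[of j] *[of "j - 1"] by (auto simp: lp_symbol_def split: if_splits)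
qed

lemma finite_lp_symbol_support:
  assumes "lp_cutoff \<psi>"
  shows "finite {k :: int ^ 'd::finite. lp_symbol \<psi> j (int_vec k) \<noteq> 0}"
  using lp_symbol_support[OF assms] by (auto intro: finite_subset[OF _ finite_int_vec_norm_le[of "2 * 2 ^ j"]])

lemma lp_symbol_bounded:
  fixes \<psi> :: "real ^ 'd::finite \<Rightarrow> real"
  assumes "lp_cutoff \<psi>"
  obtains C where "0 \<le> C" "\<And>j \<xi>. \<bar>lp_symbol \<psi> j \<xi>\<bar> \<le> C"
proof -
  have "C_k 0 \<psi>" using assms by (simp add: lp_cutoff_def smooth_def)
  then have "continuous_on UNIV (Dpart [] \<psi>)" unfolding C_k_def by blast
  then have "continuous_on (cball 0 2) \<psi>" by (auto intro: continuous_on_subset)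
  then have "compact (\<psi> ` cball 0 2)" by (rule compact_continuous_image) simp
  then have "\<exists>B. \<forall>\<xi>\<in>cball 0 2. \<bar>\<psi> \<xi>\<bar> \<le> B" by (auto dest!: compact_imp_bounded simp: bounded_iff)
  then obtain B where B: "\<And>\<xi>. \<xi> \<in> cball 0 2 \<Longrightarrow> \<bar>\<psi> \<xi>\<bar> \<le> B" by blast
  have B0: "0 \<le> B" using B[of 0] by simp
  have le: "\<bar>\<psi> \<xi>\<bar> \<le> B" for \<xi>
  proof (cases "norm \<xi> \<le> 2")
    case False
    then have "\<psi> \<xi> = 0" using assms by (simp add: lp_cutoff_def)
    then show ?thesis using B0 by simp
  qed (use B in simp)
  have "\<bar>lp_symbol \<psi> j \<xi>\<bar> \<le> 2 * B" for j \<xi>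
    using le[of \<xi>] le[of "\<xi> /\<^sub>R 2 ^ j"] le[of "\<xi> /\<^sub>R 2 ^ (j - 1)"] B0
    unfolding lp_symbol_def by (cases "j = 0"; simp; linarith)
  then show ?thesis using that B0 by (meson mult_nonneg_nonneg zero_le_numeral)
qed

lemma sum_lp_symbol: "(\<Sum>j\<le>J. lp_symbol \<psi> j \<xi>) = \<psi> (\<xi> /\<^sub>R 2 ^ J)"
  by (induction J) (simp_all add: lp_symbol_def)

lemma continuous_lp_block: "continuous_on UNIV (\<lambda>x. norm (lp_block \<psi> j f x))"
  unfolding lp_block_def by (intro continuous_intros)

section \<open>Norms of Littlewood-Paley blocks and their relation to Fourier coefficients\<close>

lemma fourier_add: "fourier (f + g) k = fourier f k + fourier g k"
  and fourier_scaleR: "fourier (a *\<^sub>R f) k = a *\<^sub>R fourier f k"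
  and fourier_diff: "fourier (f - g) k = fourier f k - fourier g k"
  by (simp_all add: fourier_def plus_distribution.rep_eq scaleR_distribution.rep_eq minus_distribution.rep_eq complex_eq_iff)

lemma lp_block_add: "lp_block \<psi> j (f + g) x = lp_block \<psi> j f x + lp_block \<psi> j g x"
  by (simp add: lp_block_def fourier_add distrib_left distrib_right sum.distrib)

lemma lp_block_scaleR: "lp_block \<psi> j (a *\<^sub>R f) x = a *\<^sub>R lp_block \<psi> j f x"
  by (simp add: lp_block_def fourier_scaleR scaleR_conv_of_real sum_distrib_left mult_ac)

lemma lp_block_diff: "lp_block \<psi> j (f - g) x = lp_block \<psi> j f x - lp_block \<psi> j g x"
  using lp_block_add[of \<psi> j "f - g" g x] by (simp add: algebra_simps)

text \<open>A block is a trigonometric polynomial, so its norm is finite for every distribution and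
  may be taken as a real number.\<close>

definition blk :: "(real ^ 'd::finite \<Rightarrow> real) \<Rightarrow> real \<Rightarrow> nat \<Rightarrow> 'd distribution \<Rightarrow> real" where
  "blk \<psi> p j f = lpn torus p (\<lambda>x. norm (lp_block \<psi> j f x))"

lemma Lp_fun_torus:
  fixes u :: "real ^ 'd::finite \<Rightarrow> real"
  assumes "0 < p" "continuous_on UNIV u"
  shows "Lp_fun torus p u"
proof -
  have "continuous_on UNIV (\<lambda>x. \<bar>u x\<bar> powr p)"
    by (rule continuous_on_powr') (use assms in \<open>auto intro!: continuous_intros\<close>)
  then show ?thesis
    unfolding Lp_fun_def using assms by (simp add: borel_measurable_torus integrable_torus)
qed

lemma Lp_fun_block: "0 < p \<Longrightarrow> Lp_fun torus p (\<lambda>x. norm (lp_block \<psi> j f x))"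
  by (intro Lp_fun_torus continuous_lp_block)

lemma blk_nonneg [simp]: "0 \<le> blk \<psi> p j f"
  by (simp add: blk_def)

lemma Lp_norm_block:
  assumes "0 < p"
  shows "Lp_norm torus (ennreal p) (\<lambda>x. ennreal (norm (lp_block \<psi> j f x))) = ennreal (blk \<psi> p j f)"
  using Lp_norm_eq_lpn[OF assms Lp_fun_block[OF assms, of \<psi> j f]] by (simp add: blk_def)

lemma blk_le_add:
  assumes p: "1 \<le> p" and n: "\<And>x. norm (lp_block \<psi> j h x) \<le> norm (lp_block \<psi> j f x) + norm (lp_block \<psi> j g x)"
  shows "blk \<psi> p j h \<le> blk \<psi> p j f + blk \<psi> p j g"
proof -
  have "blk \<psi> p j h \<le> lpn torus p (\<lambda>x. norm (lp_block \<psi> j f x) + norm (lp_block \<psi> j g x))"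
    unfolding blk_def using p n
    by (intro lpn_mono Lp_fun_block Lp_fun_add) auto
  also have "\<dots> \<le> blk \<psi> p j f + blk \<psi> p j g"
    unfolding blk_def using p by (intro lpn_add Lp_fun_block) auto
  finally show ?thesis .
qed

lemma blk_add: "1 \<le> p \<Longrightarrow> blk \<psi> p j (f + g) \<le> blk \<psi> p j f + blk \<psi> p j g"
  by (rule blk_le_add) (simp_all add: lp_block_add norm_triangle_ineq)

lemma blk_abs_diff:
  assumes "1 \<le> p"
  shows "\<bar>blk \<psi> p j f - blk \<psi> p j g\<bar> \<le> blk \<psi> p j (f - g)"
proof -
  have "blk \<psi> p j f \<le> blk \<psi> p j (f - g) + blk \<psi> p j g"
    using blk_add[OF assms, of \<psi> j "f - g" g] by simp
  moreover have "blk \<psi> p j g \<le> blk \<psi> p j (f - g) + blk \<psi> p j f"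
  proof (rule blk_le_add[OF assms])
    have "norm b \<le> norm (a - b) + norm a" for a b :: complex
      using norm_triangle_ineq4[of a "a - b"] by simp
    then show "norm (lp_block \<psi> j g x) \<le> norm (lp_block \<psi> j (f - g) x) + norm (lp_block \<psi> j f x)" for x
      by (simp add: lp_block_diff)
  qed
  ultimately show ?thesis by simp
qed

lemma blk_scaleR: "0 < p \<Longrightarrow> blk \<psi> p j (a *\<^sub>R f) = \<bar>a\<bar> * blk \<psi> p j f"
  using lpn_cmult[of p torus a "\<lambda>x. norm (lp_block \<psi> j f x)"]
  by (simp add: blk_def lp_block_scaleR lpn_def abs_mult)

lemma lpn_const_le:
  assumes "0 < p" "continuous_on UNIV u" "\<And>x. \<bar>u x\<bar> \<le> B"
  shows "lpn (torus :: (real ^ 'd::finite) measure) p u \<le> B"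
proof (rule lpn_le)
  show B: "0 \<le> B" using assms(3)[of 0] by simp
  have "(\<integral>x. \<bar>u x\<bar> powr p \<partial>torus) \<le> (\<integral>x. B powr p \<partial>(torus :: (real ^ 'd) measure))"
    using Lp_fun_torus[OF assms(1,2)] assms by (intro integral_mono) (auto simp: Lp_fun_def powr_mono2)
  then show "(\<integral>x. \<bar>u x\<bar> powr p \<partial>torus) \<le> B powr p" by (simp add: torus.prob_space)
qed (fact assms)

lemma blk_le_fourier:
  assumes c: "lp_cutoff \<psi>" and p: "0 < p"
  shows "blk \<psi> p j f \<le> (\<Sum>k | lp_symbol \<psi> j (int_vec k) \<noteq> 0. \<bar>lp_symbol \<psi> j (int_vec k)\<bar> * norm (fourier f k))"
  unfolding blk_def
proof (rule lpn_const_le[OF p continuous_lp_block])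
  fix x
  have "norm (lp_block \<psi> j f x) \<le> (\<Sum>k | lp_symbol \<psi> j (int_vec k) \<noteq> 0.
      norm (of_real (lp_symbol \<psi> j (int_vec k)) * fourier f k * cis (2 * pi * (int_vec k \<bullet> x))))"
    unfolding lp_block_def by (rule norm_sum)
  then show "\<bar>norm (lp_block \<psi> j f x)\<bar> \<le> (\<Sum>k | lp_symbol \<psi> j (int_vec k) \<noteq> 0. \<bar>lp_symbol \<psi> j (int_vec k)\<bar> * norm (fourier f k))"
    by (simp add: norm_mult)
qed

lemma integral_torus_le_lpn:
  fixes u :: "real ^ 'd::finite \<Rightarrow> real"
  assumes p: "1 \<le> p" and u: "continuous_on UNIV u"
  shows "(\<integral>x. \<bar>u x\<bar> \<partial>torus) \<le> lpn torus p u"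
proof -
  have "(\<integral>x. (\<bar>u x\<bar> powr p) powr (1 / p) * 1 powr (1 - 1 / p) \<partial>(torus :: (real ^ 'd) measure))
    \<le> (\<integral>x. \<bar>u x\<bar> powr p \<partial>torus) powr (1 / p) * (\<integral>x. 1 \<partial>(torus :: (real ^ 'd) measure)) powr (1 - 1 / p)"
    using p Lp_fun_torus[of p u] u by (intro Holder_powr) (auto simp: Lp_fun_def)
  then show ?thesis using p by (simp add: powr_powr lpn_def torus.prob_space)
qed

lemma blk_mono_p: "1 \<le> p \<Longrightarrow> blk \<psi> 1 j f \<le> blk \<psi> p j f"
  using integral_torus_le_lpn[OF _ continuous_lp_block, of p \<psi> j f] by (simp add: blk_def lpn_def)

text \<open>Integration of the block against the exponential of frequency \<open>- l\<close>
  isolates one coefficient, and on a probability space the norm with exponent 1 is at most the one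
  with exponent \<open>p\<close>.\<close>

lemma fourier_le_blk:
  fixes f :: "'d::finite distribution"
  assumes c: "lp_cutoff \<psi>" and p: "1 \<le> p"
  shows "\<bar>lp_symbol \<psi> j (int_vec l)\<bar> * norm (fourier f l) \<le> blk \<psi> p j f"
proof (cases "lp_symbol \<psi> j (int_vec l) * norm (fourier f l) = 0")
  case False
  let ?S = "{k. lp_symbol \<psi> j (int_vec k) \<noteq> 0}"
  define a where "a k = of_real (lp_symbol \<psi> j (int_vec k)) * fourier f k" for k
  have l: "l \<in> ?S" "a l \<noteq> 0" using False by (auto simp: a_def)
  \<comment> \<open>The phase that rotates the coefficient \<open>a l\<close> to its
    modulus.\<close>
  define z where "z = cnj (a l) / norm (a l)"
  have z: "norm z = 1" "z * a l = norm (a l)"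
    using l by (simp_all add: z_def norm_divide complex_norm_square[symmetric] mult.commute power2_eq_square)
  have eq: "Re (z * lp_block \<psi> j f x * cis (- (2 * pi * (int_vec l \<bullet> x)))) = (\<Sum>k\<in>?S. trig (k - l) (z * a k) x)" for x
  proof -
    have "cis (2 * pi * (int_vec (k - l) \<bullet> x)) = cis (2 * pi * (int_vec k \<bullet> x)) * cis (- (2 * pi * (int_vec l \<bullet> x)))" for k
      by (simp add: cis_mult int_vec_minus inner_diff_left algebra_simps)
    then have "z * lp_block \<psi> j f x * cis (- (2 * pi * (int_vec l \<bullet> x))) = (\<Sum>k\<in>?S. z * a k * cis (2 * pi * (int_vec (k - l) \<bullet> x)))"
      unfolding lp_block_def a_def sum_distrib_left sum_distrib_right
      by (intro sum.cong refl) (simp only: mult_ac)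
    then show ?thesis unfolding trig_def by (simp only: Re_sum)
  qed
  have "norm (a l) = (\<Sum>k\<in>?S. if k = l then norm (a l) else 0)"
    using l finite_lp_symbol_support[OF c] by simp
  also have "\<dots> = (\<Sum>k\<in>?S. \<integral>x. trig (k - l) (z * a k) x \<partial>torus)"
    by (intro sum.cong refl) (auto simp: integral_trig z)
  also have "\<dots> = (\<integral>x. Re (z * lp_block \<psi> j f x * cis (- (2 * pi * (int_vec l \<bullet> x)))) \<partial>torus)"
    unfolding eq by (simp add: integrable_trig)
  also have "\<dots> \<le> (\<integral>x. \<bar>norm (lp_block \<psi> j f x)\<bar> \<partial>torus)"
  proof (rule integral_mono)
    show "integrable torus (\<lambda>x. Re (z * lp_block \<psi> j f x * cis (- (2 * pi * (int_vec l \<bullet> x)))))"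
      unfolding eq by (intro Bochner_Integration.integrable_sum integrable_trig)
    show "integrable torus (\<lambda>x. \<bar>norm (lp_block \<psi> j f x)\<bar>)"
      by (intro integrable_torus continuous_intros continuous_lp_block)
    show "Re (z * lp_block \<psi> j f x * cis (- (2 * pi * (int_vec l \<bullet> x)))) \<le> \<bar>norm (lp_block \<psi> j f x)\<bar>" for x
      using complex_Re_le_cmod[of "z * lp_block \<psi> j f x * cis (- (2 * pi * (int_vec l \<bullet> x)))"] z
      by (simp add: norm_mult)
  qed
  also have "\<dots> \<le> blk \<psi> p j f"
    unfolding blk_def by (rule integral_torus_le_lpn[OF p continuous_lp_block])
  finally show ?thesis by (simp add: a_def norm_mult)
qed auto

lemma dyadic_wt:
  obtains J where "norm (int_vec k) \<le> 2 ^ J" "2 ^ J \<le> 2 * wt k"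
proof -
  define J where "J = nat \<lceil>log 2 (wt k)\<rceil>"
  have l: "0 \<le> log 2 (wt k)" using wt_ge_1[of k] by simp
  then have J: "log 2 (wt k) \<le> real J" "real J \<le> log 2 (wt k) + 1"
    unfolding J_def by linarith+
  have "wt k = 2 powr log 2 (wt k)" using wt_pos[of k] by simp
  also have "\<dots> \<le> 2 powr real J" using J(1) by simp
  finally have 1: "wt k \<le> 2 ^ J" by (simp add: powr_realpow)
  have "2 powr real J \<le> 2 powr (log 2 (wt k) + 1)" using J(2) by simp
  also have "\<dots> = 2 * wt k" using wt_pos[of k] by (simp add: powr_add)
  finally have 2: "2 ^ J \<le> 2 * wt k" by (simp add: powr_realpow)
  show ?thesis using that[OF _ 2] 1 by (simp add: wt_def)
qed

text \<open>The symbols up to level \<open>J\<close>, with \<open>2 ^ J\<close> comparable to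
  \<open>wt k\<close>, sum to 1 at \<open>k\<close>, so the coefficient is covered by
  \<open>J + 1\<close> blocks. Their number is at most \<open>2 ^ J\<close>, whence the exponent
  \<open>m + 1\<close>.\<close>

lemma fourier_le_wt:
  fixes f :: "'d::finite distribution"
  assumes c: "lp_cutoff \<psi>" and p: "1 \<le> p" and B: "0 \<le> B" and b: "\<And>j. blk \<psi> p j f \<le> (2 ^ j) ^ m * B"
  shows "norm (fourier f k) \<le> (2 * wt k) ^ (m + 1) * B"
proof -
  obtain J where J: "norm (int_vec k) \<le> 2 ^ J" "2 ^ J \<le> 2 * wt k" by (rule dyadic_wt)
  have "norm (int_vec k /\<^sub>R 2 ^ J) \<le> 1" using J(1) by (simp add: field_simps)
  then have "(\<Sum>j\<le>J. lp_symbol \<psi> j (int_vec k)) = 1"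
    using c by (simp add: sum_lp_symbol lp_cutoff_def)
  then have "norm (fourier f k) = \<bar>\<Sum>j\<le>J. lp_symbol \<psi> j (int_vec k)\<bar> * norm (fourier f k)" by simp
  also have "\<dots> \<le> (\<Sum>j\<le>J. \<bar>lp_symbol \<psi> j (int_vec k)\<bar>) * norm (fourier f k)"
    by (intro mult_right_mono sum_abs) auto
  also have "\<dots> \<le> (\<Sum>j\<le>J. (2 ^ J) ^ m * B)"
    unfolding sum_distrib_right
  proof (rule sum_mono)
    fix j assume "j \<in> {..J}"
    then have "((2::real) ^ j) ^ m \<le> (2 ^ J) ^ m" by (intro power_mono power_increasing) auto
    then have "(2 ^ j) ^ m * B \<le> (2 ^ J) ^ m * B" using B by (rule mult_right_mono)
    then show "\<bar>lp_symbol \<psi> j (int_vec k)\<bar> * norm (fourier f k) \<le> (2 ^ J) ^ m * B"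
      using fourier_le_blk[OF c p, of j k f] b[of j] by linarith
  qed
  also have "\<dots> = (real J + 1) * ((2 ^ J) ^ m * B)" by simp
  also have "\<dots> \<le> 2 ^ J * ((2 ^ J) ^ m * B)"
  proof (intro mult_right_mono)
    have "real (Suc J) \<le> real (2 ^ J)" using less_exp[of J] by (intro of_nat_mono) (simp add: Suc_le_eq)
    then show "real J + 1 \<le> 2 ^ J" by simp
  qed (use B in auto)
  also have "\<dots> = (2 ^ J) ^ (m + 1) * B" by simp
  also have "\<dots> \<le> (2 * wt k) ^ (m + 1) * B"
    using J B by (intro mult_right_mono power_mono) auto
  finally show ?thesis .
qed

section \<open>Besov membership and norms through sequences over the levels\<close>

definition bseq :: "(real ^ 'd::finite \<Rightarrow> real) \<Rightarrow> real \<Rightarrow> real \<Rightarrow> 'd distribution \<Rightarrow> nat \<Rightarrow> real" where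
  "bseq \<psi> s p f j = 2 powr (real j * s) * blk \<psi> p j f"

lemma bseq_nonneg [simp]: "0 \<le> bseq \<psi> s p f j"
  by (simp add: bseq_def)

lemma bseq_zero: "bseq \<psi> 0 p f j = blk \<psi> p j f"
  by (simp add: bseq_def)

lemma besov_norm_bseq:
  assumes "0 < p"
  shows "besov_norm \<psi> s (ennreal p) q f = Lp_norm (count_space UNIV) q (\<lambda>j. ennreal \<bar>bseq \<psi> s p f j\<bar>)"
  unfolding besov_norm_def Lp_norm_block[OF assms] bseq_def by (simp add: ennreal_mult abs_mult)

lemma besov_iff:
  assumes "0 < p" "0 < q"
  shows "f \<in> besov \<psi> s (ennreal p) (ennreal q) \<longleftrightarrow> lq_fun q (bseq \<psi> s p f)"
  unfolding besov_def mem_Collect_eq besov_norm_bseq[OF assms(1)]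
  by (rule Lp_norm_less_top_iff[OF assms(2)]) simp

lemma besov_norm_eq:
  assumes "0 < p" "0 < q" "f \<in> besov \<psi> s (ennreal p) (ennreal q)"
  shows "besov_norm \<psi> s (ennreal p) (ennreal q) f = ennreal (lqn q (bseq \<psi> s p f))"
  unfolding besov_norm_bseq[OF assms(1)]
  by (rule Lp_norm_eq_lpn[OF assms(2)]) (use assms in \<open>simp add: besov_iff\<close>)

lemma bseq_le_besov_top:
  assumes "0 < p" "f \<in> besov \<psi> s (ennreal p) \<top>"
  shows "bseq \<psi> s p f j \<le> enn2real (besov_norm \<psi> s (ennreal p) \<top> f)"
proof -
  have "ennreal (bseq \<psi> s p f j) \<le> besov_norm \<psi> s (ennreal p) \<top> f"
    using Lp_norm_top_ge[of j UNIV "\<lambda>j. ennreal \<bar>bseq \<psi> s p f j\<bar>"] assms(1)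
    by (simp add: besov_norm_bseq)
  moreover have "besov_norm \<psi> s (ennreal p) \<top> f < \<top>" using assms(2) by (simp add: besov_def)
  ultimately show ?thesis by (metis bseq_nonneg enn2real_ennreal enn2real_mono)
qed

lemma besov_top_bound:
  assumes "0 < p" "\<And>j. bseq \<psi> s p f j \<le> B"
  shows "besov_norm \<psi> s (ennreal p) \<top> f \<le> ennreal B"
  unfolding besov_norm_bseq[OF assms(1)] by (rule Lp_norm_top_le) (use assms(2) in \<open>simp add: ennreal_leI\<close>)

lemma blk_le_lqn:
  assumes "0 < p" "0 < q" "f \<in> besov \<psi> 0 (ennreal p) (ennreal q)"
  shows "blk \<psi> p j f \<le> lqn q (bseq \<psi> 0 p f)"
  using component_le_lqn[of q "bseq \<psi> 0 p f" j] assms by (simp add: besov_iff bseq_zero)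

text \<open>\<open>generates_besov\<close> characterizes membership by wavelet norms only among
  distributions in some \<open>besov \<psi> u 1 \<top>\<close>; this supplies that side condition
  with \<open>u = 0\<close>.\<close>

lemma besov_imp_besov_1_top:
  assumes "1 \<le> p" "0 < q" "f \<in> besov \<psi> 0 (ennreal p) (ennreal q)"
  shows "f \<in> besov \<psi> 0 1 \<top>"
proof -
  have "bseq \<psi> 0 1 f j \<le> lqn q (bseq \<psi> 0 p f)" for j
    using blk_mono_p[OF assms(1), of \<psi> j f] blk_le_lqn[of p q f \<psi> j] assms by (simp add: bseq_zero)
  then have "besov_norm \<psi> 0 (ennreal 1) \<top> f \<le> ennreal (lqn q (bseq \<psi> 0 p f))"
    by (intro besov_top_bound) auto
  then show ?thesis by (simp add: besov_def le_less_trans)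
qed

lemma besov_add:
  assumes "1 \<le> p" "0 < q" "f \<in> besov \<psi> s (ennreal p) (ennreal q)" "g \<in> besov \<psi> s (ennreal p) (ennreal q)"
  shows "f + g \<in> besov \<psi> s (ennreal p) (ennreal q)"
proof -
  have "lq_fun q (\<lambda>j. bseq \<psi> s p f j + bseq \<psi> s p g j)"
    using assms by (intro Lp_fun_add) (auto simp: besov_iff)
  then have "lq_fun q (bseq \<psi> s p (f + g))"
    by (rule Lp_fun_mono)
       (use assms blk_add[of p \<psi> _ f g] in \<open>auto simp: bseq_def distrib_left[symmetric] abs_mult intro!: mult_left_mono\<close>)
  then show ?thesis using assms by (simp add: besov_iff)
qed

lemma besov_scaleR:
  assumes "1 \<le> p" "0 < q" "f \<in> besov \<psi> s (ennreal p) (ennreal q)"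
  shows "a *\<^sub>R f \<in> besov \<psi> s (ennreal p) (ennreal q)"
proof -
  have "bseq \<psi> s p (a *\<^sub>R f) = (\<lambda>j. \<bar>a\<bar> * bseq \<psi> s p f j)"
    using assms by (simp add: fun_eq_iff bseq_def blk_scaleR)
  then show ?thesis using assms by (simp add: besov_iff Lp_fun_cmult)
qed

lemma besov_diff:
  assumes "1 \<le> p" "0 < q" "f \<in> besov \<psi> s (ennreal p) (ennreal q)" "g \<in> besov \<psi> s (ennreal p) (ennreal q)"
  shows "f - g \<in> besov \<psi> s (ennreal p) (ennreal q)"
  using besov_add[OF assms(1-3) besov_scaleR[OF assms(1,2,4), of "-1"]] by simp

text \<open>Of the \<open>2 * CARD('d) + 1\<close> powers of the weight gained from derivatives of
  \<open>\<eta>\<close>, one absorbs the growth of the coefficients of \<open>f\<close>, and the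
  rest make the lattice sum converge.\<close>

lemma dapp_le_fourier:
  fixes f :: "'d::finite distribution"
  assumes B: "\<And>k. norm (fourier f k) \<le> wt k * B" "0 \<le> B" and t: "test_function \<eta>"
    and K: "\<And>is x. length is \<le> 2 * CARD('d) + 1 \<Longrightarrow> \<bar>Dpart is \<eta> x\<bar> \<le> K"
  shows "\<bar>dapp f \<eta>\<bar> \<le> B * (2 * (real CARD('d) + 1) ^ (2 * CARD('d) + 2) * (\<Sum>n. 1 / wt (freq n :: int ^ 'd) ^ (2 * CARD('d)))) * K"
proof -
  let ?N = "2 * CARD('d)" and ?C = "2 * (real CARD('d) + 1) ^ (2 * CARD('d) + 2)"
  have le: "\<bar>Re (fcoeff \<eta> k * cnj (fourier f k))\<bar> \<le> B * ?C * K * (1 / wt k ^ ?N)" for k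
  proof -
    have "norm (fcoeff \<eta> k) * wt k ^ (?N + 1) \<le> ?C * K"
      using norm_fcoeff_wt_le[OF t, where N = "?N + 1" and K = K and k = k, OF K] by simp
    then have *: "norm (fcoeff \<eta> k) * wt k \<le> ?C * K * (1 / wt k ^ ?N)"
      using wt_pos[of k] by (simp add: field_simps)
    have "\<bar>Re (fcoeff \<eta> k * cnj (fourier f k))\<bar> \<le> norm (fcoeff \<eta> k) * norm (fourier f k)"
      using abs_Re_le_cmod[of "fcoeff \<eta> k * cnj (fourier f k)"] by (simp only: norm_mult complex_mod_cnj)
    also have "\<dots> \<le> norm (fcoeff \<eta> k) * (wt k * B)" by (intro mult_left_mono B) auto
    also have "\<dots> = B * (norm (fcoeff \<eta> k) * wt k)" by simp
    also have "\<dots> \<le> B * (?C * K * (1 / wt k ^ ?N))" by (intro mult_left_mono * B)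
    finally show ?thesis by (simp add: mult_ac)
  qed
  have sm: "summable (\<lambda>n. B * ?C * K * (1 / wt (freq n :: int ^ 'd) ^ ?N))"
    by (intro summable_mult summable_inverse_wt)
  let ?h = "\<lambda>n. Re (fcoeff \<eta> (freq n) * cnj (fourier f (freq n)))"
  have sh: "summable (\<lambda>n. \<bar>?h n\<bar>)"
    by (rule summable_comparison_test'[OF sm, of 0]) (use le in auto)
  have "dapp f \<eta> = (\<Sum>n. ?h n)"
    using dapp_trig_series[OF rapid_fcoeff[OF t], of f] by (simp add: fourier_expansion[OF t] sums_iff)
  then have "\<bar>dapp f \<eta>\<bar> \<le> (\<Sum>n. \<bar>?h n\<bar>)" using summable_rabs[OF sh] by simp
  also have "\<dots> \<le> (\<Sum>n. B * ?C * K * (1 / wt (freq n :: int ^ 'd) ^ ?N))"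
    by (intro suminf_le le sh sm)
  also have "\<dots> = B * ?C * K * (\<Sum>n. 1 / wt (freq n :: int ^ 'd) ^ ?N)"
    by (rule suminf_mult[OF summable_inverse_wt])
  finally show ?thesis by (simp add: mult_ac)
qed

section \<open>Heat smoothing in Besov spaces\<close>

abbreviation bnorm :: "(real ^ 'd::finite \<Rightarrow> real) \<Rightarrow> real \<Rightarrow> real \<Rightarrow> 'd distribution \<Rightarrow> real" where
  "bnorm \<psi> p q f \<equiv> lqn q (bseq \<psi> 0 p f)"

lemma bnorm_add:
  assumes "1 \<le> p" "1 \<le> q" "f \<in> besov \<psi> 0 (ennreal p) (ennreal q)" "g \<in> besov \<psi> 0 (ennreal p) (ennreal q)"
  shows "bnorm \<psi> p q (f + g) \<le> bnorm \<psi> p q f + bnorm \<psi> p q g"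
proof -
  have l: "lq_fun q (bseq \<psi> 0 p f)" "lq_fun q (bseq \<psi> 0 p g)" "lq_fun q (bseq \<psi> 0 p (f + g))"
    using assms besov_add[of p q f \<psi> 0 g] by (auto simp: besov_iff)
  have "bnorm \<psi> p q (f + g) \<le> lqn q (\<lambda>j. bseq \<psi> 0 p f j + bseq \<psi> 0 p g j)"
  proof (rule lpn_mono)
    show "lq_fun q (\<lambda>j. bseq \<psi> 0 p f j + bseq \<psi> 0 p g j)"
      by (rule Lp_fun_add[OF _ l(1,2)]) (use assms in simp)
    show "\<bar>bseq \<psi> 0 p (f + g) j\<bar> \<le> \<bar>bseq \<psi> 0 p f j + bseq \<psi> 0 p g j\<bar>" for j
      using blk_add[OF assms(1), of \<psi> j f g] by (simp add: bseq_zero)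
  qed (use assms l in auto)
  also have "\<dots> \<le> bnorm \<psi> p q f + bnorm \<psi> p q g"
    using assms l by (intro lpn_add) auto
  finally show ?thesis .
qed

lemma fourier_le_bnorm:
  assumes "lp_cutoff \<psi>" "1 \<le> p" "1 \<le> q" "f \<in> besov \<psi> 0 (ennreal p) (ennreal q)"
  shows "norm (fourier f k) \<le> wt k * (2 * bnorm \<psi> p q f)"
  using fourier_le_wt[OF assms(1,2), of "bnorm \<psi> p q f" f 0 k] blk_le_lqn[of p q f \<psi>] assms
  by (simp add: mult_ac)

text \<open>Constant and order are uniform in \<open>f\<close>. This makes norm Cauchy sequences
  converge at every test function, with a limit that is again a continuous functional.\<close>

lemma dapp_le_bnorm:
  fixes \<psi> :: "real ^ 'd::finite \<Rightarrow> real"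
  assumes "lp_cutoff \<psi>" "1 \<le> p" "1 \<le> q"
  obtains C where "0 \<le> C"
    "\<And>f \<eta> K. f \<in> besov \<psi> 0 (ennreal p) (ennreal q) \<Longrightarrow> test_function \<eta> \<Longrightarrow>
      (\<And>is x. length is \<le> 2 * CARD('d) + 1 \<Longrightarrow> \<bar>Dpart is \<eta> x\<bar> \<le> K) \<Longrightarrow> \<bar>dapp f \<eta>\<bar> \<le> C * bnorm \<psi> p q f * K"
proof
  let ?C = "2 * (2 * (real CARD('d) + 1) ^ (2 * CARD('d) + 2) * (\<Sum>n. 1 / wt (freq n :: int ^ 'd) ^ (2 * CARD('d))))"
  show "0 \<le> ?C" by (intro mult_nonneg_nonneg suminf_nonneg summable_inverse_wt) (auto simp: wt_nonneg)
  show "\<bar>dapp f \<eta>\<bar> \<le> ?C * bnorm \<psi> p q f * K"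
    if "f \<in> besov \<psi> 0 (ennreal p) (ennreal q)" "test_function \<eta>"
      "\<And>is x. length is \<le> 2 * CARD('d) + 1 \<Longrightarrow> \<bar>Dpart is \<eta> x\<bar> \<le> K" for f \<eta> K
    using dapp_le_fourier[of f "2 * bnorm \<psi> p q f" \<eta> K, OF fourier_le_bnorm[OF assms that(1)] _ that(2,3)]
    by (simp add: mult_ac)
qed

lemma dapp_simps: "dapp (f + g) \<eta> = dapp f \<eta> + dapp g \<eta>" "dapp (f - g) \<eta> = dapp f \<eta> - dapp g \<eta>"
  "dapp (a *\<^sub>R f) \<eta> = a * dapp f \<eta>"
  by (simp_all add: plus_distribution.rep_eq minus_distribution.rep_eq scaleR_distribution.rep_eq)

lemma dapp_non_test: "\<not> test_function \<eta> \<Longrightarrow> dapp f \<eta> = 0"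
  using is_distribution_dapp[of f] by (simp add: is_distribution_def)

text \<open>The limit is built by evaluation at each test function. Blocks depend on finitely many
  Fourier coefficients and so converge; the norm of the error is controlled through partial sums
  over the levels, as in Fatou's lemma.\<close>

theorem besov_complete:
  fixes F :: "nat \<Rightarrow> 'd::finite distribution"
  assumes c: "lp_cutoff \<psi>" and p: "1 \<le> p" and q: "1 \<le> q"
    and F: "\<And>n. F n \<in> besov \<psi> 0 (ennreal p) (ennreal q)"
    and cauchy: "\<And>e. 0 < e \<Longrightarrow> \<exists>N. \<forall>m\<ge>N. \<forall>n\<ge>N. bnorm \<psi> p q (F m - F n) < e"
  obtains f where "f \<in> besov \<psi> 0 (ennreal p) (ennreal q)" "(\<lambda>n. bnorm \<psi> p q (F n - f)) \<longlonglongrightarrow> 0"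
proof -
  let ?X = "besov \<psi> 0 (ennreal p) (ennreal q)"
  have dF: "F m - F n \<in> ?X" for m n using p q F by (intro besov_diff) auto
  obtain C where C: "0 \<le> C" "\<And>f \<eta> K. f \<in> ?X \<Longrightarrow> test_function \<eta> \<Longrightarrow>
      (\<And>is x. length is \<le> 2 * CARD('d) + 1 \<Longrightarrow> \<bar>Dpart is \<eta> x\<bar> \<le> K) \<Longrightarrow> \<bar>dapp f \<eta>\<bar> \<le> C * bnorm \<psi> p q f * K"
    using dapp_le_bnorm[OF c p q] by blast
  have conv: "convergent (\<lambda>n. dapp (F n) \<eta>)" for \<eta>
  proof (cases "test_function \<eta>")
    case True
    obtain K where K: "0 \<le> K" "\<And>is x. length is \<le> 2 * CARD('d) + 1 \<Longrightarrow> \<bar>Dpart is \<eta> x\<bar> \<le> K"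
      using test_function_Dpart_bounded[OF True] by blast
    have "Cauchy (\<lambda>n. dapp (F n) \<eta>)"
    proof (rule metric_CauchyI)
      fix e :: real assume e: "0 < e"
      have CK: "0 < C * K + 1" using C K by (simp add: add_nonneg_pos)
      then obtain N where N: "\<forall>m\<ge>N. \<forall>n\<ge>N. bnorm \<psi> p q (F m - F n) < e / (C * K + 1)"
        using cauchy[of "e / (C * K + 1)"] e by auto
      have "dist (dapp (F m) \<eta>) (dapp (F n) \<eta>) < e" if "m \<ge> N" "n \<ge> N" for m n
      proof -
        have "dist (dapp (F m) \<eta>) (dapp (F n) \<eta>) = \<bar>dapp (F m - F n) \<eta>\<bar>"
          by (simp add: dist_real_def dapp_simps)
        also have "\<dots> \<le> C * bnorm \<psi> p q (F m - F n) * K" by (rule C(2)[OF dF True K(2)])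
        also have "\<dots> = bnorm \<psi> p q (F m - F n) * (C * K)" by simp
        also have "\<dots> \<le> bnorm \<psi> p q (F m - F n) * (C * K + 1)" by (intro mult_left_mono) auto
        also have "\<dots> < e" using N that CK by (simp add: pos_less_divide_eq)
        finally show ?thesis .
      qed
      then show "\<exists>N. \<forall>m\<ge>N. \<forall>n\<ge>N. dist (dapp (F m) \<eta>) (dapp (F n) \<eta>) < e" by blast
    qed
    then show ?thesis by (rule Cauchy_convergent)
  qed (simp add: dapp_non_test convergent_const)
  define L where "L \<eta> = lim (\<lambda>n. dapp (F n) \<eta>)" for \<eta>
  have L: "(\<lambda>n. dapp (F n) \<eta>) \<longlonglongrightarrow> L \<eta>" for \<eta>
    using conv[of \<eta>] unfolding L_def convergent_LIMSEQ_iff .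
  obtain N0 where N0: "\<forall>m\<ge>N0. \<forall>n\<ge>N0. bnorm \<psi> p q (F m - F n) < 1" using cauchy[of 1] by auto
  define B where "B = 1 + bnorm \<psi> p q (F N0)"
  have B: "bnorm \<psi> p q (F n) \<le> B" if "n \<ge> N0" for n
    using bnorm_add[OF p q dF[of n N0] F[of N0]] N0[rule_format, OF that order_refl] by (simp add: B_def)
  \<comment> \<open>Boundedness of the norms from \<open>N0\<close> on gives one order and one
    constant for all these \<open>F n\<close>, which survive in the limit.\<close>
  have isd: "is_distribution L"
    unfolding is_distribution_def
  proof (intro conjI allI impI)
    show "L \<eta> = 0" if "\<not> test_function \<eta>" for \<eta>
      using L[of \<eta>] that by (simp add: dapp_non_test LIMSEQ_const_iff)
    show "L (\<lambda>x. \<eta> x + \<zeta> x) = L \<eta> + L \<zeta>" if "test_function \<eta>" "test_function \<zeta>" for \<eta> \<zeta>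
      using LIMSEQ_unique[OF L[of "\<lambda>x. \<eta> x + \<zeta> x"]] tendsto_add[OF L[of \<eta>] L[of \<zeta>]] that by (simp add: dapp_add)
    show "L (\<lambda>x. a * \<eta> x) = a * L \<eta>" if "test_function \<eta>" for a \<eta>
      using LIMSEQ_unique[OF L[of "\<lambda>x. a * \<eta> x"]] tendsto_mult_left[OF L[of \<eta>], of a] that by (simp add: dapp_cmult)
    have "\<bar>L \<eta>\<bar> \<le> C * B * K"
      if t: "test_function \<eta>" and b: "\<forall>is x. length is \<le> 2 * CARD('d) + 1 \<longrightarrow> \<bar>Dpart is \<eta> x\<bar> \<le> K" for \<eta> K
    proof (rule LIMSEQ_le_const2[OF tendsto_rabs[OF L]])
      have K0: "0 \<le> K" using b[rule_format, of "[]" 0] by simp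
      have "\<bar>dapp (F n) \<eta>\<bar> \<le> C * B * K" if "n \<ge> N0" for n
      proof -
        have "\<bar>dapp (F n) \<eta>\<bar> \<le> C * bnorm \<psi> p q (F n) * K" using b by (intro C(2) F t) auto
        also have "\<dots> \<le> C * B * K" using B[OF that] C K0 by (intro mult_right_mono mult_left_mono) auto
        finally show ?thesis .
      qed
      then show "\<exists>N. \<forall>n\<ge>N. \<bar>dapp (F n) \<eta>\<bar> \<le> C * B * K" by blast
    qed
    then show "\<exists>C N. \<forall>\<eta> K. test_function \<eta> \<longrightarrow> (\<forall>is x. length is \<le> N \<longrightarrow> \<bar>Dpart is \<eta> x\<bar> \<le> K) \<longrightarrow> \<bar>L \<eta>\<bar> \<le> C * K"
      by blast
  qed
  define f where "f = Abs_distribution L"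
  have f: "dapp f = L" unfolding f_def using isd by (simp add: Abs_distribution_inverse)
  have fl: "(\<lambda>n. fourier (F n) k) \<longlonglongrightarrow> fourier f k" for k
    unfolding fourier_trig f by (intro tendsto_Complex tendsto_minus L)
  have bl0: "(\<lambda>m. blk \<psi> p j (f - F m)) \<longlonglongrightarrow> 0" for j
  proof (rule Lim_null_comparison[OF always_eventually])
    let ?S = "{k. lp_symbol \<psi> j (int_vec k) \<noteq> 0}"
    show "\<forall>m. norm (blk \<psi> p j (f - F m)) \<le> (\<Sum>k\<in>?S. \<bar>lp_symbol \<psi> j (int_vec k)\<bar> * norm (fourier f k - fourier (F m) k))"
      using blk_le_fourier[OF c, of p j "f - F _"] p by (simp add: fourier_diff)
    have "(\<lambda>m. \<Sum>k\<in>?S. \<bar>lp_symbol \<psi> j (int_vec k)\<bar> * norm (fourier f k - fourier (F m) k)) \<longlonglongrightarrow>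
      (\<Sum>k\<in>?S. \<bar>lp_symbol \<psi> j (int_vec k)\<bar> * norm (fourier f k - fourier f k))"
      by (intro tendsto_intros fl)
    then show "(\<lambda>m. \<Sum>k\<in>?S. \<bar>lp_symbol \<psi> j (int_vec k)\<bar> * norm (fourier f k - fourier (F m) k)) \<longlonglongrightarrow> 0" by simp
  qed
  have bl: "(\<lambda>m. blk \<psi> p j (F n - F m)) \<longlonglongrightarrow> blk \<psi> p j (F n - f)" for j n
  proof (rule LIM_zero_cancel, rule Lim_null_comparison[OF always_eventually bl0[of j]], rule allI)
    fix m
    have "(F n - F m) - (F n - f) = f - F m" by simp
    then show "norm (blk \<psi> p j (F n - F m) - blk \<psi> p j (F n - f)) \<le> blk \<psi> p j (f - F m)"
      using blk_abs_diff[OF p, of \<psi> j "F n - F m" "F n - f"] by simp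
  qed
  have main: "F n - f \<in> ?X \<and> bnorm \<psi> p q (F n - f) \<le> e"
    if e: "0 < e" and N: "\<forall>m\<ge>N. \<forall>n\<ge>N. bnorm \<psi> p q (F m - F n) < e" and n: "n \<ge> N" for e N n
  proof -
    have partial: "(\<Sum>j<J. blk \<psi> p j (F n - f) powr q) \<le> e powr q" for J
    proof (rule LIMSEQ_le_const2)
      show "(\<lambda>m. \<Sum>j<J. blk \<psi> p j (F n - F m) powr q) \<longlonglongrightarrow> (\<Sum>j<J. blk \<psi> p j (F n - f) powr q)"
        using q by (intro tendsto_sum tendsto_powr' bl tendsto_const) auto
      have "(\<Sum>j<J. blk \<psi> p j (F n - F m) powr q) \<le> e powr q" if "m \<ge> N" for m
      proof -
        have l: "lq_fun q (bseq \<psi> 0 p (F n - F m))" using dF[of n m] p q by (simp add: besov_iff)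
        have "(\<Sum>j<J. blk \<psi> p j (F n - F m) powr q) \<le> (\<Sum>j. \<bar>bseq \<psi> 0 p (F n - F m) j\<bar> powr q)"
          using l by (subst (asm) lq_fun_iff) (intro order_trans[OF _ sum_le_suminf[of _ "{..<J}"]], auto simp: bseq_zero)
        also have "\<dots> = bnorm \<psi> p q (F n - F m) powr q" using l q by (simp add: lqn_powr)
        also have "\<dots> \<le> e powr q" using N n that q by (intro powr_mono2) (auto intro: less_imp_le)
        finally show ?thesis .
      qed
      then show "\<exists>N. \<forall>m\<ge>N. (\<Sum>j<J. blk \<psi> p j (F n - F m) powr q) \<le> e powr q" by blast
    qed
    have sm: "summable (\<lambda>j. blk \<psi> p j (F n - f) powr q)"
      by (intro summableI_nonneg_bounded[OF _ partial]) auto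
    then have l: "lq_fun q (bseq \<psi> 0 p (F n - f))" by (simp add: lq_fun_iff bseq_zero)
    have "(\<integral>j. \<bar>bseq \<psi> 0 p (F n - f) j\<bar> powr q \<partial>count_space UNIV) \<le> e powr q"
      using suminf_le_const[OF sm partial] lqn_powr[OF _ l] q by (simp add: lpn_powr bseq_zero)
    then have "bnorm \<psi> p q (F n - f) \<le> e" using q e by (intro lpn_le) auto
    with l show ?thesis using p q by (simp add: besov_iff)
  qed
  obtain N1 where "\<forall>m\<ge>N1. \<forall>n\<ge>N1. bnorm \<psi> p q (F m - F n) < 1" using cauchy[of 1] by auto
  then have "F N1 - f \<in> ?X" using main[of 1 N1 N1] by simp
  \<comment> \<open>This difference is \<open>f\<close>: the limit lies in the space because one
    approximant and its error do.\<close>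
  then have "F N1 - (F N1 - f) \<in> ?X"
    by (rule besov_diff[OF p less_le_trans[OF zero_less_one q] F])
  moreover have "(\<lambda>n. bnorm \<psi> p q (F n - f)) \<longlonglongrightarrow> 0"
  proof (rule LIMSEQ_I)
    fix e :: real assume e: "0 < e"
    then obtain N where N: "\<forall>m\<ge>N. \<forall>n\<ge>N. bnorm \<psi> p q (F m - F n) < e / 2" using cauchy[of "e / 2"] by auto
    have "norm (bnorm \<psi> p q (F n - f) - 0) < e" if "n \<ge> N" for n
      using main[OF _ N that] e by simp
    then show "\<exists>N. \<forall>n\<ge>N. norm (bnorm \<psi> p q (F n - f) - 0) < e" by blast
  qed
  ultimately show ?thesis using that by simp
qed

section \<open>The forward operator on the Besov space: linearity and boundedness\<close>

lemma heat_coeff_add: "heat_coeff (fourier (f + g)) t k = heat_coeff (fourier f) t k + heat_coeff (fourier g) t k"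
  by (simp add: heat_coeff_def fourier_add scaleR_add_right)

lemma T_BH_add:
  assumes "tbar > 0"
  shows "T_BH tbar (f + g) x = T_BH tbar f x + T_BH tbar g x"
  using assms trig_series_add[OF rapid_heat_coeff[OF moderate_fourier] rapid_heat_coeff[OF moderate_fourier], of tbar tbar f g x]
  by (simp add: T_BH_eq heat_coeff_add[abs_def])

lemma trig_series_scaleR:
  assumes "rapid c"
  shows "trig_series (\<lambda>k. a *\<^sub>R c k) x = a * trig_series c x"
proof -
  have "(\<lambda>n. trig (freq n) (a *\<^sub>R c (freq n)) x) sums (a * trig_series c x)"
    using sums_mult[OF trig_series_sums[OF assms, of x], of a] by (simp add: trig_eq algebra_simps)
  then show ?thesis by (simp add: trig_series_def sums_iff)
qed

lemma T_BH_scaleR: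
  assumes "tbar > 0"
  shows "T_BH tbar (a *\<^sub>R f) x = a * T_BH tbar f x"
proof -
  have "heat_coeff (fourier (a *\<^sub>R f)) tbar = (\<lambda>k. a *\<^sub>R heat_coeff (fourier f) tbar k)"
    by (simp add: fun_eq_iff heat_coeff_def fourier_scaleR)
  then show ?thesis
    using trig_series_scaleR[OF rapid_heat_coeff[OF moderate_fourier assms], of a f x] assms
    by (simp add: T_BH_eq)
qed

lemma T_BH_diff:
  assumes "tbar > 0"
  shows "T_BH tbar (f - g) x = T_BH tbar f x - T_BH tbar g x"
  using T_BH_add[OF assms, of "f - g" g x] by simp

lemma test_function_T_BH: "tbar > 0 \<Longrightarrow> test_function (T_BH tbar f)"
  by (simp add: T_BH_eq test_function_trig_series rapid_heat_coeff moderate_fourier)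

lemma fcoeff_T_BH: "tbar > 0 \<Longrightarrow> fcoeff (T_BH tbar f) = heat_coeff (fourier f) tbar"
  by (simp add: T_BH_eq fcoeff_trig_series rapid_heat_coeff moderate_fourier hermitian_heat_coeff hermitian_fourier)

lemma summable_exp_heat_rate:
  assumes "t > 0"
  shows "summable (\<lambda>n. exp (- heat_rate (freq n :: int ^ 'd::finite) * t) * wt (freq n :: int ^ 'd) ^ N)"
  using rapid_summable[OF rapid_exp_heat_rate[OF assms, where 'd = 'd], of N] by simp

text \<open>The heat factor makes the coefficients absolutely summable, though those of
  \<open>f\<close> may grow like the weight.\<close>

lemma T_BH_bounded:
  fixes \<psi> :: "real ^ 'd::finite \<Rightarrow> real"
  assumes c: "lp_cutoff \<psi>" and p: "1 \<le> p" and q: "1 \<le> q" and t: "tbar > 0"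
  obtains C where "0 \<le> C" "\<And>f x. f \<in> besov \<psi> 0 (ennreal p) (ennreal q) \<Longrightarrow> \<bar>T_BH tbar f x\<bar> \<le> C * bnorm \<psi> p q f"
proof
  let ?s = "\<lambda>n. exp (- heat_rate (freq n :: int ^ 'd) * tbar) * wt (freq n :: int ^ 'd) ^ 1"
  let ?C = "2 * (\<Sum>n. ?s n)"
  have sm: "summable ?s" by (rule summable_exp_heat_rate[OF t])
  show "0 \<le> ?C" by (intro mult_nonneg_nonneg suminf_nonneg sm) (auto simp: wt_nonneg)
  fix f x assume f: "f \<in> besov \<psi> 0 (ennreal p) (ennreal q)"
  have r: "rapid (heat_coeff (fourier f) tbar)" by (rule rapid_heat_coeff[OF moderate_fourier t])
  have "\<bar>T_BH tbar f x\<bar> \<le> (\<Sum>n. norm (heat_coeff (fourier f) tbar (freq n)))"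
    unfolding T_BH_eq[OF t] by (rule abs_trig_series_le[OF r])
  also have "\<dots> \<le> (\<Sum>n. 2 * bnorm \<psi> p q f * ?s n)"
  proof (intro suminf_le rapid_summable_norm[OF r] summable_mult sm)
    fix n
    show "norm (heat_coeff (fourier f) tbar (freq n)) \<le> 2 * bnorm \<psi> p q f * ?s n"
      using mult_left_mono[OF fourier_le_bnorm[OF c p q f, of "freq n"], of "exp (- heat_rate (freq n :: int ^ 'd) * tbar)"]
      by (simp add: norm_heat_coeff mult_ac)
  qed
  also have "\<dots> = 2 * bnorm \<psi> p q f * (\<Sum>n. ?s n)" by (rule suminf_mult[OF sm])
  finally show "\<bar>T_BH tbar f x\<bar> \<le> ?C * bnorm \<psi> p q f" by (simp add: mult_ac)
qed

lemma dapp_T_BH_le: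
  assumes t: "tbar > 0" and m: "summable m" and le: "\<And>n. norm (heat_coeff (fourier f) tbar (freq n)) * norm (fourier z (freq n)) \<le> m n"
  shows "\<bar>dapp z (T_BH tbar f)\<bar> \<le> (\<Sum>n. m n)"
proof -
  let ?h = "\<lambda>n. Re (heat_coeff (fourier f) tbar (freq n) * cnj (fourier z (freq n)))"
  have b: "\<bar>?h n\<bar> \<le> m n" for n
    using abs_Re_le_cmod[of "heat_coeff (fourier f) tbar (freq n) * cnj (fourier z (freq n))"] le[of n]
    by (simp only: norm_mult complex_mod_cnj)
  have sh: "summable (\<lambda>n. \<bar>?h n\<bar>)" by (rule summable_comparison_test'[OF m, of 0]) (use b in auto)
  have "dapp z (T_BH tbar f) = (\<Sum>n. ?h n)"
    unfolding T_BH_eq[OF t] using dapp_trig_series[OF rapid_heat_coeff[OF moderate_fourier t], of f z] by (simp only: sums_iff)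
  then have "\<bar>dapp z (T_BH tbar f)\<bar> \<le> (\<Sum>n. \<bar>?h n\<bar>)" using summable_rabs[OF sh] by simp
  also have "\<dots> \<le> (\<Sum>n. m n)" by (intro suminf_le b sh m)
  finally show ?thesis .
qed

text \<open>Here \<open>z\<close> is an arbitrary distribution: the polynomial growth of its
  coefficients is beaten by the heat factor. The constant depends on \<open>z\<close>, which is
  enough for the existence of minimizers at fixed data.\<close>

lemma dapp_T_BH_bounded:
  fixes \<psi> :: "real ^ 'd::finite \<Rightarrow> real"
  assumes c: "lp_cutoff \<psi>" and p: "1 \<le> p" and q: "1 \<le> q" and t: "tbar > 0"
  obtains C where "0 \<le> C" "\<And>f. f \<in> besov \<psi> 0 (ennreal p) (ennreal q) \<Longrightarrow> \<bar>dapp z (T_BH tbar f)\<bar> \<le> C * bnorm \<psi> p q f"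
proof -
  obtain N D where D: "0 \<le> D" "\<And>k. norm (fourier z k) \<le> D * wt k ^ N"
    using moderate_fourier[of z] unfolding moderate_def by blast
  let ?s = "\<lambda>n. exp (- heat_rate (freq n :: int ^ 'd) * tbar) * wt (freq n :: int ^ 'd) ^ (N + 1)"
  let ?C = "2 * D * (\<Sum>n. ?s n)"
  have sm: "summable ?s" by (rule summable_exp_heat_rate[OF t])
  have "0 \<le> ?C" by (intro mult_nonneg_nonneg suminf_nonneg sm D) (auto simp: wt_nonneg)
  moreover have "\<bar>dapp z (T_BH tbar f)\<bar> \<le> ?C * bnorm \<psi> p q f"
    if f: "f \<in> besov \<psi> 0 (ennreal p) (ennreal q)" for f
  proof -
    have "\<bar>dapp z (T_BH tbar f)\<bar> \<le> (\<Sum>n. 2 * D * bnorm \<psi> p q f * ?s n)"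
    proof (rule dapp_T_BH_le[OF t summable_mult[OF sm]])
      fix n
      let ?k = "freq n :: int ^ 'd"
      have "norm (heat_coeff (fourier f) tbar ?k) * norm (fourier z ?k)
          \<le> (exp (- heat_rate ?k * tbar) * (wt ?k * (2 * bnorm \<psi> p q f))) * (D * wt ?k ^ N)"
        unfolding norm_heat_coeff using D(1)
        by (intro mult_mono mult_left_mono fourier_le_bnorm[OF c p q f] D(2)) (auto intro!: mult_nonneg_nonneg simp: wt_nonneg)
      then show "norm (heat_coeff (fourier f) tbar ?k) * norm (fourier z ?k) \<le> 2 * D * bnorm \<psi> p q f * ?s n"
        by (simp add: mult_ac)
    qed
    also have "\<dots> = 2 * D * bnorm \<psi> p q f * (\<Sum>n. ?s n)" by (rule suminf_mult[OF sm])
    finally show ?thesis by (simp add: mult_ac)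
  qed
  ultimately show ?thesis using that by blast
qed

section \<open>Stability estimates in terms of the norm of the data\<close>

abbreviation T_norm :: "real \<Rightarrow> 'd::finite distribution \<Rightarrow> real" where
  "T_norm tbar f \<equiv> lpn torus 2 (T_BH tbar f)"

lemma T_norm_square: "tbar > 0 \<Longrightarrow> (T_norm tbar f)\<^sup>2 = (\<integral>x. (T_BH tbar f x)\<^sup>2 \<partial>torus)"
  using lpn_powr[of 2 torus "T_BH tbar f"] by simp

lemma heat_coeff_le_T_norm:
  assumes "tbar > 0"
  shows "exp (- heat_rate k * tbar) * norm (fourier f k) \<le> 2 * T_norm tbar f"
proof -
  note c = test_function_continuous[OF test_function_T_BH[OF assms, of f]]
  have "exp (- heat_rate k * tbar) * norm (fourier f k) = norm (fcoeff (T_BH tbar f) k)"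
    by (simp add: fcoeff_T_BH assms norm_heat_coeff)
  also have "\<dots> \<le> 2 * (\<integral>x. \<bar>T_BH tbar f x\<bar> \<partial>torus)" by (rule norm_fcoeff_le[OF c])
  also have "\<dots> \<le> 2 * T_norm tbar f" using integral_torus_le_lpn[OF _ c, of 2] by simp
  finally show ?thesis .
qed

lemma sum_le_suminf_freq:
  assumes "finite S" "summable (\<lambda>n. g (freq n))" "\<And>k. 0 \<le> g k"
  shows "(\<Sum>k\<in>S. g k) \<le> (\<Sum>n. g (freq n) :: real)"
proof -
  have inj: "inj (freq :: nat \<Rightarrow> int ^ 'a)" by (rule bij_is_inj[OF bij_freq])
  have S: "freq ` (freq -` S) = S" using bij_is_surj[OF bij_freq] by (rule surj_image_vimage_eq)
  have fin: "finite (freq -` S)" by (rule finite_vimageI[OF assms(1) inj])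
  have "(\<Sum>k\<in>S. g k) = (\<Sum>n\<in>freq -` S. g (freq n))"
    by (subst S[symmetric], subst sum.reindex) (auto simp: inj_on_def)
  also have "\<dots> \<le> (\<Sum>n. g (freq n))" by (intro sum_le_suminf assms fin)
  finally show ?thesis .
qed

text \<open>On frequencies of size at most \<open>2 ^ (j + 1)\<close> the heat semigroup is inverted at the cost of
  a factor exponential in \<open>4 ^ j\<close>; this is the source of the logarithmic rate.\<close>

lemma blk_le_T_norm:
  fixes \<psi> :: "real ^ 'd::finite \<Rightarrow> real"
  assumes c: "lp_cutoff \<psi>" and p: "1 \<le> p" and t: "tbar > 0"
  obtains C where "0 \<le> C" "\<And>f j. blk \<psi> p j f \<le> C * exp (32 * pi\<^sup>2 * tbar * 4 ^ j) * T_norm tbar f"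
proof -
  obtain D where D: "0 \<le> D" "\<And>j \<xi>. \<bar>lp_symbol \<psi> j \<xi>\<bar> \<le> D" using lp_symbol_bounded[OF c] by blast
  define s where "s k = exp (- heat_rate k * tbar)" for k :: "int ^ 'd"
  have sm: "summable (\<lambda>n. s (freq n))" using summable_exp_heat_rate[OF t, where 'd = 'd, of 0] by (simp add: s_def)
  define C where "C = 2 * D * (\<Sum>n. s (freq n))"
  have "0 \<le> C" unfolding C_def using D sm by (intro mult_nonneg_nonneg suminf_nonneg) (auto simp: s_def)
  moreover have "blk \<psi> p j f \<le> C * exp (32 * pi\<^sup>2 * tbar * 4 ^ j) * T_norm tbar f" for f j
  proof -
    let ?S = "{k :: int ^ 'd. lp_symbol \<psi> j (int_vec k) \<noteq> 0}" and ?e = "exp (32 * pi\<^sup>2 * tbar * 4 ^ j)" and ?a = "T_norm tbar f"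
    have "blk \<psi> p j f \<le> (\<Sum>k\<in>?S. \<bar>lp_symbol \<psi> j (int_vec k)\<bar> * norm (fourier f k))"
      using p by (intro blk_le_fourier[OF c]) auto
    also have "\<dots> \<le> (\<Sum>k\<in>?S. D * (2 * ?a * ?e * s k))"
    proof (rule sum_mono)
      fix k :: "int ^ 'd" assume "k \<in> ?S"
      then have "norm (int_vec k) \<le> 2 * 2 ^ j" using lp_symbol_support[OF c] by simp
      then have "(norm (int_vec k))\<^sup>2 \<le> (2 * 2 ^ j)\<^sup>2" by (intro power_mono) auto
      also have "\<dots> = 4 * 4 ^ j" by (simp add: power_mult_distrib power2_eq_square[of "2 ^ j"] flip: power_mult_distrib)
      finally have "heat_rate k \<le> 16 * pi\<^sup>2 * 4 ^ j"
        unfolding heat_rate_def using mult_left_mono[of "(norm (int_vec k))\<^sup>2" "4 * 4 ^ j" "4 * pi\<^sup>2"] by simp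
      then have "heat_rate k * tbar \<le> 16 * pi\<^sup>2 * 4 ^ j * tbar" using t by (intro mult_right_mono) auto
      \<comment> \<open>The exponent is doubled, \<open>32\<close> instead of \<open>16\<close>, in
        order to retain the factor \<open>s k\<close>; it makes the sum over the frequencies of a
        block bounded independently of \<open>j\<close>.\<close>
      then have e: "exp (heat_rate k * tbar) \<le> ?e * s k"
        by (simp add: s_def mult_exp_exp mult_ac)
      have "norm (fourier f k) = exp (heat_rate k * tbar) * (exp (- heat_rate k * tbar) * norm (fourier f k))"
        by (simp add: mult.assoc[symmetric] mult_exp_exp)
      also have "\<dots> \<le> (?e * s k) * (2 * ?a)"
        by (intro mult_mono e heat_coeff_le_T_norm t) (auto simp: s_def)
      finally have "norm (fourier f k) \<le> 2 * ?a * ?e * s k" by (simp add: mult_ac)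
      then show "\<bar>lp_symbol \<psi> j (int_vec k)\<bar> * norm (fourier f k) \<le> D * (2 * ?a * ?e * s k)"
        using D by (intro mult_mono) auto
    qed
    also have "\<dots> = 2 * D * ?a * ?e * (\<Sum>k\<in>?S. s k)"
      unfolding sum_distrib_left by (intro sum.cong refl) (simp only: mult_ac)
    also have "\<dots> \<le> 2 * D * ?a * ?e * (\<Sum>n. s (freq n))"
      using D by (intro mult_left_mono sum_le_suminf_freq finite_lp_symbol_support c sm) (auto simp: s_def)
    finally show ?thesis by (simp add: C_def mult_ac)
  qed
  ultimately show ?thesis using that by blast
qed

text \<open>Negative smoothness gives geometric weights in the level, so a sum over all levels costs
  no more than a bound for each single block: by the data norm below level \<open>K\<close>, by
  \<open>bnorm\<close> from level \<open>K\<close> on.\<close>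

lemma negative_smoothness_bound:
  fixes \<psi> :: "real ^ 'd::finite \<Rightarrow> real"
  assumes c: "lp_cutoff \<psi>" and p: "1 \<le> p" and q: "1 \<le> q" and t: "tbar > 0" and s: "0 < s"
  obtains C where "0 < C"
    "\<And>f. f \<in> besov \<psi> 0 (ennreal p) (ennreal q) \<Longrightarrow> f \<in> besov \<psi> (- s) (ennreal p) 1"
    "\<And>f K. f \<in> besov \<psi> 0 (ennreal p) (ennreal q) \<Longrightarrow>
       enn2real (besov_norm \<psi> (- s) (ennreal p) 1 f) \<le>
       C * (exp (32 * pi\<^sup>2 * tbar * 4 ^ K) * T_norm tbar f + 2 powr (- (real K * s)) * bnorm \<psi> p q f)"
proof -
  obtain D where D: "0 \<le> D" "\<And>f j. blk \<psi> p j f \<le> D * exp (32 * pi\<^sup>2 * tbar * 4 ^ j) * T_norm tbar f"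
    using blk_le_T_norm[OF c p t] by blast
  define r where "r = 2 powr (- s)"
  have r: "0 < r" "r < 1" using s by (auto simp: r_def powr_less_one)
  have rj: "2 powr (real j * - s) = r ^ j" for j
    using r by (simp add: r_def powr_realpow[symmetric] powr_powr mult.commute)
  define G where "G = (\<Sum>j. r ^ j)"
  have sr: "summable (\<lambda>j. r ^ j)" using r by (intro summable_geometric) auto
  have G: "0 < G" unfolding G_def using r sr by (intro suminf_pos) auto
  have bs: "bseq \<psi> (- s) p f j = r ^ j * blk \<psi> p j f" for f j by (simp only: bseq_def rj)
  have le: "blk \<psi> p j f \<le> bnorm \<psi> p q f" if "f \<in> besov \<psi> 0 (ennreal p) (ennreal q)" for f j
    using that p q by (intro blk_le_lqn) auto
  have sm: "summable (\<lambda>j. r ^ j * blk \<psi> p j f)" if f: "f \<in> besov \<psi> 0 (ennreal p) (ennreal q)" for f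
  proof (rule summable_comparison_test'[OF summable_mult2[OF sr, of "bnorm \<psi> p q f"], of 0])
    show "norm (r ^ j * blk \<psi> p j f) \<le> r ^ j * bnorm \<psi> p q f" for j
      using le[OF f, of j] r by (simp add: abs_mult)
  qed
  have mem: "f \<in> besov \<psi> (- s) (ennreal p) (ennreal 1)" if f: "f \<in> besov \<psi> 0 (ennreal p) (ennreal q)" for f
    by (subst besov_iff) (use sm[OF f] p r in \<open>auto simp: lq_fun_iff bs abs_mult\<close>)
  have norm: "enn2real (besov_norm \<psi> (- s) (ennreal p) (ennreal 1) f) = (\<Sum>j. r ^ j * blk \<psi> p j f)"
    if f: "f \<in> besov \<psi> 0 (ennreal p) (ennreal q)" for f
  proof -
    have l: "lq_fun 1 (bseq \<psi> (- s) p f)" using iffD1[OF besov_iff mem[OF f]] p by simp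
    have "lqn 1 (bseq \<psi> (- s) p f) powr 1 = (\<Sum>j. \<bar>bseq \<psi> (- s) p f j\<bar> powr 1)" by (rule lqn_powr[OF _ l]) simp
    then have e: "lqn 1 (bseq \<psi> (- s) p f) = (\<Sum>j. r ^ j * blk \<psi> p j f)" using r by (simp add: bs abs_mult)
    have "besov_norm \<psi> (- s) (ennreal p) (ennreal 1) f = ennreal (lqn 1 (bseq \<psi> (- s) p f))"
      by (rule besov_norm_eq[OF _ _ mem[OF f]]) (use p in auto)
    then show ?thesis unfolding e[symmetric] by simp
  qed
  define C where "C = G * (D + 1)"
  have "0 < C" using G D by (simp add: C_def)
  moreover have "enn2real (besov_norm \<psi> (- s) (ennreal p) (ennreal 1) f) \<le>
       C * (exp (32 * pi\<^sup>2 * tbar * 4 ^ K) * T_norm tbar f + 2 powr (- (real K * s)) * bnorm \<psi> p q f)"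
    if f: "f \<in> besov \<psi> 0 (ennreal p) (ennreal q)" for f K
  proof -
    let ?E = "exp (32 * pi\<^sup>2 * tbar * 4 ^ K) * T_norm tbar f"
    have "(\<Sum>j. r ^ j * blk \<psi> p j f) = (\<Sum>j. r ^ (j + K) * blk \<psi> p (j + K) f) + (\<Sum>j<K. r ^ j * blk \<psi> p j f)"
      by (rule suminf_split_initial_segment[OF sm[OF f]])
    also have "(\<Sum>j. r ^ (j + K) * blk \<psi> p (j + K) f) \<le> (\<Sum>j. r ^ K * bnorm \<psi> p q f * r ^ j)"
    proof (intro suminf_le summable_mult sr)
      show "summable (\<lambda>j. r ^ (j + K) * blk \<psi> p (j + K) f)"
        using sm[OF f] by (subst summable_iff_shift)
      show "r ^ (j + K) * blk \<psi> p (j + K) f \<le> r ^ K * bnorm \<psi> p q f * r ^ j" for j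
        using mult_left_mono[OF le[OF f, of "j + K"], of "r ^ (j + K)"] r by (simp add: power_add mult_ac)
    qed
    also have "\<dots> = r ^ K * bnorm \<psi> p q f * G" unfolding G_def by (rule suminf_mult[OF sr])
    also have "(\<Sum>j<K. r ^ j * blk \<psi> p j f) \<le> (\<Sum>j<K. r ^ j * (D * ?E))"
    proof (intro sum_mono mult_left_mono)
      fix j assume "j \<in> {..<K}"
      then have "(4::real) ^ j \<le> 4 ^ K" by (intro power_increasing) auto
      then have "exp (32 * pi\<^sup>2 * tbar * 4 ^ j) \<le> exp (32 * pi\<^sup>2 * tbar * 4 ^ K)" using t by simp
      then have "D * exp (32 * pi\<^sup>2 * tbar * 4 ^ j) * T_norm tbar f \<le> D * exp (32 * pi\<^sup>2 * tbar * 4 ^ K) * T_norm tbar f"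
        using D by (intro mult_right_mono mult_left_mono) auto
      then show "blk \<psi> p j f \<le> D * ?E" using D(2)[of j f] by (simp add: mult.assoc)
    qed (use r in auto)
    also have "(\<Sum>j<K. r ^ j * (D * ?E)) \<le> G * (D * ?E)"
      unfolding sum_distrib_right[symmetric] G_def
      using D r sr by (intro mult_right_mono sum_le_suminf) auto
    finally have "(\<Sum>j. r ^ j * blk \<psi> p j f) \<le> G * D * ?E + G * (r ^ K * bnorm \<psi> p q f)" by (simp add: mult_ac)
    also have "\<dots> \<le> C * ?E + C * (r ^ K * bnorm \<psi> p q f)"
      using G D r by (intro add_mono mult_right_mono) (auto simp: C_def algebra_simps)
    also have "r ^ K = 2 powr (- (real K * s))" using rj[of K] by simp
    finally show ?thesis by (simp only: norm[OF f] distrib_left)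
  qed
  ultimately show ?thesis using that[of C] mem by simp
qed

text \<open>The square root interpolates the two bounds \<open>exp (- heat_rate k * tbar) * norm (fourier f k) \<le> T_norm tbar f\<close>
  and \<open>norm (fourier f k) \<le> C * bnorm \<psi> p q f\<close> (up to polynomial weights); half of the exponential decay
  remains for summing over \<open>k\<close>.\<close>

lemma dapp_T_BH_interpolation:
  fixes \<psi> :: "real ^ 'd::finite \<Rightarrow> real"
  assumes c: "lp_cutoff \<psi>" and p: "1 \<le> p" and q: "1 \<le> q" and t: "tbar > 0" and a: "1 \<le> a"
  obtains C where "0 \<le> C"
    "\<And>f z. f \<in> besov \<psi> 0 (ennreal p) (ennreal q) \<Longrightarrow> z \<in> besov \<psi> (- real CARD('d) / 2) (ennreal a) \<top> \<Longrightarrow>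
       \<bar>dapp z (T_BH tbar f)\<bar> \<le> C * enn2real (besov_norm \<psi> (- real CARD('d) / 2) (ennreal a) \<top> z) * sqrt (T_norm tbar f * bnorm \<psi> p q f)"
proof -
  let ?d = "CARD('d)"
  let ?s = "\<lambda>n. exp (- heat_rate (freq n :: int ^ 'd) * (tbar / 2)) * wt (freq n :: int ^ 'd) ^ (?d + 2)"
  have sm: "summable ?s" by (rule summable_exp_heat_rate) (use t in simp)
  define C where "C = 2 * 2 ^ (?d + 1) * (\<Sum>n. ?s n)"
  have "0 \<le> C" unfolding C_def by (intro mult_nonneg_nonneg suminf_nonneg sm) (auto simp: wt_nonneg)
  moreover have "\<bar>dapp z (T_BH tbar f)\<bar> \<le> C * enn2real (besov_norm \<psi> (- real CARD('d) / 2) (ennreal a) \<top> z) * sqrt (T_norm tbar f * bnorm \<psi> p q f)"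
    if f: "f \<in> besov \<psi> 0 (ennreal p) (ennreal q)" and z: "z \<in> besov \<psi> (- real CARD('d) / 2) (ennreal a) \<top>" for f z
  proof -
    define Z where "Z = enn2real (besov_norm \<psi> (- real CARD('d) / 2) (ennreal a) \<top> z)"
    have Z0: "0 \<le> Z" by (simp add: Z_def)
    let ?n = "bnorm \<psi> p q f" and ?a = "T_norm tbar f"
    have zb: "norm (fourier z k) \<le> (2 * wt k) ^ (?d + 1) * Z" for k
    proof (rule fourier_le_wt[OF c a Z0])
      fix j
      have "bseq \<psi> (- real CARD('d) / 2) a z j \<le> Z"
        unfolding Z_def using a z by (intro bseq_le_besov_top) auto
      then have 1: "2 powr (real j * (real ?d / 2)) * bseq \<psi> (- real CARD('d) / 2) a z j \<le> 2 powr (real j * (real ?d / 2)) * Z"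
        by (intro mult_left_mono) auto
      have 2: "2 powr (real j * (real ?d / 2)) * bseq \<psi> (- real CARD('d) / 2) a z j = blk \<psi> a j z"
        by (simp add: bseq_def mult.assoc[symmetric] powr_add[symmetric])
      \<comment> \<open>The growth exponent is enlarged from \<open>?d / 2\<close> to the integer
        \<open>?d\<close>; the loss is a polynomial weight, harmless against the heat
        factor.\<close>
      have "2 powr (real j * (real ?d / 2)) \<le> 2 powr (real j * real ?d)" by simp
      then have 3: "2 powr (real j * (real ?d / 2)) * Z \<le> 2 powr (real j * real ?d) * Z" using Z0 by (rule mult_right_mono)
      have 4: "2 powr (real j * real ?d) = (2 ^ j) ^ ?d"
        by (simp add: powr_realpow[symmetric] powr_powr)
      show "blk \<psi> a j z \<le> (2 ^ j) ^ ?d * Z" using 1 3 unfolding 2 4 by (rule order_trans)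
    qed
    have "\<bar>dapp z (T_BH tbar f)\<bar> \<le> (\<Sum>n. 2 * 2 ^ (?d + 1) * Z * sqrt (?a * ?n) * ?s n)"
    proof (rule dapp_T_BH_le[OF t summable_mult[OF sm]])
      fix n
      let ?k = "freq n :: int ^ 'd"
      let ?e = "exp (- heat_rate ?k * tbar)" and ?h = "norm (fourier f ?k)"
      have "?e * ?h = sqrt (?e * ?h) * sqrt (?e * ?h)" by simp
      also have "\<dots> \<le> sqrt (2 * ?a) * sqrt (?e * (wt ?k * (2 * ?n)))"
        by (intro mult_mono real_sqrt_le_mono heat_coeff_le_T_norm t mult_left_mono fourier_le_bnorm c p q f) auto
      also have "\<dots> = 2 * sqrt (?a * ?n) * (sqrt ?e * sqrt (wt ?k))"
        by (simp add: real_sqrt_mult mult_ac)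
      also have "sqrt ?e = exp (- heat_rate ?k * (tbar / 2))"
        by (simp add: real_sqrt_unique power2_eq_square mult_exp_exp)
      \<comment> \<open>The root of the weight is replaced by the weight itself, since the summable
        majorant is stated for natural powers.\<close>
      also have "2 * sqrt (?a * ?n) * (exp (- heat_rate ?k * (tbar / 2)) * sqrt (wt ?k)) \<le> 2 * sqrt (?a * ?n) * (exp (- heat_rate ?k * (tbar / 2)) * wt ?k)"
      proof (intro mult_left_mono)
        have "wt ?k * 1 \<le> wt ?k * wt ?k" using wt_ge_1[of ?k] by (intro mult_left_mono) auto
        then show "sqrt (wt ?k) \<le> wt ?k" by (intro real_le_lsqrt) (auto simp: wt_nonneg power2_eq_square)
      qed auto
      finally have "norm (heat_coeff (fourier f) tbar ?k) \<le> 2 * sqrt (?a * ?n) * (exp (- heat_rate ?k * (tbar / 2)) * wt ?k)"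
        by (simp add: norm_heat_coeff)
      then have "norm (heat_coeff (fourier f) tbar ?k) * norm (fourier z ?k)
          \<le> (2 * sqrt (?a * ?n) * (exp (- heat_rate ?k * (tbar / 2)) * wt ?k)) * ((2 * wt ?k) ^ (?d + 1) * Z)"
        using zb[of ?k] by (intro mult_mono) (auto simp: wt_nonneg)
      then show "norm (heat_coeff (fourier f) tbar ?k) * norm (fourier z ?k) \<le> 2 * 2 ^ (?d + 1) * Z * sqrt (?a * ?n) * ?s n"
        by (simp add: power_mult_distrib mult_ac)
    qed
    also have "\<dots> = 2 * 2 ^ (?d + 1) * Z * sqrt (?a * ?n) * (\<Sum>n. ?s n)" by (rule suminf_mult[OF sm])
    finally show ?thesis by (simp add: C_def Z_def mult_ac)
  qed
  ultimately show ?thesis using that by blast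
qed

section \<open>Wavelet coefficients and the penalty\<close>

lemma lpn_cong: "(\<And>x. x \<in> space M \<Longrightarrow> u x = v x) \<Longrightarrow> lpn M p u = lpn M p v"
  unfolding lpn_def by (simp cong: Bochner_Integration.integral_cong)

text \<open>The tangent of the convex power at \<open>x\<close> lies below its graph. For
  \<open>y \<ge> x\<close> the left-hand side is nonpositive.\<close>

lemma powr_diff_le:
  fixes x y q :: real
  assumes q: "1 \<le> q" and x: "0 \<le> x" and y: "0 \<le> y"
  shows "x powr q - y powr q \<le> q * x powr (q - 1) * \<bar>x - y\<bar>"
proof (cases "y < x")
  case False
  then have "x powr q \<le> y powr q" using x q by (intro powr_mono2) auto
  moreover have "0 \<le> q * x powr (q - 1) * \<bar>x - y\<bar>" using q by simp
  ultimately show ?thesis by linarith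
next
  case True
  show ?thesis
  proof (cases "y = 0")
    case y0: True
    have "x powr q \<le> q * x powr q" using q mult_right_mono[of 1 q "x powr q"] by simp
    moreover have "x powr (q - 1) * x = x powr q" using True y0 by (simp add: powr_diff)
    ultimately show ?thesis using y0 True q by (simp add: mult.assoc)
  next
    case False
    then have y0: "0 < y" using y by simp
    have "\<exists>z>y. z < x \<and> x powr q - y powr q = (x - y) * (q * z powr (q - 1))"
      using y0 by (intro MVT2[OF True]) (auto intro!: derivative_eq_intros)
    then obtain z where z: "y < z" "z < x" "x powr q - y powr q = (x - y) * (q * z powr (q - 1))" by blast
    have "z powr (q - 1) \<le> x powr (q - 1)" using z y0 q by (intro powr_mono2) auto
    then have "(x - y) * (q * z powr (q - 1)) \<le> (x - y) * (q * x powr (q - 1))"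
      using True q by (intro mult_left_mono) auto
    then show ?thesis using z True by (simp add: mult_ac)
  qed
qed

text \<open>The level weight of the wavelet norm for finite \<open>p\<close>; the type argument
  supplies the dimension \<open>CARD('d)\<close>.\<close>

definition wwt :: "'d::finite itself \<Rightarrow> real \<Rightarrow> real \<Rightarrow> nat \<Rightarrow> real" where
  "wwt d s p j = 2 powr (real j * s) * 2 powr (real j * real CARD('d) * (1 / 2 - 1 / p))"

lemma wwt_pos [simp]: "0 < wwt d s p j"
  by (simp add: wwt_def)

lemma wwt_shift: "wwt d s p j = 2 powr (real j * s) * wwt d 0 p j"
  by (simp add: wwt_def)

definition wseq :: "'d::finite itself \<Rightarrow> (nat \<Rightarrow> 'l set) \<Rightarrow> real \<Rightarrow> real \<Rightarrow> (nat \<Rightarrow> 'l \<Rightarrow> real) \<Rightarrow> nat \<Rightarrow> real" where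
  "wseq d I s p c j = wwt d s p j * lpn (count_space (I j)) p (c j)"

lemma wseq_nonneg [simp]: "0 \<le> wseq d I s p c j"
  by (simp add: wseq_def less_imp_le)

lemma besov_seq_norm_wseq:
  assumes p: "0 < p" and c: "\<And>j. Lp_fun (count_space (I j)) p (c j)"
  shows "besov_seq_norm TYPE('d::finite) I s (ennreal p) q c
    = Lp_norm (count_space UNIV) q (\<lambda>j. ennreal \<bar>wseq TYPE('d) I s p c j\<bar>)"
  unfolding besov_seq_norm_def Lp_norm_eq_lpn[OF p c] recip_ennreal[OF p]
  by (simp add: wseq_def wwt_def ennreal_mult abs_mult mult.assoc[symmetric])

text \<open>The weights are positive, so a finite norm over the levels forces every level to be
  finite. This permits the passage from extended to real norms.\<close>

lemma besov_seq_norm_levels: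
  assumes p: "0 < p" and q: "q = \<top> \<or> (\<exists>r>0. q = ennreal r)"
    and fin: "besov_seq_norm TYPE('d::finite) I s (ennreal p) q c < \<top>"
  shows "Lp_fun (count_space (I j)) p (c j)"
proof -
  let ?w = "2 powr (real j * s) * 2 powr (real j * real CARD('d) * (1/2 - recip (ennreal p)))"
  have "ennreal ?w * Lp_norm (count_space (I j)) (ennreal p) (\<lambda>l. ennreal \<bar>c j l\<bar>) < \<top>"
    using Lp_norm_sequence_component[OF q fin[unfolded besov_seq_norm_def], of j] by simp
  moreover have "ennreal ?w \<noteq> 0" by simp
  ultimately have "Lp_norm (count_space (I j)) (ennreal p) (\<lambda>l. ennreal \<bar>c j l\<bar>) < \<top>"
    by (auto simp: ennreal_mult_less_top)
  then show ?thesis by (intro Lp_norm_less_top p) auto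
qed

lemma besov_seq_norm_finite:
  assumes p: "0 < p" and q: "0 < q" and fin: "besov_seq_norm TYPE('d::finite) I s (ennreal p) (ennreal q) c < \<top>"
  shows "lq_fun q (wseq TYPE('d) I s p c)"
    "besov_seq_norm TYPE('d) I s (ennreal p) (ennreal q) c = ennreal (lqn q (wseq TYPE('d) I s p c))"
proof -
  have c: "Lp_fun (count_space (I j)) p (c j)" for j
    by (rule besov_seq_norm_levels[OF p _ fin]) (use q in blast)
  note eq = besov_seq_norm_wseq[OF p c, where s = s and q = "ennreal q" and 'd = 'd]
  show l: "lq_fun q (wseq TYPE('d) I s p c)"
    using fin unfolding eq by (rule Lp_norm_less_top[OF q, rotated]) simp
  show "besov_seq_norm TYPE('d) I s (ennreal p) (ennreal q) c = ennreal (lqn q (wseq TYPE('d) I s p c))"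
    unfolding eq by (rule Lp_norm_eq_lpn[OF q l])
qed

lemma besov_seq_norm_finiteI:
  assumes p: "0 < p" and q: "0 < q" and c: "\<And>j. Lp_fun (count_space (I j)) p (c j)" and l: "lq_fun q (wseq TYPE('d::finite) I s p c)"
  shows "besov_seq_norm TYPE('d) I s (ennreal p) (ennreal q) c < \<top>"
  unfolding besov_seq_norm_wseq[OF p c] by (simp only: Lp_norm_eq_lpn[OF q l] ennreal_less_top)

section \<open>Wavelet coefficients and the wavelet norm of smoothness zero\<close>

locale besov_wavelets =
  fixes \<psi> :: "real ^ 'd::finite \<Rightarrow> real" and \<sigma> :: real and I :: "nat \<Rightarrow> 'l set"
    and \<phi> :: "nat \<Rightarrow> 'l \<Rightarrow> real ^ 'd \<Rightarrow> real" and p q :: real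
  assumes cutoff: "lp_cutoff \<psi>" and gen: "generates_besov \<psi> \<sigma> I \<phi>" and \<sigma>: "0 < \<sigma>"
    and p: "1 < p" "p \<le> 2" and q: "2 \<le> q"
begin

abbreviation X :: "'d distribution set" where
  "X \<equiv> besov \<psi> 0 (ennreal p) (ennreal q)"

abbreviation coef :: "'d distribution \<Rightarrow> nat \<Rightarrow> 'l \<Rightarrow> real" where
  "coef f j l \<equiv> pairing \<psi> f (\<phi> j l)"

abbreviation A :: "'d distribution \<Rightarrow> nat \<Rightarrow> real" where
  "A f \<equiv> wseq TYPE('d) I 0 p (coef f)"

definition wN :: "'d distribution \<Rightarrow> real" where
  "wN f = enn2real (wavelet_norm \<psi> I \<phi> 0 (ennreal p) (ennreal q) f)"

lemma pq: "0 < p" "1 \<le> p" "0 < q" "1 \<le> q"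
  using p q by auto

lemma ennreal_ge_1: "1 \<le> r \<Longrightarrow> 1 \<le> ennreal r"
  by (simp add: ennreal_le_iff[of r 1, symmetric] flip: ennreal_1)

lemma X_add: "f \<in> X \<Longrightarrow> g \<in> X \<Longrightarrow> f + g \<in> X"
  and X_diff: "f \<in> X \<Longrightarrow> g \<in> X \<Longrightarrow> f - g \<in> X"
  and X_scaleR: "f \<in> X \<Longrightarrow> a *\<^sub>R f \<in> X"
  using pq by (auto intro: besov_add besov_diff besov_scaleR)

lemma wavelet_norm_finite:
  assumes "f \<in> X" "\<bar>s\<bar> < \<sigma>" "1 \<le> r" "f \<in> besov \<psi> s (ennreal p) r"
  shows "wavelet_norm \<psi> I \<phi> s (ennreal p) r f < \<top>"
proof -
  have "f \<in> besov \<psi> 0 1 \<top>" using besov_imp_besov_1_top[OF pq(2,3) assms(1)] .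
  moreover have "\<bar>0\<bar> < \<sigma>" using \<sigma> by simp
  moreover have "1 \<le> ennreal p" by (rule ennreal_ge_1[OF pq(2)])
  ultimately show ?thesis
    using gen assms(2-4) unfolding generates_besov_def by blast
qed

lemma wavelet_norm_X_finite: "f \<in> X \<Longrightarrow> besov_seq_norm TYPE('d) I 0 (ennreal p) (ennreal q) (coef f) < \<top>"
  using wavelet_norm_finite[of f 0 "ennreal q"] \<sigma> ennreal_ge_1[OF pq(4)] by (simp add: wavelet_norm_def)

lemma
  assumes f: "f \<in> X"
  shows coef_Lp_fun: "Lp_fun (count_space (I j)) p (coef f j)"
    and A_lq_fun: "lq_fun q (A f)"
    and wN_eq: "wN f = lqn q (A f)"
proof -
  note fin = wavelet_norm_X_finite[OF f]
  show "Lp_fun (count_space (I j)) p (coef f j)"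
    by (rule besov_seq_norm_levels[OF pq(1) _ fin]) (use pq in blast)
  show "lq_fun q (A f)" by (rule besov_seq_norm_finite(1)[OF pq(1,3) fin])
  show "wN f = lqn q (A f)"
    unfolding wN_def wavelet_norm_def besov_seq_norm_finite(2)[OF pq(1,3) fin] by simp
qed

lemma wN_powr: "f \<in> X \<Longrightarrow> wN f powr q = (\<Sum>j. A f j powr q)"
  using lqn_powr[OF pq(3) A_lq_fun] by (simp add: wN_eq)

lemma A_summable: "f \<in> X \<Longrightarrow> summable (\<lambda>j. A f j powr q)"
  using A_lq_fun[of f] by (simp add: lq_fun_iff)

lemma wN_nonneg [simp]: "0 \<le> wN f"
  by (simp add: wN_def)

lemma equiv_wN: "besov_equiv_norm \<psi> 0 (ennreal p) (ennreal q) wN"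
  using gen \<sigma> ennreal_ge_1[OF pq(2)] ennreal_ge_1[OF pq(4)]
  unfolding generates_besov_def wN_def[abs_def] by fastforce

lemma coef_unique:
  assumes "f \<in> X" "besov_seq_norm TYPE('d) I 0 (ennreal p) (ennreal q) c < \<top>" "wavelet_expansion I \<phi> c f" "l \<in> I j"
  shows "c j l = coef f j l"
proof -
  have "\<bar>0\<bar> < \<sigma>" "1 \<le> ennreal p" "1 \<le> ennreal q"
    using \<sigma> ennreal_ge_1[OF pq(2)] ennreal_ge_1[OF pq(4)] by auto
  then have "\<forall>f\<in>X. \<forall>c. besov_seq_norm TYPE('d) I 0 (ennreal p) (ennreal q) c < \<top> \<longrightarrow> wavelet_expansion I \<phi> c f \<longrightarrow>
      (\<forall>j. \<forall>l\<in>I j. c j l = coef f j l)"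
    using gen unfolding generates_besov_def by blast
  with assms show ?thesis by blast
qed

lemma coef_expansion:
  assumes "f \<in> X"
  shows "wavelet_expansion I \<phi> (coef f) f"
proof -
  have "\<bar>0\<bar> < \<sigma>" "1 \<le> ennreal p" "1 \<le> ennreal q"
    using \<sigma> ennreal_ge_1[OF pq(2)] ennreal_ge_1[OF pq(4)] by auto
  then have "\<forall>f\<in>X. wavelet_expansion I \<phi> (coef f) f"
    using gen unfolding generates_besov_def by blast
  with assms show ?thesis by blast
qed

text \<open>The pairing is a limit, whose linearity would need convergence; linearity of the wavelet
  coefficients follows from uniqueness of the expansion instead.\<close>

lemma coef_add:
  assumes f: "f \<in> X" and g: "g \<in> X" and l: "l \<in> I j"
  shows "coef (f + g) j l = coef f j l + coef g j l"
proof -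
  let ?c = "\<lambda>j l. coef f j l + coef g j l"
  have lp: "Lp_fun (count_space (I j)) p (?c j)" for j
    using pq by (intro Lp_fun_add coef_Lp_fun f g) auto
  have s: "lq_fun q (\<lambda>j. A f j + A g j)"
    using pq by (intro Lp_fun_add A_lq_fun f g) auto
  have "lq_fun q (wseq TYPE('d) I 0 p ?c)"
  proof (rule Lp_fun_mono[OF s])
    fix j
    have "lpn (count_space (I j)) p (?c j) \<le> lpn (count_space (I j)) p (coef f j) + lpn (count_space (I j)) p (coef g j)"
      by (intro lpn_add pq coef_Lp_fun f g)
    then show "\<bar>wseq TYPE('d) I 0 p ?c j\<bar> \<le> \<bar>A f j + A g j\<bar>"
      by (simp add: wseq_def distrib_left[symmetric] abs_mult mult_left_mono less_imp_le)
  qed (use pq in auto)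
  then have fin: "besov_seq_norm TYPE('d) I 0 (ennreal p) (ennreal q) ?c < \<top>"
    by (rule besov_seq_norm_finiteI[OF pq(1,3) lp])
  have "wavelet_expansion I \<phi> ?c (f + g)"
    unfolding wavelet_expansion_def
  proof (intro allI impI)
    fix \<eta> :: "real ^ 'd \<Rightarrow> real" assume t: "test_function \<eta>"
    let ?h = "\<lambda>f. \<lambda>(j, l). coef f j l * dapp (regular_distribution (\<phi> j l)) \<eta>"
    have "(?h f has_sum dapp f \<eta>) (SIGMA j:UNIV. I j)" "(?h g has_sum dapp g \<eta>) (SIGMA j:UNIV. I j)"
      using coef_expansion[OF f] coef_expansion[OF g] t unfolding wavelet_expansion_def by blast+
    then have "((\<lambda>x. ?h f x + ?h g x) has_sum (dapp f \<eta> + dapp g \<eta>)) (SIGMA j:UNIV. I j)"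
      by (rule has_sum_add)
    moreover have "(\<lambda>x. ?h f x + ?h g x) = (\<lambda>(j, l). ?c j l * dapp (regular_distribution (\<phi> j l)) \<eta>)"
      by (auto simp: fun_eq_iff distrib_right)
    ultimately show "((\<lambda>(j, l). ?c j l * dapp (regular_distribution (\<phi> j l)) \<eta>) has_sum dapp (f + g) \<eta>) (SIGMA j:UNIV. I j)"
      by (simp add: dapp_simps)
  qed
  from coef_unique[OF X_add[OF f g] fin this l] show ?thesis by simp
qed

lemma coef_scaleR:
  assumes f: "f \<in> X" and l: "l \<in> I j"
  shows "coef (a *\<^sub>R f) j l = a * coef f j l"
proof -
  let ?c = "\<lambda>j l. a * coef f j l"
  have lp: "Lp_fun (count_space (I j)) p (?c j)" for j
    by (intro Lp_fun_cmult coef_Lp_fun f)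
  have "wseq TYPE('d) I 0 p ?c = (\<lambda>j. \<bar>a\<bar> * A f j)"
    by (simp add: fun_eq_iff wseq_def lpn_cmult pq)
  then have "lq_fun q (wseq TYPE('d) I 0 p ?c)" using Lp_fun_cmult[OF A_lq_fun[OF f]] by simp
  then have fin: "besov_seq_norm TYPE('d) I 0 (ennreal p) (ennreal q) ?c < \<top>"
    by (rule besov_seq_norm_finiteI[OF pq(1,3) lp])
  have "wavelet_expansion I \<phi> ?c (a *\<^sub>R f)"
    unfolding wavelet_expansion_def
  proof (intro allI impI)
    fix \<eta> :: "real ^ 'd \<Rightarrow> real" assume t: "test_function \<eta>"
    let ?h = "\<lambda>f. \<lambda>(j, l). coef f j l * dapp (regular_distribution (\<phi> j l)) \<eta>"
    have "(?h f has_sum dapp f \<eta>) (SIGMA j:UNIV. I j)"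
      using coef_expansion[OF f] t unfolding wavelet_expansion_def by blast
    then have "((\<lambda>x. a * ?h f x) has_sum (a * dapp f \<eta>)) (SIGMA j:UNIV. I j)"
      by (rule has_sum_cmult_right)
    moreover have "(\<lambda>x. a * ?h f x) = (\<lambda>(j, l). ?c j l * dapp (regular_distribution (\<phi> j l)) \<eta>)"
      by (auto simp: fun_eq_iff)
    ultimately show "((\<lambda>(j, l). ?c j l * dapp (regular_distribution (\<phi> j l)) \<eta>) has_sum dapp (a *\<^sub>R f) \<eta>) (SIGMA j:UNIV. I j)"
      by (simp add: dapp_simps)
  qed
  from coef_unique[OF X_scaleR[OF f] fin this l] show ?thesis by simp
qed

lemma coef_diff:
  assumes f: "f \<in> X" and g: "g \<in> X" and l: "l \<in> I j"
  shows "coef (f - g) j l = coef f j l - coef g j l"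
  using coef_add[OF f X_scaleR[OF g, of "-1"] l] coef_scaleR[OF g l, of "-1"] by simp

text \<open>The constant of \<open>lpn_uniformly_convex\<close>.\<close>

definition \<kappa> :: real where
  "\<kappa> = p * (p - 1) / 8 * 2 powr (p - q)"

lemma \<kappa>_pos: "0 < \<kappa>"
  using p by (simp add: \<kappa>_def)

text \<open>Within each level the inequality is already one between \<open>q\<close>-th powers of
  norms, so multiplying by the weights and adding up over the levels preserves the constant.\<close>

lemma wN_uniformly_convex:
  assumes f: "f \<in> X" and g: "g \<in> X"
  shows "wN ((1 / 2) *\<^sub>R (f + g)) powr q + \<kappa> * wN (f - g) powr q \<le> (wN f powr q + wN g powr q) / 2"
proof -
  have mX: "(1 / 2) *\<^sub>R (f + g) \<in> X" and dX: "f - g \<in> X"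
    by (intro X_scaleR X_add X_diff f g)+
  have le: "A ((1 / 2) *\<^sub>R (f + g)) j powr q + \<kappa> * A (f - g) j powr q \<le> (A f j powr q + A g j powr q) / 2" for j
  proof -
    let ?M = "count_space (I j)" and ?w = "wwt TYPE('d) 0 p j"
    have "lpn ?M p (coef ((1 / 2) *\<^sub>R (f + g)) j) = lpn ?M p (\<lambda>l. (coef f j l + coef g j l) / 2)"
      by (rule lpn_cong) (simp add: coef_scaleR coef_add X_add f g)
    moreover have "lpn ?M p (coef (f - g) j) = lpn ?M p (\<lambda>l. coef f j l - coef g j l)"
      by (rule lpn_cong) (simp add: coef_diff f g)
    ultimately have "lpn ?M p (coef ((1 / 2) *\<^sub>R (f + g)) j) powr q + \<kappa> * lpn ?M p (coef (f - g) j) powr q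
      \<le> (lpn ?M p (coef f j) powr q + lpn ?M p (coef g j) powr q) / 2"
      unfolding \<kappa>_def using lpn_uniformly_convex[OF p q coef_Lp_fun[OF f, of j] coef_Lp_fun[OF g, of j]] by simp
    from mult_left_mono[OF this, of "?w powr q"] show ?thesis
      by (simp add: wseq_def powr_mult algebra_simps)
  qed
  have "wN ((1 / 2) *\<^sub>R (f + g)) powr q + \<kappa> * wN (f - g) powr q = (\<Sum>j. A ((1 / 2) *\<^sub>R (f + g)) j powr q + \<kappa> * A (f - g) j powr q)"
    unfolding wN_powr[OF mX] wN_powr[OF dX]
    by (subst suminf_add[symmetric]) (auto intro!: summable_mult A_summable mX dX simp: suminf_mult A_summable dX)
  also have "\<dots> \<le> (\<Sum>j. (A f j powr q + A g j powr q) / 2)"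
    by (intro suminf_le le summable_add summable_mult summable_divide A_summable mX dX f g)
  also have "\<dots> = (wN f powr q + wN g powr q) / 2"
    unfolding wN_powr[OF f] wN_powr[OF g]
    by (subst suminf_divide) (auto intro!: summable_add A_summable f g simp: suminf_add A_summable f g)
  finally show ?thesis .
qed

text \<open>The tangent inequality is applied level by level. Smoothness of \<open>f0\<close> gives
  \<open>A f0 j \<le> P * 2 powr (- (real j * s))\<close>; its power \<open>q - 1\<close> supplies
  the weight that turns \<open>A (f - f0) j\<close> into a norm of smoothness
  \<open>- (s * (q - 1))\<close> with summation index 1.\<close>

lemma penalty_difference:
  fixes s :: real
  assumes s: "0 < s" "s * (q - 1) < \<sigma>" and f0: "f0 \<in> X" "f0 \<in> besov \<psi> s (ennreal p) \<top>" and f: "f \<in> X"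
    and h: "f - f0 \<in> besov \<psi> (- (s * (q - 1))) (ennreal p) 1"
  shows "wN f0 powr q - wN f powr q \<le> q * enn2real (wavelet_norm \<psi> I \<phi> s (ennreal p) \<top> f0) powr (q - 1)
     * enn2real (wavelet_norm \<psi> I \<phi> (- (s * (q - 1))) (ennreal p) 1 (f - f0))"
proof -
  let ?t = "s * (q - 1)" and ?h = "f - f0"
  have t0: "0 < ?t" using s q by simp
  have "s * 1 \<le> ?t" using s q by (intro mult_left_mono) auto
  then have "s < \<sigma>" using s(2) by linarith
  then have s\<sigma>: "\<bar>s\<bar> < \<sigma>" "\<bar>- ?t\<bar> < \<sigma>" using s t0 by auto
  have hX: "?h \<in> X" by (rule X_diff[OF f f0(1)])
  define P where "P = enn2real (wavelet_norm \<psi> I \<phi> s (ennreal p) \<top> f0)"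
  have P0: "0 \<le> P" by (simp add: P_def)
  have Pj: "2 powr (real j * s) * A f0 j \<le> P" for j
  proof -
    have fin: "besov_seq_norm TYPE('d) I s (ennreal p) \<top> (coef f0) < \<top>"
      using wavelet_norm_finite[OF f0(1) s\<sigma>(1) _ f0(2)] by (simp add: wavelet_norm_def)
    have "ennreal \<bar>wseq TYPE('d) I s p (coef f0) j\<bar> \<le> besov_seq_norm TYPE('d) I s (ennreal p) \<top> (coef f0)"
      unfolding besov_seq_norm_wseq[OF pq(1) coef_Lp_fun[OF f0(1)]]
      by (rule Lp_norm_top_ge[of j UNIV "\<lambda>j. ennreal \<bar>wseq TYPE('d) I s p (coef f0) j\<bar>"]) simp
    then have "wseq TYPE('d) I s p (coef f0) j \<le> P"
      unfolding P_def wavelet_norm_def using fin by (metis abs_of_nonneg wseq_nonneg enn2real_ennreal enn2real_mono)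
    then show ?thesis by (simp add: wseq_def wwt_shift[of _ s] mult.assoc)
  qed
  have hfin: "besov_seq_norm TYPE('d) I (- ?t) (ennreal p) (ennreal 1) (coef ?h) < \<top>"
    using wavelet_norm_finite[OF hX s\<sigma>(2), of "ennreal 1"] h by (simp add: wavelet_norm_def)
  define B where "B = wseq TYPE('d) I (- ?t) p (coef ?h)"
  have B: "B j = 2 powr (- (real j * ?t)) * A ?h j" for j
    by (simp add: B_def wseq_def wwt_shift[of _ "- ?t"])
  have lB: "lq_fun 1 B" unfolding B_def by (rule besov_seq_norm_finite(1)[OF pq(1) _ hfin]) simp
  have B0: "0 \<le> B j" for j by (simp add: B_def)
  have sB: "summable B" using lB B0 by (simp add: lq_fun_iff)
  have "lqn 1 B powr 1 = (\<Sum>j. \<bar>B j\<bar> powr 1)" by (rule lqn_powr[OF _ lB]) simp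
  then have "lqn 1 B = (\<Sum>j. B j)" using B0 by simp
  moreover have "enn2real (wavelet_norm \<psi> I \<phi> (- ?t) (ennreal p) (ennreal 1) ?h) = lqn 1 B"
    unfolding wavelet_norm_def B_def by (subst besov_seq_norm_finite(2)[OF pq(1) _ hfin]) simp_all
  ultimately have Bsum: "enn2real (wavelet_norm \<psi> I \<phi> (- ?t) (ennreal p) 1 ?h) = (\<Sum>j. B j)" by simp
  have le: "A f0 j powr q - A f j powr q \<le> q * P powr (q - 1) * B j" for j
  proof -
    let ?M = "count_space (I j)"
    have "\<bar>A f0 j - A f j\<bar> \<le> A ?h j"
    proof -
      have "\<bar>lpn ?M p (coef f0 j) - lpn ?M p (coef f j)\<bar> \<le> lpn ?M p (\<lambda>l. coef f0 j l - coef f j l)"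
        by (intro lpn_abs_diff pq coef_Lp_fun f0 f)
      also have "\<dots> = lpn ?M p (\<lambda>l. coef f j l - coef f0 j l)" by (rule lpn_minus)
      also have "\<dots> = lpn ?M p (coef ?h j)" by (rule lpn_cong) (simp add: coef_diff f f0)
      finally have "wwt TYPE('d) 0 p j * \<bar>lpn ?M p (coef f0 j) - lpn ?M p (coef f j)\<bar> \<le> A ?h j"
        unfolding wseq_def by (rule mult_left_mono) (simp add: less_imp_le)
      then show ?thesis
        by (simp add: wseq_def right_diff_distrib[symmetric] abs_mult less_imp_le)
    qed
    then have "q * A f0 j powr (q - 1) * \<bar>A f0 j - A f j\<bar> \<le> q * A f0 j powr (q - 1) * A ?h j"
      using q by (intro mult_left_mono) auto
    moreover have "A f0 j powr q - A f j powr q \<le> q * A f0 j powr (q - 1) * \<bar>A f0 j - A f j\<bar>"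
      using q by (intro powr_diff_le) auto
    moreover have "A f0 j powr (q - 1) \<le> P powr (q - 1) * 2 powr (- (real j * ?t))"
    proof -
      have "A f0 j \<le> P * 2 powr (- (real j * s))"
        using Pj[of j] by (simp add: powr_minus field_simps)
      then have "A f0 j powr (q - 1) \<le> (P * 2 powr (- (real j * s))) powr (q - 1)"
        using q by (intro powr_mono2) auto
      then show ?thesis by (simp add: powr_mult powr_powr mult_ac)
    qed
    then have "q * A f0 j powr (q - 1) * A ?h j \<le> q * (P powr (q - 1) * 2 powr (- (real j * ?t))) * A ?h j"
      using q by (intro mult_right_mono mult_left_mono) auto
    ultimately show ?thesis by (simp add: B mult_ac)
  qed
  have "wN f0 powr q - wN f powr q = (\<Sum>j. A f0 j powr q - A f j powr q)"
    unfolding wN_powr[OF f0(1)] wN_powr[OF f] by (rule suminf_diff[OF A_summable[OF f0(1)] A_summable[OF f]])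
  also have "\<dots> \<le> (\<Sum>j. q * P powr (q - 1) * B j)"
    by (intro suminf_le le summable_diff summable_mult A_summable f f0 sB)
  also have "\<dots> = q * P powr (q - 1) * (\<Sum>j. B j)" by (rule suminf_mult[OF sB])
  finally show ?thesis unfolding Bsum P_def .
qed

end

section \<open>Minimizers\<close>

lemma besov_equiv_normD:
  assumes "besov_equiv_norm \<psi> s p q N"
  shows "\<And>f g. f \<in> besov \<psi> s p q \<Longrightarrow> g \<in> besov \<psi> s p q \<Longrightarrow> N (f + g) \<le> N f + N g"
    and "\<And>f a. f \<in> besov \<psi> s p q \<Longrightarrow> N (a *\<^sub>R f) = \<bar>a\<bar> * N f"
    and "\<exists>c>0. \<exists>C>0. \<forall>f\<in>besov \<psi> s p q. c * enn2real (besov_norm \<psi> s p q f) \<le> N f \<and> N f \<le> C * enn2real (besov_norm \<psi> s p q f)"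
  using assms by (auto simp: besov_equiv_norm_def)

lemma is_arg_min_le:
  fixes f :: "'a \<Rightarrow> real"
  shows "is_arg_min f P x \<longleftrightarrow> P x \<and> (\<forall>y. P y \<longrightarrow> f x \<le> f y)"
  by (auto simp: is_arg_min_def not_less)

lemma T_norm_mid:
  fixes f g :: "'d::finite distribution"
  assumes t: "tbar > 0"
  shows "(T_norm tbar ((1/2) *\<^sub>R (f + g)))\<^sup>2 \<le> ((T_norm tbar f)\<^sup>2 + (T_norm tbar g)\<^sup>2) / 2"
proof -
  have c: "continuous_on UNIV (T_BH tbar h)" for h :: "'d distribution"
    by (rule test_function_continuous[OF test_function_T_BH[OF t]])
  have i: "integrable torus (\<lambda>x. (T_BH tbar h x)\<^sup>2)" for h :: "'d distribution"
    by (intro integrable_torus continuous_intros c)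
  have "(\<integral>x. (T_BH tbar ((1/2) *\<^sub>R (f + g)) x)\<^sup>2 \<partial>torus) \<le> (\<integral>x. ((T_BH tbar f x)\<^sup>2 + (T_BH tbar g x)\<^sup>2) / 2 \<partial>torus)"
  proof (rule integral_mono[OF i])
    show "integrable torus (\<lambda>x. ((T_BH tbar f x)\<^sup>2 + (T_BH tbar g x)\<^sup>2) / 2)"
      using i by simp
    fix x
    have "((u + v) / 2)\<^sup>2 \<le> (u\<^sup>2 + v\<^sup>2) / 2" for u v :: real
      using zero_le_power2[of "u - v"] by (simp add: power2_eq_square field_simps)
    then show "(T_BH tbar ((1/2) *\<^sub>R (f + g)) x)\<^sup>2 \<le> ((T_BH tbar f x)\<^sup>2 + (T_BH tbar g x)\<^sup>2) / 2"
      by (simp add: T_BH_scaleR[OF t] T_BH_add[OF t])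
  qed
  then show ?thesis using i by (simp add: T_norm_square[OF t])
qed

lemma dapp_T_BH_linear:
  assumes t: "tbar > 0"
  shows "dapp z (T_BH tbar (f + g)) = dapp z (T_BH tbar f) + dapp z (T_BH tbar g)"
    and "dapp z (T_BH tbar (a *\<^sub>R f)) = a * dapp z (T_BH tbar f)"
proof -
  have "T_BH tbar (f + g) = (\<lambda>x. T_BH tbar f x + T_BH tbar g x)" "T_BH tbar (a *\<^sub>R f) = (\<lambda>x. a * T_BH tbar f x)"
    by (simp_all add: fun_eq_iff T_BH_add[OF t] T_BH_scaleR[OF t])
  then show "dapp z (T_BH tbar (f + g)) = dapp z (T_BH tbar f) + dapp z (T_BH tbar g)"
    "dapp z (T_BH tbar (a *\<^sub>R f)) = a * dapp z (T_BH tbar f)"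
    by (simp_all add: dapp_add dapp_cmult test_function_T_BH[OF t])
qed

lemma Lp_fun_T_BH: "tbar > 0 \<Longrightarrow> Lp_fun torus 2 (T_BH tbar f)"
  by (intro Lp_fun_torus test_function_continuous test_function_T_BH) auto

context besov_wavelets
begin

lemma wN_seminorm:
  assumes "f \<in> X"
  shows "g \<in> X \<Longrightarrow> wN (f + g) \<le> wN f + wN g" "wN (a *\<^sub>R f) = \<bar>a\<bar> * wN f"
  using besov_equiv_normD[OF equiv_wN] assms by auto

lemma equiv_norm_bnorm:
  assumes "besov_equiv_norm \<psi> 0 (ennreal p) (ennreal q) N"
  obtains c C where "0 < c" "0 < C" "\<And>f. f \<in> X \<Longrightarrow> c * bnorm \<psi> p q f \<le> N f" "\<And>f. f \<in> X \<Longrightarrow> N f \<le> C * bnorm \<psi> p q f"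
proof -
  obtain c C where "0 < c" "0 < C"
    "\<forall>f\<in>X. c * enn2real (besov_norm \<psi> 0 (ennreal p) (ennreal q) f) \<le> N f \<and> N f \<le> C * enn2real (besov_norm \<psi> 0 (ennreal p) (ennreal q) f)"
    using besov_equiv_normD(3)[OF assms] by blast
  then show ?thesis
    using that[of c C] by (simp add: besov_norm_eq[OF pq(1,3)])
qed

lemma wN_minus_commute: "f \<in> X \<Longrightarrow> g \<in> X \<Longrightarrow> wN (f - g) = wN (g - f)"
  using wN_seminorm(2)[OF X_diff, of f g "-1"] by simp

lemma penalty_wN: "penalty \<psi> I \<phi> p q q f = 1 / q * wN f powr q"
  by (simp add: penalty_def wN_def)

text \<open>The minimizing sequence converges in norm, and all three parts of the functional are
  continuous with respect to it; closedness of \<open>D\<close> keeps the limit admissible.\<close>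

theorem minimizer_exists:
  assumes t: "tbar > 0" and \<alpha>: "0 < \<alpha>" and D: "D \<subseteq> X" "D \<noteq> {}" "convex D" "besov_closed \<psi> 0 (ennreal p) (ennreal q) D"
  shows "\<exists>f. is_arg_min (tikhonov tbar \<alpha> (penalty \<psi> I \<phi> p q q) g) (\<lambda>f. f \<in> D) f"
proof -
  define J where "J = tikhonov tbar \<alpha> (penalty \<psi> I \<phi> p q q) g"
  have J: "J f = 1/2 * (T_norm tbar f)\<^sup>2 - dapp g (T_BH tbar f) + \<alpha> / q * wN f powr q" for f
    by (simp add: J_def tikhonov_def penalty_wN T_norm_square[OF t])
  obtain c1 C1 where c1: "0 < c1" "0 < C1" "\<And>f. f \<in> X \<Longrightarrow> c1 * bnorm \<psi> p q f \<le> wN f" "\<And>f. f \<in> X \<Longrightarrow> wN f \<le> C1 * bnorm \<psi> p q f"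
    using equiv_norm_bnorm[OF equiv_wN] by blast
  obtain Cg where Cg: "0 \<le> Cg" "\<And>f. f \<in> X \<Longrightarrow> \<bar>dapp g (T_BH tbar f)\<bar> \<le> Cg * bnorm \<psi> p q f"
    using dapp_T_BH_bounded[OF cutoff pq(2,4) t] by blast
  obtain CT where CT: "0 \<le> CT" "\<And>f x. f \<in> X \<Longrightarrow> \<bar>T_BH tbar f x\<bar> \<le> CT * bnorm \<psi> p q f"
    using T_BH_bounded[OF cutoff pq(2,4) t] by blast
  define b where "b = Cg / c1"
  have b0: "0 \<le> b" using Cg c1 by (simp add: b_def)
  \<comment> \<open>Boundedness from below. Where \<open>wN f\<close> is at least 1 the power
    \<open>q\<close> dominates the square, and completing the square bounds the functional;
    elsewhere the linear term is at most \<open>b\<close>.\<close>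
  have lower: "- (b + q * b\<^sup>2 / (4 * \<alpha>)) \<le> J f" if f: "f \<in> X" for f
  proof -
    have "bnorm \<psi> p q f \<le> wN f / c1" using c1(1) c1(3)[OF f] by (simp add: field_simps)
    then have "Cg * bnorm \<psi> p q f \<le> Cg * (wN f / c1)" using Cg(1) by (rule mult_left_mono)
    then have "\<bar>dapp g (T_BH tbar f)\<bar> \<le> b * wN f" using Cg(2)[OF f] by (simp add: b_def)
    then have 1: "\<alpha> / q * wN f powr q - b * wN f \<le> J f" using zero_le_power2[of "T_norm tbar f"] unfolding J by linarith
    have "- (b + q * b\<^sup>2 / (4 * \<alpha>)) \<le> \<alpha> / q * wN f powr q - b * wN f"
    proof (cases "1 \<le> wN f")
      case True
      then have "(wN f)\<^sup>2 \<le> wN f powr q" using powr_mono[of 2 q "wN f"] q by simp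
      then have "\<alpha> / q * (wN f)\<^sup>2 \<le> \<alpha> / q * wN f powr q" using \<alpha> q by (intro mult_left_mono) auto
      moreover have "- (q * b\<^sup>2 / (4 * \<alpha>)) \<le> \<alpha> / q * (wN f)\<^sup>2 - b * wN f"
      proof -
        have "0 \<le> \<alpha> / q * (wN f - q * b / (2 * \<alpha>))\<^sup>2" using \<alpha> q by simp
        also have "\<dots> = \<alpha> / q * (wN f)\<^sup>2 - b * wN f + q * b\<^sup>2 / (4 * \<alpha>)"
          using \<alpha> q by (simp add: power2_eq_square field_simps)
        finally show ?thesis by linarith
      qed
      ultimately show ?thesis using b0 by linarith
    next
      case False
      then have "b * wN f \<le> b" using b0 mult_left_mono[of "wN f" 1 b] by simp
      moreover have "0 \<le> \<alpha> / q * wN f powr q" "0 \<le> q * b\<^sup>2 / (4 * \<alpha>)" using \<alpha> q by auto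
      ultimately show ?thesis by linarith
    qed
    with 1 show ?thesis by linarith
  qed
  define m where "m = Inf (J ` D)"
  have bdd: "bdd_below (J ` D)" using lower D(1) by (intro bdd_belowI[of _ "- (b + q * b\<^sup>2 / (4 * \<alpha>))"]) auto
  have m: "m \<le> J f" if "f \<in> D" for f unfolding m_def using that bdd by (intro cINF_lower)
  have "\<exists>f\<in>D. J f < m + 1 / real (Suc n)" for n
    using cInf_lessD[of "J ` D" "m + 1 / real (Suc n)"] D(2) by (auto simp: m_def)
  then obtain F where F: "\<And>n. F n \<in> D" "\<And>n. J (F n) < m + 1 / real (Suc n)" by metis
  have FX: "F n \<in> X" for n using F(1) D(1) by blast
  \<comment> \<open>The data part is midpoint convex, and the penalty contributes the gain; the
    value at the midpoint is at least the infimum \<open>m\<close>.\<close>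
  have mid: "\<alpha> * \<kappa> / q * wN (f - h) powr q \<le> (J f + J h) / 2 - m" if f: "f \<in> D" and h: "h \<in> D" for f h
  proof -
    let ?m = "(1/2) *\<^sub>R (f + h)"
    have "(1/2) *\<^sub>R f + (1/2) *\<^sub>R h \<in> D" using D(3) f h by (intro convexD) auto
    then have "m \<le> J ?m" by (intro m) (simp add: scaleR_add_right)
    moreover have "(T_norm tbar ?m)\<^sup>2 \<le> ((T_norm tbar f)\<^sup>2 + (T_norm tbar h)\<^sup>2) / 2" by (rule T_norm_mid[OF t])
    moreover have "dapp g (T_BH tbar ?m) = (dapp g (T_BH tbar f) + dapp g (T_BH tbar h)) / 2"
      by (simp only: dapp_T_BH_linear[OF t])
    moreover have "\<alpha> / q * wN ?m powr q + \<alpha> * \<kappa> / q * wN (f - h) powr q \<le> (\<alpha> / q * wN f powr q + \<alpha> / q * wN h powr q) / 2"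
    proof -
      have "f \<in> X" "h \<in> X" using f h D(1) by auto
      from mult_left_mono[OF wN_uniformly_convex[OF this], of "\<alpha> / q"] show ?thesis
        using \<alpha> q by (simp add: algebra_simps)
    qed
    moreover have "k \<le> (1/2 * A - z1 + w1 + (1/2 * B - z2 + w2)) / 2 - n"
      if "n \<le> 1/2 * M - Z + W" "M \<le> (A + B) / 2" "Z = (z1 + z2) / 2" "W + k \<le> (w1 + w2) / 2"
      for k A B z1 z2 w1 w2 n M Z W :: real
      using that by argo
    ultimately show ?thesis unfolding J by blast
  qed
  have cauchy: "\<exists>N. \<forall>m\<ge>N. \<forall>n\<ge>N. bnorm \<psi> p q (F m - F n) < e" if e: "0 < e" for e
  proof -
    define k where "k = \<alpha> * \<kappa> / q"
    have k: "0 < k" using \<alpha> \<kappa>_pos q by (simp add: k_def)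
    have "0 < k * (c1 * e) powr q" using k c1 e by simp
    then obtain N where N: "1 / real (Suc N) < k * (c1 * e) powr q"
      by (rule nat_approx_posE)
    have "bnorm \<psi> p q (F i - F j) < e" if ij: "i \<ge> N" "j \<ge> N" for i j
    proof -
      have "1 / real (Suc i) \<le> 1 / real (Suc N)" "1 / real (Suc j) \<le> 1 / real (Suc N)"
        using ij by (auto simp: frac_le)
      then have "k * wN (F i - F j) powr q < k * (c1 * e) powr q"
        using mid[OF F(1) F(1), of i j, folded k_def] F(2)[of i] F(2)[of j] N by argo
      then have "wN (F i - F j) powr q < (c1 * e) powr q" using k by simp
      then have "wN (F i - F j) < c1 * e"
        using powr_mono2[of q "c1 * e" "wN (F i - F j)"] mult_pos_pos[OF c1(1) e] pq(3) by fastforce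
      then have "c1 * bnorm \<psi> p q (F i - F j) < c1 * e" using c1(3)[OF X_diff[OF FX FX], of i j] by linarith
      then show ?thesis using c1(1) by simp
    qed
    then show ?thesis by blast
  qed
  obtain f where f: "f \<in> X" "(\<lambda>n. bnorm \<psi> p q (F n - f)) \<longlonglongrightarrow> 0"
    using besov_complete[OF cutoff pq(2,4) FX cauchy] by blast
  have dX: "F n - f \<in> X" for n by (intro X_diff FX f)
  have "(\<lambda>n. besov_norm \<psi> 0 (ennreal p) (ennreal q) (F n - f)) \<longlonglongrightarrow> 0"
    using tendsto_ennrealI[OF f(2)] besov_norm_eq[OF pq(1,3) dX] by simp
  then have fD: "f \<in> D" using D(4) F(1) f(1) unfolding besov_closed_def by blast
  have lim0: "(\<lambda>n. C * bnorm \<psi> p q (F n - f)) \<longlonglongrightarrow> 0" for C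
    using tendsto_mult_left[OF f(2), of C] by simp
  have "(\<lambda>n. T_norm tbar (F n)) \<longlonglongrightarrow> T_norm tbar f"
  proof (rule LIM_zero_cancel, rule Lim_null_comparison[OF always_eventually lim0[of CT]], rule allI)
    fix n
    have "\<bar>T_norm tbar (F n) - T_norm tbar f\<bar> \<le> lpn torus 2 (\<lambda>x. T_BH tbar (F n) x - T_BH tbar f x)"
      by (intro lpn_abs_diff Lp_fun_T_BH t) simp
    also have "\<dots> = T_norm tbar (F n - f)" by (simp add: T_BH_diff[OF t, abs_def])
    also have "\<dots> \<le> CT * bnorm \<psi> p q (F n - f)"
      by (intro lpn_const_le test_function_continuous test_function_T_BH t CT dX) simp
    finally show "norm (T_norm tbar (F n) - T_norm tbar f) \<le> CT * bnorm \<psi> p q (F n - f)" by simp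
  qed
  moreover have "(\<lambda>n. dapp g (T_BH tbar (F n))) \<longlonglongrightarrow> dapp g (T_BH tbar f)"
  proof (rule LIM_zero_cancel, rule Lim_null_comparison[OF always_eventually lim0[of Cg]], rule allI)
    fix n
    have "dapp g (T_BH tbar (F n)) - dapp g (T_BH tbar f) = dapp g (T_BH tbar (F n - f))"
      using dapp_T_BH_linear(1)[OF t, of g "F n - f" f] by simp
    then show "norm (dapp g (T_BH tbar (F n)) - dapp g (T_BH tbar f)) \<le> Cg * bnorm \<psi> p q (F n - f)"
      using Cg(2)[OF dX, of n] by simp
  qed
  moreover have wlim: "(\<lambda>n. wN (F n)) \<longlonglongrightarrow> wN f"
  proof (rule LIM_zero_cancel, rule Lim_null_comparison[OF always_eventually lim0[of C1]], rule allI)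
    fix n
    have "wN (F n) \<le> wN (F n - f) + wN f" using wN_seminorm(1)[OF dX f(1), of n] by simp
    moreover have "wN f \<le> wN (f - F n) + wN (F n)" using wN_seminorm(1)[OF X_diff[OF f(1) FX] FX, of n n] by simp
    ultimately show "norm (wN (F n) - wN f) \<le> C1 * bnorm \<psi> p q (F n - f)"
      using wN_minus_commute[OF f(1) FX, of n] c1(4)[OF dX, of n] by simp
  qed
  then have "(\<lambda>n. wN (F n) powr q) \<longlonglongrightarrow> wN f powr q"
    using pq by (intro tendsto_powr'[OF wlim tendsto_const]) auto
  ultimately have "(\<lambda>n. J (F n)) \<longlonglongrightarrow> J f"
    unfolding J by (intro tendsto_add tendsto_diff tendsto_mult tendsto_power tendsto_const)
  moreover have "(\<lambda>n. m + 1 / real (Suc n)) \<longlonglongrightarrow> m + 0"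
    by (intro tendsto_intros LIMSEQ_Suc lim_1_over_n)
  ultimately have "J f \<le> m + 0"
    by (rule LIMSEQ_le) (use F(2) in \<open>auto intro: less_imp_le\<close>)
  then have "is_arg_min J (\<lambda>f. f \<in> D) f"
    unfolding is_arg_min_le using fD m by fastforce
  then show ?thesis unfolding J_def by blast
qed

text \<open>The minimizer is compared with the midpoint of minimizer and true solution. Together with
  uniform convexity of the penalty this replaces a variational source condition.\<close>

lemma minimizer_inequality:
  assumes t: "tbar > 0" and \<epsilon>: "0 < \<epsilon>" and D: "D \<subseteq> X" "convex D" and f0: "f0 \<in> D"
    and fh: "is_arg_min (tikhonov tbar (\<epsilon> / 4) (penalty \<psi> I \<phi> p q q) (observation tbar \<epsilon> z f0)) (\<lambda>f. f \<in> D) fh"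
  shows "3/8 * (T_norm tbar (fh - f0))\<^sup>2 + \<epsilon> * (\<kappa> / (4 * q)) * wN (fh - f0) powr q
    \<le> \<epsilon> / 2 * dapp z (T_BH tbar (fh - f0)) + \<epsilon> / (8 * q) * (wN f0 powr q - wN fh powr q)"
proof -
  let ?J = "tikhonov tbar (\<epsilon> / 4) (penalty \<psi> I \<phi> p q q) (observation tbar \<epsilon> z f0)"
  let ?m = "(1/2) *\<^sub>R (fh + f0)" and ?h = "fh - f0"
  define u where "u = T_BH tbar f0"
  define v where "v = T_BH tbar ?h"
  have fhD: "fh \<in> D" and min: "\<And>f. f \<in> D \<Longrightarrow> ?J fh \<le> ?J f" using fh by (auto simp: is_arg_min_le)
  have X: "fh \<in> X" "f0 \<in> X" using fhD f0 D by auto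
  have "(1/2) *\<^sub>R fh + (1/2) *\<^sub>R f0 \<in> D" using D(2) fhD f0 by (intro convexD) auto
  then have le: "?J fh \<le> ?J ?m" by (intro min) (simp add: scaleR_add_right)
  have cu: "continuous_on UNIV u" and cv: "continuous_on UNIV v"
    unfolding u_def v_def by (intro test_function_continuous test_function_T_BH t)+
  have i: "integrable torus (\<lambda>x. (u x)\<^sup>2)" "integrable torus (\<lambda>x. (v x)\<^sup>2)" "integrable torus (\<lambda>x. u x * v x)"
    by (intro integrable_torus continuous_intros cu cv)+
  have tuv: "test_function u" "test_function v" unfolding u_def v_def by (intro test_function_T_BH t)+
  \<comment> \<open>On the segment from \<open>f0\<close> (\<open>a = 0\<close>) to
    \<open>fh\<close> (\<open>a = 1\<close>) the mixed term cancels because the data contain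
    \<open>u\<close> itself, so apart from the noise the data part is \<open>a\<^sup>2 / 2\<close>
    times the squared norm of \<open>v\<close>, up to a constant. The values \<open>a = 1\<close>
    and \<open>a = 1/2\<close> differ by \<open>1/2 - 1/8 = 3/8\<close>.\<close>
  have J: "?J (f0 + a *\<^sub>R ?h) = a\<^sup>2 / 2 * (\<integral>x. (v x)\<^sup>2 \<partial>torus) - 1/2 * (\<integral>x. (u x)\<^sup>2 \<partial>torus) - \<epsilon> * (dapp z u + a * dapp z v)
      + \<epsilon> / 4 * (1 / q * wN (f0 + a *\<^sub>R ?h) powr q)" for a
  proof -
    have T: "T_BH tbar (f0 + a *\<^sub>R ?h) = (\<lambda>x. u x + a * v x)"
      by (simp add: fun_eq_iff T_BH_add[OF t] T_BH_scaleR[OF t] u_def v_def)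
    have tT: "test_function (\<lambda>x. u x + a * v x)" by (intro test_function_add test_function_cmult tuv)
    have "(\<integral>x. (u x + a * v x)\<^sup>2 \<partial>torus) = (\<integral>x. (u x)\<^sup>2 + (2 * a) * (u x * v x) + a\<^sup>2 * (v x)\<^sup>2 \<partial>torus)"
      by (rule Bochner_Integration.integral_cong) (auto simp: power2_eq_square algebra_simps)
    also have "\<dots> = (\<integral>x. (u x)\<^sup>2 \<partial>torus) + (2 * a) * (\<integral>x. u x * v x \<partial>torus) + a\<^sup>2 * (\<integral>x. (v x)\<^sup>2 \<partial>torus)"
      using i by simp
    finally have sq: "(\<integral>x. (u x + a * v x)\<^sup>2 \<partial>torus) = (\<integral>x. (u x)\<^sup>2 \<partial>torus) + (2 * a) * (\<integral>x. u x * v x \<partial>torus) + a\<^sup>2 * (\<integral>x. (v x)\<^sup>2 \<partial>torus)" .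
    have "dapp (regular_distribution u) (\<lambda>x. u x + a * v x) = (\<integral>x. u x * (u x + a * v x) \<partial>torus)"
      by (rule dapp_regular[OF cu tT])
    also have "\<dots> = (\<integral>x. (u x)\<^sup>2 + a * (u x * v x) \<partial>torus)"
      by (rule Bochner_Integration.integral_cong) (auto simp: power2_eq_square algebra_simps)
    also have "\<dots> = (\<integral>x. (u x)\<^sup>2 \<partial>torus) + a * (\<integral>x. u x * v x \<partial>torus)" using i by simp
    finally have reg: "dapp (regular_distribution u) (\<lambda>x. u x + a * v x) = (\<integral>x. (u x)\<^sup>2 \<partial>torus) + a * (\<integral>x. u x * v x \<partial>torus)" .
    have zz: "dapp z (\<lambda>x. u x + a * v x) = dapp z u + a * dapp z v"
      by (simp add: dapp_add dapp_cmult tuv test_function_cmult)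
    show ?thesis
      unfolding tikhonov_def observation_def T dapp_simps u_def[symmetric] sq reg zz penalty_wN by (simp add: algebra_simps)
  qed
  have e1: "f0 + 1 *\<^sub>R ?h = fh" by simp
  have e2: "f0 + (1/2) *\<^sub>R ?h = ?m"
  proof -
    have half: "f0 - (1/2) *\<^sub>R f0 = (1/2) *\<^sub>R f0"
      using scaleR_left_diff_distrib[of 1 "1/2" f0] by simp
    have "f0 + (1/2) *\<^sub>R ?h = (1/2) *\<^sub>R fh + (f0 - (1/2) *\<^sub>R f0)"
      by (simp only: scaleR_diff_right) (simp only: add_diff_eq add.commute)
    then show ?thesis unfolding half by (simp only: scaleR_add_right)
  qed
  have J1: "?J fh = 1 / 2 * (\<integral>x. (v x)\<^sup>2 \<partial>torus) - 1/2 * (\<integral>x. (u x)\<^sup>2 \<partial>torus) - \<epsilon> * (dapp z u + dapp z v) + \<epsilon> / 4 * (1 / q * wN fh powr q)"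
    and J2: "?J ?m = 1 / 8 * (\<integral>x. (v x)\<^sup>2 \<partial>torus) - 1/2 * (\<integral>x. (u x)\<^sup>2 \<partial>torus) - \<epsilon> * (dapp z u + 1/2 * dapp z v) + \<epsilon> / 4 * (1 / q * wN ?m powr q)"
    using J[of 1] J[of "1/2"] unfolding e1 e2 by (simp_all add: power2_eq_square)
  have V: "(\<integral>x. (v x)\<^sup>2 \<partial>torus) = (T_norm tbar ?h)\<^sup>2" unfolding v_def by (rule T_norm_square[OF t, symmetric])
  have "wN ?m powr q + \<kappa> * wN ?h powr q \<le> (wN fh powr q + wN f0 powr q) / 2"
    by (rule wN_uniformly_convex[OF X])
  from mult_left_mono[OF this, of "\<epsilon> / 4 * (1 / q)"]
  have "\<epsilon> / 4 * (1 / q * wN ?m powr q) + \<epsilon> * (\<kappa> / (4 * q)) * wN ?h powr q \<le> \<epsilon> / 4 * (1 / q * wN fh powr q) + \<epsilon> / (8 * q) * (wN f0 powr q - wN fh powr q)"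
    using \<epsilon> q by (simp add: field_simps)
  with le show ?thesis
    unfolding J1 J2 V by (simp add: v_def algebra_simps)
qed

text \<open>The three constants depend only on the spaces, the chosen norms and \<open>tbar\<close>,
  not on data or domain, because they collect norm equivalences and operator bounds. The level
  \<open>K\<close> stays free for a later choice.\<close>

theorem minimizer_estimate:
  fixes s :: real
  assumes t: "tbar > 0" and s: "0 < s" "s * (q - 1) < \<sigma>" and Ns: "besov_equiv_norm \<psi> s (ennreal p) \<top> Ns"
    and NZ: "besov_equiv_norm \<psi> (- real CARD('d) / 2) (ennreal a) \<top> NZ" and a: "1 \<le> a"
  obtains k1 k2 k3 where "0 < k1" "0 < k2" "0 < k3"
    "\<And>D f0 \<epsilon> z fh \<rho> K. D \<subseteq> X \<Longrightarrow> convex D \<Longrightarrow> f0 \<in> D \<Longrightarrow> f0 \<in> besov \<psi> s (ennreal p) \<top> \<Longrightarrow> Ns f0 \<le> \<rho> \<Longrightarrow> 0 < \<rho> \<Longrightarrow>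
      0 < \<epsilon> \<Longrightarrow> z \<in> besov \<psi> (- real CARD('d) / 2) (ennreal a) \<top> \<Longrightarrow>
      is_arg_min (tikhonov tbar (\<epsilon> / 4) (penalty \<psi> I \<phi> p q q) (observation tbar \<epsilon> z f0)) (\<lambda>f. f \<in> D) fh \<Longrightarrow>
      3/8 * (T_norm tbar (fh - f0))\<^sup>2 + \<epsilon> * k1 * wN (fh - f0) powr q
      \<le> \<epsilon> * k2 * NZ z * sqrt (T_norm tbar (fh - f0) * wN (fh - f0))
        + \<epsilon> * k3 * \<rho> powr (q - 1) * (exp (32 * pi\<^sup>2 * tbar * 4 ^ K) * T_norm tbar (fh - f0) + 2 powr (- (real K * (s * (q - 1)))) * wN (fh - f0))"
proof -
  let ?s' = "s * (q - 1)"
  have s'0: "0 < ?s'" using s q by simp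
  have "s * 1 \<le> ?s'" using s q by (intro mult_left_mono) auto
  then have "s < \<sigma>" using s(2) by linarith
  then have s\<sigma>: "\<bar>s\<bar> < \<sigma>" "\<bar>- ?s'\<bar> < \<sigma>" using s s'0 by auto
  obtain c1 C1 where c1: "0 < c1" "0 < C1" "\<And>f. f \<in> X \<Longrightarrow> c1 * bnorm \<psi> p q f \<le> wN f" "\<And>f. f \<in> X \<Longrightarrow> wN f \<le> C1 * bnorm \<psi> p q f"
    using equiv_norm_bnorm[OF equiv_wN] by blast
  obtain CI where CI: "0 \<le> CI" "\<And>f z. f \<in> X \<Longrightarrow> z \<in> besov \<psi> (- real CARD('d) / 2) (ennreal a) \<top> \<Longrightarrow>
       \<bar>dapp z (T_BH tbar f)\<bar> \<le> CI * enn2real (besov_norm \<psi> (- real CARD('d) / 2) (ennreal a) \<top> z) * sqrt (T_norm tbar f * bnorm \<psi> p q f)"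
    using dapp_T_BH_interpolation[OF cutoff pq(2,4) t a] by blast
  obtain CB where CB: "0 < CB" "\<And>f. f \<in> X \<Longrightarrow> f \<in> besov \<psi> (- ?s') (ennreal p) 1"
    "\<And>f K. f \<in> X \<Longrightarrow> enn2real (besov_norm \<psi> (- ?s') (ennreal p) 1 f) \<le>
       CB * (exp (32 * pi\<^sup>2 * tbar * 4 ^ K) * T_norm tbar f + 2 powr (- (real K * ?s')) * bnorm \<psi> p q f)"
    using negative_smoothness_bound[OF cutoff pq(2,4) t s'0] by blast
  obtain cz where cz: "0 < cz" "\<And>z. z \<in> besov \<psi> (- real CARD('d) / 2) (ennreal a) \<top> \<Longrightarrow> cz * enn2real (besov_norm \<psi> (- real CARD('d) / 2) (ennreal a) \<top> z) \<le> NZ z"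
    using besov_equiv_normD(3)[OF NZ] by blast
  obtain cs where cs: "0 < cs" "\<And>f. f \<in> besov \<psi> s (ennreal p) \<top> \<Longrightarrow> cs * enn2real (besov_norm \<psi> s (ennreal p) \<top> f) \<le> Ns f"
    using besov_equiv_normD(3)[OF Ns] by blast
  have ones: "1 \<le> ennreal p" "1 \<le> (\<top>::ennreal)" "1 \<le> (1::ennreal)" using ennreal_ge_1[OF pq(2)] by auto
  have "besov_equiv_norm \<psi> s (ennreal p) \<top> (\<lambda>f. enn2real (wavelet_norm \<psi> I \<phi> s (ennreal p) \<top> f))"
    "besov_equiv_norm \<psi> (- ?s') (ennreal p) 1 (\<lambda>f. enn2real (wavelet_norm \<psi> I \<phi> (- ?s') (ennreal p) 1 f))"
    using gen s\<sigma> ones unfolding generates_besov_def by blast+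
  then obtain W1 W2 where W: "0 < W1" "\<And>f. f \<in> besov \<psi> s (ennreal p) \<top> \<Longrightarrow>
        enn2real (wavelet_norm \<psi> I \<phi> s (ennreal p) \<top> f) \<le> W1 * enn2real (besov_norm \<psi> s (ennreal p) \<top> f)"
      "0 < W2" "\<And>f. f \<in> besov \<psi> (- ?s') (ennreal p) 1 \<Longrightarrow>
        enn2real (wavelet_norm \<psi> I \<phi> (- ?s') (ennreal p) 1 f) \<le> W2 * enn2real (besov_norm \<psi> (- ?s') (ennreal p) 1 f)"
    using besov_equiv_normD(3) by (metis (no_types, lifting))
  define k1 where "k1 = \<kappa> / (4 * q)"
  \<comment> \<open>\<open>CI\<close> is only known to be nonnegative; adding 1 makes the constant
    positive.\<close>
  define k2 where "k2 = CI / (2 * cz * sqrt c1) + 1"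
  define CP where "CP = W1 / cs"
  define CW where "CW = W2 * CB * (1 + 1 / c1)"
  define k3 where "k3 = CP powr (q - 1) * CW / 8 + 1"
  have CP: "0 < CP" and CW: "0 < CW" using W cs CB c1 by (auto simp: CP_def CW_def intro!: mult_pos_pos add_pos_pos)
  have k: "0 < k1" "0 < k2" "0 < k3"
    using \<kappa>_pos q CI cz c1 CW by (auto simp: k1_def k2_def k3_def intro!: add_nonneg_pos)
  show ?thesis
  proof (rule that[OF k])
    fix D f0 \<epsilon> z fh \<rho> K
    assume D: "D \<subseteq> X" "convex D" and f0: "f0 \<in> D" "f0 \<in> besov \<psi> s (ennreal p) \<top>" and \<rho>: "Ns f0 \<le> \<rho>" "0 < \<rho>"
      and \<epsilon>: "0 < \<epsilon>" and z: "z \<in> besov \<psi> (- real CARD('d) / 2) (ennreal a) \<top>"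
      and fh: "is_arg_min (tikhonov tbar (\<epsilon> / 4) (penalty \<psi> I \<phi> p q q) (observation tbar \<epsilon> z f0)) (\<lambda>f. f \<in> D) fh"
    let ?h = "fh - f0"
    let ?a = "T_norm tbar ?h" and ?b = "wN ?h" and ?E = "exp (32 * pi\<^sup>2 * tbar * 4 ^ K)" and ?r = "2 powr (- (real K * ?s'))"
    have X: "fh \<in> X" "f0 \<in> X" using fh f0 D by (auto simp: is_arg_min_le)
    have hX: "?h \<in> X" by (rule X_diff[OF X])
    have bn: "bnorm \<psi> p q ?h \<le> ?b / c1" using c1(1) c1(3)[OF hX] by (simp add: field_simps)
    have 1: "dapp z (T_BH tbar ?h) \<le> 2 * k2 * NZ z * sqrt (?a * ?b)"
    proof -
      let ?Z = "enn2real (besov_norm \<psi> (- real CARD('d) / 2) (ennreal a) \<top> z)"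
      have Z: "?Z \<le> NZ z / cz" using cz(1) cz(2)[OF z] by (simp add: field_simps)
      have N0: "0 \<le> NZ z" using cz(1) cz(2)[OF z] by (meson enn2real_nonneg less_imp_le mult_nonneg_nonneg order_trans)
      have "?a * bnorm \<psi> p q ?h \<le> ?a * (?b / c1)" using bn by (intro mult_left_mono) auto
      then have "sqrt (?a * bnorm \<psi> p q ?h) \<le> sqrt (?a * ?b) / sqrt c1"
        by (simp add: real_sqrt_divide[symmetric])
      then have "CI * ?Z * sqrt (?a * bnorm \<psi> p q ?h) \<le> CI * (NZ z / cz) * (sqrt (?a * ?b) / sqrt c1)"
        using CI(1) Z N0 cz(1) by (intro mult_mono) auto
      also have "\<dots> = 2 * (CI / (2 * cz * sqrt c1)) * NZ z * sqrt (?a * ?b)" using cz c1 by (simp add: field_simps)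
      also have "\<dots> \<le> 2 * k2 * NZ z * sqrt (?a * ?b)"
        using N0 by (intro mult_right_mono mult_left_mono) (auto simp: k2_def)
      finally show ?thesis using CI(2)[OF hX z] by linarith
    qed
    have 2: "wN f0 powr q - wN fh powr q \<le> 8 * q * k3 * \<rho> powr (q - 1) * (?E * ?a + ?r * ?b)"
    proof -
      let ?P = "enn2real (wavelet_norm \<psi> I \<phi> s (ennreal p) \<top> f0)" and ?W = "enn2real (wavelet_norm \<psi> I \<phi> (- ?s') (ennreal p) 1 ?h)"
      have "enn2real (besov_norm \<psi> s (ennreal p) \<top> f0) \<le> \<rho> / cs" using cs(1) cs(2)[OF f0(2)] \<rho> by (simp add: field_simps)
      then have "W1 * enn2real (besov_norm \<psi> s (ennreal p) \<top> f0) \<le> W1 * (\<rho> / cs)" using W(1) by (intro mult_left_mono) auto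
      then have P: "?P \<le> CP * \<rho>" using W(2)[OF f0(2)] by (simp add: CP_def)
      have pos: "0 \<le> ?E * ?a + ?r * ?b" by simp
      have "enn2real (besov_norm \<psi> (- ?s') (ennreal p) 1 ?h) \<le> CB * (?E * ?a + ?r * (?b / c1))"
        using CB(3)[OF hX, of K] mult_left_mono[OF mult_left_mono[OF bn, of ?r], of CB] CB(1) by (simp add: distrib_left)
      also have "\<dots> \<le> CB * ((1 + 1 / c1) * (?E * ?a + ?r * ?b))"
      proof (intro mult_left_mono)
        have "0 \<le> 1 / c1 * (?E * ?a)" "0 \<le> ?r * ?b" using c1 by auto
        then show "?E * ?a + ?r * (?b / c1) \<le> (1 + 1 / c1) * (?E * ?a + ?r * ?b)" by (simp add: algebra_simps)
      qed (use CB in simp)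
      finally have "W2 * enn2real (besov_norm \<psi> (- ?s') (ennreal p) 1 ?h) \<le> W2 * (CB * ((1 + 1 / c1) * (?E * ?a + ?r * ?b)))"
        using W(3) by (intro mult_left_mono) auto
      then have Wh: "?W \<le> CW * (?E * ?a + ?r * ?b)" using W(4)[OF CB(2)[OF hX]] by (simp add: CW_def mult_ac)
      have "wN f0 powr q - wN fh powr q \<le> q * ?P powr (q - 1) * ?W"
        by (rule penalty_difference[OF s X(2) f0(2) X(1) CB(2)[OF hX]])
      also have "\<dots> \<le> q * (CP * \<rho>) powr (q - 1) * (CW * (?E * ?a + ?r * ?b))"
        using P Wh q by (intro mult_mono mult_left_mono powr_mono2) auto
      also have "\<dots> = 8 * q * (CP powr (q - 1) * CW / 8) * \<rho> powr (q - 1) * (?E * ?a + ?r * ?b)"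
        by (simp add: powr_mult)
      also have "\<dots> \<le> 8 * q * k3 * \<rho> powr (q - 1) * (?E * ?a + ?r * ?b)"
        using q pos by (intro mult_right_mono mult_left_mono) (auto simp: k3_def)
      finally show ?thesis .
    qed
    have "\<epsilon> / 2 * dapp z (T_BH tbar ?h) \<le> \<epsilon> / 2 * (2 * k2 * NZ z * sqrt (?a * ?b))"
      using 1 \<epsilon> by (intro mult_left_mono) auto
    also have "\<dots> = \<epsilon> * k2 * NZ z * sqrt (?a * ?b)" by simp
    finally have 3: "\<epsilon> / 2 * dapp z (T_BH tbar ?h) \<le> \<epsilon> * k2 * NZ z * sqrt (?a * ?b)" .
    have "\<epsilon> / (8 * q) * (wN f0 powr q - wN fh powr q) \<le> \<epsilon> / (8 * q) * (8 * q * k3 * \<rho> powr (q - 1) * (?E * ?a + ?r * ?b))"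
      using 2 \<epsilon> q by (intro mult_left_mono) auto
    also have "\<dots> = \<epsilon> * k3 * \<rho> powr (q - 1) * (?E * ?a + ?r * ?b)" using q by simp
    finally have 4: "\<epsilon> / (8 * q) * (wN f0 powr q - wN fh powr q) \<le> \<epsilon> * k3 * \<rho> powr (q - 1) * (?E * ?a + ?r * ?b)" .
    show "3/8 * ?a\<^sup>2 + \<epsilon> * k1 * ?b powr q \<le> \<epsilon> * k2 * NZ z * sqrt (?a * ?b) + \<epsilon> * k3 * \<rho> powr (q - 1) * (?E * ?a + ?r * ?b)"
      using minimizer_inequality[OF t \<epsilon> D f0(1) fh] 3 4 unfolding k1_def by linarith
  qed
qed

end

section \<open>Scalar inequalities and choice of the truncation\<close>

text \<open>Young's inequality with exponents 4 and 4/3, rescaled by \<open>d\<close> with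
  \<open>d powr 4 = 1/2\<close> to reach the coefficient 1/8; the other coefficient is rounded up to
  2.\<close>

lemma Young_quarter:
  fixes x w :: real
  assumes "0 \<le> x" "0 \<le> w"
  shows "sqrt x * w \<le> x\<^sup>2 / 8 + 2 * w powr (4/3)"
proof -
  define d where "d = (1/2) powr (1/4 :: real)"
  have d: "0 < d" by (simp add: d_def)
  have "(d * sqrt x) * (w / d) \<le> (d * sqrt x) powr 4 / 4 + (w / d) powr (4/3) / (4/3)"
    using assms d by (intro Youngs_inequality) auto
  also have "(d * sqrt x) powr 4 = x\<^sup>2 / 2"
  proof -
    have "(sqrt x) powr 4 = x\<^sup>2"
      using assms by (simp add: powr_half_sqrt[symmetric] powr_powr)
    moreover have "d powr 4 = 1/2" by (simp add: d_def powr_powr)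
    ultimately show ?thesis by (simp add: powr_mult)
  qed
  also have "(w / d) powr (4/3) / (4/3) \<le> 2 * w powr (4/3)"
  proof -
    have "d powr (4/3) = (1/2) powr (1/3 :: real)" by (simp add: d_def powr_powr)
    moreover have "(1/2) powr 1 \<le> (1/2) powr (1/3 :: real)" by (intro powr_mono') auto
    ultimately have "1/2 \<le> d powr (4/3)" by simp
    then have "w powr (4/3) / d powr (4/3) \<le> w powr (4/3) / (1/2)" by (intro divide_left_mono) auto
    then have "(w / d) powr (4/3) \<le> 2 * w powr (4/3)" by (simp add: powr_divide)
    moreover have "x / (4/3) \<le> y" if "x \<le> y" "0 \<le> x" for x y :: real using that by simp
    ultimately show ?thesis using powr_ge_zero by blast
  qed
  finally show ?thesis using d by simp
qed

lemma powr_root_le: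
  fixes b c e :: real
  assumes "0 < e" "0 \<le> b" "b powr e \<le> c"
  shows "b \<le> c powr (1 / e)"
proof -
  have "(b powr e) powr (1 / e) \<le> c powr (1 / e)" using assms by (intro powr_mono2) auto
  then show ?thesis using assms by (simp add: powr_powr)
qed

text \<open>Both terms that contain \<open>a\<close> are split so that each costs
  \<open>a\<^sup>2 / 8\<close>, which the left-hand side covers. What remains is bounded by three
  terms without \<open>a\<close>; the largest of them is at least a third of the left-hand side, and
  that inequality can be solved for \<open>b\<close>.\<close>

lemma error_from_inequality:
  fixes k1 k2 k3 q s :: real
  assumes k: "0 < k1" "0 < k2" "0 < k3" and q: "2 \<le> q"
  obtains C where "0 < C"
    "\<And>a b \<epsilon> \<rho> n E r. 0 \<le> a \<Longrightarrow> 0 \<le> b \<Longrightarrow> 0 < \<epsilon> \<Longrightarrow> 0 < \<rho> \<Longrightarrow> 0 \<le> n \<Longrightarrow> 0 \<le> E \<Longrightarrow> 0 \<le> r \<Longrightarrow>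
      3/8 * a\<^sup>2 + \<epsilon> * k1 * b powr q \<le> \<epsilon> * k2 * n * sqrt (a * b) + \<epsilon> * k3 * \<rho> powr (q - 1) * (E * a + r powr (q - 1) * b) \<Longrightarrow>
      b \<le> C * ((\<epsilon> powr (1/4) * n) powr (4 / (3 * q - 2)) + (\<epsilon> * \<rho> powr (2 * q - 2) * E\<^sup>2) powr (1 / q) + \<rho> * r)"
proof -
  \<comment> \<open>Factors from solving for \<open>b\<close> in the three cases below; each
    includes the 3 from the choice of the largest of three terms.\<close>
  define A1 where "A1 = (6 * k2 powr (4/3) / k1) powr (1 / (q - 2/3))"
  define A2 where "A2 = (6 * k3\<^sup>2 / k1) powr (1 / q)"
  define A3 where "A3 = (3 * k3 / k1) powr (1 / (q - 1))"
  define C where "C = A1 + A2 + A3"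
  have A: "0 < A1" "0 < A2" "0 < A3" using k by (auto simp: A1_def A2_def A3_def)
  then have "0 < C" by (simp add: C_def)
  moreover have "b \<le> C * ((\<epsilon> powr (1/4) * n) powr (4 / (3 * q - 2)) + (\<epsilon> * \<rho> powr (2 * q - 2) * E\<^sup>2) powr (1 / q) + \<rho> * r)"
    if nn: "0 \<le> a" "0 \<le> b" "0 < \<epsilon>" "0 < \<rho>" "0 \<le> n" "0 \<le> E" "0 \<le> r"
      and le: "3/8 * a\<^sup>2 + \<epsilon> * k1 * b powr q \<le> \<epsilon> * k2 * n * sqrt (a * b) + \<epsilon> * k3 * \<rho> powr (q - 1) * (E * a + r powr (q - 1) * b)"
    for a b \<epsilon> \<rho> n E r
  proof -
    let ?B1 = "(\<epsilon> powr (1/4) * n) powr (4 / (3 * q - 2))" and ?B2 = "(\<epsilon> * \<rho> powr (2 * q - 2) * E\<^sup>2) powr (1 / q)" and ?B3 = "\<rho> * r"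
    have B: "0 \<le> ?B1" "0 \<le> ?B2" "0 \<le> ?B3" using nn by auto
    have "b \<le> A1 * ?B1 + A2 * ?B2 + A3 * ?B3"
    proof (cases "b = 0")
      case True
      then show ?thesis using A B by (auto intro!: add_nonneg_nonneg mult_nonneg_nonneg simp: less_imp_le)
    next
      case False
      then have b: "0 < b" using nn by simp
      define w where "w = \<epsilon> * k2 * n * sqrt b"
      define y where "y = \<epsilon> * k3 * \<rho> powr (q - 1) * E"
      have "\<epsilon> * k2 * n * sqrt (a * b) = sqrt a * w" by (simp add: w_def real_sqrt_mult)
      also have "\<dots> \<le> a\<^sup>2 / 8 + 2 * w powr (4/3)" using nn k by (intro Young_quarter) (auto simp: w_def)
      finally have t1: "\<epsilon> * k2 * n * sqrt (a * b) \<le> a\<^sup>2 / 8 + 2 * w powr (4/3)" .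
      have t2: "y * a \<le> a\<^sup>2 / 8 + 2 * y\<^sup>2"
        using zero_le_power2[of "a - 4 * y"] by (simp add: power2_eq_square algebra_simps)
      have "\<epsilon> * k3 * \<rho> powr (q - 1) * (E * a + r powr (q - 1) * b) = y * a + \<epsilon> * (k3 * (\<rho> * r) powr (q - 1) * b)"
        by (simp add: y_def powr_mult algebra_simps)
      with le t1 t2 have "\<epsilon> * k1 * b powr q \<le> 2 * w powr (4/3) + 2 * y\<^sup>2 + \<epsilon> * (k3 * (\<rho> * r) powr (q - 1) * b)"
        using zero_le_power2[of a] by linarith
      moreover have "w powr (4/3) = \<epsilon> * (k2 powr (4/3) * (\<epsilon> powr (1/4) * n) powr (4/3) * b powr (2/3))"
      proof -
        have "sqrt b powr (4/3) = b powr (2/3)" using b by (simp add: powr_half_sqrt[symmetric] powr_powr)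
        moreover have "\<epsilon> powr (4/3) = \<epsilon> * (\<epsilon> powr (1/4)) powr (4/3)"
          using nn powr_add[of \<epsilon> 1 "1/3"] by (simp add: powr_powr)
        ultimately show ?thesis by (simp add: w_def powr_mult mult_ac)
      qed
      moreover have "y\<^sup>2 = \<epsilon> * (k3\<^sup>2 * (\<epsilon> * \<rho> powr (2 * q - 2) * E\<^sup>2))"
      proof -
        have "(\<rho> powr (q - 1))\<^sup>2 = \<rho> powr (2 * q - 2)" using nn by (simp add: power2_eq_square powr_add[symmetric])
        then show ?thesis by (simp add: y_def power_mult_distrib power2_eq_square[of \<epsilon>] mult_ac)
      qed
      ultimately have "\<epsilon> * (k1 * b powr q) \<le> \<epsilon> * (2 * k2 powr (4/3) * (\<epsilon> powr (1/4) * n) powr (4/3) * b powr (2/3)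
          + 2 * k3\<^sup>2 * (\<epsilon> * \<rho> powr (2 * q - 2) * E\<^sup>2) + k3 * (\<rho> * r) powr (q - 1) * b)"
        by (simp add: algebra_simps)
      then have main: "k1 * b powr q \<le> 2 * k2 powr (4/3) * (\<epsilon> powr (1/4) * n) powr (4/3) * b powr (2/3)
          + 2 * k3\<^sup>2 * (\<epsilon> * \<rho> powr (2 * q - 2) * E\<^sup>2) + k3 * (\<rho> * r) powr (q - 1) * b"
        using nn by simp
      then consider "k1 * b powr q \<le> 3 * (2 * k2 powr (4/3) * (\<epsilon> powr (1/4) * n) powr (4/3) * b powr (2/3))"
        | "k1 * b powr q \<le> 3 * (2 * k3\<^sup>2 * (\<epsilon> * \<rho> powr (2 * q - 2) * E\<^sup>2))"
        | "k1 * b powr q \<le> 3 * (k3 * (\<rho> * r) powr (q - 1) * b)"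
        by linarith
      then show ?thesis
      proof cases
        case 1
        have "b powr q = b powr (q - 2/3) * b powr (2/3)" by (simp add: powr_add[symmetric])
        with 1 have "(k1 * b powr (q - 2/3)) * b powr (2/3) \<le> (6 * k2 powr (4/3) * (\<epsilon> powr (1/4) * n) powr (4/3)) * b powr (2/3)"
          by (simp add: mult_ac)
        then have "k1 * b powr (q - 2/3) \<le> 6 * k2 powr (4/3) * (\<epsilon> powr (1/4) * n) powr (4/3)"
          using b by simp
        then have "b powr (q - 2/3) \<le> 6 * k2 powr (4/3) / k1 * (\<epsilon> powr (1/4) * n) powr (4/3)"
          using k by (simp add: field_simps)
        then have "b \<le> (6 * k2 powr (4/3) / k1 * (\<epsilon> powr (1/4) * n) powr (4/3)) powr (1 / (q - 2/3))"
          using q nn by (intro powr_root_le) auto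
        also have "\<dots> = A1 * ?B1"
        proof -
          have "4/3 * (1 / (q - 2/3)) = 4 / (3 * q - 2)" using q by (simp add: field_simps)
          then have "((\<epsilon> powr (1/4) * n) powr (4/3)) powr (1 / (q - 2/3)) = ?B1" by (simp only: powr_powr)
          then show ?thesis unfolding A1_def powr_mult[of "6 * k2 powr (4/3) / k1" "(\<epsilon> powr (1/4) * n) powr (4/3)"] by (rule arg_cong)
        qed
        finally show ?thesis using A B by (auto intro!: add_increasing2 mult_nonneg_nonneg simp: less_imp_le)
      next
        case 2
        then have "b powr q \<le> 6 * k3\<^sup>2 / k1 * (\<epsilon> * \<rho> powr (2 * q - 2) * E\<^sup>2)" using k by (simp add: field_simps)
        then have "b \<le> (6 * k3\<^sup>2 / k1 * (\<epsilon> * \<rho> powr (2 * q - 2) * E\<^sup>2)) powr (1 / q)"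
          using q nn by (intro powr_root_le) auto
        also have "\<dots> = A2 * ?B2" unfolding A2_def by (rule powr_mult)
        finally have "b \<le> A2 * ?B2" .
        moreover have "0 \<le> A1 * ?B1" "0 \<le> A3 * ?B3" using A B by auto
        ultimately show ?thesis by linarith
      next
        case 3
        have "b powr q = b powr (q - 1) * b" using b by (simp add: powr_diff)
        with 3 have "(k1 * b powr (q - 1)) * b \<le> (3 * k3 * (\<rho> * r) powr (q - 1)) * b" by (simp add: mult_ac)
        then have "k1 * b powr (q - 1) \<le> 3 * k3 * (\<rho> * r) powr (q - 1)" using b by simp
        then have "b powr (q - 1) \<le> 3 * k3 / k1 * (\<rho> * r) powr (q - 1)" using k by (simp add: field_simps)
        then have "b \<le> (3 * k3 / k1 * (\<rho> * r) powr (q - 1)) powr (1 / (q - 1))"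
          using q nn by (intro powr_root_le) auto
        also have "\<dots> = A3 * ((\<rho> * r) powr (q - 1)) powr (1 / (q - 1))" unfolding A3_def by (rule powr_mult)
        also have "((\<rho> * r) powr (q - 1)) powr (1 / (q - 1)) = ?B3" using q nn by (simp add: powr_powr)
        finally have "b \<le> A3 * ?B3" .
        moreover have "0 \<le> A1 * ?B1" "0 \<le> A2 * ?B2" using A B by auto
        ultimately show ?thesis by linarith
      qed
    qed
    also have "\<dots> \<le> C * ?B1 + C * ?B2 + C * ?B3"
      using A B by (intro add_mono mult_right_mono) (auto simp: C_def)
    finally show ?thesis by (simp add: distrib_left)
  qed
  ultimately show ?thesis using that by blast
qed

text \<open>Half of the power \<open>\<epsilon> powr a\<close> is spent on the logarithm, the other
  half tends to zero.\<close>

lemma eventually_small_noise: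
  fixes a b C \<rho> :: real
  assumes a: "0 < a" and b: "0 < b" and \<rho>: "0 < \<rho>" and C: "0 \<le> C"
  shows "eventually (\<lambda>\<epsilon>. C * \<epsilon> powr a \<le> \<rho> * ln (\<rho> / \<epsilon>) powr (- b)) (at_right 0)"
proof -
  \<comment> \<open>With \<open>ln x \<le> x powr d / d\<close> this exponent gives
    \<open>ln x powr b \<le> x powr (a / 2) / d powr b\<close>.\<close>
  define d where "d = a / (2 * b)"
  have d: "0 < d" using a b by (simp add: d_def)
  define D where "D = C * (\<rho> powr (a / 2) / d powr b)"
  have "((\<lambda>\<epsilon>. \<epsilon> powr (a / 2)) \<longlongrightarrow> 0) (at_right (0::real))"
    using a by (intro tendsto_zero_powrI[where b = "a / 2"] tendsto_intros)
      (auto intro!: eventually_at_right_less[THEN eventually_mono])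
  then have "((\<lambda>\<epsilon>. D * \<epsilon> powr (a / 2)) \<longlongrightarrow> D * 0) (at_right (0::real))"
    by (rule tendsto_mult_left)
  then have "eventually (\<lambda>\<epsilon>. D * \<epsilon> powr (a / 2) < \<rho>) (at_right 0)"
    using order_tendstoD(2)[of "\<lambda>\<epsilon>. D * \<epsilon> powr (a / 2)" "D * 0" _ \<rho>] \<rho> by simp
  moreover have "eventually (\<lambda>\<epsilon>. \<epsilon> \<in> {0<..<\<rho>}) (at_right 0)"
    by (rule eventually_at_rightI[OF _ \<rho>])
  ultimately show ?thesis
  proof eventually_elim
    case (elim \<epsilon>)
    then have \<epsilon>: "0 < \<epsilon>" "\<epsilon> < \<rho>" by auto
    let ?x = "\<rho> / \<epsilon>"
    have x: "1 < ?x" using \<epsilon> by simp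
    then have l: "0 < ln ?x" by simp
    have "ln ?x \<le> ?x powr d / d" using x d by (intro ln_powr_bound) auto
    then have "ln ?x powr b \<le> (?x powr d / d) powr b" using l b by (intro powr_mono2) auto
    also have "\<dots> = ?x powr (a / 2) / d powr b"
    proof -
      have "d * b = a / 2" using b by (simp add: d_def)
      then show ?thesis by (simp only: powr_divide[of "?x powr d" d b] powr_powr[of ?x d b])
    qed
    finally have "C * \<epsilon> powr a * ln ?x powr b \<le> C * \<epsilon> powr a * (?x powr (a / 2) / d powr b)"
      using C by (intro mult_left_mono) auto
    also have "\<dots> = D * \<epsilon> powr (a / 2)"
    proof -
      have "\<epsilon> powr a = \<epsilon> powr (a / 2) * \<epsilon> powr (a / 2)" by (simp add: powr_add[symmetric])
      moreover have "0 < \<epsilon> powr (a / 2)" using \<epsilon> by simp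
      ultimately show ?thesis by (simp add: D_def powr_divide)
    qed
    finally have le: "C * \<epsilon> powr a * ln ?x powr b \<le> \<rho>" using elim(1) by linarith
    have "C * \<epsilon> powr a = (C * \<epsilon> powr a * ln ?x powr b) * ln ?x powr (- b)"
      using l by (simp add: mult.assoc powr_add[symmetric])
    also have "\<dots> \<le> \<rho> * ln ?x powr (- b)"
      using le by (intro mult_right_mono) auto
    finally show ?case .
  qed
qed

section \<open>Balancing the truncation level against the noise level\<close>

lemma dyadic_scale:
  fixes x :: real
  assumes "1 \<le> x"
  obtains K where "4 ^ K \<le> x" "x \<le> 4 * 4 ^ K"
proof -
  define K where "K = nat \<lfloor>log 4 x\<rfloor>"
  have l: "0 \<le> log 4 x" using assms by simp
  then have K: "real K \<le> log 4 x" "log 4 x \<le> real K + 1" unfolding K_def by linarith+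
  have x: "x = 4 powr log 4 x" using assms by simp
  have "4 powr real K \<le> x" by (subst x) (use K(1) in simp)
  moreover have "x \<le> 4 powr (real K + 1)" by (subst x) (use K(2) in simp)
  ultimately show ?thesis using that[of K] by (simp add: powr_realpow powr_add mult.commute)
qed

text \<open>For small \<open>\<epsilon>\<close> the level \<open>K\<close> is taken with
  \<open>4 ^ K\<close> comparable to \<open>\<kappa> * ln (\<rho> / \<epsilon>)\<close>: the terms
  with powers of \<open>\<epsilon>\<close> then fall below the logarithmic rate, which is the size
  of the truncation error. For \<open>\<epsilon>\<close> between the threshold and
  \<open>\<rho>\<close> the choice \<open>K = 0\<close> works, with a constant depending on
  \<open>\<rho>\<close>.\<close>

lemma choose_truncation:
  fixes q s k4 m \<theta> :: real
  assumes q: "2 \<le> q" and s: "0 < s" and k4: "0 < k4" and \<theta>: "0 < \<theta>" and m: "0 \<le> m"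
  obtains c where "0 < c"
    "\<And>\<rho>. 0 < \<rho> \<Longrightarrow> \<exists>\<epsilon>0>0. \<exists>c'>0. \<forall>\<epsilon>. 0 < \<epsilon> \<and> \<epsilon> < \<rho> \<longrightarrow> (\<exists>K.
      m * \<epsilon> powr \<theta> + (\<epsilon> * \<rho> powr (2 * q - 2) * (exp (k4 * 4 ^ K))\<^sup>2) powr (1 / q) + \<rho> * 2 powr (- (real K * s))
      \<le> (if \<epsilon> < \<epsilon>0 then c else c') * (\<rho> * ln (\<rho> / \<epsilon>) powr (- s / 2)))"
proof -
  \<comment> \<open>Small enough that the squared exponential is at most
    \<open>(\<rho> / \<epsilon>) powr (1/2)\<close>, so that half a power of
    \<open>\<epsilon>\<close> is left.\<close>
  define \<kappa> where "\<kappa> = 1 / (4 * k4)"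
  have \<kappa>: "0 < \<kappa>" using k4 by (simp add: \<kappa>_def)
  \<comment> \<open>One for each of the first two terms, the rest for the truncation error, where
    \<open>4 ^ K \<ge> \<kappa> / 4 * ln (\<rho> / \<epsilon>)\<close>.\<close>
  define c where "c = 2 + (\<kappa> / 4) powr (- s / 2)"
  have c0: "0 < c" by (simp add: c_def add_pos_nonneg)
  let ?L = "\<lambda>\<rho> K \<epsilon>. m * \<epsilon> powr \<theta> + (\<epsilon> * \<rho> powr (2 * q - 2) * (exp (k4 * 4 ^ K))\<^sup>2) powr (1 / q) + \<rho> * 2 powr (- (real K * s))"
  have "\<exists>\<epsilon>0>0. \<exists>c'>0. \<forall>\<epsilon>. 0 < \<epsilon> \<and> \<epsilon> < \<rho> \<longrightarrow> (\<exists>K. ?L \<rho> K \<epsilon> \<le> (if \<epsilon> < \<epsilon>0 then c else c') * (\<rho> * ln (\<rho> / \<epsilon>) powr (- s / 2)))"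
    if \<rho>: "0 < \<rho>" for \<rho> :: real
  proof -
    define D where "D = (\<rho> powr (2 * q - 3/2)) powr (1 / q)"
    have e1: "eventually (\<lambda>\<epsilon>. m * \<epsilon> powr \<theta> \<le> \<rho> * ln (\<rho> / \<epsilon>) powr (- (s / 2))) (at_right 0)"
      using s by (intro eventually_small_noise \<theta> \<rho> m) auto
    have e2: "eventually (\<lambda>\<epsilon>. D * \<epsilon> powr (1 / (2 * q)) \<le> \<rho> * ln (\<rho> / \<epsilon>) powr (- (s / 2))) (at_right 0)"
      using q s by (intro eventually_small_noise \<rho>) (auto simp: D_def)
    have e3: "eventually (\<lambda>\<epsilon>. 1 \<le> \<kappa> * ln (\<rho> / \<epsilon>)) (at_right 0)"
    proof (rule eventually_at_rightI)
      show "0 < \<rho> * exp (- (1 / \<kappa>))" using \<rho> by simp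
      fix \<epsilon> assume "\<epsilon> \<in> {0<..<\<rho> * exp (- (1 / \<kappa>))}"
      then have \<epsilon>: "0 < \<epsilon>" "\<epsilon> < \<rho> * exp (- (1 / \<kappa>))" by auto
      then have "exp (1 / \<kappa>) \<le> \<rho> / \<epsilon>" by (simp add: exp_minus field_simps)
      then have "1 / \<kappa> \<le> ln (\<rho> / \<epsilon>)" using \<rho> \<epsilon> by (subst ln_ge_iff) auto
      then show "1 \<le> \<kappa> * ln (\<rho> / \<epsilon>)" using \<kappa> by (simp add: field_simps)
    qed
    have "eventually (\<lambda>\<epsilon>. m * \<epsilon> powr \<theta> \<le> \<rho> * ln (\<rho> / \<epsilon>) powr (- (s / 2)) \<and> D * \<epsilon> powr (1 / (2 * q)) \<le> \<rho> * ln (\<rho> / \<epsilon>) powr (- (s / 2))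
        \<and> 1 \<le> \<kappa> * ln (\<rho> / \<epsilon>)) (at_right 0)"
      using e1 e2 e3 by eventually_elim blast
    then obtain \<epsilon>0 where \<epsilon>0: "0 < \<epsilon>0" "\<And>\<epsilon>. 0 < \<epsilon> \<Longrightarrow> \<epsilon> < \<epsilon>0 \<Longrightarrow> m * \<epsilon> powr \<theta> \<le> \<rho> * ln (\<rho> / \<epsilon>) powr (- (s / 2)) \<and> D * \<epsilon> powr (1 / (2 * q)) \<le> \<rho> * ln (\<rho> / \<epsilon>) powr (- (s / 2))
        \<and> 1 \<le> \<kappa> * ln (\<rho> / \<epsilon>)"
      unfolding eventually_at_right_field by blast
    have small: "\<exists>K. ?L \<rho> K \<epsilon> \<le> c * (\<rho> * ln (\<rho> / \<epsilon>) powr (- s / 2))" if \<epsilon>: "0 < \<epsilon>" "\<epsilon> < \<epsilon>0" for \<epsilon>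
    proof -
      let ?l = "ln (\<rho> / \<epsilon>)"
      note h = \<epsilon>0(2)[OF \<epsilon>]
      have l: "0 < ?l" using h \<kappa> by (smt (verit) zero_less_mult_pos)
      obtain K where K: "4 ^ K \<le> \<kappa> * ?l" "\<kappa> * ?l \<le> 4 * 4 ^ K" using dyadic_scale h by blast
      have "2 * (k4 * 4 ^ K) \<le> ?l / 2"
        using mult_left_mono[OF K(1), of "2 * k4"] k4 by (simp add: \<kappa>_def)
      then have "exp (2 * (k4 * 4 ^ K)) \<le> exp (?l / 2)" by simp
      also have "exp (?l / 2) = (\<rho> / \<epsilon>) powr (1/2)" using \<rho> \<epsilon> by (simp add: powr_def)
      finally have "(exp (k4 * 4 ^ K))\<^sup>2 \<le> (\<rho> / \<epsilon>) powr (1/2)" by (simp add: power2_eq_square mult_exp_exp)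
      then have "\<epsilon> * \<rho> powr (2 * q - 2) * (exp (k4 * 4 ^ K))\<^sup>2 \<le> \<epsilon> * \<rho> powr (2 * q - 2) * (\<rho> / \<epsilon>) powr (1/2)"
        using \<epsilon> by (intro mult_left_mono) auto
      also have "\<dots> = \<rho> powr (2 * q - 3/2) * \<epsilon> powr (1/2)"
      proof -
        have "\<epsilon> = \<epsilon> powr (1/2) * \<epsilon> powr (1/2)" using \<epsilon> by (simp add: powr_add[symmetric])
        moreover have "\<rho> powr (2 * q - 2) * \<rho> powr (1/2) = \<rho> powr (2 * q - 3/2)" using \<rho> by (simp add: powr_add[symmetric])
        moreover have "0 < \<epsilon> powr (1/2)" using \<epsilon> by simp
        ultimately show ?thesis by (simp add: powr_divide field_simps)
      qed
      finally have "(\<epsilon> * \<rho> powr (2 * q - 2) * (exp (k4 * 4 ^ K))\<^sup>2) powr (1 / q) \<le> (\<rho> powr (2 * q - 3/2) * \<epsilon> powr (1/2)) powr (1 / q)"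
        using q \<epsilon> by (intro powr_mono2) auto
      also have "\<dots> = D * \<epsilon> powr (1 / (2 * q))" by (simp add: D_def powr_mult powr_powr)
      finally have 2: "(\<epsilon> * \<rho> powr (2 * q - 2) * (exp (k4 * 4 ^ K))\<^sup>2) powr (1 / q) \<le> \<rho> * ?l powr (- (s / 2))" using h by linarith
      have "2 powr (- (real K * s)) = (4 ^ K) powr (- (s / 2))"
      proof -
        have "(4::real) ^ K = 2 powr (2 * real K)" by (simp add: powr_realpow[symmetric] powr_powr[symmetric])
        then show ?thesis by (simp add: powr_powr mult_ac)
      qed
      also have "\<dots> \<le> (\<kappa> / 4 * ?l) powr (- (s / 2))"
        using K(2) \<kappa> l s by (intro powr_mono2') auto
      also have "\<dots> = (\<kappa> / 4) powr (- s / 2) * ?l powr (- (s / 2))" by (simp only: powr_mult minus_divide_left)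
      finally have 3: "\<rho> * 2 powr (- (real K * s)) \<le> (\<kappa> / 4) powr (- s / 2) * (\<rho> * ?l powr (- (s / 2)))"
        using \<rho> by (simp add: mult.left_commute)
      have "?L \<rho> K \<epsilon> \<le> \<rho> * ?l powr (- (s / 2)) + \<rho> * ?l powr (- (s / 2)) + (\<kappa> / 4) powr (- s / 2) * (\<rho> * ?l powr (- (s / 2)))"
        using h 2 3 by linarith
      also have "\<dots> = c * (\<rho> * ?l powr (- s / 2))" by (simp add: c_def algebra_simps)
      finally show ?thesis by blast
    qed
    \<comment> \<open>\<open>H\<close> bounds the left-hand side for \<open>K = 0\<close> and all
      \<open>\<epsilon> < \<rho>\<close>; \<open>H2\<close> bounds the rate from below for
      \<open>\<epsilon>0 \<le> \<epsilon> < \<rho>\<close>, as the logarithm decreases in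
      \<open>\<epsilon>\<close> and its exponent is negative.\<close>
    define H where "H = m * \<rho> powr \<theta> + (\<rho> * \<rho> powr (2 * q - 2) * (exp (k4 * 4 ^ 0))\<^sup>2) powr (1 / q) + \<rho> * 2 powr (- (real 0 * s))"
    define H2 where "H2 = \<rho> * ln (\<rho> / \<epsilon>0) powr (- s / 2)"
    define c' where "c' = max 1 (H / H2)"
    have large: "?L \<rho> 0 \<epsilon> \<le> c' * (\<rho> * ln (\<rho> / \<epsilon>) powr (- s / 2))" if \<epsilon>: "0 < \<epsilon>" "\<epsilon> < \<rho>" "\<epsilon>0 \<le> \<epsilon>" for \<epsilon>
    proof -
      have "ln (\<rho> / \<epsilon>) \<le> ln (\<rho> / \<epsilon>0)" "0 < ln (\<rho> / \<epsilon>)" "0 < ln (\<rho> / \<epsilon>0)"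
        using \<epsilon> \<epsilon>0(1) \<rho> by (auto intro!: divide_left_mono)
      then have "ln (\<rho> / \<epsilon>0) powr (- s / 2) \<le> ln (\<rho> / \<epsilon>) powr (- s / 2)" "0 < ln (\<rho> / \<epsilon>0) powr (- s / 2)"
        using s by (auto intro!: powr_mono2')
      then have H2: "H2 \<le> \<rho> * ln (\<rho> / \<epsilon>) powr (- s / 2)" "0 < H2"
        unfolding H2_def using \<rho> by (blast intro: mult_left_mono mult_pos_pos less_imp_le)+
      have "?L \<rho> 0 \<epsilon> \<le> H"
        unfolding H_def using \<epsilon> m \<theta> q \<rho> by (intro add_mono mult_left_mono mult_right_mono powr_mono2) auto
      also have "H = H / H2 * H2" using H2 by simp
      also have "\<dots> \<le> c' * H2" using H2 by (intro mult_right_mono) (auto simp: c'_def)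
      also have "\<dots> \<le> c' * (\<rho> * ln (\<rho> / \<epsilon>) powr (- s / 2))" using H2 by (intro mult_left_mono) (auto simp: c'_def)
      finally show ?thesis .
    qed
    have "0 < c'" by (simp add: c'_def)
    moreover have "\<exists>K. ?L \<rho> K \<epsilon> \<le> (if \<epsilon> < \<epsilon>0 then c else c') * (\<rho> * ln (\<rho> / \<epsilon>) powr (- s / 2))" if "0 < \<epsilon> \<and> \<epsilon> < \<rho>" for \<epsilon>
    proof (cases "\<epsilon> < \<epsilon>0")
      case True
      then show ?thesis using small that by simp
    next
      case False
      then show ?thesis using large[of \<epsilon>] that by (intro exI[of _ 0]) simp
    qed
    ultimately show ?thesis using \<epsilon>0(1) by blast
  qed
  then show ?thesis using that c0 by blast
qed

section \<open>Deviation of the minimizer\<close>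

text \<open>A measurable cover of \<open>A\<close> covers \<open>B\<close> after adding the null
  set, at no cost in measure.\<close>

lemma outer_measure_of_le_Un_null:
  assumes "N \<in> null_sets M" "B \<subseteq> A \<union> N"
  shows "outer_measure_of M B \<le> outer_measure_of M A"
  unfolding outer_measure_of_def[of M A]
proof (rule INF_greatest)
  fix E assume "E \<in> {E \<in> sets M. A \<subseteq> E}"
  then have E: "E \<in> sets M" "A \<subseteq> E" by auto
  have "outer_measure_of M B \<le> emeasure M (E \<union> N)"
    unfolding outer_measure_of_def using E assms by (intro INF_lower) auto
  also have "\<dots> = emeasure M E" using E assms by (intro emeasure_Un_null_set)
  finally show "outer_measure_of M B \<le> emeasure M E" .
qed

context besov_wavelets
begin

text \<open>Randomness is separated off: the estimate holds for each realization of bounded noise,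
  and the deviation inequality later controls the others. The constant \<open>c\<close> is fixed
  before \<open>\<rho>\<close>; the threshold and \<open>c'\<close> may depend on it.\<close>

theorem pathwise_error_bound:
  fixes s :: real
  assumes t: "tbar > 0" and s: "0 < s" "s * (q - 1) < \<sigma>"
    and NX: "besov_equiv_norm \<psi> 0 (ennreal p) (ennreal q) NX" and Ns: "besov_equiv_norm \<psi> s (ennreal p) \<top> Ns"
    and NZ: "besov_equiv_norm \<psi> (- real CARD('d) / 2) (ennreal a) \<top> NZ" and a: "1 \<le> a"
    and D: "D \<subseteq> X" "convex D" and mZ: "0 < mZ"
  obtains c where "0 < c"
    "\<And>\<rho>. 0 < \<rho> \<Longrightarrow> \<exists>\<epsilon>0>0. \<exists>c'>0. \<forall>\<epsilon>. 0 < \<epsilon> \<and> \<epsilon> < \<rho> \<longrightarrow>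
      (\<forall>f0 z fh t. f0 \<in> D \<longrightarrow> f0 \<in> besov \<psi> s (ennreal p) \<top> \<longrightarrow> Ns f0 \<le> \<rho> \<longrightarrow> 0 < t \<longrightarrow>
        z \<in> besov \<psi> (- real CARD('d) / 2) (ennreal a) \<top> \<longrightarrow>
        NZ z \<le> mZ + \<epsilon> powr (- 1/4) * t powr ((3 * q - 2) / 4) \<longrightarrow>
        is_arg_min (tikhonov tbar (\<epsilon> / 4) (penalty \<psi> I \<phi> p q q) (observation tbar \<epsilon> z f0)) (\<lambda>f. f \<in> D) fh \<longrightarrow>
        NX (fh - f0) < (if \<epsilon> < \<epsilon>0 then c else c') * (\<rho> * ln (\<rho> / \<epsilon>) powr (- s / 2) + t))"
proof -
  obtain k1 k2 k3 where k: "0 < k1" "0 < k2" "0 < k3" and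
    est: "\<And>D f0 \<epsilon> z fh \<rho> K. D \<subseteq> X \<Longrightarrow> convex D \<Longrightarrow> f0 \<in> D \<Longrightarrow> f0 \<in> besov \<psi> s (ennreal p) \<top> \<Longrightarrow> Ns f0 \<le> \<rho> \<Longrightarrow> 0 < \<rho> \<Longrightarrow>
      0 < \<epsilon> \<Longrightarrow> z \<in> besov \<psi> (- real CARD('d) / 2) (ennreal a) \<top> \<Longrightarrow>
      is_arg_min (tikhonov tbar (\<epsilon> / 4) (penalty \<psi> I \<phi> p q q) (observation tbar \<epsilon> z f0)) (\<lambda>f. f \<in> D) fh \<Longrightarrow>
      3/8 * (T_norm tbar (fh - f0))\<^sup>2 + \<epsilon> * k1 * wN (fh - f0) powr q
      \<le> \<epsilon> * k2 * NZ z * sqrt (T_norm tbar (fh - f0) * wN (fh - f0))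
        + \<epsilon> * k3 * \<rho> powr (q - 1) * (exp (32 * pi\<^sup>2 * tbar * 4 ^ K) * T_norm tbar (fh - f0) + 2 powr (- (real K * (s * (q - 1)))) * wN (fh - f0))"
    using minimizer_estimate[OF t s Ns NZ a] by blast
  obtain C where C: "0 < C" and err:
    "\<And>a b \<epsilon> \<rho> n E r. 0 \<le> a \<Longrightarrow> 0 \<le> b \<Longrightarrow> 0 < \<epsilon> \<Longrightarrow> 0 < \<rho> \<Longrightarrow> 0 \<le> n \<Longrightarrow> 0 \<le> E \<Longrightarrow> 0 \<le> r \<Longrightarrow>
      3/8 * a\<^sup>2 + \<epsilon> * k1 * b powr q \<le> \<epsilon> * k2 * n * sqrt (a * b) + \<epsilon> * k3 * \<rho> powr (q - 1) * (E * a + r powr (q - 1) * b) \<Longrightarrow>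
      b \<le> C * ((\<epsilon> powr (1/4) * n) powr (4 / (3 * q - 2)) + (\<epsilon> * \<rho> powr (2 * q - 2) * E\<^sup>2) powr (1 / q) + \<rho> * r)"
    using error_from_inequality[OF k q] by blast
  define k4 where "k4 = 32 * pi\<^sup>2 * tbar"
  \<comment> \<open>The exponent of the noise term, reciprocal to that of \<open>t\<close> in the
    noise level, so that this level contributes a multiple of \<open>t\<close>.\<close>
  define \<theta> where "\<theta> = 4 / (3 * q - 2)"
  define m where "m = 2 powr \<theta> * mZ powr \<theta>"
  have \<theta>: "0 < \<theta>" "(3 * q - 2) / 4 * \<theta> = 1" using q by (auto simp: \<theta>_def)
  have "0 < k4" "0 < \<theta> / 4" "0 \<le> m" using t \<theta> by (auto simp: k4_def m_def)
  from choose_truncation[OF q s(1) this] obtain c where c: "0 < c"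
    "\<And>\<rho>. 0 < \<rho> \<Longrightarrow> \<exists>\<epsilon>0>0. \<exists>c'>0. \<forall>\<epsilon>. 0 < \<epsilon> \<and> \<epsilon> < \<rho> \<longrightarrow> (\<exists>K.
      m * \<epsilon> powr (\<theta> / 4) + (\<epsilon> * \<rho> powr (2 * q - 2) * (exp (k4 * 4 ^ K))\<^sup>2) powr (1 / q) + \<rho> * 2 powr (- (real K * s))
      \<le> (if \<epsilon> < \<epsilon>0 then c else c') * (\<rho> * ln (\<rho> / \<epsilon>) powr (- s / 2)))"
    by blast
  obtain c1 C1 where c1: "0 < c1" "\<And>f. f \<in> X \<Longrightarrow> c1 * bnorm \<psi> p q f \<le> wN f"
    using equiv_norm_bnorm[OF equiv_wN] by metis
  obtain c2 C2 where C2: "0 < C2" "\<And>f. f \<in> X \<Longrightarrow> NX f \<le> C2 * bnorm \<psi> p q f"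
    using equiv_norm_bnorm[OF NX] by metis
  define k5 where "k5 = C2 / c1"
  have k5: "0 < k5" using c1 C2 by (simp add: k5_def)
  have NXw: "NX f \<le> k5 * wN f" if "f \<in> X" for f
  proof -
    have "bnorm \<psi> p q f \<le> wN f / c1" using c1(1) c1(2)[OF that] by (simp add: field_simps)
    then have "C2 * bnorm \<psi> p q f \<le> C2 * (wN f / c1)" using C2(1) by (intro mult_left_mono) auto
    then show ?thesis using C2(2)[OF that] by (simp add: k5_def)
  qed
  \<comment> \<open>The summand 1 makes the final inequality strict, which excludes the event that
    the error is at least the bound.\<close>
  define cc where "cc x = k5 * C * (x + 2 powr \<theta>) + 1" for x :: real
  have cc: "0 < cc x" if "0 < x" for x
    using that k5 C unfolding cc_def by (intro add_pos_pos mult_pos_pos) auto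
  have "\<exists>\<epsilon>0>0. \<exists>c'>0. \<forall>\<epsilon>. 0 < \<epsilon> \<and> \<epsilon> < \<rho> \<longrightarrow>
      (\<forall>f0 z fh t. f0 \<in> D \<longrightarrow> f0 \<in> besov \<psi> s (ennreal p) \<top> \<longrightarrow> Ns f0 \<le> \<rho> \<longrightarrow> 0 < t \<longrightarrow>
        z \<in> besov \<psi> (- real CARD('d) / 2) (ennreal a) \<top> \<longrightarrow>
        NZ z \<le> mZ + \<epsilon> powr (- 1/4) * t powr ((3 * q - 2) / 4) \<longrightarrow>
        is_arg_min (tikhonov tbar (\<epsilon> / 4) (penalty \<psi> I \<phi> p q q) (observation tbar \<epsilon> z f0)) (\<lambda>f. f \<in> D) fh \<longrightarrow>
        NX (fh - f0) < (if \<epsilon> < \<epsilon>0 then cc c else c') * (\<rho> * ln (\<rho> / \<epsilon>) powr (- s / 2) + t))"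
    if \<rho>: "0 < \<rho>" for \<rho>
  proof -
    obtain \<epsilon>0 c' where e0: "0 < \<epsilon>0" and c': "0 < c'" and tr: "\<And>\<epsilon>. 0 < \<epsilon> \<and> \<epsilon> < \<rho> \<Longrightarrow> (\<exists>K.
      m * \<epsilon> powr (\<theta> / 4) + (\<epsilon> * \<rho> powr (2 * q - 2) * (exp (k4 * 4 ^ K))\<^sup>2) powr (1 / q) + \<rho> * 2 powr (- (real K * s))
      \<le> (if \<epsilon> < \<epsilon>0 then c else c') * (\<rho> * ln (\<rho> / \<epsilon>) powr (- s / 2)))"
      using c(2)[OF \<rho>] by blast
    have main: "NX (fh - f0) < (if \<epsilon> < \<epsilon>0 then cc c else cc c') * (\<rho> * ln (\<rho> / \<epsilon>) powr (- s / 2) + t)"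
      if \<epsilon>: "0 < \<epsilon> \<and> \<epsilon> < \<rho>" and f0: "f0 \<in> D" "f0 \<in> besov \<psi> s (ennreal p) \<top>" "Ns f0 \<le> \<rho>" and t0: "0 < t"
        and z: "z \<in> besov \<psi> (- real CARD('d) / 2) (ennreal a) \<top>" "NZ z \<le> mZ + \<epsilon> powr (- 1/4) * t powr ((3 * q - 2) / 4)"
        and fh: "is_arg_min (tikhonov tbar (\<epsilon> / 4) (penalty \<psi> I \<phi> p q q) (observation tbar \<epsilon> z f0)) (\<lambda>f. f \<in> D) fh"
      for \<epsilon> f0 z fh t
    proof -
      define x where "x = (if \<epsilon> < \<epsilon>0 then c else c')"
      have x: "0 < x" using c(1) c' by (simp add: x_def)
      define \<tau> where "\<tau> = \<epsilon> powr (- 1/4) * t powr ((3 * q - 2) / 4)"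
      define n where "n = mZ + \<tau>"
      define R where "R = \<rho> * ln (\<rho> / \<epsilon>) powr (- s / 2)"
      have R: "0 \<le> R" using \<rho> by (simp add: R_def)
      have n: "0 \<le> n" using mZ by (simp add: n_def \<tau>_def)
      obtain K where K: "m * \<epsilon> powr (\<theta> / 4) + (\<epsilon> * \<rho> powr (2 * q - 2) * (exp (k4 * 4 ^ K))\<^sup>2) powr (1 / q) + \<rho> * 2 powr (- (real K * s)) \<le> x * R"
        using tr[OF \<epsilon>] unfolding x_def R_def by blast
      let ?a = "T_norm tbar (fh - f0)" and ?b = "wN (fh - f0)" and ?E = "exp (k4 * 4 ^ K)" and ?r = "2 powr (- (real K * s))"
      have r: "2 powr (- (real K * (s * (q - 1)))) = ?r powr (q - 1)"
        by (simp add: powr_powr mult.assoc)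
      have "3/8 * ?a\<^sup>2 + \<epsilon> * k1 * ?b powr q \<le> \<epsilon> * k2 * NZ z * sqrt (?a * ?b) + \<epsilon> * k3 * \<rho> powr (q - 1) * (?E * ?a + ?r powr (q - 1) * ?b)"
        using est[OF D f0 \<rho> conjunct1[OF \<epsilon>] z(1) fh, of K] unfolding k4_def r .
      moreover have "\<epsilon> * k2 * NZ z * sqrt (?a * ?b) \<le> \<epsilon> * k2 * n * sqrt (?a * ?b)"
        using z(2) \<epsilon> k unfolding n_def \<tau>_def by (intro mult_right_mono mult_left_mono) auto
      ultimately have "3/8 * ?a\<^sup>2 + \<epsilon> * k1 * ?b powr q \<le> \<epsilon> * k2 * n * sqrt (?a * ?b) + \<epsilon> * k3 * \<rho> powr (q - 1) * (?E * ?a + ?r powr (q - 1) * ?b)"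
        by linarith
      then have b: "?b \<le> C * ((\<epsilon> powr (1/4) * n) powr \<theta> + (\<epsilon> * \<rho> powr (2 * q - 2) * ?E\<^sup>2) powr (1 / q) + \<rho> * ?r)"
        unfolding \<theta>_def using \<epsilon> \<rho> n by (intro err) (auto simp: wN_def)
      \<comment> \<open>The offset \<open>mZ\<close> and the deviation are separated: the former
        becomes the power of \<open>\<epsilon>\<close> that the choice of \<open>K\<close> takes
        care of, the latter becomes \<open>t\<close>.\<close>
      have "(\<epsilon> powr (1/4) * n) powr \<theta> \<le> m * \<epsilon> powr (\<theta> / 4) + 2 powr \<theta> * t"
      proof -
        have 1: "\<epsilon> powr (1/4) * \<tau> = t powr ((3 * q - 2) / 4)"
          using \<epsilon> by (simp add: \<tau>_def mult.assoc[symmetric] powr_add[symmetric])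
        have "(\<epsilon> powr (1/4) * n) powr \<theta> = (\<epsilon> powr (1/4) * mZ + \<epsilon> powr (1/4) * \<tau>) powr \<theta>"
          by (simp add: n_def distrib_left)
        also have "\<dots> \<le> 2 powr \<theta> * ((\<epsilon> powr (1/4) * mZ) powr \<theta> + (\<epsilon> powr (1/4) * \<tau>) powr \<theta>)"
          using mZ \<theta> by (intro powr_add_crude) (auto simp: 1)
        also have "(\<epsilon> powr (1/4) * \<tau>) powr \<theta> = t" using t0 unfolding 1 powr_powr \<theta>(2) by simp
        also have "(\<epsilon> powr (1/4) * mZ) powr \<theta> = \<epsilon> powr (\<theta> / 4) * mZ powr \<theta>"
          by (simp add: powr_mult powr_powr)
        finally show ?thesis by (simp add: m_def algebra_simps)
      qed
      then have "(\<epsilon> powr (1/4) * n) powr \<theta> + (\<epsilon> * \<rho> powr (2 * q - 2) * ?E\<^sup>2) powr (1 / q) + \<rho> * ?r \<le> x * R + 2 powr \<theta> * t"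
        using K by linarith
      also have "\<dots> \<le> (x + 2 powr \<theta>) * (R + t)" using x R t0 by (simp add: algebra_simps)
      finally have "?b \<le> C * ((x + 2 powr \<theta>) * (R + t))" using b C by (meson less_imp_le mult_left_mono order_trans)
      then have "k5 * ?b \<le> k5 * (C * ((x + 2 powr \<theta>) * (R + t)))" using k5 by (intro mult_left_mono) auto
      also have "\<dots> < cc x * (R + t)" using R t0 by (simp add: cc_def algebra_simps)
      finally have "k5 * ?b < cc x * (R + t)" .
      moreover have "fh - f0 \<in> X" using fh f0 D by (intro X_diff) (auto simp: is_arg_min_le)
      ultimately have "NX (fh - f0) < cc x * (R + t)" using NXw by fastforce
      then show ?thesis unfolding x_def R_def by (simp split: if_splits)
    qed
    show ?thesis
      by (rule exI[of _ \<epsilon>0], rule conjI[OF e0], rule exI[of _ "cc c'"], rule conjI[OF cc[OF c']], intro allI impI) (rule main)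
  qed
  with cc[OF c(1)] show ?thesis by (rule that)
qed

end

theorem theorem5p5:
  fixes \<psi> :: "real ^ 'd::finite \<Rightarrow> real"
    and I :: "nat \<Rightarrow> 'l set"
    and \<phi> :: "nat \<Rightarrow> 'l \<Rightarrow> real ^ 'd \<Rightarrow> real"
    and \<D> :: "'d distribution set"
    and M :: "'w measure"
    and Z :: "'w \<Rightarrow> 'd distribution"
    and N\<^sub>X N\<^sub>s :: "'d distribution \<Rightarrow> real"
    and N\<^sub>Z :: "real \<Rightarrow> 'd distribution \<Rightarrow> real"
    and \<sigma> tbar p q s r C\<^sub>Z M\<^sub>Z \<mu> :: real
  assumes "lp_cutoff \<psi>"
    and "generates_besov \<psi> \<sigma> I \<phi>"
    and "\<sigma> > real CARD('d) / 2" and "\<sigma> > s * (q - 1)"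
    and "1 < p" "p \<le> 2" and "2 \<le> q" and "s > 0" and "r = max 2 (max p q)"
    and "tbar > 0"
    and "\<D> \<subseteq> besov \<psi> 0 (ennreal p) (ennreal q)" and "\<D> \<noteq> {}" and "convex \<D>"
    and "besov_closed \<psi> 0 (ennreal p) (ennreal q) \<D>"
    and "besov_equiv_norm \<psi> 0 (ennreal p) (ennreal q) N\<^sub>X"
    and "besov_equiv_norm \<psi> s (ennreal p) \<top> N\<^sub>s"
    and "\<And>a. 1 < a \<Longrightarrow> besov_equiv_norm \<psi> (- real CARD('d) / 2) (ennreal a) \<top> (N\<^sub>Z a)"
    and "prob_space M" and "random_distribution M Z"
    and "\<And>a. 1 < a \<Longrightarrow> AE \<omega> in M. Z \<omega> \<in> besov \<psi> (- real CARD('d) / 2) (ennreal a) \<top>"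
    and "\<And>a. 1 < a \<Longrightarrow> \<exists>C m \<nu>. deviation_inequality M Z (N\<^sub>Z a) C m \<nu>"
    and "deviation_inequality M Z (N\<^sub>Z (p / (p - 1))) C\<^sub>Z M\<^sub>Z \<mu>"
  shows "(\<forall>\<epsilon>>0. \<forall>\<alpha>>0. \<forall>f\<^sub>0 \<in> \<D> \<inter> besov \<psi> s (ennreal p) \<top>.
            AE \<omega> in M. \<exists>f. is_arg_min
              (tikhonov tbar \<alpha> (penalty \<psi> I \<phi> p q r) (observation tbar \<epsilon> (Z \<omega>) f\<^sub>0)) (\<lambda>f. f \<in> \<D>) f)
       \<and> (\<exists>c>0. \<forall>\<rho>>0. \<exists>\<epsilon>\<^sub>0>0. \<exists>c'>0.
            \<forall>\<epsilon>. 0 < \<epsilon> \<and> \<epsilon> < \<rho> \<longrightarrow>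
            (\<forall>f\<^sub>0 \<in> \<D> \<inter> besov \<psi> s (ennreal p) \<top>. N\<^sub>s f\<^sub>0 \<le> \<rho> \<longrightarrow>
            (\<forall>fhat :: 'w \<Rightarrow> 'd distribution.
               (AE \<omega> in M. is_arg_min
                  (tikhonov tbar (\<epsilon> / 4) (penalty \<psi> I \<phi> p q r) (observation tbar \<epsilon> (Z \<omega>) f\<^sub>0))
                  (\<lambda>f. f \<in> \<D>) (fhat \<omega>)) \<longrightarrow>
               (\<forall>t>0. outer_measure_of M
                  {\<omega> \<in> space M. N\<^sub>X (fhat \<omega> - f\<^sub>0) \<ge>
                     (if \<epsilon> < \<epsilon>\<^sub>0 then c else c') * (\<rho> * ln (\<rho> / \<epsilon>) powr (- s / 2) + t)}
                  \<le> ennreal (exp (- C\<^sub>Z * \<epsilon> powr (- \<mu> / 4) * t powr ((3 * q - 2) / 4 * \<mu>)))))))"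
proof -
  have "0 < \<sigma>" using assms(3) by (smt (verit) divide_nonneg_pos of_nat_0_le_iff)
  then interpret besov_wavelets \<psi> \<sigma> I \<phi> p q
    using assms by unfold_locales auto
  interpret prob_space M by fact
  have r: "r = q" using assms by simp
  \<comment> \<open>The Hoelder conjugate of \<open>p\<close>.\<close>
  define a where "a = p / (p - 1)"
  have a: "1 < a" using p by (simp add: a_def)
  note DX = assms(11) and dev = assms(22)[folded a_def]
  have mZ: "0 < M\<^sub>Z" using dev by (simp add: deviation_inequality_def)
  have "s * (q - 1) < \<sigma>" using assms by simp
  obtain c where c: "0 < c"
    "\<And>\<rho>. 0 < \<rho> \<Longrightarrow> \<exists>\<epsilon>0>0. \<exists>c'>0. \<forall>\<epsilon>. 0 < \<epsilon> \<and> \<epsilon> < \<rho> \<longrightarrow>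
      (\<forall>f0 z fh t. f0 \<in> \<D> \<longrightarrow> f0 \<in> besov \<psi> s (ennreal p) \<top> \<longrightarrow> N\<^sub>s f0 \<le> \<rho> \<longrightarrow> 0 < t \<longrightarrow>
        z \<in> besov \<psi> (- real CARD('d) / 2) (ennreal a) \<top> \<longrightarrow>
        N\<^sub>Z a z \<le> M\<^sub>Z + \<epsilon> powr (- 1/4) * t powr ((3 * q - 2) / 4) \<longrightarrow>
        is_arg_min (tikhonov tbar (\<epsilon> / 4) (penalty \<psi> I \<phi> p q q) (observation tbar \<epsilon> z f0)) (\<lambda>f. f \<in> \<D>) fh \<longrightarrow>
        N\<^sub>X (fh - f0) < (if \<epsilon> < \<epsilon>0 then c else c') * (\<rho> * ln (\<rho> / \<epsilon>) powr (- s / 2) + t))"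
    by (rule pathwise_error_bound[OF assms(10,8) \<open>s * (q - 1) < \<sigma>\<close> assms(15,16) assms(17)[OF a] less_imp_le[OF a] DX assms(13) mZ]) (rule that)
  \<comment> \<open>Contraposition of \<open>good\<close>: outside the null set where the almost
    sure statements fail, a large error forces the noise norm above
    \<open>M\<^sub>Z + \<tau>\<close>.\<close>
  have bound: "outer_measure_of M {\<omega> \<in> space M. B \<le> N\<^sub>X (fhat \<omega> - f0)}
      \<le> ennreal (exp (- C\<^sub>Z * \<epsilon> powr (- \<mu> / 4) * t powr ((3 * q - 2) / 4 * \<mu>)))"
    if \<epsilon>: "0 < \<epsilon>" and t: "0 < t"
      and good: "\<And>z fh. z \<in> besov \<psi> (- real CARD('d) / 2) (ennreal a) \<top> \<Longrightarrow>
        N\<^sub>Z a z \<le> M\<^sub>Z + \<epsilon> powr (- 1/4) * t powr ((3 * q - 2) / 4) \<Longrightarrow>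
        is_arg_min (tikhonov tbar (\<epsilon> / 4) (penalty \<psi> I \<phi> p q q) (observation tbar \<epsilon> z f0)) (\<lambda>f. f \<in> \<D>) fh \<Longrightarrow>
        N\<^sub>X (fh - f0) < B"
      and fhat: "AE \<omega> in M. is_arg_min (tikhonov tbar (\<epsilon> / 4) (penalty \<psi> I \<phi> p q q) (observation tbar \<epsilon> (Z \<omega>) f0))
        (\<lambda>f. f \<in> \<D>) (fhat \<omega>)"
    for \<epsilon> t B f0 and fhat :: "'w \<Rightarrow> 'd distribution"
  proof -
    \<comment> \<open>The level at which the deviation inequality is used; its power
      \<open>\<mu>\<close> produces the exponents of the claim.\<close>
    define \<tau> where "\<tau> = \<epsilon> powr (- 1/4) * t powr ((3 * q - 2) / 4)"
    have \<tau>: "0 < \<tau>" using \<epsilon> t by (simp add: \<tau>_def)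
    have "AE \<omega> in M. Z \<omega> \<in> besov \<psi> (- real CARD('d) / 2) (ennreal a) \<top> \<and>
        is_arg_min (tikhonov tbar (\<epsilon> / 4) (penalty \<psi> I \<phi> p q q) (observation tbar \<epsilon> (Z \<omega>) f0)) (\<lambda>f. f \<in> \<D>) (fhat \<omega>)"
      using assms(20)[OF a] fhat by eventually_elim blast
    then obtain N where N: "N \<in> null_sets M" "{\<omega> \<in> space M. \<not> (Z \<omega> \<in> besov \<psi> (- real CARD('d) / 2) (ennreal a) \<top> \<and>
        is_arg_min (tikhonov tbar (\<epsilon> / 4) (penalty \<psi> I \<phi> p q q) (observation tbar \<epsilon> (Z \<omega>) f0)) (\<lambda>f. f \<in> \<D>) (fhat \<omega>))} \<subseteq> N"
      unfolding eventually_ae_filter by blast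
    have "{\<omega> \<in> space M. B \<le> N\<^sub>X (fhat \<omega> - f0)} \<subseteq> {\<omega> \<in> space M. N\<^sub>Z a (Z \<omega>) > M\<^sub>Z + \<tau>} \<union> N"
    proof
      fix \<omega> assume \<omega>: "\<omega> \<in> {\<omega> \<in> space M. B \<le> N\<^sub>X (fhat \<omega> - f0)}"
      show "\<omega> \<in> {\<omega> \<in> space M. N\<^sub>Z a (Z \<omega>) > M\<^sub>Z + \<tau>} \<union> N"
      proof (rule ccontr)
        assume n: "\<omega> \<notin> {\<omega> \<in> space M. N\<^sub>Z a (Z \<omega>) > M\<^sub>Z + \<tau>} \<union> N"
        then have "N\<^sub>X (fhat \<omega> - f0) < B"
          using \<omega> N(2) by (intro good[of "Z \<omega>"]) (auto simp: \<tau>_def not_less)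
        then show False using \<omega> by simp
      qed
    qed
    then have "outer_measure_of M {\<omega> \<in> space M. B \<le> N\<^sub>X (fhat \<omega> - f0)} \<le> outer_measure_of M {\<omega> \<in> space M. N\<^sub>Z a (Z \<omega>) > M\<^sub>Z + \<tau>}"
      by (rule outer_measure_of_le_Un_null[OF N(1)])
    also have "\<dots> \<le> ennreal (exp (- C\<^sub>Z * \<tau> powr \<mu>))"
      using dev \<tau> unfolding deviation_inequality_def by blast
    also have "- C\<^sub>Z * \<tau> powr \<mu> = - C\<^sub>Z * \<epsilon> powr (- \<mu> / 4) * t powr ((3 * q - 2) / 4 * \<mu>)"
    proof -
      have "- 1 / 4 * \<mu> = - \<mu> / 4" by simp
      then show ?thesis by (simp only: \<tau>_def powr_mult powr_powr mult.assoc)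
    qed
    finally show ?thesis .
  qed
  show ?thesis
    unfolding r
  \<comment> \<open>Minimizers exist for every realization, so the almost sure claim is proved
    pointwise.\<close>
  proof (intro conjI allI impI ballI AE_I2)
    fix \<epsilon> \<alpha> :: real and f0 \<omega>
    assume "0 < \<alpha>"
    then show "\<exists>f. is_arg_min (tikhonov tbar \<alpha> (penalty \<psi> I \<phi> p q q) (observation tbar \<epsilon> (Z \<omega>) f0)) (\<lambda>f. f \<in> \<D>) f"
      by (rule minimizer_exists[OF assms(10) _ assms(11-14)])
  next
    show "\<exists>c>0. \<forall>\<rho>>0. \<exists>\<epsilon>\<^sub>0>0. \<exists>c'>0. \<forall>\<epsilon>. 0 < \<epsilon> \<and> \<epsilon> < \<rho> \<longrightarrow>
            (\<forall>f\<^sub>0 \<in> \<D> \<inter> besov \<psi> s (ennreal p) \<top>. N\<^sub>s f\<^sub>0 \<le> \<rho> \<longrightarrow>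
            (\<forall>fhat :: 'w \<Rightarrow> 'd distribution.
               (AE \<omega> in M. is_arg_min
                  (tikhonov tbar (\<epsilon> / 4) (penalty \<psi> I \<phi> p q q) (observation tbar \<epsilon> (Z \<omega>) f\<^sub>0))
                  (\<lambda>f. f \<in> \<D>) (fhat \<omega>)) \<longrightarrow>
               (\<forall>t>0. outer_measure_of M
                  {\<omega> \<in> space M. N\<^sub>X (fhat \<omega> - f\<^sub>0) \<ge>
                     (if \<epsilon> < \<epsilon>\<^sub>0 then c else c') * (\<rho> * ln (\<rho> / \<epsilon>) powr (- s / 2) + t)}
                  \<le> ennreal (exp (- C\<^sub>Z * \<epsilon> powr (- \<mu> / 4) * t powr ((3 * q - 2) / 4 * \<mu>))))))"
    proof (rule exI[of _ c], rule conjI[OF c(1)], intro allI impI)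
      fix \<rho> :: real assume "0 < \<rho>"
      from c(2)[OF this] obtain \<epsilon>0 c' where e: "0 < \<epsilon>0" "0 < c'" and *: "\<forall>\<epsilon>. 0 < \<epsilon> \<and> \<epsilon> < \<rho> \<longrightarrow>
        (\<forall>f0 z fh t. f0 \<in> \<D> \<longrightarrow> f0 \<in> besov \<psi> s (ennreal p) \<top> \<longrightarrow> N\<^sub>s f0 \<le> \<rho> \<longrightarrow> 0 < t \<longrightarrow>
          z \<in> besov \<psi> (- real CARD('d) / 2) (ennreal a) \<top> \<longrightarrow>
          N\<^sub>Z a z \<le> M\<^sub>Z + \<epsilon> powr (- 1/4) * t powr ((3 * q - 2) / 4) \<longrightarrow>
          is_arg_min (tikhonov tbar (\<epsilon> / 4) (penalty \<psi> I \<phi> p q q) (observation tbar \<epsilon> z f0)) (\<lambda>f. f \<in> \<D>) fh \<longrightarrow>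
          N\<^sub>X (fh - f0) < (if \<epsilon> < \<epsilon>0 then c else c') * (\<rho> * ln (\<rho> / \<epsilon>) powr (- s / 2) + t))"
        by (elim exE conjE) (rule that)
      show "\<exists>\<epsilon>\<^sub>0>0. \<exists>c'>0. \<forall>\<epsilon>. 0 < \<epsilon> \<and> \<epsilon> < \<rho> \<longrightarrow>
            (\<forall>f\<^sub>0 \<in> \<D> \<inter> besov \<psi> s (ennreal p) \<top>. N\<^sub>s f\<^sub>0 \<le> \<rho> \<longrightarrow>
            (\<forall>fhat :: 'w \<Rightarrow> 'd distribution.
               (AE \<omega> in M. is_arg_min
                  (tikhonov tbar (\<epsilon> / 4) (penalty \<psi> I \<phi> p q q) (observation tbar \<epsilon> (Z \<omega>) f\<^sub>0))
                  (\<lambda>f. f \<in> \<D>) (fhat \<omega>)) \<longrightarrow>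
               (\<forall>t>0. outer_measure_of M
                  {\<omega> \<in> space M. N\<^sub>X (fhat \<omega> - f\<^sub>0) \<ge>
                     (if \<epsilon> < \<epsilon>\<^sub>0 then c else c') * (\<rho> * ln (\<rho> / \<epsilon>) powr (- s / 2) + t)}
                  \<le> ennreal (exp (- C\<^sub>Z * \<epsilon> powr (- \<mu> / 4) * t powr ((3 * q - 2) / 4 * \<mu>))))))"
      proof (rule exI[of _ \<epsilon>0], rule conjI[OF e(1)], rule exI[of _ c'], rule conjI[OF e(2)], intro allI impI ballI)
        fix \<epsilon> t :: real and f0 and fhat :: "'w \<Rightarrow> 'd distribution"
        assume \<epsilon>: "0 < \<epsilon> \<and> \<epsilon> < \<rho>" and f0: "f0 \<in> \<D> \<inter> besov \<psi> s (ennreal p) \<top>" "N\<^sub>s f0 \<le> \<rho>" and t: "0 < t"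
          and fhat: "AE \<omega> in M. is_arg_min (tikhonov tbar (\<epsilon> / 4) (penalty \<psi> I \<phi> p q q) (observation tbar \<epsilon> (Z \<omega>) f0))
            (\<lambda>f. f \<in> \<D>) (fhat \<omega>)"
        show "outer_measure_of M {\<omega> \<in> space M. N\<^sub>X (fhat \<omega> - f0) \<ge>
            (if \<epsilon> < \<epsilon>0 then c else c') * (\<rho> * ln (\<rho> / \<epsilon>) powr (- s / 2) + t)}
          \<le> ennreal (exp (- C\<^sub>Z * \<epsilon> powr (- \<mu> / 4) * t powr ((3 * q - 2) / 4 * \<mu>)))"
          by (rule bound[OF conjunct1[OF \<epsilon>] t *[rule_format, OF \<epsilon> IntD1[OF f0(1)] IntD2[OF f0(1)] f0(2) t] fhat])
      qed
    qed
  qed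
qed

end
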